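(* Let $p$ be an odd prime, $K$ a number field, $B$ a central simple $K$-algebra of dimension $p^2$, and $\mathcal{R}$ a maximal $\mathcal{O}_K$-order of $B$. Then the group $K^\times\backslash J_K/nr(\mathfrak{N}(\mathcal{R}))$ is an elementary abelian group of exponent $p$.
   Context: For a place $\nu$ of $K$, $K_\nu$ is the completion, $B_\nu=B\otimes_K K_\nu$, and for finite $\nu$, $\mathcal{O}_\nu$ is the valuation ring. $J_K$ and $J_B$ are the idele groups of $K$ and $B$; $nr$ is the reduced norm, applied componentwise on ideles. Put $\mathcal{R}_\nu=\mathcal{R}\otimes_{\mathcal{O}_K}\mathcal{O}_\nu$ for finite $\nu$ and $\mathcal{R}_\nu=B_\nu$ for infinite $\nu$; $\mathcal{N}(\mathcal{R}_\nu)$ is the normalizer of $\mathcal{R}_\nu$ in $B_\nu^\times$ and $\mathfrak{N}(\mathcal{R})=J_B\cap\prod_\nu\mathcal{N}(\mathcal{R}_\nu)$. *)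

theory Defs
  imports "HOL-Algebra.Algebra" "HOL-Algebra.Algebraic_Closure_Type"
    "HOL-Combinatorics.Permutations"
begin

text \<open>
  The global objects K and B are types, with B a K-algebra through a scalar
  multiplication \<open>scale\<close>. Local objects depend on a place, so they are rings
  in the sense of \<open>HOL-Algebra\<close>; \<^const>\<open>ring_of_type_algebra\<close> links the two.
\<close>

definition number_field :: "'k::field_char_0 itself \<Rightarrow> bool" where
  "number_field _ \<longleftrightarrow>
     (\<exists>S :: 'k set. finite S \<and> module.span (\<lambda>(q::rat) x. of_rat q * x) S = UNIV)"

definition ring_of_integers :: "'k::field_char_0 set" where
  "ring_of_integers = {x. algebraic_int x}"

definition is_algebra :: "('k::field \<Rightarrow> 'b::ring_1 \<Rightarrow> 'b) \<Rightarrow> bool" where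
  "is_algebra scale \<longleftrightarrow> vector_space scale \<and>
     (\<forall>c x y. scale c x * y = scale c (x * y) \<and> x * scale c y = scale c (x * y))"

definition central_simple_algebra :: "('k::field \<Rightarrow> 'b::ring_1 \<Rightarrow> 'b) \<Rightarrow> bool" where
  "central_simple_algebra scale \<longleftrightarrow> is_algebra scale \<and>
     (\<exists>S. finite S \<and> module.span scale S = UNIV) \<and>
     {z. \<forall>x. z * x = x * z} = range (\<lambda>c. scale c 1) \<and>
     (\<forall>I. ideal I (ring_of_type_algebra :: 'b ring) \<longrightarrow> I = {0} \<or> I = UNIV)"

definition is_order :: "('k::field_char_0 \<Rightarrow> 'b::ring_1 \<Rightarrow> 'b) \<Rightarrow> 'b set \<Rightarrow> bool" where
  "is_order scale R \<longleftrightarrow> subring R ring_of_type_algebra \<and>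
     (\<exists>S. finite S \<and>
        R = {\<Sum>s\<in>S. scale (c s) s |c. \<forall>s\<in>S. c s \<in> ring_of_integers}) \<and>
     module.span scale R = UNIV"

definition maximal_order :: "('k::field_char_0 \<Rightarrow> 'b::ring_1 \<Rightarrow> 'b) \<Rightarrow> 'b set \<Rightarrow> bool" where
  "maximal_order scale R \<longleftrightarrow> is_order scale R \<and>
     (\<forall>R'. is_order scale R' \<and> R \<subseteq> R' \<longrightarrow> R' = R)"

text \<open>
  The integral monoid ring on the multiplicative monoid \<open>A \<times> C\<close>: formal
  integer combinations of pairs, multiplied componentwise on pairs.
\<close>

definition pair_ring :: "('a, 'm) ring_scheme \<Rightarrow> ('c, 'n) ring_scheme \<Rightarrow> ('a \<times> 'c \<Rightarrow>\<^sub>0 int) ring" where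
  "pair_ring A C =
     \<lparr>carrier = {x. Poly_Mapping.keys x \<subseteq> carrier A \<times> carrier C},
      monoid.mult = (\<lambda>x y. frag_extend (\<lambda>(a, c). frag_extend
         (\<lambda>(a', c'). frag_of (a \<otimes>\<^bsub>A\<^esub> a', c \<otimes>\<^bsub>C\<^esub> c')) y) x),
      one = frag_of (\<one>\<^bsub>A\<^esub>, \<one>\<^bsub>C\<^esub>),
      ring.zero = 0,
      add = (+)\<rparr>"

definition tensor_relations ::
  "('k, 'l) ring_scheme \<Rightarrow> ('k \<Rightarrow> 'a) \<Rightarrow> ('a, 'm) ring_scheme \<Rightarrow>
   ('k \<Rightarrow> 'c) \<Rightarrow> ('c, 'n) ring_scheme \<Rightarrow> ('a \<times> 'c \<Rightarrow>\<^sub>0 int) set" where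
  "tensor_relations k f A g C =
     {frag_of (a \<oplus>\<^bsub>A\<^esub> a', c) - frag_of (a, c) - frag_of (a', c)
        |a a' c. a \<in> carrier A \<and> a' \<in> carrier A \<and> c \<in> carrier C} \<union>
     {frag_of (a, c \<oplus>\<^bsub>C\<^esub> c') - frag_of (a, c) - frag_of (a, c')
        |a c c'. a \<in> carrier A \<and> c \<in> carrier C \<and> c' \<in> carrier C} \<union>
     {frag_of (f r \<otimes>\<^bsub>A\<^esub> a, c) - frag_of (a, g r \<otimes>\<^bsub>C\<^esub> c)
        |r a c. r \<in> carrier k \<and> a \<in> carrier A \<and> c \<in> carrier C}"

text \<open>
  The tensor product over the commutative ring \<open>k\<close> of the \<open>k\<close>-algebras \<open>A\<close> and
  \<open>C\<close> with structure maps \<open>f\<close> and \<open>g\<close> (with central images). Multiplying one of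
  the relations by a pair gives a relation of the same shape, so the ideal
  generated by the relations is the additive subgroup they generate, and the
  underlying group is the usual tensor product of \<open>k\<close>-modules.
\<close>

definition tensor_ideal ::
  "('k, 'l) ring_scheme \<Rightarrow> ('k \<Rightarrow> 'a) \<Rightarrow> ('a, 'm) ring_scheme \<Rightarrow>
   ('k \<Rightarrow> 'c) \<Rightarrow> ('c, 'n) ring_scheme \<Rightarrow> ('a \<times> 'c \<Rightarrow>\<^sub>0 int) set" where
  "tensor_ideal k f A g C = Idl\<^bsub>pair_ring A C\<^esub> (tensor_relations k f A g C)"

definition tensor_ring ::
  "('k, 'l) ring_scheme \<Rightarrow> ('k \<Rightarrow> 'a) \<Rightarrow> ('a, 'm) ring_scheme \<Rightarrow>
   ('k \<Rightarrow> 'c) \<Rightarrow> ('c, 'n) ring_scheme \<Rightarrow> ('a \<times> 'c \<Rightarrow>\<^sub>0 int) set ring" where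
  "tensor_ring k f A g C = pair_ring A C Quot tensor_ideal k f A g C"

definition pure_tensor ::
  "('k, 'l) ring_scheme \<Rightarrow> ('k \<Rightarrow> 'a) \<Rightarrow> ('a, 'm) ring_scheme \<Rightarrow>
   ('k \<Rightarrow> 'c) \<Rightarrow> ('c, 'n) ring_scheme \<Rightarrow> 'a \<Rightarrow> 'c \<Rightarrow> ('a \<times> 'c \<Rightarrow>\<^sub>0 int) set" where
  "pure_tensor k f A g C a c = tensor_ideal k f A g C +>\<^bsub>pair_ring A C\<^esub> frag_of (a, c)"

definition matrix_ring :: "nat \<Rightarrow> ('l, 'm) ring_scheme \<Rightarrow> (nat \<Rightarrow> nat \<Rightarrow> 'l) ring" where
  "matrix_ring n L =
     \<lparr>carrier = {..<n} \<rightarrow>\<^sub>E ({..<n} \<rightarrow>\<^sub>E carrier L),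
      monoid.mult = (\<lambda>M N. \<lambda>i\<in>{..<n}. \<lambda>j\<in>{..<n}. \<Oplus>\<^bsub>L\<^esub>h\<in>{..<n}. M i h \<otimes>\<^bsub>L\<^esub> N h j),
      one = (\<lambda>i\<in>{..<n}. \<lambda>j\<in>{..<n}. if i = j then \<one>\<^bsub>L\<^esub> else \<zero>\<^bsub>L\<^esub>),
      ring.zero = (\<lambda>i\<in>{..<n}. \<lambda>j\<in>{..<n}. \<zero>\<^bsub>L\<^esub>),
      add = (\<lambda>M N. \<lambda>i\<in>{..<n}. \<lambda>j\<in>{..<n}. M i j \<oplus>\<^bsub>L\<^esub> N i j)\<rparr>"

definition scalar_matrix :: "nat \<Rightarrow> ('l, 'm) ring_scheme \<Rightarrow> 'l \<Rightarrow> nat \<Rightarrow> nat \<Rightarrow> 'l" where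
  "scalar_matrix n L l = (\<lambda>i\<in>{..<n}. \<lambda>j\<in>{..<n}. if i = j then l else \<zero>\<^bsub>L\<^esub>)"

definition determinant :: "nat \<Rightarrow> ('l, 'm) ring_scheme \<Rightarrow> (nat \<Rightarrow> nat \<Rightarrow> 'l) \<Rightarrow> 'l" where
  "determinant n L M =
     (\<Oplus>\<^bsub>L\<^esub>\<pi>\<in>{\<pi>. \<pi> permutes {..<n}}.
        (if evenperm \<pi> then \<one>\<^bsub>L\<^esub> else \<ominus>\<^bsub>L\<^esub> \<one>\<^bsub>L\<^esub>) \<otimes>\<^bsub>L\<^esub> (\<Otimes>\<^bsub>L\<^esub>i\<in>{..<n}. M i (\<pi> i)))"

text \<open>
  \<open>A\<close> is an algebra over the field \<open>F\<close> with structure map \<open>f\<close>. The extension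
  \<open>j : F \<rightarrow> L\<close> splits \<open>A\<close> through the isomorphism \<open>\<phi>\<close> of \<open>L\<close>-algebras from the
  tensor product of \<open>A\<close> and \<open>L\<close> over \<open>F\<close> to the n by n matrices over \<open>L\<close>.
\<close>

definition splitting ::
  "'f ring \<Rightarrow> ('f \<Rightarrow> 'a) \<Rightarrow> 'a ring \<Rightarrow> ('f \<Rightarrow> 'l) \<Rightarrow> 'l ring \<Rightarrow> nat \<Rightarrow>
   (('a \<times> 'l \<Rightarrow>\<^sub>0 int) set \<Rightarrow> nat \<Rightarrow> nat \<Rightarrow> 'l) \<Rightarrow> bool" where
  "splitting F f A j L n \<phi> \<longleftrightarrow> field L \<and> j \<in> ring_hom F L \<and>
     \<phi> \<in> ring_iso (tensor_ring F f A j L) (matrix_ring n L) \<and>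
     (\<forall>l\<in>carrier L. \<phi> (pure_tensor F f A j L \<one>\<^bsub>A\<^esub> l) = scalar_matrix n L l)"

text \<open>
  The reduced norm of \<open>a\<close> is the element of \<open>F\<close> given by the determinant of the
  image of \<open>a\<close> under any splitting. A central simple algebra contains a subfield
  that splits it, so it is enough to let \<open>L\<close> range over the fields carried by the
  type of \<open>A\<close>.
\<close>

definition reduced_norm :: "'f ring \<Rightarrow> ('f \<Rightarrow> 'a) \<Rightarrow> 'a ring \<Rightarrow> 'a \<Rightarrow> 'f" where
  "reduced_norm F f A a = (THE c. c \<in> carrier F \<and>
     (\<exists>(L :: 'a ring) j n \<phi>. splitting F f A j L n \<phi> \<and>
        j c = determinant n L (\<phi> (pure_tensor F f A j L a \<one>\<^bsub>L\<^esub>))))"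

definition absolute_value :: "('k::field \<Rightarrow> real) \<Rightarrow> bool" where
  "absolute_value v \<longleftrightarrow> (\<forall>x. 0 \<le> v x) \<and> (\<forall>x. v x = 0 \<longleftrightarrow> x = 0) \<and>
     (\<forall>x y. v (x * y) = v x * v y) \<and> (\<forall>x y. v (x + y) \<le> v x + v y)"

definition nontrivial_absolute_value :: "('k::field \<Rightarrow> real) \<Rightarrow> bool" where
  "nontrivial_absolute_value v \<longleftrightarrow> absolute_value v \<and> (\<exists>x. x \<noteq> 0 \<and> v x \<noteq> 1)"

definition equivalent_absolute_values :: "('k::field \<Rightarrow> real) \<Rightarrow> ('k \<Rightarrow> real) \<Rightarrow> bool" where
  "equivalent_absolute_values v w \<longleftrightarrow> (\<exists>s>0. \<forall>x. w x = v x powr s)"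

type_synonym 'k place = "('k \<Rightarrow> real) set"

definition places :: "'k::field place set" where
  "places = {{w. absolute_value w \<and> equivalent_absolute_values v w} |v.
     nontrivial_absolute_value v}"

definition nonarchimedean :: "('k::field \<Rightarrow> real) \<Rightarrow> bool" where
  "nonarchimedean v \<longleftrightarrow> (\<forall>x y. v (x + y) \<le> max (v x) (v y))"

definition finite_places :: "'k::field place set" where
  "finite_places = {\<nu> \<in> places. \<forall>v\<in>\<nu>. nonarchimedean v}"

definition cauchy_ring :: "('k::field \<Rightarrow> real) \<Rightarrow> (nat \<Rightarrow> 'k) ring" where
  "cauchy_ring v =
     \<lparr>carrier = {x. \<forall>e>0. \<exists>N. \<forall>m\<ge>N. \<forall>n\<ge>N. v (x m - x n) < e},
      monoid.mult = (\<lambda>x y n. x n * y n),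
      one = (\<lambda>n. 1),
      ring.zero = (\<lambda>n. 0),
      add = (\<lambda>x y n. x n + y n)\<rparr>"

definition null_ideal :: "('k::field \<Rightarrow> real) \<Rightarrow> (nat \<Rightarrow> 'k) set" where
  "null_ideal v = {x. (\<lambda>n. v (x n)) \<longlonglongrightarrow> 0}"

text \<open>
  Equivalent absolute values have the same Cauchy sequences, the same null
  sequences and the same valuation ring, so the choice of a representative of
  the place below is immaterial.
\<close>

definition place_abs :: "'k::field place \<Rightarrow> 'k \<Rightarrow> real" where
  "place_abs \<nu> = (SOME v. v \<in> \<nu>)"

definition completion_at :: "'k::field place \<Rightarrow> (nat \<Rightarrow> 'k) set ring" where
  "completion_at \<nu> = cauchy_ring (place_abs \<nu>) Quot null_ideal (place_abs \<nu>)"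

definition to_completion :: "'k::field place \<Rightarrow> 'k \<Rightarrow> (nat \<Rightarrow> 'k) set" where
  "to_completion \<nu> k =
     null_ideal (place_abs \<nu>) +>\<^bsub>cauchy_ring (place_abs \<nu>)\<^esub> (\<lambda>n. k)"

definition completion_abs :: "'k::field place \<Rightarrow> (nat \<Rightarrow> 'k) set \<Rightarrow> real" where
  "completion_abs \<nu> Z = (THE c. \<forall>x\<in>Z. (\<lambda>n. place_abs \<nu> (x n)) \<longlonglongrightarrow> c)"

definition valuation_ring :: "'k::field place \<Rightarrow> (nat \<Rightarrow> 'k) set set" where
  "valuation_ring \<nu> = {Z \<in> carrier (completion_at \<nu>). completion_abs \<nu> Z \<le> 1}"

definition local_algebra ::
  "('k::field \<Rightarrow> 'b::ring_1 \<Rightarrow> 'b) \<Rightarrow> 'k place \<Rightarrow> ('b \<times> (nat \<Rightarrow> 'k) set \<Rightarrow>\<^sub>0 int) set ring" where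
  "local_algebra scale \<nu> =
     tensor_ring ring_of_type_algebra (\<lambda>c. scale c 1) ring_of_type_algebra
       (to_completion \<nu>) (completion_at \<nu>)"

definition to_local_algebra ::
  "('k::field \<Rightarrow> 'b::ring_1 \<Rightarrow> 'b) \<Rightarrow> 'k place \<Rightarrow> (nat \<Rightarrow> 'k) set \<Rightarrow>
   ('b \<times> (nat \<Rightarrow> 'k) set \<Rightarrow>\<^sub>0 int) set" where
  "to_local_algebra scale \<nu> =
     pure_tensor ring_of_type_algebra (\<lambda>c. scale c 1) ring_of_type_algebra
       (to_completion \<nu>) (completion_at \<nu>) 1"

definition local_reduced_norm ::
  "('k::field \<Rightarrow> 'b::ring_1 \<Rightarrow> 'b) \<Rightarrow> 'k place \<Rightarrow>
   ('b \<times> (nat \<Rightarrow> 'k) set \<Rightarrow>\<^sub>0 int) set \<Rightarrow> (nat \<Rightarrow> 'k) set" where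
  "local_reduced_norm scale \<nu> =
     reduced_norm (completion_at \<nu>) (to_local_algebra scale \<nu>) (local_algebra scale \<nu>)"

definition order_tensor ::
  "('k::field_char_0 \<Rightarrow> 'b::ring_1 \<Rightarrow> 'b) \<Rightarrow> 'b set \<Rightarrow> 'k place \<Rightarrow>
   ('b \<times> (nat \<Rightarrow> 'k) set \<Rightarrow>\<^sub>0 int) set ring" where
  "order_tensor scale R \<nu> =
     tensor_ring (ring_of_type_algebra\<lparr>carrier := ring_of_integers\<rparr>)
       (\<lambda>c. scale c 1) (ring_of_type_algebra\<lparr>carrier := R\<rparr>)
       (to_completion \<nu>) (completion_at \<nu>\<lparr>carrier := valuation_ring \<nu>\<rparr>)"

text \<open>
  At a finite place, \<open>\<R>\<^sub>\<nu>\<close> is viewed inside \<open>B\<^sub>\<nu>\<close> as the image of \<^const>\<open>order_tensor\<close>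
  under the canonical injection, which sends the class of a formal
  combination of pairs in \<open>\<R> \<times> \<O>\<^sub>\<nu>\<close> to its class in \<open>B\<^sub>\<nu>\<close>, that is, the coset \<open>Z\<close>
  to the coset \<open>Y\<close> containing it.
\<close>

definition local_order ::
  "('k::field_char_0 \<Rightarrow> 'b::ring_1 \<Rightarrow> 'b) \<Rightarrow> 'b set \<Rightarrow> 'k place \<Rightarrow>
   ('b \<times> (nat \<Rightarrow> 'k) set \<Rightarrow>\<^sub>0 int) set set" where
  "local_order scale R \<nu> =
     (if \<nu> \<in> finite_places
      then {Y \<in> carrier (local_algebra scale \<nu>). \<exists>Z\<in>carrier (order_tensor scale R \<nu>). Z \<subseteq> Y}
      else carrier (local_algebra scale \<nu>))"

definition unit_normalizer :: "('a, 'm) ring_scheme \<Rightarrow> 'a set \<Rightarrow> 'a set" where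
  "unit_normalizer A S = {x \<in> Units A. (\<lambda>r. x \<otimes>\<^bsub>A\<^esub> r \<otimes>\<^bsub>A\<^esub> inv\<^bsub>A\<^esub> x) ` S = S}"

definition idele_group :: "('k::field place \<Rightarrow> (nat \<Rightarrow> 'k) set) monoid" where
  "idele_group =
     (product_group places (\<lambda>\<nu>. units_of (completion_at \<nu>)))
       \<lparr>carrier := {x \<in> \<Pi>\<^sub>E \<nu>\<in>places. Units (completion_at \<nu>).
          finite {\<nu> \<in> finite_places.
            x \<nu> \<notin> Units (completion_at \<nu>\<lparr>carrier := valuation_ring \<nu>\<rparr>)}}\<rparr>"

definition principal_ideles :: "('k::field place \<Rightarrow> (nat \<Rightarrow> 'k) set) set" where
  "principal_ideles = (\<lambda>k. \<lambda>\<nu>\<in>places. to_completion \<nu> k) ` (UNIV - {0})"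

text \<open>
  Any two orders of B have the same completions at almost all places, so the
  group below is the same for every order \<open>R\<close> of B.
\<close>

definition algebra_ideles ::
  "('k::field_char_0 \<Rightarrow> 'b::ring_1 \<Rightarrow> 'b) \<Rightarrow> 'b set \<Rightarrow>
   ('k place \<Rightarrow> ('b \<times> (nat \<Rightarrow> 'k) set \<Rightarrow>\<^sub>0 int) set) set" where
  "algebra_ideles scale R =
     {x \<in> \<Pi>\<^sub>E \<nu>\<in>places. Units (local_algebra scale \<nu>).
        finite {\<nu> \<in> finite_places.
          x \<nu> \<notin> Units (local_algebra scale \<nu>\<lparr>carrier := local_order scale R \<nu>\<rparr>)}}"

definition normalizer_ideles ::
  "('k::field_char_0 \<Rightarrow> 'b::ring_1 \<Rightarrow> 'b) \<Rightarrow> 'b set \<Rightarrow>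
   ('k place \<Rightarrow> ('b \<times> (nat \<Rightarrow> 'k) set \<Rightarrow>\<^sub>0 int) set) set" where
  "normalizer_ideles scale R = algebra_ideles scale R \<inter>
     (\<Pi>\<^sub>E \<nu>\<in>places. unit_normalizer (local_algebra scale \<nu>) (local_order scale R \<nu>))"

definition idele_norm ::
  "('k::field \<Rightarrow> 'b::ring_1 \<Rightarrow> 'b) \<Rightarrow>
   ('k place \<Rightarrow> ('b \<times> (nat \<Rightarrow> 'k) set \<Rightarrow>\<^sub>0 int) set) \<Rightarrow> 'k place \<Rightarrow> (nat \<Rightarrow> 'k) set" where
  "idele_norm scale x = (\<lambda>\<nu>\<in>places. local_reduced_norm scale \<nu> (x \<nu>))"

text \<open>
  The double cosets of \<open>K\<^sup>\<times>\<close> and \<open>nr(N(R))\<close> in the abelian group \<open>J\<^sub>K\<close> are the cosets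
  of the product of these two subgroups.
\<close>

definition idele_norm_quotient ::
  "('k::field_char_0 \<Rightarrow> 'b::ring_1 \<Rightarrow> 'b) \<Rightarrow> 'b set \<Rightarrow>
   ('k place \<Rightarrow> (nat \<Rightarrow> 'k) set) set monoid" where
  "idele_norm_quotient scale R =
     idele_group Mod
       (principal_ideles <#>\<^bsub>idele_group\<^esub> (idele_norm scale ` normalizer_ideles scale R))"

text \<open>
  The trivial group is allowed: for the p by p matrices over a field of class
  number one the quotient above is trivial.
\<close>

definition elementary_abelian :: "nat \<Rightarrow> ('a, 'm) monoid_scheme \<Rightarrow> bool" where
  "elementary_abelian p G \<longleftrightarrow> comm_group G \<and>
     (\<forall>x\<in>carrier G. x \<noteq> \<one>\<^bsub>G\<^esub> \<longrightarrow> group.ord G x = p)"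

end

theory Submission
  imports Defs "Jordan_Normal_Form.Char_Poly" "HOL-Algebra.Free_Abelian_Groups" "HOL-Library.Function_Algebras"
begin

hide_const (open) Ring_Hom.ring_hom

text \<open>
  For an idele \<open>x\<close> of \<open>K\<close> the idele of central elements \<open>1 \<otimes> x\<^sub>\<nu>\<close> lies in \<open>N(R)\<close> and has reduced norm
  \<open>x\<^sup>p\<close>. So every p-th power is trivial in the quotient, and what remains is that \<open>K\<^sup>\<times>\<close> and \<open>nr(N(R))\<close>
  are subgroups of \<open>J\<^sub>K\<close>. The reduced norm of a unit of \<open>R\<^sub>\<nu>\<close> has absolute value 1 because the powers of the
  unit act on \<open>B\<^sub>\<nu>\<close> by matrices with uniformly bounded entries.

  The p-th power of the reduced norm is the determinant of left multiplication. Along the line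
  \<open>1 + t (a - 1)\<close> these determinants are polynomials with constant term 1, whose p-th roots are unique in
  characteristic 0, so the reduced norm lies in the base field and does not depend on the splitting. A splitting
  of \<open>B\<^sub>\<nu>\<close> exists over any field containing both \<open>K\<^sub>\<nu>\<close> and an algebraic closure of \<open>K\<close>; such a field
  is a quotient of a ring of sequences over the algebraic closure.
\<close>

text \<open>The definitions create three obstacles. \<open>reduced_norm\<close> ranges over
  splitting fields carried by the type of the algebra, so it is not enough that
  \<open>local_algebra\<close> splits somewhere: the splitting field must fit into that type. Its
  elements are represented by sequences over an algebraic closure of K, which is countable because K
  is a number field, and such sequences can be encoded as elements of the type of
  \<open>local_algebra\<close>.

  Two splittings may use unrelated fields. They are compared only through a matrix over the base
  field that both of them see, which takes the place of conjugacy of splittings and of Galois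
  descent.

  Places are classes of absolute values, not prime ideals. Principal ideles are ideles because a
  nonzero element of K is a unit at almost all finite places. This is proved by approximation: the
  absolute values above one rational prime yield rationally independent elements of K, so their
  number is bounded by the size of a spanning set of K over the rationals.\<close>

section \<open>Determinants over rings given by records\<close>

text \<open>
  A single typed commutative ring that maps onto every commutative ring with carrier in \<open>'t\<close>.
  It carries the determinant theory of \<open>Jordan_Normal_Form\<close>, which is developed for type classes,
  over to rings given by records. The integer component only makes the ring nontrivial.
\<close>

typedef 't ring_product =
  "{(n :: int, f :: 't ring \<Rightarrow> 't). \<forall>L. if cring L then f L \<in> carrier L else f L = undefined}"
proof -
  have "(0, \<lambda>L. if cring L then \<zero>\<^bsub>L\<^esub> else undefined) \<in> {(n :: int, f :: 't ring \<Rightarrow> 't). \<forall>L. if cring L then f L \<in> carrier L else f L = undefined}"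
    by (auto simp: cring.cring_simprules)
  then show ?thesis by (rule exI)
qed

setup_lifting type_definition_ring_product

instantiation ring_product :: (type) comm_ring_1
begin

lift_definition zero_ring_product :: "'a ring_product" is
  "(0, \<lambda>L. if cring L then \<zero>\<^bsub>L\<^esub> else undefined)"
  by (auto simp: cring.cring_simprules)
lift_definition one_ring_product :: "'a ring_product" is
  "(1, \<lambda>L. if cring L then \<one>\<^bsub>L\<^esub> else undefined)"
  by (auto simp: cring.cring_simprules)
lift_definition plus_ring_product :: "'a ring_product \<Rightarrow> 'a ring_product \<Rightarrow> 'a ring_product" is
  "\<lambda>(m, f) (n, g). (m + n, \<lambda>L. if cring L then f L \<oplus>\<^bsub>L\<^esub> g L else undefined)"
  by (auto simp: cring.cring_simprules split: if_splits)
lift_definition times_ring_product :: "'a ring_product \<Rightarrow> 'a ring_product \<Rightarrow> 'a ring_product" is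
  "\<lambda>(m, f) (n, g). (m * n, \<lambda>L. if cring L then f L \<otimes>\<^bsub>L\<^esub> g L else undefined)"
  by (auto simp: cring.cring_simprules split: if_splits)
lift_definition uminus_ring_product :: "'a ring_product \<Rightarrow> 'a ring_product" is
  "\<lambda>(m, f). (- m, \<lambda>L. if cring L then \<ominus>\<^bsub>L\<^esub> f L else undefined)"
  by (auto simp: cring.cring_simprules split: if_splits)
definition minus_ring_product :: "'a ring_product \<Rightarrow> 'a ring_product \<Rightarrow> 'a ring_product" where
  "minus_ring_product x y = x + - y"

instance
proof
  fix a b c :: "'a ring_product"
  show "a * b * c = a * (b * c)"
    by transfer (auto simp: fun_eq_iff cring.cring_simprules split: if_splits, (metis cring.cring_simprules)?)
  show "a * b = b * a"
    by transfer (auto simp: fun_eq_iff cring.cring_simprules split: if_splits, (metis cring.cring_simprules)?)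
  show "1 * a = a"
    by transfer (auto simp: fun_eq_iff monoid.l_one[OF ring.is_monoid[OF cring.axioms(1)]] split: if_splits; metis)
  show "a + b + c = a + (b + c)"
    by transfer (auto simp: fun_eq_iff cring.cring_simprules split: if_splits, (metis cring.cring_simprules)?)
  show "a + b = b + a"
    by transfer (auto simp: fun_eq_iff cring.cring_simprules split: if_splits, (metis cring.cring_simprules)?)
  show "0 + a = a"
    by transfer (auto simp: fun_eq_iff cring.cring_simprules split: if_splits, (metis cring.cring_simprules)?)
  show "- a + a = 0"
    by transfer (auto simp: fun_eq_iff cring.cring_simprules split: if_splits, (metis cring.cring_simprules)?)
  show "a - b = a + - b" by (simp add: minus_ring_product_def)
  show "(a + b) * c = a * c + b * c"
    by transfer (auto simp: fun_eq_iff cring.cring_simprules algebra_simps split: if_splits)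
  show "(0 :: 'a ring_product) \<noteq> 1"
    by transfer auto
qed

end

lift_definition component :: "'t ring \<Rightarrow> 't ring_product \<Rightarrow> 't" is "\<lambda>L (n, f). f L" .

text \<open>A set-theoretic section of \<open>component L\<close>, not a homomorphism. Matrices over
  L are lifted entrywise, an identity of determinants is used in \<open>ring_product\<close>, and
  \<open>component L\<close>, which is a homomorphism, brings it back.\<close>

lift_definition lift_component :: "'t ring \<Rightarrow> 't \<Rightarrow> 't ring_product" is
  "\<lambda>L x. (0, \<lambda>L'. if cring L' then (if L' = L \<and> x \<in> carrier L then x else \<zero>\<^bsub>L'\<^esub>) else undefined)"
  by (auto simp: cring.cring_simprules)

locale record_cring = cring L for L :: "'t ring" (structure)
begin

lemma component_closed [simp, intro]: "component L x \<in> carrier L"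
  by (transfer fixing: L) (use cring_axioms in \<open>auto dest!: spec[of _ L]\<close>)

lemma component_simps [simp]:
  "component L 0 = \<zero>" "component L 1 = \<one>"
  "component L (x + y) = component L x \<oplus> component L y"
  "component L (x * y) = component L x \<otimes> component L y"
  "component L (- x) = \<ominus> component L x"
  using cring_axioms by (transfer fixing: L; auto)+

lemma component_lift [simp]: "x \<in> carrier L \<Longrightarrow> component L (lift_component L x) = x"
  by (transfer fixing: L) (use cring_axioms in auto)

lemma component_sum: "component L (sum f A) = (\<Oplus>i\<in>A. component L (f i))"
  by (induction A rule: infinite_finite_induct) (auto simp: finsum_infinite)

lemma component_prod: "component L (prod f A) = (\<Otimes>i\<in>A. component L (f i))"
  by (induction A rule: infinite_finite_induct) (auto simp: finprod_infinite)

lemma component_det: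
  assumes "A \<in> carrier_mat n n"
  shows "component L (det A) = determinant n L (\<lambda>i j. component L (A $$ (i, j)))"
  unfolding determinant_def det_def'[OF assms] component_sum
  by (auto intro!: finsum_cong' finprod_cong' arg_cong2[of _ _ _ _ "(\<otimes>)"]
      simp: component_prod sign_def atLeast0LessThan)

definition lifted :: "nat \<Rightarrow> (nat \<Rightarrow> nat \<Rightarrow> 't) \<Rightarrow> 't ring_product mat" where
  "lifted n M = mat n n (\<lambda>(i, j). lift_component L (M i j))"

lemma lifted_carrier [simp]: "lifted n M \<in> carrier_mat n n"
  by (simp add: lifted_def)

lemma determinant_cong:
  assumes "\<And>i j. i < n \<Longrightarrow> j < n \<Longrightarrow> M i j = N i j" "\<And>i j. i < n \<Longrightarrow> j < n \<Longrightarrow> N i j \<in> carrier L"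
  shows "determinant n L M = determinant n L N"
proof -
  have "(\<Otimes>i\<in>{..<n}. M i (\<pi> i)) = (\<Otimes>i\<in>{..<n}. N i (\<pi> i)) \<and> (\<Otimes>i\<in>{..<n}. N i (\<pi> i)) \<in> carrier L"
    if "\<pi> permutes {..<n}" for \<pi>
  proof -
    have "\<pi> i < n" if "i < n" for i using permutes_in_image[OF \<open>\<pi> permutes {..<n}\<close>, of i] that by simp
    then show ?thesis using assms by (intro conjI finprod_cong' finprod_closed) auto
  qed
  then show ?thesis
    unfolding determinant_def by (intro finsum_cong') auto
qed

lemma determinant_lifted:
  assumes "\<And>i j. i < n \<Longrightarrow> j < n \<Longrightarrow> M i j \<in> carrier L"
  shows "determinant n L M = component L (det (lifted n M))"
  unfolding component_det[OF lifted_carrier]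
  by (rule determinant_cong) (auto simp: lifted_def assms)

lemma determinant_closed:
  assumes "\<And>i j. i < n \<Longrightarrow> j < n \<Longrightarrow> M i j \<in> carrier L"
  shows "determinant n L M \<in> carrier L"
  by (simp add: determinant_lifted assms)

lemma determinant_mult:
  assumes M: "\<And>i j. i < n \<Longrightarrow> j < n \<Longrightarrow> M i j \<in> carrier L"
    and N: "\<And>i j. i < n \<Longrightarrow> j < n \<Longrightarrow> N i j \<in> carrier L"
  shows "determinant n L (\<lambda>i j. \<Oplus>h\<in>{..<n}. M i h \<otimes> N h j) = determinant n L M \<otimes> determinant n L N"
proof -
  have "determinant n L M \<otimes> determinant n L N = component L (det (lifted n M * lifted n N))"
    by (simp add: determinant_lifted M N det_mult[of _ n])
  also have "\<dots> = determinant n L (\<lambda>i j. component L ((lifted n M * lifted n N) $$ (i, j)))"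
    by (rule component_det[of _ n]) (rule mult_carrier_mat[of _ n n]; simp)
  also have "\<dots> = determinant n L (\<lambda>i j. \<Oplus>h\<in>{..<n}. M i h \<otimes> N h j)"
  proof (rule determinant_cong)
    fix i j assume "i < n" "j < n"
    then show "component L ((lifted n M * lifted n N) $$ (i, j)) = (\<Oplus>h\<in>{..<n}. M i h \<otimes> N h j)"
      by (auto simp: lifted_def scalar_prod_def component_sum M N atLeast0LessThan intro!: finsum_cong')
  qed (auto intro!: finsum_closed M N)
  finally show ?thesis by simp
qed

lemma determinant_one: "determinant n L (\<lambda>i j. if i = j then \<one> else \<zero>) = \<one>"
proof -
  have "\<one> = component L (det (1\<^sub>m n))" by simp
  also have "\<dots> = determinant n L (\<lambda>i j. if i = j then \<one> else \<zero>)"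
    by (subst component_det[of _ n]) (auto intro!: determinant_cong)
  finally show ?thesis by simp
qed

lemma component_power: "component L (x ^ n) = component L x [^] n"
  by (induction n) (auto simp: m_comm)

lemma determinant_scalar:
  assumes "r \<in> carrier L"
  shows "determinant n L (\<lambda>i j. if i = j then r else \<zero>) = r [^] n"
proof -
  have "r [^] n = component L (det (lift_component L r \<cdot>\<^sub>m 1\<^sub>m n))"
    by (simp add: component_power assms)
  also have "\<dots> = determinant n L (\<lambda>i j. if i = j then r else \<zero>)"
    by (subst component_det[of _ n]) (auto intro!: determinant_cong simp: assms)
  finally show ?thesis by simp
qed

end

section \<open>Determinants of block matrices\<close>

lemma det_shift_block:
  fixes B :: "nat \<Rightarrow> nat \<Rightarrow> 'a :: comm_ring_1"
  shows "det (mat (m + n) (m + n) (\<lambda>(i, j). if i < m \<or> j < m then (if i = j then 1 else 0) else B (i - m) (j - m)))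
    = det (mat n n (\<lambda>(i, j). B i j))"
proof (induction m)
  case (Suc m)
  let ?A = "mat (Suc m + n) (Suc m + n) (\<lambda>(i, j). if i < Suc m \<or> j < Suc m then (if i = j then 1 else 0) else B (i - Suc m) (j - Suc m))"
  have "det ?A = (\<Sum>j<Suc m + n. ?A $$ (0, j) * cofactor ?A 0 j)"
    by (rule laplace_expansion_row) auto
  also have "\<dots> = (\<Sum>j\<in>{0}. ?A $$ (0, j) * cofactor ?A 0 j)"
    by (rule sum.mono_neutral_right) auto
  also have "\<dots> = det (mat_delete ?A 0 0)"
    by (simp add: cofactor_def)
  also have "mat_delete ?A 0 0 = mat (m + n) (m + n) (\<lambda>(i, j). if i < m \<or> j < m then (if i = j then 1 else 0) else B (i - m) (j - m))"
    by (rule eq_matI) (auto simp: mat_delete_def)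
  finally show ?case using Suc by simp
qed simp

lemma det_extend_block:
  fixes B :: "nat \<Rightarrow> nat \<Rightarrow> 'a :: comm_ring_1"
  shows "det (mat (n + m) (n + m) (\<lambda>(i, j). if i < n \<and> j < n then B i j else (if i = j then 1 else 0)))
    = det (mat n n (\<lambda>(i, j). B i j))"
proof (induction m)
  case 0
  show ?case by (intro arg_cong[of _ _ det] eq_matI) auto
next
  case (Suc m)
  let ?A = "mat (n + Suc m) (n + Suc m) (\<lambda>(i, j). if i < n \<and> j < n then B i j else (if i = j then 1 else 0))"
  have "det ?A = (\<Sum>j<n + Suc m. ?A $$ (n + m, j) * cofactor ?A (n + m) j)"
    by (rule laplace_expansion_row) auto
  also have "\<dots> = (\<Sum>j\<in>{n + m}. ?A $$ (n + m, j) * cofactor ?A (n + m) j)"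
    by (rule sum.mono_neutral_right) auto
  also have "\<dots> = det (mat_delete ?A (n + m) (n + m))"
    by (simp add: cofactor_def)
  also have "mat_delete ?A (n + m) (n + m) = mat (n + m) (n + m) (\<lambda>(i, j). if i < n \<and> j < n then B i j else (if i = j then 1 else 0))"
    by (rule eq_matI) (auto simp: mat_delete_def)
  finally show ?case using Suc by simp
qed

text \<open>Position i lies in block \<open>i div n\<close> at offset \<open>i mod n\<close>. The
  last block is split off by a product of two matrices, \<open>?U\<close> with an identity in place
  of the last block and \<open>?V\<close> with an identity in place of all the others; the two
  preceding lemmas evaluate their determinants.\<close>

lemma det_block_diagonal:
  fixes B :: "nat \<Rightarrow> nat \<Rightarrow> 'a :: comm_ring_1"
  shows "det (mat (s * n) (s * n) (\<lambda>(i, j). if i div n = j div n then B (i mod n) (j mod n) else 0))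
    = det (mat n n (\<lambda>(i, j). B i j)) ^ s"
proof (induction s)
  case (Suc s)
  let ?D = "\<lambda>s. mat (s * n) (s * n) (\<lambda>(i, j). if i div n = j div n then B (i mod n) (j mod n) else 0)"
  let ?U = "mat (s * n + n) (s * n + n) (\<lambda>(i, j). if i < s * n \<and> j < s * n then (if i div n = j div n then B (i mod n) (j mod n) else 0) else (if i = j then 1 else 0))"
  let ?V = "mat (s * n + n) (s * n + n) (\<lambda>(i, j). if i < s * n \<or> j < s * n then (if i = j then 1 else 0) else B (i - s * n) (j - s * n))"
  have "?D (Suc s) = ?U * ?V"
  proof (rule eq_matI)
    fix i j assume "i < dim_row (?U * ?V)" "j < dim_col (?U * ?V)"
    then have ij: "i < s * n + n" "j < s * n + n" by auto
    have *: "(?U * ?V) $$ (i, j) = (\<Sum>h<s * n + n. ?U $$ (i, h) * ?V $$ (h, j))"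
      using ij by (simp add: scalar_prod_def atLeast0LessThan)
    have n0: "n > 0" using ij by (cases n) auto
    have div: "h div n < s" if "h < s * n" for h using that n0 by (simp add: less_mult_imp_div_less)
    have div': "h div n = s" "h mod n = h - s * n" if "h < s * n + n" "\<not> h < s * n" for h
    proof -
      show 1: "h div n = s" using that n0 by (intro div_nat_eqI) (auto simp: algebra_simps)
      show "h mod n = h - s * n" using 1 by (metis minus_div_mult_eq_mod)
    qed
    show "?D (Suc s) $$ (i, j) = (?U * ?V) $$ (i, j)"
    \<comment> \<open>In either case one factor has a single nonzero entry in the relevant row or
      column, so the sum over h collapses to h = j or to h = i.\<close>
    proof (cases "i < s * n")
      case True
      have "(?U * ?V) $$ (i, j) = (\<Sum>h\<in>{j}. ?U $$ (i, h) * ?V $$ (h, j))"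
        unfolding * using True ij by (intro sum.mono_neutral_right) auto
      then show ?thesis using True ij div[of i] div[of j] div'[of j] by (cases "j < s * n") (auto simp: algebra_simps)
    next
      case False
      have "(?U * ?V) $$ (i, j) = (\<Sum>h\<in>{i}. ?U $$ (i, h) * ?V $$ (h, j))"
        unfolding * using False ij by (intro sum.mono_neutral_right) auto
      then show ?thesis using False ij div[of j] div'[of i] div'[of j] by (cases "j < s * n") (auto simp: algebra_simps)
    qed
  qed (auto simp: algebra_simps)
  then have "det (?D (Suc s)) = det ?U * det ?V"
    by (simp add: det_mult[of _ "s * n + n"])
  also have "det ?U = det (?D s)"
    by (subst det_extend_block[of "s * n" n "\<lambda>i j. if i div n = j div n then B (i mod n) (j mod n) else 0"]) simp
  also have "det ?V = det (mat n n (\<lambda>(i, j). B i j))"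
    by (rule det_shift_block)
  finally show ?case using Suc by (simp add: mult.commute)
qed simp

context record_cring
begin

lemma determinant_block_diagonal:
  assumes "\<And>i j. i < n \<Longrightarrow> j < n \<Longrightarrow> M i j \<in> carrier L"
  shows "determinant (s * n) L (\<lambda>i j. if i div n = j div n then M (i mod n) (j mod n) else \<zero>) = determinant n L M [^] s"
proof -
  let ?D = "mat (s * n) (s * n) (\<lambda>(i, j). if i div n = j div n then lift_component L (M (i mod n) (j mod n)) else 0)"
  have "determinant n L M [^] s = component L (det (lifted n M) ^ s)"
    by (simp add: determinant_lifted component_power assms)
  also have "\<dots> = component L (det ?D)"
    using det_block_diagonal[of s n "\<lambda>i j. lift_component L (M i j)"] by (simp only: lifted_def)
  also have "\<dots> = determinant (s * n) L (\<lambda>i j. component L (?D $$ (i, j)))"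
    by (rule component_det) simp
  also have "\<dots> = determinant (s * n) L (\<lambda>i j. if i div n = j div n then M (i mod n) (j mod n) else \<zero>)"
  proof (rule determinant_cong)
    fix i j assume ij: "i < s * n" "j < s * n"
    then have "n > 0" by (cases n) auto
    then show "component L (?D $$ (i, j)) = (if i div n = j div n then M (i mod n) (j mod n) else \<zero>)"
      "(if i div n = j div n then M (i mod n) (j mod n) else \<zero>) \<in> carrier L"
      using ij assms by auto
  qed
  finally show ?thesis by simp
qed

end

lemma determinant_hom:
  assumes L: "cring L" and L': "cring L'" and h: "h \<in> ring_hom L L'"
    and M: "\<And>i j. i < n \<Longrightarrow> j < n \<Longrightarrow> M i j \<in> carrier L"
  shows "h (determinant n L M) = determinant n L' (\<lambda>i j. h (M i j))"
proof -
  interpret L: cring L by (rule L)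
  interpret L': cring L' by (rule L')
  interpret h: ring_hom_cring L L' h
    using L L' h by (simp add: ring_hom_cring_def ring_hom_cring_axioms_def)
  have cl: "(\<lambda>i. M i (\<pi> i)) \<in> {..<n} \<rightarrow> carrier L" if "\<pi> permutes {..<n}" for \<pi>
  proof (rule Pi_I)
    fix i assume "i \<in> {..<n}"
    then have "i < n" "\<pi> i < n" using permutes_in_image[OF that, of i] by auto
    then show "M i (\<pi> i) \<in> carrier L" by (rule M)
  qed
  have cl': "(\<lambda>i. h (M i (\<pi> i))) \<in> {..<n} \<rightarrow> carrier L'" if "\<pi> permutes {..<n}" for \<pi>
    using cl[OF that] by auto
  have "h (determinant n L M) = (\<Oplus>\<^bsub>L'\<^esub>\<pi>\<in>{\<pi>. \<pi> permutes {..<n}}.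
      h ((if evenperm \<pi> then \<one>\<^bsub>L\<^esub> else \<ominus>\<^bsub>L\<^esub> \<one>\<^bsub>L\<^esub>) \<otimes>\<^bsub>L\<^esub> (\<Otimes>\<^bsub>L\<^esub>i\<in>{..<n}. M i (\<pi> i))))"
    unfolding determinant_def using cl by (subst h.hom_finsum) (auto simp: comp_def)
  also have "\<dots> = determinant n L' (\<lambda>i j. h (M i j))"
    unfolding determinant_def
  proof (rule L'.finsum_cong')
    fix \<pi> assume "\<pi> \<in> {\<pi>. \<pi> permutes {..<n}}"
    then have \<pi>: "\<pi> permutes {..<n}" by simp
    show "h ((if evenperm \<pi> then \<one>\<^bsub>L\<^esub> else \<ominus>\<^bsub>L\<^esub> \<one>\<^bsub>L\<^esub>) \<otimes>\<^bsub>L\<^esub> (\<Otimes>\<^bsub>L\<^esub>i\<in>{..<n}. M i (\<pi> i))) =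
      (if evenperm \<pi> then \<one>\<^bsub>L'\<^esub> else \<ominus>\<^bsub>L'\<^esub> \<one>\<^bsub>L'\<^esub>) \<otimes>\<^bsub>L'\<^esub> (\<Otimes>\<^bsub>L'\<^esub>i\<in>{..<n}. h (M i (\<pi> i)))"
      using cl[OF \<pi>] by (simp add: h.hom_finprod comp_def L.finprod_closed)
  qed (use cl' in \<open>auto intro!: L'.finprod_closed\<close>)
  finally show ?thesis .
qed

section \<open>Polynomials and determinants of pencils\<close>

text \<open>The polynomial ring \<open>UP L\<close> stripped of its additional record fields. The
  result has the plain type \<open>ring\<close>, so \<open>record_cring\<close> and the determinant
  lemmas apply to polynomial matrices.\<close>

definition polys :: "'t ring \<Rightarrow> (nat \<Rightarrow> 't) ring" where
  "polys L = \<lparr>carrier = up L, monoid.mult = (\<otimes>\<^bsub>UP L\<^esub>), one = \<one>\<^bsub>UP L\<^esub>, ring.zero = \<zero>\<^bsub>UP L\<^esub>, add = (\<oplus>\<^bsub>UP L\<^esub>)\<rparr>"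

lemma polys_simps:
  fixes L (structure)
  shows "carrier (polys L) = up L"
  "p \<in> up L \<Longrightarrow> q \<in> up L \<Longrightarrow> (p \<otimes>\<^bsub>polys L\<^esub> q) k = (\<Oplus>i\<in>{..k}. p i \<otimes> q (k - i))"
  "p \<in> up L \<Longrightarrow> q \<in> up L \<Longrightarrow> (p \<oplus>\<^bsub>polys L\<^esub> q) k = p k \<oplus> q k"
  "\<one>\<^bsub>polys L\<^esub> = (\<lambda>k. if k = 0 then \<one> else \<zero>)"
  "\<zero>\<^bsub>polys L\<^esub> = (\<lambda>k. \<zero>)"
  by (simp_all add: polys_def UP_def)

lemma UP_simps: "carrier (UP L) = up L" "p \<in> up L \<Longrightarrow> up_ring.coeff (UP L) p i = p i"
  by (simp_all add: UP_def)

lemma polys_UP: "carrier (polys L) = carrier (UP L)" "monoid.mult (polys L) = monoid.mult (UP L)" "monoid.one (polys L) = monoid.one (UP L)"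
    "ring.zero (polys L) = ring.zero (UP L)" "ring.add (polys L) = ring.add (UP L)"
  by (simp_all add: polys_def UP_def)

context record_cring
begin

lemma cring_polys: "cring (polys L)"
proof -
  interpret UP: UP_cring L "UP L"
    by unfold_locales
  note c = polys_UP[of L]
  have a: "abelian_group (polys L)"
  proof (rule abelian_groupI)
    fix x assume "x \<in> carrier (polys L)"
    then show "\<exists>y\<in>carrier (polys L). y \<oplus>\<^bsub>polys L\<^esub> x = \<zero>\<^bsub>polys L\<^esub>"
      unfolding c by (rule UP.UP_l_neg_ex)
  qed (auto simp: c UP.P.a_assoc intro: UP.P.a_comm)
  show ?thesis
    by (rule cringI[OF a]) (auto simp: c UP.P.l_distr UP.P.m_assoc intro!: comm_monoidI intro: UP.P.m_comm)
qed

interpretation P: record_cring "polys L"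
  by (simp add: record_cring_def cring_polys)

lemma up_closed [simp]: "p \<in> up L \<Longrightarrow> p k \<in> carrier L"
  by auto

lemma upI:
  assumes "\<And>i. p i \<in> carrier L" "\<And>i. i > d \<Longrightarrow> p i = \<zero>"
  shows "p \<in> up L"
  by (intro mem_upI exI[of _ d] bound.intro assms)

lemma up_vanishes:
  assumes "p \<in> up L"
  obtains d where "\<And>i. i > d \<Longrightarrow> p i = \<zero>"
  using assms unfolding up_def by (auto dest: bound.bound)

definition const_poly :: "'t \<Rightarrow> nat \<Rightarrow> 't" where
  "const_poly c = (\<lambda>k. if k = 0 then c else \<zero>)"

lemma const_poly_up [simp]: "c \<in> carrier L \<Longrightarrow> const_poly c \<in> up L"
  by (rule upI[of _ 0]) (auto simp: const_poly_def)

lemma const_poly_mult: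
  assumes "c \<in> carrier L" "p \<in> up L"
  shows "(const_poly c \<otimes>\<^bsub>polys L\<^esub> p) k = c \<otimes> p k"
proof -
  have "(const_poly c \<otimes>\<^bsub>polys L\<^esub> p) k = (\<Oplus>i\<in>{..k}. const_poly c i \<otimes> p (k - i))"
    by (rule polys_simps) (use assms in auto)
  also have "\<dots> = (\<Oplus>i\<in>{..k}. if 0 = i then c \<otimes> p (k - i) else \<zero>)"
    by (rule finsum_cong') (use assms in \<open>auto simp: const_poly_def\<close>)
  also have "\<dots> = c \<otimes> p k"
    by (subst finsum_singleton[of 0 "{..k}" "\<lambda>i. c \<otimes> p (k - i)"]) (use assms in auto)
  finally show ?thesis .
qed

lemma coeff0_hom: "(\<lambda>p. p 0) \<in> ring_hom (polys L) L"
  by (rule ring_hom_memI) (auto simp: polys_simps)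

definition eval1 :: "(nat \<Rightarrow> 't) \<Rightarrow> 't" where
  "eval1 = UnivPoly.eval L L (\<lambda>x. x) \<one>"

lemma eval1_hom: "eval1 \<in> ring_hom (polys L) L"
proof -
  have eq: "ring_hom (UP L) L = ring_hom (polys L) L"
    by (simp only: Ring.ring_hom_def polys_UP)
  have "(\<lambda>x. x) \<in> ring_hom L L" by (rule ring_hom_memI) (rule refl | assumption)+
  then have "UP_pre_univ_prop L L (\<lambda>x. x)"
    by (rule UP_pre_univ_propI[OF cring_axioms cring_axioms])
  then interpret E: UP_pre_univ_prop L L "\<lambda>x. x" "UP L" .
  have "eval1 \<in> ring_hom (UP L) L"
    unfolding eval1_def by (rule E.eval_ring_hom) (rule one_closed)
  then show ?thesis unfolding eq .
qed

lemma eval1: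
  assumes "p \<in> up L" "\<And>i. i > d \<Longrightarrow> p i = \<zero>"
  shows "eval1 p = (\<Oplus>i\<in>{..d}. p i)"
proof -
  interpret UP: UP_cring L "UP L"
    by unfold_locales
  have p: "p \<in> carrier (UP L)" "\<And>i. up_ring.coeff (UP L) p i = p i"
    using assms by (simp_all add: UP_simps)
  have d: "deg L p \<le> d" by (rule UP.deg_aboveI) (use p assms in auto)
  have "eval1 p = (\<Oplus>i\<in>{..deg L p}. p i)"
    unfolding eval1_def using p by (subst UP.eval_on_carrier) (auto intro!: finsum_cong' simp: assms)
  also have "\<dots> = (\<Oplus>i\<in>{..d}. p i)"
    by (rule add.finprod_mono_neutral_cong_left)
       (use d assms(1) UP.deg_aboveD[OF _ p(1)] p in auto)
  finally show ?thesis .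
qed

text \<open>The polynomial matrix \<open>1 + t (M - 1)\<close>.\<close>

definition pencil :: "(nat \<Rightarrow> nat \<Rightarrow> 't) \<Rightarrow> nat \<Rightarrow> nat \<Rightarrow> nat \<Rightarrow> 't" where
  "pencil M i j = (\<lambda>k. let \<delta> = (if i = j then \<one> else \<zero>) in
     if k = 0 then \<delta> else if k = 1 then M i j \<ominus> \<delta> else \<zero>)"

definition pencil_det :: "nat \<Rightarrow> (nat \<Rightarrow> nat \<Rightarrow> 't) \<Rightarrow> nat \<Rightarrow> 't" where
  "pencil_det n M = determinant n (polys L) (pencil M)"

lemma pencil_up [simp]: "M i j \<in> carrier L \<Longrightarrow> pencil M i j \<in> up L"
  by (rule upI[of _ 1]) (auto simp: pencil_def Let_def)

lemma pencil_det_up: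
  assumes "\<And>i j. i < n \<Longrightarrow> j < n \<Longrightarrow> M i j \<in> carrier L"
  shows "pencil_det n M \<in> up L"
  using P.determinant_closed[of n "pencil M"] assms by (auto simp: pencil_det_def polys_simps)

lemma pencil_det_0:
  assumes "\<And>i j. i < n \<Longrightarrow> j < n \<Longrightarrow> M i j \<in> carrier L"
  shows "pencil_det n M 0 = \<one>"
proof -
  have "pencil_det n M 0 = determinant n L (\<lambda>i j. pencil M i j 0)"
    unfolding pencil_det_def
    by (rule determinant_hom[OF cring_polys cring_axioms coeff0_hom]) (use assms in \<open>auto simp: polys_simps\<close>)
  also have "\<dots> = determinant n L (\<lambda>i j. if i = j then \<one> else \<zero>)"
    by (simp add: pencil_def Let_def)
  finally show ?thesis by (simp add: determinant_one)
qed

lemma pencil_det_eval1: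
  assumes "\<And>i j. i < n \<Longrightarrow> j < n \<Longrightarrow> M i j \<in> carrier L"
  shows "eval1 (pencil_det n M) = determinant n L M"
proof -
  have "eval1 (pencil_det n M) = determinant n L (\<lambda>i j. eval1 (pencil M i j))"
    unfolding pencil_det_def
    by (rule determinant_hom[OF cring_polys cring_axioms eval1_hom]) (use assms in \<open>auto simp: polys_simps\<close>)
  also have "\<dots> = determinant n L M"
  proof (rule determinant_cong)
    fix i j assume "i < n" "j < n"
    then have m: "M i j \<in> carrier L" by (rule assms)
    have "eval1 (pencil M i j) = (\<Oplus>k\<in>{..1}. pencil M i j k)"
      by (rule eval1) (use m in \<open>simp, simp add: pencil_def\<close>)
    also have "\<dots> = M i j"
    proof -
      have "(if i = j then \<one> else \<zero>) \<oplus> (M i j \<ominus> (if i = j then \<one> else \<zero>)) = M i j"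
        using m by (auto simp: minus_eq a_ac r_neg r_neg1 intro: a_comm)
      moreover have "{..1::nat} = {0, 1}" by auto
      ultimately show ?thesis using m by (auto simp: pencil_def Let_def a_comm)
    qed
    finally show "eval1 (pencil M i j) = M i j" .
  qed (rule assms)
  finally show ?thesis .
qed

lemma pencil_det_block_diagonal:
  assumes "\<And>i j. i < n \<Longrightarrow> j < n \<Longrightarrow> M i j \<in> carrier L"
  shows "pencil_det (s * n) (\<lambda>i j. if i div n = j div n then M (i mod n) (j mod n) else \<zero>) = pencil_det n M [^]\<^bsub>polys L\<^esub> s"
proof -
  have "pencil_det n M [^]\<^bsub>polys L\<^esub> s = determinant (s * n) (polys L)
      (\<lambda>i j. if i div n = j div n then pencil M (i mod n) (j mod n) else \<zero>\<^bsub>polys L\<^esub>)"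
    unfolding pencil_det_def
    by (rule P.determinant_block_diagonal[symmetric]) (use assms in \<open>auto simp: polys_simps\<close>)
  also have "\<dots> = pencil_det (s * n) (\<lambda>i j. if i div n = j div n then M (i mod n) (j mod n) else \<zero>)"
    unfolding pencil_det_def
  proof (rule P.determinant_cong)
    fix i j assume ij: "i < s * n" "j < s * n"
    then have "n > 0" by (cases n) auto
    then have m: "M (i mod n) (j mod n) \<in> carrier L" by (intro assms) auto
    \<comment> \<open>Inside a diagonal block the Kronecker delta of the large matrix is that of the
      block, so taking the pencil commutes with forming the block matrix.\<close>
    have e: "i = j \<longleftrightarrow> i mod n = j mod n" if "i div n = j div n"
      using that by (metis div_mult_mod_eq)
    show "(if i div n = j div n then pencil M (i mod n) (j mod n) else \<zero>\<^bsub>polys L\<^esub>) =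
      pencil (\<lambda>i j. if i div n = j div n then M (i mod n) (j mod n) else \<zero>) i j"
      using e by (auto simp: pencil_def polys_simps fun_eq_iff Let_def minus_eq)
    show "pencil (\<lambda>i j. if i div n = j div n then M (i mod n) (j mod n) else \<zero>) i j \<in> carrier (polys L)"
      using m by (auto simp: polys_simps)
  qed
  finally show ?thesis by simp
qed

text \<open>With the entries of Q read as constant polynomials, the relation Q M = D Q passes to the
  pencils, and taking determinants gives equality up to the factor det Q. The right inverse Q' makes
  det Q a unit of the commutative ring \<open>polys L\<close>, so it can be cancelled although that
  ring need not be a domain.\<close>

lemma pencil_det_similar:
  assumes M: "\<And>i j. i < n \<Longrightarrow> j < n \<Longrightarrow> M i j \<in> carrier L"
    and D: "\<And>i j. i < n \<Longrightarrow> j < n \<Longrightarrow> D i j \<in> carrier L"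
    and Q: "\<And>i j. i < n \<Longrightarrow> j < n \<Longrightarrow> Q i j \<in> carrier L"
    and Q': "\<And>i j. i < n \<Longrightarrow> j < n \<Longrightarrow> Q' i j \<in> carrier L"
    and inv: "\<And>i j. i < n \<Longrightarrow> j < n \<Longrightarrow> (\<Oplus>h\<in>{..<n}. Q i h \<otimes> Q' h j) = (if i = j then \<one> else \<zero>)"
    and sim: "\<And>i j. i < n \<Longrightarrow> j < n \<Longrightarrow> (\<Oplus>h\<in>{..<n}. Q i h \<otimes> M h j) = (\<Oplus>h\<in>{..<n}. D i h \<otimes> Q h j)"
  shows "pencil_det n M = pencil_det n D"
proof -
  let ?c = "\<lambda>i j. const_poly (Q i j)" and ?c' = "\<lambda>i j. const_poly (Q' i j)"
  have fin: "(\<Oplus>\<^bsub>polys L\<^esub>h\<in>A. f h) k = (\<Oplus>h\<in>A. f h k)" if "f \<in> A \<rightarrow> up L" "finite A" for f k and A :: "nat set"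
    using that(2,1)
  proof (induction A)
    case (insert x A)
    then have "(\<Oplus>\<^bsub>polys L\<^esub>h\<in>A. f h) \<in> carrier (polys L)"
      by (intro P.finsum_closed) (auto simp: polys_simps)
    with insert show ?case
      by (subst P.finsum_insert) (auto simp: polys_simps(1) polys_simps(3) Pi_def)
  qed (simp add: polys_simps)
  have comm: "(\<Oplus>\<^bsub>polys L\<^esub>h\<in>{..<n}. ?c i h \<otimes>\<^bsub>polys L\<^esub> pencil M h j) = (\<Oplus>\<^bsub>polys L\<^esub>h\<in>{..<n}. pencil D i h \<otimes>\<^bsub>polys L\<^esub> ?c h j)"
    if ij: "i < n" "j < n" for i j
  proof
    fix k
    have l: "(\<Oplus>\<^bsub>polys L\<^esub>h\<in>{..<n}. ?c i h \<otimes>\<^bsub>polys L\<^esub> pencil M h j) k = (\<Oplus>h\<in>{..<n}. Q i h \<otimes> pencil M h j k)"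
      using ij Q M P.m_closed by (subst fin) (auto simp: polys_simps(1) const_poly_mult intro!: finsum_cong')
    have r1: "(\<Oplus>\<^bsub>polys L\<^esub>h\<in>{..<n}. pencil D i h \<otimes>\<^bsub>polys L\<^esub> ?c h j) = (\<Oplus>\<^bsub>polys L\<^esub>h\<in>{..<n}. ?c h j \<otimes>\<^bsub>polys L\<^esub> pencil D i h)"
      using ij Q D by (intro P.finsum_cong') (auto simp: polys_simps(1) intro!: P.m_comm P.m_closed[unfolded polys_simps(1)])
    have r: "(\<Oplus>\<^bsub>polys L\<^esub>h\<in>{..<n}. pencil D i h \<otimes>\<^bsub>polys L\<^esub> ?c h j) k = (\<Oplus>h\<in>{..<n}. Q h j \<otimes> pencil D i h k)"
      unfolding r1 using ij Q D P.m_closed by (subst fin) (auto simp: polys_simps(1) const_poly_mult intro!: finsum_cong')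
    have d1: "(\<Oplus>h\<in>{..<n}. Q i h \<otimes> (if h = j then \<one> else \<zero>)) = Q i j"
    proof -
      have "(\<Oplus>h\<in>{..<n}. Q i h \<otimes> (if h = j then \<one> else \<zero>)) = (\<Oplus>h\<in>{..<n}. if j = h then Q i h else \<zero>)"
        using ij Q by (intro finsum_cong') auto
      also have "\<dots> = Q i j" using ij Q by (subst finsum_singleton) auto
      finally show ?thesis .
    qed
    have d2: "(\<Oplus>h\<in>{..<n}. Q h j \<otimes> (if i = h then \<one> else \<zero>)) = Q i j"
    proof -
      have "(\<Oplus>h\<in>{..<n}. Q h j \<otimes> (if i = h then \<one> else \<zero>)) = (\<Oplus>h\<in>{..<n}. if i = h then Q h j else \<zero>)"
        using ij Q by (intro finsum_cong') auto
      also have "\<dots> = Q i j" using ij Q by (subst finsum_singleton) auto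
      finally show ?thesis .
    qed
    have s: "(\<Oplus>h\<in>{..<n}. f h \<otimes> (g h \<ominus> e h)) = (\<Oplus>h\<in>{..<n}. f h \<otimes> g h) \<ominus> (\<Oplus>h\<in>{..<n}. f h \<otimes> e h)"
      if "f \<in> {..<n} \<rightarrow> carrier L" "g \<in> {..<n} \<rightarrow> carrier L" "e \<in> {..<n} \<rightarrow> carrier L" for f g e
    proof -
      have "(\<Oplus>h\<in>{..<n}. f h \<otimes> (g h \<ominus> e h)) = (\<Oplus>h\<in>{..<n}. f h \<otimes> g h \<oplus> \<ominus> \<one> \<otimes> (f h \<otimes> e h))"
        using that by (intro finsum_cong') (auto simp: Pi_def minus_eq r_distr r_minus l_minus)
      also have "\<dots> = (\<Oplus>h\<in>{..<n}. f h \<otimes> g h) \<oplus> (\<Oplus>h\<in>{..<n}. \<ominus> \<one> \<otimes> (f h \<otimes> e h))"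
        using that by (intro finsum_addf) (auto simp: Pi_def)
      also have "(\<Oplus>h\<in>{..<n}. \<ominus> \<one> \<otimes> (f h \<otimes> e h)) = \<ominus> \<one> \<otimes> (\<Oplus>h\<in>{..<n}. f h \<otimes> e h)"
        using that by (intro finsum_rdistr[symmetric]) (auto simp: Pi_def)
      finally show ?thesis using that by (simp add: Pi_def minus_eq l_minus finsum_closed)
    qed
    have "(\<Oplus>h\<in>{..<n}. Q i h \<otimes> pencil M h j k) = (\<Oplus>h\<in>{..<n}. Q h j \<otimes> pencil D i h k)"
    proof -
      \<comment> \<open>Coefficient 0 of both sides is Q i j, coefficient 1 is the relation
        \<open>sim\<close> with Q i j subtracted on both sides, and all higher coefficients
        vanish.\<close>
      consider "k = 0" | "k = 1" | "k > 1" by linarith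
      then show ?thesis
      proof cases
        case 1 then show ?thesis using d1 d2 by (simp add: pencil_def Let_def)
      next
        case 2
        have "(\<Oplus>h\<in>{..<n}. Q i h \<otimes> (M h j \<ominus> (if h = j then \<one> else \<zero>))) = (\<Oplus>h\<in>{..<n}. Q i h \<otimes> M h j) \<ominus> Q i j"
          using ij Q M by (subst s) (auto simp: d1)
        moreover have "(\<Oplus>h\<in>{..<n}. Q h j \<otimes> (D i h \<ominus> (if i = h then \<one> else \<zero>))) = (\<Oplus>h\<in>{..<n}. Q h j \<otimes> D i h) \<ominus> Q i j"
          using ij Q D by (subst s) (auto simp: d2)
        moreover have "(\<Oplus>h\<in>{..<n}. Q h j \<otimes> D i h) = (\<Oplus>h\<in>{..<n}. D i h \<otimes> Q h j)"
          using ij Q D by (intro finsum_cong') (auto intro: m_comm)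
        ultimately show ?thesis using 2 sim[OF ij] by (simp add: pencil_def Let_def)
      next
        case 3
        then have z: "pencil M h j k = \<zero>" "pencil D i h k = \<zero>" for h by (simp_all add: pencil_def)
        have "(\<Oplus>h\<in>{..<n}. Q i h \<otimes> \<zero>) = (\<Oplus>h\<in>{..<n}. \<zero>)"
          by (rule finsum_cong') (use ij Q in auto)
        moreover have "(\<Oplus>h\<in>{..<n}. Q h j \<otimes> \<zero>) = (\<Oplus>h\<in>{..<n}. \<zero>)"
          by (rule finsum_cong') (use ij Q in auto)
        ultimately show ?thesis by (simp add: z)
      qed
    qed
    then show "(\<Oplus>\<^bsub>polys L\<^esub>h\<in>{..<n}. ?c i h \<otimes>\<^bsub>polys L\<^esub> pencil M h j) k = (\<Oplus>\<^bsub>polys L\<^esub>h\<in>{..<n}. pencil D i h \<otimes>\<^bsub>polys L\<^esub> ?c h j) k"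
      using l r by simp
  qed
  let ?d = "determinant n (polys L) ?c" and ?d' = "determinant n (polys L) ?c'"
  have cl: "?d \<in> carrier (polys L)" "?d' \<in> carrier (polys L)" "pencil_det n M \<in> carrier (polys L)" "pencil_det n D \<in> carrier (polys L)"
    subgoal by (rule P.determinant_closed) (use Q in \<open>simp add: polys_simps(1)\<close>)
    subgoal by (rule P.determinant_closed) (use Q' in \<open>simp add: polys_simps(1)\<close>)
    using M D by (simp_all add: polys_simps(1) pencil_det_up)
  have "?d \<otimes>\<^bsub>polys L\<^esub> pencil_det n M = determinant n (polys L) (\<lambda>i j. \<Oplus>\<^bsub>polys L\<^esub>h\<in>{..<n}. ?c i h \<otimes>\<^bsub>polys L\<^esub> pencil M h j)"
    unfolding pencil_det_def by (rule P.determinant_mult[symmetric]) (use Q M in \<open>auto simp: polys_simps(1)\<close>)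
  also have "\<dots> = determinant n (polys L) (\<lambda>i j. \<Oplus>\<^bsub>polys L\<^esub>h\<in>{..<n}. pencil D i h \<otimes>\<^bsub>polys L\<^esub> ?c h j)"
  proof (rule P.determinant_cong)
    fix i j assume ij: "i < n" "j < n"
    then show "(\<Oplus>\<^bsub>polys L\<^esub>h\<in>{..<n}. pencil D i h \<otimes>\<^bsub>polys L\<^esub> ?c h j) \<in> carrier (polys L)"
      by (intro P.finsum_closed Pi_I P.m_closed) (use Q D in \<open>simp_all add: polys_simps(1)\<close>)
  qed (rule comm)
  also have "\<dots> = pencil_det n D \<otimes>\<^bsub>polys L\<^esub> ?d"
    unfolding pencil_det_def by (rule P.determinant_mult) (use Q D in \<open>auto simp: polys_simps(1)\<close>)
  finally have 1: "?d \<otimes>\<^bsub>polys L\<^esub> pencil_det n M = ?d \<otimes>\<^bsub>polys L\<^esub> pencil_det n D"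
    using cl by (simp add: P.m_comm)
  have "?d \<otimes>\<^bsub>polys L\<^esub> ?d' = determinant n (polys L) (\<lambda>i j. \<Oplus>\<^bsub>polys L\<^esub>h\<in>{..<n}. ?c i h \<otimes>\<^bsub>polys L\<^esub> ?c' h j)"
    by (rule P.determinant_mult[symmetric]) (use Q Q' in \<open>auto simp: polys_simps(1)\<close>)
  also have "\<dots> = determinant n (polys L) (\<lambda>i j. if i = j then \<one>\<^bsub>polys L\<^esub> else \<zero>\<^bsub>polys L\<^esub>)"
  proof (rule P.determinant_cong)
    fix i j assume ij: "i < n" "j < n"
    show "(\<Oplus>\<^bsub>polys L\<^esub>h\<in>{..<n}. ?c i h \<otimes>\<^bsub>polys L\<^esub> ?c' h j) = (if i = j then \<one>\<^bsub>polys L\<^esub> else \<zero>\<^bsub>polys L\<^esub>)"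
    proof
      fix k
      have "(\<Oplus>\<^bsub>polys L\<^esub>h\<in>{..<n}. ?c i h \<otimes>\<^bsub>polys L\<^esub> ?c' h j) k = (\<Oplus>h\<in>{..<n}. Q i h \<otimes> const_poly (Q' h j) k)"
        using ij Q Q' P.m_closed by (subst fin) (auto simp: polys_simps(1) const_poly_mult intro!: finsum_cong')
      also have "\<dots> = (if k = 0 then (\<Oplus>h\<in>{..<n}. Q i h \<otimes> Q' h j) else (\<Oplus>h\<in>{..<n}. \<zero>))"
      proof (cases "k = 0")
        case False
        have "(\<Oplus>h\<in>{..<n}. Q i h \<otimes> \<zero>) = (\<Oplus>h\<in>{..<n}. \<zero>)"
          by (rule finsum_cong') (use ij Q in auto)
        then show ?thesis using False by (simp add: const_poly_def)
      qed (simp add: const_poly_def)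
      finally show "(\<Oplus>\<^bsub>polys L\<^esub>h\<in>{..<n}. ?c i h \<otimes>\<^bsub>polys L\<^esub> ?c' h j) k = (if i = j then \<one>\<^bsub>polys L\<^esub> else \<zero>\<^bsub>polys L\<^esub>) k"
        using inv[OF ij] by (auto simp: polys_simps(4,5))
    qed
  qed (auto intro: P.zero_closed P.one_closed)
  finally have 2: "?d' \<otimes>\<^bsub>polys L\<^esub> ?d = \<one>\<^bsub>polys L\<^esub>"
    using cl by (simp add: P.determinant_one P.m_comm)
  have "pencil_det n M = ?d' \<otimes>\<^bsub>polys L\<^esub> (?d \<otimes>\<^bsub>polys L\<^esub> pencil_det n M)"
    using cl 2 by (simp flip: P.m_assoc)
  also have "\<dots> = pencil_det n D"
    unfolding 1 using cl 2 by (simp flip: P.m_assoc)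
  finally show ?thesis .
qed

section \<open>Coefficients of powers of polynomials\<close>

lemma polys_mult_cong:
  assumes "p \<in> up L" "q \<in> up L" "p' \<in> up L" "q' \<in> up L"
    and "\<And>i. i \<le> k \<Longrightarrow> p i = p' i" "\<And>i. i \<le> k \<Longrightarrow> q i = q' i"
  shows "(p \<otimes>\<^bsub>polys L\<^esub> q) k = (p' \<otimes>\<^bsub>polys L\<^esub> q') k"
  using assms by (auto simp: polys_simps(2) intro!: finsum_cong')

text \<open>In the expansion of an m-th power, coefficient k of the base appears once for each of
  the m factors, always multiplied by constant terms, which are 1. Changing only that coefficient
  therefore changes coefficient k of the power by m times the difference. Where m is invertible this
  can be solved for the coefficient of the base.\<close>

lemma polys_power_coeff:
  assumes pq: "p \<in> up L" "q \<in> up L" and k: "k > 0"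
    and eq: "\<And>i. i < k \<Longrightarrow> p i = q i" and 1: "q 0 = \<one>"
  shows "(\<forall>i<k. (p [^]\<^bsub>polys L\<^esub> m) i = (q [^]\<^bsub>polys L\<^esub> m) i) \<and> (q [^]\<^bsub>polys L\<^esub> (m :: nat)) 0 = \<one> \<and>
    (p [^]\<^bsub>polys L\<^esub> m) k = (q [^]\<^bsub>polys L\<^esub> m) k \<oplus> [m] \<cdot> (p k \<ominus> q k)"
proof (induction m)
  case 0
  show ?case using pq by (auto simp: polys_simps(4))
next
  case (Suc m)
  let ?P = "p [^]\<^bsub>polys L\<^esub> m" and ?Q = "q [^]\<^bsub>polys L\<^esub> m"
  have up: "?P \<in> up L" "?Q \<in> up L"
    using pq P.nat_pow_closed unfolding polys_simps(1) by auto
  \<comment> \<open>Coefficient k of a factor enters the convolution only through the two end terms;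
    the interior terms, compared in \<open>mid\<close>, involve lower coefficients alone.\<close>
  have split: "{..k} = insert 0 (insert k {0<..<k})" using k by auto
  have ex: "(x \<otimes>\<^bsub>polys L\<^esub> y) k = x 0 \<otimes> y k \<oplus> (x k \<otimes> y 0 \<oplus> (\<Oplus>i\<in>{0<..<k}. x i \<otimes> y (k - i)))"
    if "x \<in> up L" "y \<in> up L" for x y
    unfolding polys_simps(2)[OF that] split using that k
    by (subst finsum_insert; auto simp: Pi_def)+
  have mid: "(\<Oplus>i\<in>{0<..<k}. ?P i \<otimes> p (k - i)) = (\<Oplus>i\<in>{0<..<k}. ?Q i \<otimes> q (k - i))"
    using Suc eq up pq by (intro finsum_cong') auto
  define r where "r = (\<Oplus>i\<in>{0<..<k}. ?Q i \<otimes> q (k - i))"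
  have r: "r \<in> carrier L" unfolding r_def using up pq by (auto intro!: finsum_closed)
  have c: "p k \<in> carrier L" "q k \<in> carrier L" "?Q k \<in> carrier L" "?P k \<in> carrier L" "p 0 = \<one>" "?P 0 = \<one>" "?Q 0 = \<one>"
    using up pq eq[of 0] k 1 Suc by auto
  have "(p [^]\<^bsub>polys L\<^esub> Suc m) k = p k \<oplus> (?P k \<oplus> r)"
    using ex[OF up(1) pq(1)] c by (simp add: mid r_def)
  also have "\<dots> = p k \<oplus> (?Q k \<oplus> [m] \<cdot> (p k \<ominus> q k) \<oplus> r)"
    using Suc by simp
  also have "\<dots> = (q k \<oplus> (?Q k \<oplus> r)) \<oplus> ([m] \<cdot> (p k \<ominus> q k) \<oplus> (p k \<ominus> q k))"
  proof -
    define e s where "e = p k \<ominus> q k" and "s = [m] \<cdot> e"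
    have es: "e \<in> carrier L" "s \<in> carrier L" using c by (auto simp: e_def s_def)
    have "q k \<oplus> e = (q k \<oplus> \<ominus> q k) \<oplus> p k" using c unfolding e_def minus_eq by (simp only: a_ac a_inv_closed)
    then have "p k = q k \<oplus> e" using c by (simp add: r_neg)
    then have "p k \<oplus> (?Q k \<oplus> s \<oplus> r) = (q k \<oplus> (?Q k \<oplus> r)) \<oplus> (s \<oplus> e)"
      using c r es by (simp add: a_ac)
    then show ?thesis unfolding s_def e_def .
  qed
  also have "q k \<oplus> (?Q k \<oplus> r) = (q [^]\<^bsub>polys L\<^esub> Suc m) k"
    using ex[OF up(2) pq(2)] c 1 by (simp add: r_def)
  also have "[m] \<cdot> (p k \<ominus> q k) \<oplus> (p k \<ominus> q k) = [Suc m] \<cdot> (p k \<ominus> q k)"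
    using c by (simp add: add.nat_pow_Suc)
  finally have "(p [^]\<^bsub>polys L\<^esub> Suc m) k = (q [^]\<^bsub>polys L\<^esub> Suc m) k \<oplus> [Suc m] \<cdot> (p k \<ominus> q k)" .
  moreover have "(p [^]\<^bsub>polys L\<^esub> Suc m) i = (q [^]\<^bsub>polys L\<^esub> Suc m) i" if "i < k" for i
    using polys_mult_cong[OF up(1) pq(1) up(2) pq(2), of i] that Suc eq by simp
  moreover have "(q [^]\<^bsub>polys L\<^esub> Suc m) 0 = \<one>"
    using polys_simps(2)[OF up(2) pq(2), of 0] c 1 by simp
  ultimately show ?case by blast
qed

end

lemma polys_map_hom:
  assumes F: "cring F" and L: "cring L" and j: "j \<in> ring_hom F L"
  shows "(\<lambda>p k. j (p k)) \<in> ring_hom (polys F) (polys L)"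
proof -
  interpret F: record_cring F using F by (simp add: record_cring_def)
  interpret L: record_cring L using L by (simp add: record_cring_def)
  interpret j: ring_hom_cring F L j
    using F L j by (simp add: ring_hom_cring_def ring_hom_cring_axioms_def)
  have cl: "(\<lambda>k. j (p k)) \<in> up L" if p: "p \<in> up F" for p
    using F.up_vanishes[OF p] p by (metis F.up_closed L.upI j.hom_closed j.hom_zero)
  show ?thesis
  proof (rule ring_hom_memI, unfold polys_simps(1))
    fix x y assume xy: "x \<in> up F" "y \<in> up F"
    show "(\<lambda>k. j ((x \<otimes>\<^bsub>polys F\<^esub> y) k)) = (\<lambda>k. j (x k)) \<otimes>\<^bsub>polys L\<^esub> (\<lambda>k. j (y k))"
    proof
      fix k
      have "j (\<Oplus>\<^bsub>F\<^esub>i\<in>{..k}. x i \<otimes>\<^bsub>F\<^esub> y (k - i)) = (\<Oplus>\<^bsub>L\<^esub>i\<in>{..k}. j (x i) \<otimes>\<^bsub>L\<^esub> j (y (k - i)))"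
        using xy by (subst j.hom_finsum) (auto intro!: L.finsum_cong')
      then show "j ((x \<otimes>\<^bsub>polys F\<^esub> y) k) = ((\<lambda>k. j (x k)) \<otimes>\<^bsub>polys L\<^esub> (\<lambda>k. j (y k))) k"
        using xy by (simp add: polys_simps(2) cl)
    qed
  qed (auto simp: polys_simps(3,4) cl)
qed

lemma pencil_det_hom:
  assumes F: "cring F" and L: "cring L" and j: "j \<in> ring_hom F L"
    and M: "\<And>i k. i < n \<Longrightarrow> k < n \<Longrightarrow> M i k \<in> carrier F"
  shows "j (record_cring.pencil_det F n M k) = record_cring.pencil_det L n (\<lambda>i k. j (M i k)) k"
proof -
  interpret F: record_cring F using F by (simp add: record_cring_def)
  interpret L: record_cring L using L by (simp add: record_cring_def)
  interpret P: record_cring "polys L" using L.cring_polys by (simp add: record_cring_def)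
  interpret j: ring_hom_cring F L j
    using F L j by (simp add: ring_hom_cring_def ring_hom_cring_axioms_def)
  have "(\<lambda>k. j (F.pencil_det n M k)) = determinant n (polys L) (\<lambda>i l k. j (F.pencil M i l k))"
    unfolding F.pencil_det_def
    by (rule determinant_hom[OF F.cring_polys L.cring_polys polys_map_hom[OF F L j]])
       (use M in \<open>simp add: polys_simps(1)\<close>)
  also have "\<dots> = L.pencil_det n (\<lambda>i k. j (M i k))"
    unfolding L.pencil_det_def
  proof (rule P.determinant_cong)
    fix i l assume "i < n" "l < n"
    then show "(\<lambda>k. j (F.pencil M i l k)) = L.pencil (\<lambda>i k. j (M i k)) i l"
      using M[of i l] by (auto simp: F.pencil_def L.pencil_def fun_eq_iff a_minus_def Let_def)
    show "L.pencil (\<lambda>i k. j (M i k)) i l \<in> carrier (polys L)"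
      using M \<open>i < n\<close> \<open>l < n\<close> by (simp add: polys_simps(1))
  qed
  finally show ?thesis by (rule fun_cong)
qed

text \<open>
  In characteristic 0 the coefficients of an n-th root with constant term 1 are determined recursively by rational
  formulas, so a root found in an extension is already defined over the base field, by coefficients that
  do not depend on the extension.
\<close>

lemma polys_root_descent:
  fixes F :: "'f ring" and S :: "('l ring \<times> ('f \<Rightarrow> 'l) \<times> (nat \<Rightarrow> 'l)) set"
  assumes F: "field F" and n: "[n] \<cdot>\<^bsub>F\<^esub> \<one>\<^bsub>F\<^esub> \<noteq> \<zero>\<^bsub>F\<^esub>" and f: "f \<in> up F"
    and S: "\<And>L j g. (L, j, g) \<in> S \<Longrightarrow> cring L \<and> j \<in> ring_hom F L \<and> g \<in> up L \<and> g 0 = \<one>\<^bsub>L\<^esub> \<and>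
      (\<forall>k. (g [^]\<^bsub>polys L\<^esub> (n :: nat)) k = j (f k))"
  shows "\<exists>c\<in>carrier F. \<forall>(L, j, g)\<in>S. j c = g k"
proof (induction k rule: less_induct)
  case (less k)
  interpret F: field F by (rule F)
  interpret F: record_cring F by unfold_locales
  interpret PF: record_cring "polys F" using F.cring_polys by (simp add: record_cring_def)
  show ?case
  proof (cases "k = 0")
    case True
    have "j \<one>\<^bsub>F\<^esub> = g 0" if "(L, j, g) \<in> S" for L j g
      using S[OF that] by (auto dest: ring_hom_one)
    then show ?thesis using True by (intro bexI[of _ "\<one>\<^bsub>F\<^esub>"]) auto
  next
    case False
    obtain c where c: "\<And>i. i < k \<Longrightarrow> c i \<in> carrier F" "\<And>i L j g. i < k \<Longrightarrow> (L, j, g) \<in> S \<Longrightarrow> j (c i) = g i"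
      using less by (metis (mono_tags, lifting) case_prodD)
    \<comment> \<open>The part of the root found so far, continued by zero. By
      \<open>polys_power_coeff\<close> the defect of its n-th power at coefficient k is n times the
      coefficient that is sought, in every extension. Since c and f live over F, the solution d
      below serves all members of S at once.\<close>
    define q where "q i = (if i < k then c i else \<zero>\<^bsub>F\<^esub>)" for i
    have q: "q \<in> up F" by (rule F.upI[of _ k]) (auto simp: q_def c)
    define u where "u = [n] \<cdot>\<^bsub>F\<^esub> \<one>\<^bsub>F\<^esub>"
    have u: "u \<in> carrier F" "u \<in> Units F" using n by (auto simp: u_def F.field_Units)
    have qn: "q [^]\<^bsub>polys F\<^esub> n \<in> up F" using PF.nat_pow_closed q by (simp add: polys_simps(1))
    define d where "d = inv\<^bsub>F\<^esub> u \<otimes>\<^bsub>F\<^esub> (f k \<ominus>\<^bsub>F\<^esub> (q [^]\<^bsub>polys F\<^esub> n) k)"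
    have dc: "d \<in> carrier F" using u f qn by (simp add: d_def)
    have "j d = g k" if LS: "(L, j, g) \<in> S" for L j g
    proof -
      have L: "cring L" "j \<in> ring_hom F L" "g \<in> up L" "g 0 = \<one>\<^bsub>L\<^esub>" "\<And>k. (g [^]\<^bsub>polys L\<^esub> n) k = j (f k)"
        using S[OF LS] by auto
      interpret L: record_cring L using L by (simp add: record_cring_def)
      interpret PL: record_cring "polys L" using L.cring_polys by (simp add: record_cring_def)
      interpret j: ring_hom_cring F L j
        using L F.cring_axioms by (simp add: ring_hom_cring_def ring_hom_cring_axioms_def)
      interpret Pj: ring_hom_cring "polys F" "polys L" "\<lambda>p k. j (p k)"
        using polys_map_hom[OF F.cring_axioms L(1,2)] F.cring_polys L.cring_polys
        by (simp add: ring_hom_cring_def ring_hom_cring_axioms_def)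
      define q' where "q' = (\<lambda>i. j (q i))"
      have q': "q' \<in> up L" using Pj.hom_closed[of q] q by (simp add: polys_simps(1) q'_def)
      have q'n: "q' [^]\<^bsub>polys L\<^esub> n = (\<lambda>k. j ((q [^]\<^bsub>polys F\<^esub> n) k))"
        using Pj.hom_pow[of q n] q by (simp add: polys_simps(1) q'_def)
      have "(g [^]\<^bsub>polys L\<^esub> n) k = (q' [^]\<^bsub>polys L\<^esub> n) k \<oplus>\<^bsub>L\<^esub> [n] \<cdot>\<^bsub>L\<^esub> (g k \<ominus>\<^bsub>L\<^esub> q' k)"
      proof -
        have "g i = q' i" if "i < k" for i using c(2)[OF that LS] that by (simp add: q'_def q_def)
        moreover from this[of 0] have "q' 0 = \<one>\<^bsub>L\<^esub>" using False L(4) by simp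
        ultimately show ?thesis using L.polys_power_coeff[OF L(3) q', of k n] False by blast
      qed
      moreover have "g k \<ominus>\<^bsub>L\<^esub> q' k = g k" using L(3) by (simp add: q'_def q_def a_minus_def)
      moreover have "[n] \<cdot>\<^bsub>L\<^esub> g k = j u \<otimes>\<^bsub>L\<^esub> g k"
      proof -
        have "j u = [n] \<cdot>\<^bsub>L\<^esub> \<one>\<^bsub>L\<^esub>"
          unfolding u_def by (induction n) (auto simp: F.add.nat_pow_Suc L.add.nat_pow_Suc)
        then show ?thesis using L(3) L.add_pow_ldistr[of "\<one>\<^bsub>L\<^esub>" "g k" n] by simp
      qed
      ultimately have e: "j (f k) = j ((q [^]\<^bsub>polys F\<^esub> n) k) \<oplus>\<^bsub>L\<^esub> j u \<otimes>\<^bsub>L\<^esub> g k"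
        using L(5) q'n by simp
      have cl: "j (f k) \<in> carrier L" "j ((q [^]\<^bsub>polys F\<^esub> n) k) \<in> carrier L" "g k \<in> carrier L" "j u \<in> carrier L" "j (inv\<^bsub>F\<^esub> u) \<in> carrier L"
        using f qn L(3) u by auto
      have "j d = j (inv\<^bsub>F\<^esub> u) \<otimes>\<^bsub>L\<^esub> (j (f k) \<ominus>\<^bsub>L\<^esub> j ((q [^]\<^bsub>polys F\<^esub> n) k))"
        using u f qn by (simp add: d_def a_minus_def)
      also have "j (f k) \<ominus>\<^bsub>L\<^esub> j ((q [^]\<^bsub>polys F\<^esub> n) k) = j u \<otimes>\<^bsub>L\<^esub> g k"
      proof -
        have ab: "(a \<oplus>\<^bsub>L\<^esub> b) \<ominus>\<^bsub>L\<^esub> a = b" if "a \<in> carrier L" "b \<in> carrier L" for a b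
        proof -
          have "(b \<oplus>\<^bsub>L\<^esub> a) \<ominus>\<^bsub>L\<^esub> a = b" using that by (simp add: a_minus_def L.a_assoc L.r_neg)
          then show ?thesis by (simp only: L.a_comm[OF that])
        qed
        show ?thesis unfolding e by (rule ab[OF cl(2) L.m_closed[OF cl(4,3)]])
      qed
      also have "j (inv\<^bsub>F\<^esub> u) \<otimes>\<^bsub>L\<^esub> (j u \<otimes>\<^bsub>L\<^esub> g k) = j (inv\<^bsub>F\<^esub> u \<otimes>\<^bsub>F\<^esub> u) \<otimes>\<^bsub>L\<^esub> g k"
        unfolding j.hom_mult[OF F.Units_inv_closed[OF u(2)] u(1)] by (rule L.m_assoc[OF cl(5,4,3), symmetric])
      also have "inv\<^bsub>F\<^esub> u \<otimes>\<^bsub>F\<^esub> u = \<one>\<^bsub>F\<^esub>" by (rule F.Units_l_inv[OF u(2)])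
      also have "j \<one>\<^bsub>F\<^esub> \<otimes>\<^bsub>L\<^esub> g k = g k" using cl by simp
      finally show ?thesis .
    qed
    then show ?thesis using dc by auto
  qed
qed

section \<open>Tensor products with an algebra that has a basis\<close>

lemma (in ring) finsum_minus:
  assumes "u \<in> I \<rightarrow> carrier R" "v \<in> I \<rightarrow> carrier R"
  shows "(\<Oplus>i\<in>I. u i \<ominus> v i) = (\<Oplus>i\<in>I. u i) \<ominus> (\<Oplus>i\<in>I. v i)"
proof -
  have "(\<Oplus>i\<in>I. u i) = (\<Oplus>i\<in>I. (u i \<ominus> v i) \<oplus> v i)"
    using assms by (intro finsum_cong') (auto simp: Pi_iff minus_eq a_assoc l_neg)
  also have "\<dots> = (\<Oplus>i\<in>I. u i \<ominus> v i) \<oplus> (\<Oplus>i\<in>I. v i)"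
    using assms by (intro finsum_addf) (auto simp: Pi_iff)
  finally have *: "(\<Oplus>i\<in>I. u i) = (\<Oplus>i\<in>I. u i \<ominus> v i) \<oplus> (\<Oplus>i\<in>I. v i)" .
  have "(\<Oplus>i\<in>I. u i \<ominus> v i) \<in> carrier R" "(\<Oplus>i\<in>I. v i) \<in> carrier R"
    using assms by (auto intro!: finsum_closed)
  then show ?thesis unfolding * by (simp only: minus_eq a_assoc a_inv_closed r_neg r_zero)
qed

lemma (in ring) finsum_zero_fun:
  assumes "\<And>i. i \<in> I \<Longrightarrow> u i = \<zero>" shows "(\<Oplus>i\<in>I. u i) = \<zero>"
proof -
  have "(\<Oplus>i\<in>I. u i) = (\<Oplus>i\<in>I. \<zero>)" by (rule finsum_cong') (use assms in auto)
  then show ?thesis by simp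
qed

lemma frag_extend_add_fun: "frag_extend (\<lambda>p. f p + g p) x = frag_extend f x + frag_extend g x"
  using subset_UNIV by (induction x rule: frag_induction) (auto simp: frag_extend_diff)

lemma frag_extend_diff_fun: "frag_extend (\<lambda>p. f p - g p) x = frag_extend f x - frag_extend g x"
  using subset_UNIV by (induction x rule: frag_induction) (auto simp: frag_extend_diff)

lemma pair_ring_simps:
  "carrier (pair_ring A C) = {x. Poly_Mapping.keys x \<subseteq> carrier A \<times> carrier C}"
  "x \<oplus>\<^bsub>pair_ring A C\<^esub> y = x + y"
  "\<zero>\<^bsub>pair_ring A C\<^esub> = 0"
  "\<one>\<^bsub>pair_ring A C\<^esub> = frag_of (\<one>\<^bsub>A\<^esub>, \<one>\<^bsub>C\<^esub>)"
  by (simp_all add: pair_ring_def)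

lemma pair_ring_mult:
  "frag_of (a, c) \<otimes>\<^bsub>pair_ring A C\<^esub> frag_of (a', c') = frag_of (a \<otimes>\<^bsub>A\<^esub> a', c \<otimes>\<^bsub>C\<^esub> c')"
  "(x + x') \<otimes>\<^bsub>pair_ring A C\<^esub> y = x \<otimes>\<^bsub>pair_ring A C\<^esub> y + x' \<otimes>\<^bsub>pair_ring A C\<^esub> y"
  "x \<otimes>\<^bsub>pair_ring A C\<^esub> (y + y') = x \<otimes>\<^bsub>pair_ring A C\<^esub> y + x \<otimes>\<^bsub>pair_ring A C\<^esub> y'"
  "(x - x') \<otimes>\<^bsub>pair_ring A C\<^esub> y = x \<otimes>\<^bsub>pair_ring A C\<^esub> y - x' \<otimes>\<^bsub>pair_ring A C\<^esub> y"
  "x \<otimes>\<^bsub>pair_ring A C\<^esub> (y - y') = x \<otimes>\<^bsub>pair_ring A C\<^esub> y - x \<otimes>\<^bsub>pair_ring A C\<^esub> y'"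
  "0 \<otimes>\<^bsub>pair_ring A C\<^esub> y = 0" "x \<otimes>\<^bsub>pair_ring A C\<^esub> 0 = 0"
  by (simp_all add: pair_ring_def frag_extend_add frag_extend_diff frag_extend_eq_0
      case_prod_unfold frag_extend_add_fun frag_extend_diff_fun)

lemma ring_pair_ring:
  assumes "ring A" "ring C"
  shows "ring (pair_ring A C)"
proof -
  interpret A: ring A by fact
  interpret C: ring C by fact
  let ?P = "pair_ring A C" and ?S = "carrier A \<times> carrier C"
  have diff: "Poly_Mapping.keys (x - y) \<subseteq> S" if "Poly_Mapping.keys x \<subseteq> S" "Poly_Mapping.keys y \<subseteq> S"
    for x y :: "'x \<Rightarrow>\<^sub>0 int" and S
    using that keys_diff[of x y] by blast
  have closed: "x \<otimes>\<^bsub>?P\<^esub> y \<in> carrier ?P" if "x \<in> carrier ?P" "y \<in> carrier ?P" for x y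
    using that(1)[unfolded pair_ring_simps mem_Collect_eq]
  proof (induction x rule: frag_induction)
    case (one p)
    show ?case using that(2)[unfolded pair_ring_simps mem_Collect_eq]
    proof (induction y rule: frag_induction)
      case (one q)
      then show ?case using \<open>p \<in> ?S\<close> by (cases p; cases q) (auto simp: pair_ring_mult pair_ring_simps)
    qed (simp_all add: pair_ring_mult pair_ring_simps diff)
  qed (simp_all add: pair_ring_mult pair_ring_simps diff)
  have assoc: "(x \<otimes>\<^bsub>?P\<^esub> y) \<otimes>\<^bsub>?P\<^esub> z = x \<otimes>\<^bsub>?P\<^esub> (y \<otimes>\<^bsub>?P\<^esub> z)"
    if "x \<in> carrier ?P" "y \<in> carrier ?P" "z \<in> carrier ?P" for x y z
    using that(1)[unfolded pair_ring_simps mem_Collect_eq]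
  proof (induction x rule: frag_induction)
    case (one p)
    show ?case using that(2)[unfolded pair_ring_simps mem_Collect_eq]
    proof (induction y rule: frag_induction)
      case (one q)
      show ?case using that(3)[unfolded pair_ring_simps mem_Collect_eq]
      proof (induction z rule: frag_induction)
        case (one r)
        then show ?case using \<open>p \<in> ?S\<close> \<open>q \<in> ?S\<close>
          by (cases p; cases q; cases r) (auto simp: pair_ring_mult A.m_assoc C.m_assoc)
      qed (auto simp: pair_ring_mult)
    qed (auto simp: pair_ring_mult)
  qed (auto simp: pair_ring_mult)
  have one: "\<one>\<^bsub>?P\<^esub> \<otimes>\<^bsub>?P\<^esub> x = x \<and> x \<otimes>\<^bsub>?P\<^esub> \<one>\<^bsub>?P\<^esub> = x" if "x \<in> carrier ?P" for x
    using that[unfolded pair_ring_simps mem_Collect_eq]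
  proof (induction x rule: frag_induction)
    case (one p)
    then show ?case by (cases p) (auto simp: pair_ring_mult pair_ring_simps)
  qed (auto simp: pair_ring_mult)
  show ?thesis
  proof (rule ringI)
    show "abelian_group ?P"
    proof (rule abelian_groupI)
      fix x assume "x \<in> carrier ?P"
      then show "\<exists>y\<in>carrier ?P. y \<oplus>\<^bsub>?P\<^esub> x = \<zero>\<^bsub>?P\<^esub>"
        by (intro bexI[of _ "- x"]) (auto simp: pair_ring_simps)
    next
      fix x y assume "x \<in> carrier ?P" "y \<in> carrier ?P"
      then show "x \<oplus>\<^bsub>?P\<^esub> y \<in> carrier ?P"
        using Poly_Mapping.keys_add[of x y] by (auto simp: pair_ring_simps)
    qed (auto simp: pair_ring_simps algebra_simps)
    show "Group.monoid ?P"
      by (rule Group.monoidI) (use closed assoc one in \<open>auto simp: pair_ring_simps\<close>)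
  qed (auto simp: pair_ring_simps(2) pair_ring_mult)
qed

text \<open>An algebra that is free of rank N as a module, given by a structure map because a ring
  record carries no scalar multiplication. It is used for B over K and, through
  \<open>tensor_basis\<close>, for the scalar extensions of B.\<close>

locale based_algebra = k: cring k + A: ring A for k :: "'k ring" and A :: "'a ring" +
  fixes f :: "'k \<Rightarrow> 'a" and N :: nat and e :: "nat \<Rightarrow> 'a"
  assumes f: "f \<in> ring_hom k A"
    and central: "s \<in> carrier k \<Longrightarrow> a \<in> carrier A \<Longrightarrow> f s \<otimes>\<^bsub>A\<^esub> a = a \<otimes>\<^bsub>A\<^esub> f s"
    and e [simp]: "i < N \<Longrightarrow> e i \<in> carrier A"
    and basis_ex: "a \<in> carrier A \<Longrightarrow> \<exists>r\<in>{..<N} \<rightarrow> carrier k. a = (\<Oplus>\<^bsub>A\<^esub>i\<in>{..<N}. f (r i) \<otimes>\<^bsub>A\<^esub> e i)"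
    and basis_unique: "r \<in> {..<N} \<rightarrow> carrier k \<Longrightarrow> r' \<in> {..<N} \<rightarrow> carrier k \<Longrightarrow>
      (\<Oplus>\<^bsub>A\<^esub>i\<in>{..<N}. f (r i) \<otimes>\<^bsub>A\<^esub> e i) = (\<Oplus>\<^bsub>A\<^esub>i\<in>{..<N}. f (r' i) \<otimes>\<^bsub>A\<^esub> e i) \<Longrightarrow> i < N \<Longrightarrow> r i = r' i"
begin

sublocale f: ring_hom_ring k A f
  using f k.ring_axioms A.ring_axioms by (simp add: ring_hom_ring_def ring_hom_ring_axioms_def)

definition coord :: "'a \<Rightarrow> nat \<Rightarrow> 'k" where
  "coord a = (SOME r. r \<in> {..<N} \<rightarrow> carrier k \<and> a = (\<Oplus>\<^bsub>A\<^esub>i\<in>{..<N}. f (r i) \<otimes>\<^bsub>A\<^esub> e i))"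

lemma
  assumes "a \<in> carrier A"
  shows coord_Pi: "coord a \<in> {..<N} \<rightarrow> carrier k"
    and coord_expand: "a = (\<Oplus>\<^bsub>A\<^esub>i\<in>{..<N}. f (coord a i) \<otimes>\<^bsub>A\<^esub> e i)"
  using someI_ex[OF basis_ex[OF assms, unfolded Bex_def]] unfolding coord_def by blast+

lemma coord_closed [simp]: "a \<in> carrier A \<Longrightarrow> i < N \<Longrightarrow> coord a i \<in> carrier k"
  using coord_Pi by auto

lemma coord_eqI:
  assumes r: "\<And>i. i < N \<Longrightarrow> r i \<in> carrier k" and a: "a = (\<Oplus>\<^bsub>A\<^esub>i\<in>{..<N}. f (r i) \<otimes>\<^bsub>A\<^esub> e i)" and "i < N"
  shows "coord a i = r i"
proof -
  have "a \<in> carrier A" unfolding a using r by (auto intro!: A.finsum_closed)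
  then show ?thesis
    by (intro basis_unique[OF coord_Pi _ trans[OF coord_expand[symmetric] a] \<open>i < N\<close>]) (use r in auto)
qed

lemma coord_add:
  assumes "a \<in> carrier A" "b \<in> carrier A" "i < N"
  shows "coord (a \<oplus>\<^bsub>A\<^esub> b) i = coord a i \<oplus>\<^bsub>k\<^esub> coord b i"
proof (rule coord_eqI)
  have "(\<Oplus>\<^bsub>A\<^esub>i\<in>{..<N}. f (coord a i \<oplus>\<^bsub>k\<^esub> coord b i) \<otimes>\<^bsub>A\<^esub> e i) =
    (\<Oplus>\<^bsub>A\<^esub>i\<in>{..<N}. f (coord a i) \<otimes>\<^bsub>A\<^esub> e i \<oplus>\<^bsub>A\<^esub> f (coord b i) \<otimes>\<^bsub>A\<^esub> e i)"
    using assms by (intro A.finsum_cong') (auto simp: A.l_distr)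
  also have "\<dots> = (\<Oplus>\<^bsub>A\<^esub>i\<in>{..<N}. f (coord a i) \<otimes>\<^bsub>A\<^esub> e i) \<oplus>\<^bsub>A\<^esub> (\<Oplus>\<^bsub>A\<^esub>i\<in>{..<N}. f (coord b i) \<otimes>\<^bsub>A\<^esub> e i)"
    using assms by (intro A.finsum_addf) auto
  also have "\<dots> = a \<oplus>\<^bsub>A\<^esub> b" using assms by (simp flip: coord_expand)
  finally show "a \<oplus>\<^bsub>A\<^esub> b = (\<Oplus>\<^bsub>A\<^esub>i\<in>{..<N}. f (coord a i \<oplus>\<^bsub>k\<^esub> coord b i) \<otimes>\<^bsub>A\<^esub> e i)" by simp
qed (use assms in auto)

lemma coord_scale:
  assumes "r \<in> carrier k" "a \<in> carrier A" "i < N"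
  shows "coord (f r \<otimes>\<^bsub>A\<^esub> a) i = r \<otimes>\<^bsub>k\<^esub> coord a i"
proof (rule coord_eqI)
  have "f r \<otimes>\<^bsub>A\<^esub> a = f r \<otimes>\<^bsub>A\<^esub> (\<Oplus>\<^bsub>A\<^esub>i\<in>{..<N}. f (coord a i) \<otimes>\<^bsub>A\<^esub> e i)"
    using assms by (simp flip: coord_expand)
  also have "\<dots> = (\<Oplus>\<^bsub>A\<^esub>i\<in>{..<N}. f r \<otimes>\<^bsub>A\<^esub> (f (coord a i) \<otimes>\<^bsub>A\<^esub> e i))"
    using assms by (intro A.finsum_rdistr) auto
  also have "\<dots> = (\<Oplus>\<^bsub>A\<^esub>i\<in>{..<N}. f (r \<otimes>\<^bsub>k\<^esub> coord a i) \<otimes>\<^bsub>A\<^esub> e i)"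
    using assms by (intro A.finsum_cong') (auto simp: A.m_assoc)
  finally show "f r \<otimes>\<^bsub>A\<^esub> a = (\<Oplus>\<^bsub>A\<^esub>i\<in>{..<N}. f (r \<otimes>\<^bsub>k\<^esub> coord a i) \<otimes>\<^bsub>A\<^esub> e i)" .
qed (use assms in auto)

lemma coord_zero [simp]: "i < N \<Longrightarrow> coord \<zero>\<^bsub>A\<^esub> i = \<zero>\<^bsub>k\<^esub>"
  using coord_scale[of "\<zero>\<^bsub>k\<^esub>" "\<zero>\<^bsub>A\<^esub>" i] by simp

lemma coord_finsum:
  assumes "finite I" "b \<in> I \<rightarrow> carrier A" "i < N"
  shows "coord (\<Oplus>\<^bsub>A\<^esub>l\<in>I. b l) i = (\<Oplus>\<^bsub>k\<^esub>l\<in>I. coord (b l) i)"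
  using assms(1,2)
proof (induction I)
  case (insert l I)
  then have "b l \<in> carrier A" "b \<in> I \<rightarrow> carrier A" by auto
  with insert assms(3) show ?case
    by (subst A.finsum_insert; simp add: coord_add A.finsum_closed)
       (subst k.finsum_insert; auto simp: Pi_iff)
qed (use assms in simp)

lemma coord_e: "i < N \<Longrightarrow> j < N \<Longrightarrow> coord (e j) i = (if i = j then \<one>\<^bsub>k\<^esub> else \<zero>\<^bsub>k\<^esub>)"
proof (rule coord_eqI)
  assume "j < N"
  have "(\<Oplus>\<^bsub>A\<^esub>i\<in>{..<N}. f (if i = j then \<one>\<^bsub>k\<^esub> else \<zero>\<^bsub>k\<^esub>) \<otimes>\<^bsub>A\<^esub> e i) = (\<Oplus>\<^bsub>A\<^esub>i\<in>{..<N}. if j = i then e i else \<zero>\<^bsub>A\<^esub>)"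
    by (intro A.finsum_cong') auto
  also have "\<dots> = e j" using \<open>j < N\<close> by (subst A.finsum_singleton) auto
  finally show "e j = (\<Oplus>\<^bsub>A\<^esub>i\<in>{..<N}. f (if i = j then \<one>\<^bsub>k\<^esub> else \<zero>\<^bsub>k\<^esub>) \<otimes>\<^bsub>A\<^esub> e i)" by simp
qed auto

text \<open>The right factor is expanded, and its coordinates are moved past \<open>a\<close> by
  \<open>central\<close>. The companion \<open>coord_mult'\<close> expands the left factor. Together
  they describe left and right multiplication in coordinates, as needed to recognise a two-sided
  ideal.\<close>

lemma coord_mult:
  assumes "a \<in> carrier A" "b \<in> carrier A" "l < N"
  shows "coord (a \<otimes>\<^bsub>A\<^esub> b) l = (\<Oplus>\<^bsub>k\<^esub>i\<in>{..<N}. coord b i \<otimes>\<^bsub>k\<^esub> coord (a \<otimes>\<^bsub>A\<^esub> e i) l)"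
proof -
  have "a \<otimes>\<^bsub>A\<^esub> b = a \<otimes>\<^bsub>A\<^esub> (\<Oplus>\<^bsub>A\<^esub>i\<in>{..<N}. f (coord b i) \<otimes>\<^bsub>A\<^esub> e i)"
    using assms by (simp flip: coord_expand)
  also have "\<dots> = (\<Oplus>\<^bsub>A\<^esub>i\<in>{..<N}. a \<otimes>\<^bsub>A\<^esub> (f (coord b i) \<otimes>\<^bsub>A\<^esub> e i))"
    using assms by (intro A.finsum_rdistr) auto
  also have "\<dots> = (\<Oplus>\<^bsub>A\<^esub>i\<in>{..<N}. f (coord b i) \<otimes>\<^bsub>A\<^esub> (a \<otimes>\<^bsub>A\<^esub> e i))"
  proof (intro A.finsum_cong')
    fix i assume "i \<in> {..<N}"
    then have cl: "f (coord b i) \<in> carrier A" "e i \<in> carrier A" "coord b i \<in> carrier k" using assms by auto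
    show "a \<otimes>\<^bsub>A\<^esub> (f (coord b i) \<otimes>\<^bsub>A\<^esub> e i) = f (coord b i) \<otimes>\<^bsub>A\<^esub> (a \<otimes>\<^bsub>A\<^esub> e i)"
      by (simp only: A.m_assoc[OF assms(1) cl(1,2), symmetric] A.m_assoc[OF cl(1) assms(1) cl(2), symmetric]
          central[OF cl(3) assms(1)])
  qed (use assms in auto)
  finally have *: "a \<otimes>\<^bsub>A\<^esub> b = (\<Oplus>\<^bsub>A\<^esub>i\<in>{..<N}. f (coord b i) \<otimes>\<^bsub>A\<^esub> (a \<otimes>\<^bsub>A\<^esub> e i))" .
  show ?thesis unfolding *
    using assms by (subst coord_finsum) (auto intro!: k.finsum_cong' simp: coord_scale)
qed

lemma coord_mult':
  assumes "a \<in> carrier A" "b \<in> carrier A" "l < N"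
  shows "coord (a \<otimes>\<^bsub>A\<^esub> b) l = (\<Oplus>\<^bsub>k\<^esub>i\<in>{..<N}. coord a i \<otimes>\<^bsub>k\<^esub> coord (e i \<otimes>\<^bsub>A\<^esub> b) l)"
proof -
  have "a \<otimes>\<^bsub>A\<^esub> b = (\<Oplus>\<^bsub>A\<^esub>i\<in>{..<N}. f (coord a i) \<otimes>\<^bsub>A\<^esub> e i) \<otimes>\<^bsub>A\<^esub> b"
    using assms by (simp flip: coord_expand)
  also have "\<dots> = (\<Oplus>\<^bsub>A\<^esub>i\<in>{..<N}. f (coord a i) \<otimes>\<^bsub>A\<^esub> e i \<otimes>\<^bsub>A\<^esub> b)"
    using assms by (intro A.finsum_ldistr) auto
  also have "\<dots> = (\<Oplus>\<^bsub>A\<^esub>i\<in>{..<N}. f (coord a i) \<otimes>\<^bsub>A\<^esub> (e i \<otimes>\<^bsub>A\<^esub> b))"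
    using assms by (intro A.finsum_cong') (auto simp: A.m_assoc)
  finally have *: "a \<otimes>\<^bsub>A\<^esub> b = (\<Oplus>\<^bsub>A\<^esub>i\<in>{..<N}. f (coord a i) \<otimes>\<^bsub>A\<^esub> (e i \<otimes>\<^bsub>A\<^esub> b))" .
  show ?thesis unfolding *
    using assms by (subst coord_finsum) (auto intro!: k.finsum_cong' simp: coord_scale)
qed

end

section \<open>Relations and pure tensors in a tensor product\<close>

locale tensor_algebra = k: cring k + A: ring A + C: cring C
  for k :: "'k ring" and A :: "'a ring" and C :: "'c ring" +
  fixes f :: "'k \<Rightarrow> 'a" and g :: "'k \<Rightarrow> 'c"
  assumes f: "f \<in> ring_hom k A" and g: "g \<in> ring_hom k C"
    and central: "s \<in> carrier k \<Longrightarrow> a \<in> carrier A \<Longrightarrow> f s \<otimes>\<^bsub>A\<^esub> a = a \<otimes>\<^bsub>A\<^esub> f s"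
begin

sublocale f: ring_hom_ring k A f
  using f k.ring_axioms A.ring_axioms by (simp add: ring_hom_ring_def ring_hom_ring_axioms_def)

sublocale g: ring_hom_ring k C g
  using g k.ring_axioms C.ring_axioms by (simp add: ring_hom_ring_def ring_hom_ring_axioms_def)

abbreviation P where "P \<equiv> pair_ring A C"
abbreviation J where "J \<equiv> tensor_ideal k f A g C"
abbreviation T where "T \<equiv> tensor_ring k f A g C"
abbreviation pt where "pt \<equiv> pure_tensor k f A g C"

lemma ring_P: "ring P" by (rule ring_pair_ring) unfold_locales

lemma frag_in_P [simp]: "a \<in> carrier A \<Longrightarrow> c \<in> carrier C \<Longrightarrow> frag_of (a, c) \<in> carrier P"
  by (simp add: pair_ring_simps)

lemma P_induct [consumes 1, case_names zero frag diff]: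
  assumes "x \<in> carrier P" and "Q 0"
    and "\<And>a c. a \<in> carrier A \<Longrightarrow> c \<in> carrier C \<Longrightarrow> Q (frag_of (a, c))"
    and "\<And>x y. x \<in> carrier P \<Longrightarrow> y \<in> carrier P \<Longrightarrow> Q x \<Longrightarrow> Q y \<Longrightarrow> Q (x - y)"
  shows "Q x"
proof -
  have "x \<in> carrier P \<and> Q x"
    using assms(1)[unfolded pair_ring_simps mem_Collect_eq]
  proof (induction x rule: frag_induction)
    case (diff x y)
    then show ?case using keys_diff[of x y] assms(4) by (auto simp: pair_ring_simps)
  qed (use assms in \<open>auto simp: pair_ring_simps\<close>)
  then show ?thesis by simp
qed

lemma diff_in_P: "x \<in> carrier P \<Longrightarrow> y \<in> carrier P \<Longrightarrow> x - y \<in> carrier P"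
  using keys_diff[of x y] by (auto simp: pair_ring_simps)

lemma relations_in_P: "tensor_relations k f A g C \<subseteq> carrier P"
  by (auto simp: tensor_relations_def intro!: diff_in_P)

lemma ideal_J: "ideal J P"
  unfolding tensor_ideal_def by (rule ring.genideal_ideal[OF ring_P relations_in_P])

lemma relations_in_J: "tensor_relations k f A g C \<subseteq> J"
  unfolding tensor_ideal_def by (rule ring.genideal_self[OF ring_P relations_in_P])

lemma ring_T: "ring T"
  unfolding tensor_ring_def by (rule ideal.quotient_is_ring[OF ideal_J])

sublocale T: ring T by (rule ring_T)

lemma coset_hom: "(+>\<^bsub>P\<^esub>) J \<in> ring_hom P T"
  unfolding tensor_ring_def by (rule ideal.rcos_ring_hom[OF ideal_J])

lemma pt_closed [simp]: "a \<in> carrier A \<Longrightarrow> c \<in> carrier C \<Longrightarrow> pt a c \<in> carrier T"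
  unfolding pure_tensor_def by (rule ring_hom_closed[OF coset_hom]) simp

lemma pt_mult [simp]:
  assumes "a \<in> carrier A" "c \<in> carrier C" "a' \<in> carrier A" "c' \<in> carrier C"
  shows "pt a c \<otimes>\<^bsub>T\<^esub> pt a' c' = pt (a \<otimes>\<^bsub>A\<^esub> a') (c \<otimes>\<^bsub>C\<^esub> c')"
  unfolding pure_tensor_def using assms
  by (simp add: ring_hom_mult[OF coset_hom, symmetric] pair_ring_mult)

lemma pt_one: "\<one>\<^bsub>T\<^esub> = pt \<one>\<^bsub>A\<^esub> \<one>\<^bsub>C\<^esub>"
  unfolding pure_tensor_def using ring_hom_one[OF coset_hom] by (simp add: pair_ring_simps)

lemma coset_eq: "x \<in> carrier P \<Longrightarrow> y \<in> carrier P \<Longrightarrow> x - y \<in> J \<Longrightarrow> J +>\<^bsub>P\<^esub> x = J +>\<^bsub>P\<^esub> y"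
proof -
  interpret P: ring P by (rule ring_P)
  interpret J: ideal J P by (rule ideal_J)
  assume *: "x \<in> carrier P" "y \<in> carrier P" "x - y \<in> J"
  have "x \<in> J +>\<^bsub>P\<^esub> y"
    using * by (auto simp: a_r_coset_def' pair_ring_simps intro!: bexI[of _ "x - y"])
  then show ?thesis using * abelian_subgroup.a_repr_independence'[OF abelian_subgroupI3[OF J.additive_subgroup_axioms P.abelian_group_axioms]] by metis
qed

lemma pt_add_left:
  assumes "a \<in> carrier A" "a' \<in> carrier A" "c \<in> carrier C"
  shows "pt (a \<oplus>\<^bsub>A\<^esub> a') c = pt a c \<oplus>\<^bsub>T\<^esub> pt a' c"
proof -
  have "J +>\<^bsub>P\<^esub> frag_of (a \<oplus>\<^bsub>A\<^esub> a', c) = J +>\<^bsub>P\<^esub> (frag_of (a, c) \<oplus>\<^bsub>P\<^esub> frag_of (a', c))"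
  proof (rule coset_eq)
    have "frag_of (a \<oplus>\<^bsub>A\<^esub> a', c) - frag_of (a, c) - frag_of (a', c) \<in> tensor_relations k f A g C"
      using assms by (auto simp: tensor_relations_def)
    then show "frag_of (a \<oplus>\<^bsub>A\<^esub> a', c) - (frag_of (a, c) \<oplus>\<^bsub>P\<^esub> frag_of (a', c)) \<in> J"
      using relations_in_J by (auto simp: pair_ring_simps diff_diff_add)
  qed (use assms ring.ring_simprules(1)[OF ring_P] in auto)
  then show ?thesis unfolding pure_tensor_def using assms
    by (simp add: ring_hom_add[OF coset_hom])
qed

lemma pt_add_right:
  assumes "a \<in> carrier A" "c \<in> carrier C" "c' \<in> carrier C"
  shows "pt a (c \<oplus>\<^bsub>C\<^esub> c') = pt a c \<oplus>\<^bsub>T\<^esub> pt a c'"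
proof -
  have "J +>\<^bsub>P\<^esub> frag_of (a, c \<oplus>\<^bsub>C\<^esub> c') = J +>\<^bsub>P\<^esub> (frag_of (a, c) \<oplus>\<^bsub>P\<^esub> frag_of (a, c'))"
  proof (rule coset_eq)
    have "frag_of (a, c \<oplus>\<^bsub>C\<^esub> c') - frag_of (a, c) - frag_of (a, c') \<in> tensor_relations k f A g C"
      using assms by (auto simp: tensor_relations_def)
    then show "frag_of (a, c \<oplus>\<^bsub>C\<^esub> c') - (frag_of (a, c) \<oplus>\<^bsub>P\<^esub> frag_of (a, c')) \<in> J"
      using relations_in_J by (auto simp: pair_ring_simps diff_diff_add)
  qed (use assms ring.ring_simprules(1)[OF ring_P] in auto)
  then show ?thesis unfolding pure_tensor_def using assms
    by (simp add: ring_hom_add[OF coset_hom])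
qed

lemma pt_balanced:
  assumes "r \<in> carrier k" "a \<in> carrier A" "c \<in> carrier C"
  shows "pt (f r \<otimes>\<^bsub>A\<^esub> a) c = pt a (g r \<otimes>\<^bsub>C\<^esub> c)"
  unfolding pure_tensor_def
proof (rule coset_eq)
  have "frag_of (f r \<otimes>\<^bsub>A\<^esub> a, c) - frag_of (a, g r \<otimes>\<^bsub>C\<^esub> c) \<in> tensor_relations k f A g C"
    using assms by (auto simp: tensor_relations_def)
  then show "frag_of (f r \<otimes>\<^bsub>A\<^esub> a, c) - frag_of (a, g r \<otimes>\<^bsub>C\<^esub> c) \<in> J"
    using relations_in_J by auto
qed (use assms in auto)

lemma pt_right_hom: "pt \<one>\<^bsub>A\<^esub> \<in> ring_hom C T"
  by (rule ring_hom_memI) (simp_all add: pt_add_right pt_one)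

lemma pt_zero [simp]: "c \<in> carrier C \<Longrightarrow> pt \<zero>\<^bsub>A\<^esub> c = \<zero>\<^bsub>T\<^esub>" "a \<in> carrier A \<Longrightarrow> pt a \<zero>\<^bsub>C\<^esub> = \<zero>\<^bsub>T\<^esub>"
  using pt_add_left[of "\<zero>\<^bsub>A\<^esub>" "\<zero>\<^bsub>A\<^esub>" c] pt_add_right[of a "\<zero>\<^bsub>C\<^esub>" "\<zero>\<^bsub>C\<^esub>"]
    T.add.r_cancel_one'[of "pt \<zero>\<^bsub>A\<^esub> c"] T.add.r_cancel_one'[of "pt a \<zero>\<^bsub>C\<^esub>"] by auto

lemma T_carrier: "carrier T = (\<lambda>x. J +>\<^bsub>P\<^esub> x) ` carrier P"
  by (auto simp: tensor_ring_def FactRing_def A_RCOSETS_def')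

text \<open>Negatives need no case of their own, because the negative of a pure tensor of a and c is
  the pure tensor of the negative of a and c.\<close>

lemma tensor_induct [consumes 1, case_names pure add]:
  assumes "z \<in> carrier T"
    and pure: "\<And>a c. a \<in> carrier A \<Longrightarrow> c \<in> carrier C \<Longrightarrow> Q (pt a c)"
    and add: "\<And>z w. z \<in> carrier T \<Longrightarrow> w \<in> carrier T \<Longrightarrow> Q z \<Longrightarrow> Q w \<Longrightarrow> Q (z \<oplus>\<^bsub>T\<^esub> w)"
  shows "Q z"
proof -
  obtain x where x: "x \<in> carrier P" "z = J +>\<^bsub>P\<^esub> x" using assms(1) by (auto simp: T_carrier)
  have neg: "- x \<in> carrier P" if "x \<in> carrier P" for x
    using that by (simp add: pair_ring_simps)
  \<comment> \<open>The induction principle for formal combinations works with differences, so the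
    claim is strengthened to x and its negative simultaneously.\<close>
  have "x \<in> carrier P \<and> Q (J +>\<^bsub>P\<^esub> x) \<and> Q (J +>\<^bsub>P\<^esub> (- x))"
    using x(1)[unfolded pair_ring_simps mem_Collect_eq]
  proof (induction x rule: frag_induction)
    case zero
    have "J +>\<^bsub>P\<^esub> 0 = \<zero>\<^bsub>T\<^esub>"
      using ring_hom_zero[OF coset_hom ring_P ring_T] by (simp add: pair_ring_simps)
    then show ?case using pure[of "\<zero>\<^bsub>A\<^esub>" "\<zero>\<^bsub>C\<^esub>"] by (simp add: pair_ring_simps)
  next
    case (one p)
    then obtain a c where p: "p = (a, c)" and ac: "a \<in> carrier A" "c \<in> carrier C" by auto
    have "pt (\<ominus>\<^bsub>A\<^esub> a) c \<oplus>\<^bsub>T\<^esub> pt a c = \<zero>\<^bsub>T\<^esub>"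
      using ac by (simp flip: pt_add_left add: A.l_neg)
    moreover have "(J +>\<^bsub>P\<^esub> (- frag_of p)) \<oplus>\<^bsub>T\<^esub> pt a c = \<zero>\<^bsub>T\<^esub>"
    proof -
      have "(J +>\<^bsub>P\<^esub> (- frag_of p)) \<oplus>\<^bsub>T\<^esub> pt a c = J +>\<^bsub>P\<^esub> (- frag_of p \<oplus>\<^bsub>P\<^esub> frag_of p)"
        using ac p neg[of "frag_of p"] unfolding pure_tensor_def by (simp add: ring_hom_add[OF coset_hom])
      also have "\<dots> = \<zero>\<^bsub>T\<^esub>"
        using ring_hom_zero[OF coset_hom ring_P ring_T] by (simp add: pair_ring_simps)
      finally show ?thesis .
    qed
    ultimately have "J +>\<^bsub>P\<^esub> (- frag_of p) = pt (\<ominus>\<^bsub>A\<^esub> a) c"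
      using ac p neg[of "frag_of p"] ring_hom_closed[OF coset_hom, of "- frag_of p"]
        T.minus_equality[of _ "pt a c"] by (metis A.a_inv_closed frag_in_P pt_closed)
    moreover have "J +>\<^bsub>P\<^esub> frag_of p = pt a c" by (simp add: p pure_tensor_def)
    ultimately show ?case using ac p pure[of a c] pure[of "\<ominus>\<^bsub>A\<^esub> a" c] by simp
  next
    case (diff x y)
    then have xy: "x \<in> carrier P" "y \<in> carrier P" "- x \<in> carrier P" "- y \<in> carrier P" using neg by auto
    have "J +>\<^bsub>P\<^esub> (x - y) = (J +>\<^bsub>P\<^esub> x) \<oplus>\<^bsub>T\<^esub> (J +>\<^bsub>P\<^esub> (- y))"
      "J +>\<^bsub>P\<^esub> (- (x - y)) = (J +>\<^bsub>P\<^esub> y) \<oplus>\<^bsub>T\<^esub> (J +>\<^bsub>P\<^esub> (- x))"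
      using xy by (simp_all add: ring_hom_add[OF coset_hom, symmetric] pair_ring_simps(2))
    then show ?case using diff xy diff_in_P ring_hom_closed[OF coset_hom] add by auto
  qed
  then show ?thesis using x by simp
qed

lemma pt_central:
  assumes "c \<in> carrier C" "z \<in> carrier T"
  shows "pt \<one>\<^bsub>A\<^esub> c \<otimes>\<^bsub>T\<^esub> z = z \<otimes>\<^bsub>T\<^esub> pt \<one>\<^bsub>A\<^esub> c"
  using assms(2)
proof (induction rule: tensor_induct)
  case (pure a c')
  then show ?case using assms by (simp add: C.m_comm)
next
  case (add z w)
  then show ?case using assms by (simp add: T.r_distr T.l_distr)
qed

end

locale tensor_based = based_algebra k A f N e + tensor_algebra k A C f g
  for k :: "'k ring" and A :: "'a ring" and C :: "'c ring" and f g N e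
begin

text \<open>The coordinate functionals exist first on formal combinations, by the universal property
  of the free abelian group; there is nothing to check yet about the tensor relations.\<close>

lemma tensor_coord_frag:
  obtains h where "\<And>i x y. i < N \<Longrightarrow> x \<in> carrier P \<Longrightarrow> y \<in> carrier P \<Longrightarrow> h i (x + y) = h i x \<oplus>\<^bsub>C\<^esub> h i y"
    and "\<And>i x. i < N \<Longrightarrow> x \<in> carrier P \<Longrightarrow> h i x \<in> carrier C"
    and "\<And>i a c. i < N \<Longrightarrow> a \<in> carrier A \<Longrightarrow> c \<in> carrier C \<Longrightarrow> h i (frag_of (a, c)) = g (coord a i) \<otimes>\<^bsub>C\<^esub> c"
proof -
  have "\<exists>h. h \<in> hom (free_Abelian_group (carrier A \<times> carrier C)) (add_monoid C) \<and>
      (\<forall>p\<in>carrier A \<times> carrier C. h (frag_of p) = g (coord (fst p) i) \<otimes>\<^bsub>C\<^esub> snd p)" if "i < N" for i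
  proof -
    have "(\<lambda>p. g (coord (fst p) i) \<otimes>\<^bsub>C\<^esub> snd p) ` (carrier A \<times> carrier C) \<subseteq> carrier C"
      using that by auto
    from C.add.free_Abelian_group_universal[OF this] show ?thesis by metis
  qed
  then obtain h where h: "\<And>i. i < N \<Longrightarrow> h i \<in> hom (free_Abelian_group (carrier A \<times> carrier C)) (add_monoid C)"
      "\<And>i p. i < N \<Longrightarrow> p \<in> carrier A \<times> carrier C \<Longrightarrow> h i (frag_of p) = g (coord (fst p) i) \<otimes>\<^bsub>C\<^esub> snd p"
    by metis
  show ?thesis
  proof (rule that[of h])
    fix i x y assume "i < N" "x \<in> carrier P" "y \<in> carrier P"
    then show "h i (x + y) = h i x \<oplus>\<^bsub>C\<^esub> h i y" "h i x \<in> carrier C"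
      using h(1)[of i] by (auto simp: hom_def pair_ring_simps free_Abelian_group_def Pi_iff)
  qed (use h(2) in auto)
qed

text \<open>The functionals of \<open>tensor_coord_frag\<close> must vanish on the ideal generated
  by the relations, which is larger than the set of relations. Their common kernel is shown to be a
  two-sided ideal containing the relations; hence it contains that ideal, and the functionals
  descend to the quotient.\<close>

lemma tensor_coord_ex:
  "\<exists>H. \<forall>i<N. (\<forall>z\<in>carrier T. H i z \<in> carrier C) \<and>
    (\<forall>z\<in>carrier T. \<forall>w\<in>carrier T. H i (z \<oplus>\<^bsub>T\<^esub> w) = H i z \<oplus>\<^bsub>C\<^esub> H i w) \<and>
    (\<forall>a\<in>carrier A. \<forall>c\<in>carrier C. H i (pt a c) = g (coord a i) \<otimes>\<^bsub>C\<^esub> c)"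
proof -
  interpret P: ring P by (rule ring_P)
  interpret J: ideal J P by (rule ideal_J)
  obtain h where add: "\<And>i x y. i < N \<Longrightarrow> x \<in> carrier P \<Longrightarrow> y \<in> carrier P \<Longrightarrow> h i (x + y) = h i x \<oplus>\<^bsub>C\<^esub> h i y"
    and cl: "\<And>i x. i < N \<Longrightarrow> x \<in> carrier P \<Longrightarrow> h i x \<in> carrier C"
    and hfrag: "\<And>i a c. i < N \<Longrightarrow> a \<in> carrier A \<Longrightarrow> c \<in> carrier C \<Longrightarrow> h i (frag_of (a, c)) = g (coord a i) \<otimes>\<^bsub>C\<^esub> c"
    using tensor_coord_frag by blast
  have h0: "h i 0 = \<zero>\<^bsub>C\<^esub>" if "i < N" for i
    using add[OF that, of 0 0] cl[OF that, of 0] by (simp add: pair_ring_simps)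
  have in_P: "x - y \<in> carrier P" "- x \<in> carrier P" if "x \<in> carrier P" "y \<in> carrier P" for x y
    using diff_in_P[OF that] that by (auto simp: pair_ring_simps)
  have hdiff: "h i (x - y) = h i x \<ominus>\<^bsub>C\<^esub> h i y" if "i < N" "x \<in> carrier P" "y \<in> carrier P" for i x y
  proof -
    have "h i x = h i (x - y) \<oplus>\<^bsub>C\<^esub> h i y"
      using add[OF that(1) in_P(1)[OF that(2,3)] that(3)] by simp
    then show ?thesis using that in_P cl by (simp add: C.minus_eq C.a_assoc C.r_neg)
  qed
  \<comment> \<open>Multiplication by a pair acts on the vector of all coordinates through a matrix
    over C. Hence it maps a common zero of the h l to a common zero, although a single kernel need
    not be stable.\<close>
  have left: "h i (frag_of (a, c) \<otimes>\<^bsub>P\<^esub> x) = (\<Oplus>\<^bsub>C\<^esub>l\<in>{..<N}. g (coord (a \<otimes>\<^bsub>A\<^esub> e l) i) \<otimes>\<^bsub>C\<^esub> c \<otimes>\<^bsub>C\<^esub> h l x)"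
    if "i < N" "a \<in> carrier A" "c \<in> carrier C" "x \<in> carrier P" for i a c x
    using that(4)
  proof (induction x rule: P_induct)
    case zero
    have "(\<Oplus>\<^bsub>C\<^esub>l\<in>{..<N}. g (coord (a \<otimes>\<^bsub>A\<^esub> e l) i) \<otimes>\<^bsub>C\<^esub> c \<otimes>\<^bsub>C\<^esub> h l 0) = \<zero>\<^bsub>C\<^esub>"
      using that by (intro C.finsum_zero_fun) (auto simp: h0)
    then show ?case using that by (simp add: pair_ring_mult h0)
  next
    case (frag a' c')
    have "h i (frag_of (a, c) \<otimes>\<^bsub>P\<^esub> frag_of (a', c')) = g (coord (a \<otimes>\<^bsub>A\<^esub> a') i) \<otimes>\<^bsub>C\<^esub> (c \<otimes>\<^bsub>C\<^esub> c')"
      using that frag by (simp add: pair_ring_mult hfrag)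
    also have "g (coord (a \<otimes>\<^bsub>A\<^esub> a') i) = (\<Oplus>\<^bsub>C\<^esub>l\<in>{..<N}. g (coord a' l \<otimes>\<^bsub>k\<^esub> coord (a \<otimes>\<^bsub>A\<^esub> e l) i))"
      unfolding coord_mult[OF that(2) frag(1) that(1)]
      by (subst g.hom_finsum) (use that frag in \<open>auto simp: comp_def\<close>)
    also have "\<dots> \<otimes>\<^bsub>C\<^esub> (c \<otimes>\<^bsub>C\<^esub> c') = (\<Oplus>\<^bsub>C\<^esub>l\<in>{..<N}. g (coord a' l \<otimes>\<^bsub>k\<^esub> coord (a \<otimes>\<^bsub>A\<^esub> e l) i) \<otimes>\<^bsub>C\<^esub> (c \<otimes>\<^bsub>C\<^esub> c'))"
      by (rule C.finsum_ldistr) (use that frag in auto)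
    also have "\<dots> = (\<Oplus>\<^bsub>C\<^esub>l\<in>{..<N}. g (coord (a \<otimes>\<^bsub>A\<^esub> e l) i) \<otimes>\<^bsub>C\<^esub> c \<otimes>\<^bsub>C\<^esub> h l (frag_of (a', c')))"
      using that frag by (intro C.finsum_cong') (auto simp: hfrag C.m_ac)
    finally show ?case .
  next
    case (diff x y)
    have cl': "frag_of (a, c) \<otimes>\<^bsub>P\<^esub> x \<in> carrier P" "frag_of (a, c) \<otimes>\<^bsub>P\<^esub> y \<in> carrier P"
      using that diff P.m_closed by auto
    have "(\<Oplus>\<^bsub>C\<^esub>l\<in>{..<N}. g (coord (a \<otimes>\<^bsub>A\<^esub> e l) i) \<otimes>\<^bsub>C\<^esub> c \<otimes>\<^bsub>C\<^esub> h l (x - y)) =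
      (\<Oplus>\<^bsub>C\<^esub>l\<in>{..<N}. g (coord (a \<otimes>\<^bsub>A\<^esub> e l) i) \<otimes>\<^bsub>C\<^esub> c \<otimes>\<^bsub>C\<^esub> h l x \<ominus>\<^bsub>C\<^esub> g (coord (a \<otimes>\<^bsub>A\<^esub> e l) i) \<otimes>\<^bsub>C\<^esub> c \<otimes>\<^bsub>C\<^esub> h l y)"
      using that diff by (intro C.finsum_cong') (auto simp: hdiff cl C.minus_eq C.r_distr C.r_minus)
    also have "\<dots> = h i (frag_of (a, c) \<otimes>\<^bsub>P\<^esub> x) \<ominus>\<^bsub>C\<^esub> h i (frag_of (a, c) \<otimes>\<^bsub>P\<^esub> y)"
      unfolding diff(3,4) using that diff by (intro C.finsum_minus) (auto simp: cl)
    also have "\<dots> = h i (frag_of (a, c) \<otimes>\<^bsub>P\<^esub> (x - y))"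
      using that cl' by (simp add: pair_ring_mult hdiff)
    finally show ?case by simp
  qed
  have right: "h i (x \<otimes>\<^bsub>P\<^esub> frag_of (a, c)) = (\<Oplus>\<^bsub>C\<^esub>l\<in>{..<N}. g (coord (e l \<otimes>\<^bsub>A\<^esub> a) i) \<otimes>\<^bsub>C\<^esub> c \<otimes>\<^bsub>C\<^esub> h l x)"
    if "i < N" "a \<in> carrier A" "c \<in> carrier C" "x \<in> carrier P" for i a c x
    using that(4)
  proof (induction x rule: P_induct)
    case zero
    have "(\<Oplus>\<^bsub>C\<^esub>l\<in>{..<N}. g (coord (e l \<otimes>\<^bsub>A\<^esub> a) i) \<otimes>\<^bsub>C\<^esub> c \<otimes>\<^bsub>C\<^esub> h l 0) = \<zero>\<^bsub>C\<^esub>"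
      using that by (intro C.finsum_zero_fun) (auto simp: h0)
    then show ?case using that by (simp add: pair_ring_mult h0)
  next
    case (frag a' c')
    have "h i (frag_of (a', c') \<otimes>\<^bsub>P\<^esub> frag_of (a, c)) = g (coord (a' \<otimes>\<^bsub>A\<^esub> a) i) \<otimes>\<^bsub>C\<^esub> (c' \<otimes>\<^bsub>C\<^esub> c)"
      using that frag by (simp add: pair_ring_mult hfrag)
    also have "g (coord (a' \<otimes>\<^bsub>A\<^esub> a) i) = (\<Oplus>\<^bsub>C\<^esub>l\<in>{..<N}. g (coord a' l \<otimes>\<^bsub>k\<^esub> coord (e l \<otimes>\<^bsub>A\<^esub> a) i))"
      unfolding coord_mult'[OF frag(1) that(2) that(1)]
      by (subst g.hom_finsum) (use that frag in \<open>auto simp: comp_def\<close>)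
    also have "\<dots> \<otimes>\<^bsub>C\<^esub> (c' \<otimes>\<^bsub>C\<^esub> c) = (\<Oplus>\<^bsub>C\<^esub>l\<in>{..<N}. g (coord a' l \<otimes>\<^bsub>k\<^esub> coord (e l \<otimes>\<^bsub>A\<^esub> a) i) \<otimes>\<^bsub>C\<^esub> (c' \<otimes>\<^bsub>C\<^esub> c))"
      by (rule C.finsum_ldistr) (use that frag in auto)
    also have "\<dots> = (\<Oplus>\<^bsub>C\<^esub>l\<in>{..<N}. g (coord (e l \<otimes>\<^bsub>A\<^esub> a) i) \<otimes>\<^bsub>C\<^esub> c \<otimes>\<^bsub>C\<^esub> h l (frag_of (a', c')))"
      using that frag by (intro C.finsum_cong') (auto simp: hfrag C.m_ac)
    finally show ?case .
  next
    case (diff x y)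
    have cl': "x \<otimes>\<^bsub>P\<^esub> frag_of (a, c) \<in> carrier P" "y \<otimes>\<^bsub>P\<^esub> frag_of (a, c) \<in> carrier P"
      using that diff P.m_closed by auto
    have "(\<Oplus>\<^bsub>C\<^esub>l\<in>{..<N}. g (coord (e l \<otimes>\<^bsub>A\<^esub> a) i) \<otimes>\<^bsub>C\<^esub> c \<otimes>\<^bsub>C\<^esub> h l (x - y)) =
      (\<Oplus>\<^bsub>C\<^esub>l\<in>{..<N}. g (coord (e l \<otimes>\<^bsub>A\<^esub> a) i) \<otimes>\<^bsub>C\<^esub> c \<otimes>\<^bsub>C\<^esub> h l x \<ominus>\<^bsub>C\<^esub> g (coord (e l \<otimes>\<^bsub>A\<^esub> a) i) \<otimes>\<^bsub>C\<^esub> c \<otimes>\<^bsub>C\<^esub> h l y)"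
      using that diff by (intro C.finsum_cong') (auto simp: hdiff cl C.minus_eq C.r_distr C.r_minus)
    also have "\<dots> = h i (x \<otimes>\<^bsub>P\<^esub> frag_of (a, c)) \<ominus>\<^bsub>C\<^esub> h i (y \<otimes>\<^bsub>P\<^esub> frag_of (a, c))"
      unfolding diff(3,4) using that diff by (intro C.finsum_minus) (auto simp: cl)
    also have "\<dots> = h i ((x - y) \<otimes>\<^bsub>P\<^esub> frag_of (a, c))"
      using that cl' by (simp add: pair_ring_mult hdiff)
    finally show ?case by simp
  qed
  define D where "D = {x \<in> carrier P. \<forall>i<N. h i x = \<zero>\<^bsub>C\<^esub>}"
  have Dm: "y \<otimes>\<^bsub>P\<^esub> x \<in> D \<and> x \<otimes>\<^bsub>P\<^esub> y \<in> D" if x: "x \<in> D" and y: "y \<in> carrier P" for x y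
    using y
  proof (induction y rule: P_induct)
    case zero
    then show ?case by (auto simp: D_def pair_ring_mult h0 pair_ring_simps)
  next
    case (frag a c)
    have "x \<in> carrier P" "\<And>i. i < N \<Longrightarrow> h i x = \<zero>\<^bsub>C\<^esub>" using x by (auto simp: D_def)
    then show ?case using frag
      by (auto simp: D_def left right intro!: C.finsum_zero_fun P.m_closed)
  next
    case (diff y z)
    then show ?case by (auto simp: D_def pair_ring_mult hdiff in_P C.minus_eq)
  qed
  have "ideal D P"
  proof (rule idealI[OF ring_P])
    show "subgroup D (add_monoid P)"
    proof (rule group.subgroupI[OF P.a_group])
      show "D \<noteq> {}" using h0 by (auto simp: D_def pair_ring_simps intro!: exI[of _ 0])
      fix x assume x: "x \<in> D"
      have "inv\<^bsub>add_monoid P\<^esub> x = - x"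
        using P.minus_equality[of "- x" x] x in_P[of x x] by (auto simp: D_def pair_ring_simps(2,3) a_inv_def)
      moreover have "h i (- x) = \<zero>\<^bsub>C\<^esub>" if "i < N" for i
        using hdiff[of i 0 x] x that by (simp add: D_def h0 C.minus_eq pair_ring_simps(1))
      moreover have "- x \<in> carrier P" using x in_P[of x x] by (simp add: D_def)
      ultimately show "inv\<^bsub>add_monoid P\<^esub> x \<in> D" by (simp add: D_def)
    next
      fix x y assume "x \<in> D" "y \<in> D"
      then show "x \<otimes>\<^bsub>add_monoid P\<^esub> y \<in> D"
        using P.add.m_closed[of x y] by (auto simp: D_def pair_ring_simps(2) add)
    qed (auto simp: D_def)
  qed (use Dm in auto)
  moreover have "tensor_relations k f A g C \<subseteq> D"
  proof -
    have z: "u \<oplus>\<^bsub>C\<^esub> (v \<oplus>\<^bsub>C\<^esub> (\<ominus>\<^bsub>C\<^esub> u \<oplus>\<^bsub>C\<^esub> \<ominus>\<^bsub>C\<^esub> v)) = \<zero>\<^bsub>C\<^esub>" if "u \<in> carrier C" "v \<in> carrier C" for u v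
    proof -
      have "u \<oplus>\<^bsub>C\<^esub> (v \<oplus>\<^bsub>C\<^esub> (\<ominus>\<^bsub>C\<^esub> u \<oplus>\<^bsub>C\<^esub> \<ominus>\<^bsub>C\<^esub> v)) = (u \<oplus>\<^bsub>C\<^esub> v) \<oplus>\<^bsub>C\<^esub> (\<ominus>\<^bsub>C\<^esub> u \<oplus>\<^bsub>C\<^esub> \<ominus>\<^bsub>C\<^esub> v)"
        using that by (simp only: C.a_assoc C.a_inv_closed C.a_closed)
      also have "\<dots> = \<zero>\<^bsub>C\<^esub>" using that by (simp only: C.minus_add[symmetric] C.r_neg C.a_closed)
      finally show ?thesis .
    qed
    have "h i x = \<zero>\<^bsub>C\<^esub>" if "x \<in> tensor_relations k f A g C" "i < N" for i x
      using that unfolding tensor_relations_def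
      by (auto simp: hdiff diff_in_P hfrag coord_add coord_scale C.l_distr C.r_distr C.m_ac C.minus_eq C.r_neg C.minus_add C.a_ac z)
    then show ?thesis using relations_in_P by (auto simp: D_def)
  qed
  ultimately have JD: "J \<subseteq> D"
    unfolding tensor_ideal_def by (rule P.genideal_minimal)
  \<comment> \<open>Each h i is constant on a coset, so its image of the coset is a singleton and
    \<open>the_elem\<close> extracts the value.\<close>
  define H where "H i z = the_elem (h i ` z)" for i z
  have H: "H i (J +>\<^bsub>P\<^esub> x) = h i x" if "i < N" "x \<in> carrier P" for i x
  proof -
    have "h i y = h i x" if y: "y \<in> J +>\<^bsub>P\<^esub> x" for y
    proof -
      obtain d where "d \<in> J" "y = d + x" using y by (auto simp: a_r_coset_def' pair_ring_simps(2))
      moreover from this have "d \<in> carrier P" "h i d = \<zero>\<^bsub>C\<^esub>" using JD \<open>i < N\<close> by (auto simp: D_def)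
      ultimately show ?thesis using that \<open>x \<in> carrier P\<close> \<open>i < N\<close> by (simp add: add cl)
    qed
    moreover have "x \<in> J +>\<^bsub>P\<^esub> x" using J.a_rcos_self that by auto
    ultimately have "h i ` (J +>\<^bsub>P\<^esub> x) = {h i x}" by blast
    then show ?thesis by (simp add: H_def)
  qed
  show ?thesis
  proof (rule exI[of _ H], intro allI impI conjI ballI)
    fix i z assume "i < N" "z \<in> carrier T"
    then show "H i z \<in> carrier C" by (auto simp: T_carrier H cl)
  next
    fix i z w assume "i < N" "z \<in> carrier T" "w \<in> carrier T"
    then obtain x y where "x \<in> carrier P" "y \<in> carrier P" "z = J +>\<^bsub>P\<^esub> x" "w = J +>\<^bsub>P\<^esub> y" by (auto simp: T_carrier)
    moreover from this have "z \<oplus>\<^bsub>T\<^esub> w = J +>\<^bsub>P\<^esub> (x + y)" "x + y \<in> carrier P"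
      using ring_hom_add[OF coset_hom, of x y] P.add.m_closed[of x y] by (auto simp: pair_ring_simps(2))
    ultimately show "H i (z \<oplus>\<^bsub>T\<^esub> w) = H i z \<oplus>\<^bsub>C\<^esub> H i w" using \<open>i < N\<close> by (simp add: H add)
  next
    fix i a c assume "i < N" "a \<in> carrier A" "c \<in> carrier C"
    then show "H i (pt a c) = g (coord a i) \<otimes>\<^bsub>C\<^esub> c" by (simp add: pure_tensor_def H hfrag)
  qed
qed

text \<open>The functionals from \<open>tensor_coord_ex\<close> do both halves: they supply the
  coefficients of an expansion, proved by induction on sums of pure tensors, and they recover the
  coefficients of any given expansion, which proves uniqueness.\<close>

lemma tensor_basis: "based_algebra C T (pt \<one>\<^bsub>A\<^esub>) N (\<lambda>i. pt (e i) \<one>\<^bsub>C\<^esub>)"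
  and tensor_coord_pure: "a \<in> carrier A \<Longrightarrow> c \<in> carrier C \<Longrightarrow> i < N \<Longrightarrow>
    based_algebra.coord C T (pt \<one>\<^bsub>A\<^esub>) N (\<lambda>i. pt (e i) \<one>\<^bsub>C\<^esub>) (pt a c) i = g (coord a i) \<otimes>\<^bsub>C\<^esub> c"
proof -
  obtain H where H: "\<And>i z. i < N \<Longrightarrow> z \<in> carrier T \<Longrightarrow> H i z \<in> carrier C"
    and add: "\<And>i z w. i < N \<Longrightarrow> z \<in> carrier T \<Longrightarrow> w \<in> carrier T \<Longrightarrow> H i (z \<oplus>\<^bsub>T\<^esub> w) = H i z \<oplus>\<^bsub>C\<^esub> H i w"
    and pure: "\<And>i a c. i < N \<Longrightarrow> a \<in> carrier A \<Longrightarrow> c \<in> carrier C \<Longrightarrow> H i (pt a c) = g (coord a i) \<otimes>\<^bsub>C\<^esub> c"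
    using tensor_coord_ex by blast
  have simp_e: "pt \<one>\<^bsub>A\<^esub> c \<otimes>\<^bsub>T\<^esub> pt (e i) \<one>\<^bsub>C\<^esub> = pt (e i) c" if "c \<in> carrier C" "i < N" for c i
    using that by simp
  have expand: "z = (\<Oplus>\<^bsub>T\<^esub>i\<in>{..<N}. pt (e i) (H i z))" if "z \<in> carrier T" for z
    using that
  proof (induction z rule: tensor_induct)
    case (pure a c)
    have "pt a c = pt (\<Oplus>\<^bsub>A\<^esub>i\<in>{..<N}. f (coord a i) \<otimes>\<^bsub>A\<^esub> e i) c"
      using pure by (simp flip: coord_expand)
    also have "\<dots> = (\<Oplus>\<^bsub>T\<^esub>i\<in>{..<N}. pt (f (coord a i) \<otimes>\<^bsub>A\<^esub> e i) c)"
    proof -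
      have "pt (\<Oplus>\<^bsub>A\<^esub>i\<in>I. u i) c = (\<Oplus>\<^bsub>T\<^esub>i\<in>I. pt (u i) c)" if "finite I" "u \<in> I \<rightarrow> carrier A" for I :: "nat set" and u
        using that
      proof (induction I)
        case (insert l I)
        then have "u l \<in> carrier A" "u \<in> I \<rightarrow> carrier A" by auto
        with insert pure show ?case
          by (subst A.finsum_insert; simp add: pt_add_left A.finsum_closed)
             (subst T.finsum_insert; auto simp: Pi_iff)
      qed (use pure in simp)
      then show ?thesis using pure by auto
    qed
    also have "\<dots> = (\<Oplus>\<^bsub>T\<^esub>i\<in>{..<N}. pt (e i) (H i (pt a c)))"
      using pure by (intro T.finsum_cong') (auto simp: pt_balanced \<open>\<And>i a c. i < N \<Longrightarrow> a \<in> carrier A \<Longrightarrow> c \<in> carrier C \<Longrightarrow> H i (pt a c) = g (coord a i) \<otimes>\<^bsub>C\<^esub> c\<close>)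
    finally show ?case .
  next
    case (add z w)
    have "z \<oplus>\<^bsub>T\<^esub> w = (\<Oplus>\<^bsub>T\<^esub>i\<in>{..<N}. pt (e i) (H i z)) \<oplus>\<^bsub>T\<^esub> (\<Oplus>\<^bsub>T\<^esub>i\<in>{..<N}. pt (e i) (H i w))"
      using add(3,4) by simp
    also have "\<dots> = (\<Oplus>\<^bsub>T\<^esub>i\<in>{..<N}. pt (e i) (H i z) \<oplus>\<^bsub>T\<^esub> pt (e i) (H i w))"
      using add H by (intro T.finsum_addf[symmetric]) auto
    also have "\<dots> = (\<Oplus>\<^bsub>T\<^esub>i\<in>{..<N}. pt (e i) (H i (z \<oplus>\<^bsub>T\<^esub> w)))"
      using add H by (intro T.finsum_cong') (auto simp: pt_add_right \<open>\<And>i z w. i < N \<Longrightarrow> z \<in> carrier T \<Longrightarrow> w \<in> carrier T \<Longrightarrow> H i (z \<oplus>\<^bsub>T\<^esub> w) = H i z \<oplus>\<^bsub>C\<^esub> H i w\<close>)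
    finally show ?case .
  qed
  have unique: "H l (\<Oplus>\<^bsub>T\<^esub>i\<in>{..<N}. pt (e i) (r i)) = r l" if r: "r \<in> {..<N} \<rightarrow> carrier C" and l: "l < N" for r l
  proof -
    have H0: "H l \<zero>\<^bsub>T\<^esub> = \<zero>\<^bsub>C\<^esub>"
      using pure[OF l, of "\<zero>\<^bsub>A\<^esub>" "\<zero>\<^bsub>C\<^esub>"] l by simp
    have "H l (\<Oplus>\<^bsub>T\<^esub>i\<in>I. u i) = (\<Oplus>\<^bsub>C\<^esub>i\<in>I. H l (u i))" if "finite I" "u \<in> I \<rightarrow> carrier T" for I :: "nat set" and u
      using that
    proof (induction I)
      case (insert m I)
      then have "u m \<in> carrier T" "u \<in> I \<rightarrow> carrier T" by auto
      with insert l show ?case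
        by (subst T.finsum_insert; simp add: add T.finsum_closed)
           (subst C.finsum_insert; auto simp: Pi_iff H)
    qed (use H0 in simp)
    then have "H l (\<Oplus>\<^bsub>T\<^esub>i\<in>{..<N}. pt (e i) (r i)) = (\<Oplus>\<^bsub>C\<^esub>i\<in>{..<N}. H l (pt (e i) (r i)))"
      using r by (auto simp: Pi_iff)
    also have "\<dots> = (\<Oplus>\<^bsub>C\<^esub>i\<in>{..<N}. if l = i then r i else \<zero>\<^bsub>C\<^esub>)"
      using r l by (intro C.finsum_cong') (auto simp: pure coord_e Pi_iff)
    also have "\<dots> = r l" using r l by (subst C.finsum_singleton) auto
    finally show ?thesis .
  qed
  show B: "based_algebra C T (pt \<one>\<^bsub>A\<^esub>) N (\<lambda>i. pt (e i) \<one>\<^bsub>C\<^esub>)"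
  proof (unfold_locales, goal_cases)
    case 1 show ?case by (rule pt_right_hom)
  next
    case 2 then show ?case by (rule pt_central)
  next
    case 3 then show ?case by simp
  next
    case (4 z)
    then have "z = (\<Oplus>\<^bsub>T\<^esub>i\<in>{..<N}. pt \<one>\<^bsub>A\<^esub> (H i z) \<otimes>\<^bsub>T\<^esub> pt (e i) \<one>\<^bsub>C\<^esub>)"
    proof (rule trans[OF expand])
      show "(\<Oplus>\<^bsub>T\<^esub>i\<in>{..<N}. pt (e i) (H i z)) = (\<Oplus>\<^bsub>T\<^esub>i\<in>{..<N}. pt \<one>\<^bsub>A\<^esub> (H i z) \<otimes>\<^bsub>T\<^esub> pt (e i) \<one>\<^bsub>C\<^esub>)"
        by (rule T.finsum_cong') (use 4 H in auto)
    qed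
    then show ?case by (rule bexI[of _ "\<lambda>i. H i z"]) (use H 4 in auto)
  next
    case (5 r r' i)
    have "(\<Oplus>\<^bsub>T\<^esub>i\<in>{..<N}. pt \<one>\<^bsub>A\<^esub> (r i) \<otimes>\<^bsub>T\<^esub> pt (e i) \<one>\<^bsub>C\<^esub>) = (\<Oplus>\<^bsub>T\<^esub>i\<in>{..<N}. pt (e i) (r i))"
      if "r \<in> {..<N} \<rightarrow> carrier C" for r
      using that by (intro T.finsum_cong') (auto simp: Pi_iff)
    from this[OF 5(1)] this[OF 5(2)] 5(3)
    have "(\<Oplus>\<^bsub>T\<^esub>i\<in>{..<N}. pt (e i) (r i)) = (\<Oplus>\<^bsub>T\<^esub>i\<in>{..<N}. pt (e i) (r' i))" by (simp only:)
    then have "H i (\<Oplus>\<^bsub>T\<^esub>i\<in>{..<N}. pt (e i) (r i)) = H i (\<Oplus>\<^bsub>T\<^esub>i\<in>{..<N}. pt (e i) (r' i))" by (simp only:)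
    then show ?case unfolding unique[OF 5(1,4)] unique[OF 5(2,4)] .
  qed
  interpret B: based_algebra C T "pt \<one>\<^bsub>A\<^esub>" N "\<lambda>i. pt (e i) \<one>\<^bsub>C\<^esub>" by (rule B)
  assume ac: "a \<in> carrier A" "c \<in> carrier C" "i < N"
  have "B.coord (pt a c) i = H i (pt a c)"
  proof (rule B.coord_eqI)
    show "pt a c = (\<Oplus>\<^bsub>T\<^esub>i\<in>{..<N}. pt \<one>\<^bsub>A\<^esub> (H i (pt a c)) \<otimes>\<^bsub>T\<^esub> pt (e i) \<one>\<^bsub>C\<^esub>)"
    proof (rule trans[OF expand])
      show "(\<Oplus>\<^bsub>T\<^esub>i\<in>{..<N}. pt (e i) (H i (pt a c))) = (\<Oplus>\<^bsub>T\<^esub>i\<in>{..<N}. pt \<one>\<^bsub>A\<^esub> (H i (pt a c)) \<otimes>\<^bsub>T\<^esub> pt (e i) \<one>\<^bsub>C\<^esub>)"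
        by (rule T.finsum_cong') (use ac H in auto)
    qed (use ac in simp)
  qed (use ac H in auto)
  then show "B.coord (pt a c) i = g (coord a i) \<otimes>\<^bsub>C\<^esub> c" using ac pure by simp
qed

end

section \<open>The reduced norm\<close>

definition ring_char_0 :: "('f, 'm) ring_scheme \<Rightarrow> bool" where
  "ring_char_0 F \<longleftrightarrow> (\<forall>m::nat. m > 0 \<longrightarrow> add_pow F (m :: nat) \<one>\<^bsub>F\<^esub> \<noteq> \<zero>\<^bsub>F\<^esub>)"

lemma field_hom_inj:
  assumes "field F" "field L" "j \<in> ring_hom F L" "x \<in> carrier F" "y \<in> carrier F" "j x = j y"
  shows "x = y"
proof -
  interpret F: field F by fact
  interpret L: field L by fact
  interpret j: ring_hom_ring F L j
    using assms F.ring_axioms L.ring_axioms by (simp add: ring_hom_ring_def ring_hom_ring_axioms_def)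
  have "x \<ominus>\<^bsub>F\<^esub> y = \<zero>\<^bsub>F\<^esub>"
  proof (rule ccontr)
    assume nz: "x \<ominus>\<^bsub>F\<^esub> y \<noteq> \<zero>\<^bsub>F\<^esub>"
    then have u: "x \<ominus>\<^bsub>F\<^esub> y \<in> Units F" using assms by (simp add: F.field_Units)
    then have "j (x \<ominus>\<^bsub>F\<^esub> y) \<otimes>\<^bsub>L\<^esub> j (inv\<^bsub>F\<^esub> (x \<ominus>\<^bsub>F\<^esub> y)) = \<one>\<^bsub>L\<^esub>"
      using j.hom_mult[of "x \<ominus>\<^bsub>F\<^esub> y" "inv\<^bsub>F\<^esub> (x \<ominus>\<^bsub>F\<^esub> y)"] F.Units_closed[OF u] by (simp add: F.Units_r_inv)
    moreover have "j (x \<ominus>\<^bsub>F\<^esub> y) = \<zero>\<^bsub>L\<^esub>" using assms by (simp add: F.minus_eq L.r_neg)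
    ultimately show False using u by simp
  qed
  then show ?thesis using assms by simp
qed

lemma hom_nat_multiple:
  assumes "ring F" "ring L" "j \<in> ring_hom F L"
  shows "j (add_pow F (m :: nat) \<one>\<^bsub>F\<^esub>) = add_pow L (m :: nat) \<one>\<^bsub>L\<^esub>"
proof -
  interpret F: ring F by fact
  interpret L: ring L by fact
  interpret j: ring_hom_ring F L j
    using assms by (simp add: ring_hom_ring_def ring_hom_ring_axioms_def)
  show ?thesis by (induction m) (auto simp: F.add.nat_pow_Suc L.add.nat_pow_Suc)
qed

lemma ring_char_0_hom:
  assumes "field F" "field L" "j \<in> ring_hom F L" "ring_char_0 F"
  shows "ring_char_0 L"
proof -
  interpret F: field F by fact
  interpret L: field L by fact
  have "j (add_pow F (m :: nat) \<one>\<^bsub>F\<^esub>) \<noteq> j \<zero>\<^bsub>F\<^esub>" if "m > 0" for m :: nat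
    using field_hom_inj[OF assms(1-3), of "add_pow F (m :: nat) \<one>\<^bsub>F\<^esub>" "\<zero>\<^bsub>F\<^esub>"] assms(4) that
    by (auto simp: ring_char_0_def)
  then show ?thesis
    using hom_nat_multiple[OF F.ring_axioms L.ring_axioms assms(3)] ring_hom_zero[OF assms(3) F.ring_axioms L.ring_axioms]
    by (auto simp: ring_char_0_def)
qed

lemma (in abelian_monoid) finsum_swap:
  assumes "finite I" "\<And>i k. i \<in> I \<Longrightarrow> k \<in> K \<Longrightarrow> x i k \<in> carrier G"
  shows "(\<Oplus>i\<in>I. \<Oplus>k\<in>K. x i k) = (\<Oplus>k\<in>K. \<Oplus>i\<in>I. x i k)"
  using assms
proof (induction I)
  case empty
  have "(\<Oplus>k\<in>K. \<zero>) = \<zero>" by simp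
  then show ?case by simp
next
  case (insert i I)
  have "(\<Oplus>k\<in>K. \<Oplus>i\<in>insert i I. x i k) = (\<Oplus>k\<in>K. x i k \<oplus> (\<Oplus>i\<in>I. x i k))"
    using insert by (intro finsum_cong') (auto intro!: finsum_insert finsum_closed)
  also have "\<dots> = (\<Oplus>k\<in>K. x i k) \<oplus> (\<Oplus>k\<in>K. \<Oplus>i\<in>I. x i k)"
    using insert by (intro finsum_addf) (auto intro!: finsum_closed)
  also have "(\<Oplus>k\<in>K. \<Oplus>i\<in>I. x i k) = (\<Oplus>i\<in>I. \<Oplus>k\<in>K. x i k)"
    using insert by simp
  finally show ?case
    using insert by (subst finsum_insert) (auto intro!: finsum_closed)
qed

lemma (in cring) finsum_div_block:
  fixes n c :: nat
  assumes "c < n" "\<And>u. u < n * n \<Longrightarrow> x u \<in> carrier R"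
  shows "(\<Oplus>u\<in>{..<n * n}. if u div n = c then x u else \<zero>) = (\<Oplus>h\<in>{..<n}. x (c * n + h))"
proof -
  have c: "c * n + h < n * n" if "h < n" for h
  proof -
    have "c * n + h < c * n + n" using that by simp
    also have "\<dots> = Suc c * n" by simp
    also have "\<dots> \<le> n * n" using assms(1) by (intro mult_le_mono1) simp
    finally show ?thesis .
  qed
  have inj: "inj_on (\<lambda>h. c * n + h) {..<n}" by (auto simp: inj_on_def)
  have "(\<Oplus>h\<in>{..<n}. x (c * n + h)) = (\<Oplus>u\<in>(\<lambda>h. c * n + h) ` {..<n}. x u)"
    by (subst finsum_reindex) (use c assms inj in auto)
  also have "\<dots> = (\<Oplus>u\<in>{..<n * n}. if u div n = c then x u else \<zero>)"
  proof (rule add.finprod_mono_neutral_cong_left)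
    have "u \<in> (\<lambda>h. c * n + h) ` {..<n}" if "u div n = c" for u
      using that assms(1) by (intro image_eqI[of _ _ "u mod n"]) (auto simp: mult.commute)
    then show "\<And>u. u \<in> {..<n * n} - (\<lambda>h. c * n + h) ` {..<n} \<Longrightarrow> (if u div n = c then x u else \<zero>) = \<zero>"
      by auto
  qed (use c assms in auto)
  finally show ?thesis by simp
qed

definition (in based_algebra) mult_matrix :: "'a \<Rightarrow> nat \<Rightarrow> nat \<Rightarrow> 'k" where
  "mult_matrix a i l = coord (a \<otimes>\<^bsub>A\<^esub> e l) i"

locale split_algebra = based_algebra F A f N e
  for F :: "'f ring" and A :: "'a ring" and f N e +
  fixes L :: "'l ring" and j :: "'f \<Rightarrow> 'l" and n :: nat and \<phi> :: "('a \<times> 'l \<Rightarrow>\<^sub>0 int) set \<Rightarrow> nat \<Rightarrow> nat \<Rightarrow> 'l"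
  assumes field_F: "field F" and char_F: "ring_char_0 F" and splitting: "splitting F f A j L n \<phi>"
begin

lemma field_L: "field L" and j_hom: "j \<in> ring_hom F L"
  using splitting by (auto simp: splitting_def)

sublocale L: field L by (rule field_L)
sublocale L: record_cring L by unfold_locales

sublocale tensor_based F A L f j N e
  by unfold_locales (use j_hom f central in auto)

sublocale T: based_algebra L T "pt \<one>\<^bsub>A\<^esub>" N "\<lambda>i. pt (e i) \<one>\<^bsub>L\<^esub>"
  by (rule tensor_basis)

lemma phi_hom: "\<phi> \<in> ring_hom T (matrix_ring n L)" and phi_bij: "bij_betw \<phi> (carrier T) (carrier (matrix_ring n L))"
  and phi_scalar: "l \<in> carrier L \<Longrightarrow> \<phi> (pt \<one>\<^bsub>A\<^esub> l) = scalar_matrix n L l"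
  using splitting by (auto simp: splitting_def ring_iso_def)

lemma phi_ext: "z \<in> carrier T \<Longrightarrow> \<phi> z \<in> {..<n} \<rightarrow>\<^sub>E ({..<n} \<rightarrow>\<^sub>E carrier L)"
  using ring_hom_closed[OF phi_hom, of z] by (simp add: matrix_ring_def)

lemma phi_closed [simp]: "z \<in> carrier T \<Longrightarrow> r < n \<Longrightarrow> c < n \<Longrightarrow> \<phi> z r c \<in> carrier L"
  using phi_ext[of z] by (auto simp: PiE_iff)

lemma phi_add: "z \<in> carrier T \<Longrightarrow> w \<in> carrier T \<Longrightarrow> r < n \<Longrightarrow> c < n \<Longrightarrow> \<phi> (z \<oplus>\<^bsub>T\<^esub> w) r c = \<phi> z r c \<oplus>\<^bsub>L\<^esub> \<phi> w r c"
  using ring_hom_add[OF phi_hom, of z w] by (simp add: matrix_ring_def)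

lemma phi_mult: "z \<in> carrier T \<Longrightarrow> w \<in> carrier T \<Longrightarrow> r < n \<Longrightarrow> c < n \<Longrightarrow>
    \<phi> (z \<otimes>\<^bsub>T\<^esub> w) r c = (\<Oplus>\<^bsub>L\<^esub>h\<in>{..<n}. \<phi> z r h \<otimes>\<^bsub>L\<^esub> \<phi> w h c)"
  using ring_hom_mult[OF phi_hom, of z w] by (simp add: matrix_ring_def)

lemma phi_scale:
  assumes "l \<in> carrier L" "z \<in> carrier T" "r < n" "c < n"
  shows "\<phi> (pt \<one>\<^bsub>A\<^esub> l \<otimes>\<^bsub>T\<^esub> z) r c = l \<otimes>\<^bsub>L\<^esub> \<phi> z r c"
proof -
  have "\<phi> (pt \<one>\<^bsub>A\<^esub> l \<otimes>\<^bsub>T\<^esub> z) r c = (\<Oplus>\<^bsub>L\<^esub>h\<in>{..<n}. scalar_matrix n L l r h \<otimes>\<^bsub>L\<^esub> \<phi> z h c)"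
    using assms by (subst phi_mult) (auto simp: phi_scalar)
  also have "\<dots> = (\<Oplus>\<^bsub>L\<^esub>h\<in>{..<n}. if r = h then l \<otimes>\<^bsub>L\<^esub> \<phi> z h c else \<zero>\<^bsub>L\<^esub>)"
    using assms by (intro L.finsum_cong') (auto simp: scalar_matrix_def)
  also have "\<dots> = l \<otimes>\<^bsub>L\<^esub> \<phi> z r c" using assms by (subst L.finsum_singleton) auto
  finally show ?thesis .
qed

lemma phi_zero: "r < n \<Longrightarrow> c < n \<Longrightarrow> \<phi> \<zero>\<^bsub>T\<^esub> r c = \<zero>\<^bsub>L\<^esub>"
  using phi_scale[of "\<zero>\<^bsub>L\<^esub>" "\<zero>\<^bsub>T\<^esub>" r c] by simp

lemma phi_finsum:
  assumes "finite I" "u \<in> I \<rightarrow> carrier T" "r < n" "c < n"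
  shows "\<phi> (\<Oplus>\<^bsub>T\<^esub>i\<in>I. u i) r c = (\<Oplus>\<^bsub>L\<^esub>i\<in>I. \<phi> (u i) r c)"
  using assms(1,2)
proof (induction I)
  case (insert i I)
  then have "u i \<in> carrier T" "u \<in> I \<rightarrow> carrier T" by auto
  with insert assms(3,4) show ?case
    by (subst T.finsum_insert; simp add: phi_add T.finsum_closed)
       (subst L.finsum_insert; auto simp: Pi_iff)
qed (use assms phi_zero in simp)

lemma phi_expand:
  assumes "z \<in> carrier T" "r < n" "c < n"
  shows "\<phi> z r c = (\<Oplus>\<^bsub>L\<^esub>i\<in>{..<N}. T.coord z i \<otimes>\<^bsub>L\<^esub> \<phi> (pt (e i) \<one>\<^bsub>L\<^esub>) r c)"
proof -
  have "\<phi> z r c = \<phi> (\<Oplus>\<^bsub>T\<^esub>i\<in>{..<N}. pt \<one>\<^bsub>A\<^esub> (T.coord z i) \<otimes>\<^bsub>T\<^esub> pt (e i) \<one>\<^bsub>L\<^esub>) r c"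
    using T.coord_expand[OF assms(1)] by simp
  also have "\<dots> = (\<Oplus>\<^bsub>L\<^esub>i\<in>{..<N}. \<phi> (pt \<one>\<^bsub>A\<^esub> (T.coord z i) \<otimes>\<^bsub>T\<^esub> pt (e i) \<one>\<^bsub>L\<^esub>) r c)"
    using assms by (intro phi_finsum) auto
  also have "\<dots> = (\<Oplus>\<^bsub>L\<^esub>i\<in>{..<N}. T.coord z i \<otimes>\<^bsub>L\<^esub> \<phi> (pt (e i) \<one>\<^bsub>L\<^esub>) r c)"
    using assms by (intro L.finsum_cong') (auto simp: phi_scale simp del: pt_mult)
  finally show ?thesis .
qed

text \<open>Preimages of the matrix units under the surjection \<phi>. They form a second basis of
  the tensor product, to be compared with the one coming from the basis of A.\<close>

lemma matrix_units_ex: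
  obtains E where "\<And>r c. E r c \<in> carrier T"
    and "\<And>r c r' c'. r' < n \<Longrightarrow> c' < n \<Longrightarrow> \<phi> (E r c) r' c' = (if r' = r \<and> c' = c then \<one>\<^bsub>L\<^esub> else \<zero>\<^bsub>L\<^esub>)"
proof -
  have "\<exists>z\<in>carrier T. \<forall>r'<n. \<forall>c'<n. \<phi> z r' c' = (if r' = r \<and> c' = c then \<one>\<^bsub>L\<^esub> else \<zero>\<^bsub>L\<^esub>)" for r c
  proof -
    have "(\<lambda>r'\<in>{..<n}. \<lambda>c'\<in>{..<n}. if r' = r \<and> c' = c then \<one>\<^bsub>L\<^esub> else \<zero>\<^bsub>L\<^esub>) \<in> \<phi> ` carrier T"
      using phi_bij by (auto simp: bij_betw_def matrix_ring_def)
    then obtain z where z: "z \<in> carrier T" "\<phi> z = (\<lambda>r'\<in>{..<n}. \<lambda>c'\<in>{..<n}. if r' = r \<and> c' = c then \<one>\<^bsub>L\<^esub> else \<zero>\<^bsub>L\<^esub>)"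
      by (metis (no_types, lifting) imageE)
    show ?thesis by (rule bexI[OF _ z(1)]) (simp add: z(2))
  qed
  then show ?thesis using that by metis
qed

lemma phi_eqI:
  assumes "z \<in> carrier T" "w \<in> carrier T" "\<And>r c. r < n \<Longrightarrow> c < n \<Longrightarrow> \<phi> z r c = \<phi> w r c"
  shows "z = w"
proof -
  have "\<phi> z = \<phi> w"
  proof (rule PiE_ext[OF phi_ext[OF assms(1)] phi_ext[OF assms(2)]])
    fix r assume r: "r \<in> {..<n}"
    show "\<phi> z r = \<phi> w r"
      by (rule PiE_ext[OF PiE_mem[OF phi_ext[OF assms(1)] r] PiE_mem[OF phi_ext[OF assms(2)] r]]) (use r assms in auto)
  qed
  then show ?thesis using phi_bij assms by (auto simp: bij_betw_def dest: inj_onD)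
qed

text \<open>The matrices Q and Q' express the two bases of the tensor product in terms of each
  other, the basis coming from A and the matrix units. In the second basis left multiplication by a
  consists of n diagonal copies of the matrix of a, so the determinant of its pencil is an n-th
  power.\<close>

lemma dimension_and_pencil:
  shows dimension: "n * n = N"
    and pencil_power: "a \<in> carrier A \<Longrightarrow> L.pencil_det N (\<lambda>i l. j (mult_matrix a i l)) = L.pencil_det n (\<phi> (pt a \<one>\<^bsub>L\<^esub>)) [^]\<^bsub>polys L\<^esub> n"
proof -
  obtain E where E: "\<And>r c. E r c \<in> carrier T"
    "\<And>r c r' c'. r' < n \<Longrightarrow> c' < n \<Longrightarrow> \<phi> (E r c) r' c' = (if r' = r \<and> c' = c then \<one>\<^bsub>L\<^esub> else \<zero>\<^bsub>L\<^esub>)"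
    using matrix_units_ex by blast
  \<comment> \<open>The index u stands for row \<open>u mod n\<close> and column
    \<open>u div n\<close>: columns are stacked. Left multiplication acts on each column separately,
    which is what makes it block diagonal.\<close>
  define Q where "Q u i = \<phi> (pt (e i) \<one>\<^bsub>L\<^esub>) (u mod n) (u div n)" for u i
  define Q' where "Q' i u = T.coord (E (u mod n) (u div n)) i" for i u
  have dm: "u mod n < n" "u div n < n" if "u < n * n" for u
  proof -
    have "n > 0" using that by (cases n) auto
    then show "u mod n < n" "u div n < n" using that by (auto simp: less_mult_imp_div_less)
  qed
  have Q: "Q u i \<in> carrier L" if "u < n * n" "i < N" for u i
    using dm[OF that(1)] that(2) by (simp add: Q_def)
  have Q': "Q' i u \<in> carrier L" if "i < N" for u i
    using that E by (simp add: Q'_def)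
  have QQ': "(\<Oplus>\<^bsub>L\<^esub>h\<in>{..<N}. Q u h \<otimes>\<^bsub>L\<^esub> Q' h v) = (if u = v then \<one>\<^bsub>L\<^esub> else \<zero>\<^bsub>L\<^esub>)" if "u < n * n" "v < n * n" for u v
  proof -
    have "(\<Oplus>\<^bsub>L\<^esub>h\<in>{..<N}. Q u h \<otimes>\<^bsub>L\<^esub> Q' h v) = (\<Oplus>\<^bsub>L\<^esub>h\<in>{..<N}. T.coord (E (v mod n) (v div n)) h \<otimes>\<^bsub>L\<^esub> \<phi> (pt (e h) \<one>\<^bsub>L\<^esub>) (u mod n) (u div n))"
      using that Q Q' E dm[OF that(1)] by (intro L.finsum_cong') (auto simp: Q_def Q'_def L.m_comm)
    also have "\<dots> = \<phi> (E (v mod n) (v div n)) (u mod n) (u div n)"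
      using phi_expand[OF E(1) dm[OF that(1)]] by simp
    also have "\<dots> = (if u = v then \<one>\<^bsub>L\<^esub> else \<zero>\<^bsub>L\<^esub>)"
      using E(2)[OF dm[OF that(1)]] by (auto, metis div_mult_mod_eq)
    finally show ?thesis .
  qed
  have Q'Q: "(\<Oplus>\<^bsub>L\<^esub>u\<in>{..<n * n}. Q' i u \<otimes>\<^bsub>L\<^esub> Q u l) = (if i = l then \<one>\<^bsub>L\<^esub> else \<zero>\<^bsub>L\<^esub>)" if il: "i < N" "l < N" for i l
  proof -
    let ?z = "\<Oplus>\<^bsub>T\<^esub>u\<in>{..<n * n}. pt \<one>\<^bsub>A\<^esub> (Q u l) \<otimes>\<^bsub>T\<^esub> E (u mod n) (u div n)"
    have cl: "(\<lambda>u. pt \<one>\<^bsub>A\<^esub> (Q u l) \<otimes>\<^bsub>T\<^esub> E (u mod n) (u div n)) \<in> {..<n * n} \<rightarrow> carrier T"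
      using Q E il by (auto simp del: pt_mult)
    have "?z = pt (e l) \<one>\<^bsub>L\<^esub>"
    proof (rule phi_eqI)
      fix r c assume rc: "r < n" "c < n"
      have "\<phi> ?z r c = (\<Oplus>\<^bsub>L\<^esub>u\<in>{..<n * n}. \<phi> (pt \<one>\<^bsub>A\<^esub> (Q u l) \<otimes>\<^bsub>T\<^esub> E (u mod n) (u div n)) r c)"
        using cl rc by (intro phi_finsum) auto
      also have "\<dots> = (\<Oplus>\<^bsub>L\<^esub>u\<in>{..<n * n}. if c * n + r = u then Q u l else \<zero>\<^bsub>L\<^esub>)"
      proof (rule L.finsum_cong')
        fix u assume "u \<in> {..<n * n}"
        then have u: "u < n * n" by simp
        have "c * n + r = u \<longleftrightarrow> r = u mod n \<and> c = u div n"
          using rc by auto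
        then show "\<phi> (pt \<one>\<^bsub>A\<^esub> (Q u l) \<otimes>\<^bsub>T\<^esub> E (u mod n) (u div n)) r c = (if c * n + r = u then Q u l else \<zero>\<^bsub>L\<^esub>)"
          using Q[OF u il(2)] E rc by (simp add: phi_scale del: pt_mult)
      qed (use Q il in auto)
      also have "\<dots> = Q (c * n + r) l"
      proof -
        have "c * n + r < Suc c * n" using rc by simp
        also have "\<dots> \<le> n * n" using rc by (intro mult_le_mono1) simp
        finally show ?thesis using Q il by (subst L.finsum_singleton) auto
      qed
      also have "\<dots> = \<phi> (pt (e l) \<one>\<^bsub>L\<^esub>) r c" using rc by (simp add: Q_def)
      finally show "\<phi> ?z r c = \<phi> (pt (e l) \<one>\<^bsub>L\<^esub>) r c" .
    qed (use cl il in \<open>auto intro!: T.finsum_closed\<close>)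
    then have "T.coord ?z i = (if i = l then \<one>\<^bsub>L\<^esub> else \<zero>\<^bsub>L\<^esub>)"
      using T.coord_e[OF il] by simp
    moreover have "T.coord ?z i = (\<Oplus>\<^bsub>L\<^esub>u\<in>{..<n * n}. T.coord (pt \<one>\<^bsub>A\<^esub> (Q u l) \<otimes>\<^bsub>T\<^esub> E (u mod n) (u div n)) i)"
      using cl il by (intro T.coord_finsum) auto
    moreover have "\<dots> = (\<Oplus>\<^bsub>L\<^esub>u\<in>{..<n * n}. Q' i u \<otimes>\<^bsub>L\<^esub> Q u l)"
      using Q Q' E il by (intro L.finsum_cong') (auto simp: T.coord_scale Q'_def L.m_comm simp del: pt_mult)
    ultimately show ?thesis by simp
  qed
  have tr: "(\<Oplus>\<^bsub>L\<^esub>u\<in>{..<m::nat}. \<one>\<^bsub>L\<^esub>) = add_pow L (m :: nat) \<one>\<^bsub>L\<^esub>" for m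
    by (induction m) (auto simp: lessThan_Suc L.add.nat_pow_Suc L.a_comm)
  \<comment> \<open>The traces of Q Q' and Q' Q agree. One product is an identity matrix of size n *
    n, the other of size N, and in characteristic 0 the corresponding multiples of 1 are equal only
    if the sizes are.\<close>
  have "add_pow L (n * n :: nat) \<one>\<^bsub>L\<^esub> = (\<Oplus>\<^bsub>L\<^esub>u\<in>{..<n * n}. \<Oplus>\<^bsub>L\<^esub>h\<in>{..<N}. Q u h \<otimes>\<^bsub>L\<^esub> Q' h u)"
    unfolding tr[symmetric] by (intro L.finsum_cong') (auto simp: QQ')
  also have "\<dots> = (\<Oplus>\<^bsub>L\<^esub>h\<in>{..<N}. \<Oplus>\<^bsub>L\<^esub>u\<in>{..<n * n}. Q u h \<otimes>\<^bsub>L\<^esub> Q' h u)"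
    using Q Q' by (intro L.finsum_swap) auto
  also have "\<dots> = (\<Oplus>\<^bsub>L\<^esub>h\<in>{..<N}. \<Oplus>\<^bsub>L\<^esub>u\<in>{..<n * n}. Q' h u \<otimes>\<^bsub>L\<^esub> Q u h)"
    using Q Q' by (intro L.finsum_cong') (auto intro!: L.finsum_closed L.m_comm)
  also have "\<dots> = add_pow L (N :: nat) \<one>\<^bsub>L\<^esub>"
    unfolding tr[symmetric] by (intro L.finsum_cong') (auto simp: Q'Q)
  finally have eq: "add_pow L (n * n :: nat) \<one>\<^bsub>L\<^esub> = add_pow L (N :: nat) \<one>\<^bsub>L\<^esub>" .
  have inj: "a = b" if "add_pow L (a :: nat) \<one>\<^bsub>L\<^esub> = add_pow L (b :: nat) \<one>\<^bsub>L\<^esub>" "a \<le> b" for a b :: nat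
  proof (rule ccontr)
    assume "a \<noteq> b"
    have "add_pow L (b :: nat) \<one>\<^bsub>L\<^esub> = add_pow L (a :: nat) \<one>\<^bsub>L\<^esub> \<oplus>\<^bsub>L\<^esub> add_pow L (b - a :: nat) \<one>\<^bsub>L\<^esub>"
      using that(2) by (subst L.add.nat_pow_mult) auto
    then have "add_pow L (b - a :: nat) \<one>\<^bsub>L\<^esub> = \<zero>\<^bsub>L\<^esub>" using that(1) by simp
    then show False using ring_char_0_hom[OF field_F field_L j_hom char_F] \<open>a \<noteq> b\<close> that(2)
      by (auto simp: ring_char_0_def)
  qed
  show N: "n * n = N" using inj[OF eq] inj[OF eq[symmetric]] by linarith
  assume a: "a \<in> carrier A"
  let ?X = "\<phi> (pt a \<one>\<^bsub>L\<^esub>)"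
  let ?D = "\<lambda>u v. if u div n = v div n then ?X (u mod n) (v mod n) else \<zero>\<^bsub>L\<^esub>"
  have Dcl: "?D u v \<in> carrier L" if "u < n * n" "v < n * n" for u v
    using dm[OF that(1)] dm[OF that(2)] a by auto
  have Mcl: "mult_matrix a i l \<in> carrier F" if "i < N" "l < N" for i l
    using that a by (simp add: mult_matrix_def)
  have "L.pencil_det N (\<lambda>i l. j (mult_matrix a i l)) = L.pencil_det N ?D"
  proof (rule L.pencil_det_similar[where Q = Q and Q' = Q'])
    fix u l assume ul: "u < N" "l < N"
    then have u: "u < n * n" by (simp add: N)
    have "(\<Oplus>\<^bsub>L\<^esub>h\<in>{..<N}. Q u h \<otimes>\<^bsub>L\<^esub> j (mult_matrix a h l)) =
      (\<Oplus>\<^bsub>L\<^esub>h\<in>{..<N}. T.coord (pt (a \<otimes>\<^bsub>A\<^esub> e l) \<one>\<^bsub>L\<^esub>) h \<otimes>\<^bsub>L\<^esub> \<phi> (pt (e h) \<one>\<^bsub>L\<^esub>) (u mod n) (u div n))"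
      using a ul dm[OF u] by (intro L.finsum_cong') (auto simp: tensor_coord_pure Q_def mult_matrix_def L.m_comm)
    also have "\<dots> = \<phi> (pt (a \<otimes>\<^bsub>A\<^esub> e l) \<one>\<^bsub>L\<^esub>) (u mod n) (u div n)"
      using a ul dm[OF u] phi_expand[of "pt (a \<otimes>\<^bsub>A\<^esub> e l) \<one>\<^bsub>L\<^esub>" "u mod n" "u div n"] by simp
    also have "\<dots> = (\<Oplus>\<^bsub>L\<^esub>h\<in>{..<n}. ?X (u mod n) h \<otimes>\<^bsub>L\<^esub> \<phi> (pt (e l) \<one>\<^bsub>L\<^esub>) h (u div n))"
      using phi_mult[of "pt a \<one>\<^bsub>L\<^esub>" "pt (e l) \<one>\<^bsub>L\<^esub>" "u mod n" "u div n"] a ul dm[OF u] by simp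
    also have "\<dots> = (\<Oplus>\<^bsub>L\<^esub>h\<in>{..<n}. ?X (u mod n) ((u div n * n + h) mod n) \<otimes>\<^bsub>L\<^esub> Q (u div n * n + h) l)"
      using a ul dm[OF u] by (intro L.finsum_cong') (auto simp: Q_def)
    also have "\<dots> = (\<Oplus>\<^bsub>L\<^esub>v\<in>{..<n * n}. if v div n = u div n then ?X (u mod n) (v mod n) \<otimes>\<^bsub>L\<^esub> Q v l else \<zero>\<^bsub>L\<^esub>)"
      by (rule L.finsum_div_block[symmetric]) (use a ul dm[OF u] dm Q in auto)
    also have "\<dots> = (\<Oplus>\<^bsub>L\<^esub>v\<in>{..<N}. ?D u v \<otimes>\<^bsub>L\<^esub> Q v l)"
      unfolding N by (rule L.finsum_cong') (use a ul dm[OF u] dm Q N in auto)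
    finally show "(\<Oplus>\<^bsub>L\<^esub>h\<in>{..<N}. Q u h \<otimes>\<^bsub>L\<^esub> j (mult_matrix a h l)) = (\<Oplus>\<^bsub>L\<^esub>v\<in>{..<N}. ?D u v \<otimes>\<^bsub>L\<^esub> Q v l)" .
  qed (use Q Q' QQ' Dcl Mcl N in auto)
  also have "\<dots> = L.pencil_det n ?X [^]\<^bsub>polys L\<^esub> n"
    unfolding N[symmetric] by (rule L.pencil_det_block_diagonal) (use a in auto)
  finally show "L.pencil_det N (\<lambda>i l. j (mult_matrix a i l)) = L.pencil_det n ?X [^]\<^bsub>polys L\<^esub> n" .
qed

end

text \<open>The splitting field in \<open>split_ex\<close> is carried by the type \<open>'a\<close>
  of A, because this is the range of the existential quantifier in
  \<open>reduced_norm\<close>.\<close>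

locale normed_algebra = based_algebra F A f N e
  for F :: "'f ring" and A :: "'a ring" and f N e +
  assumes field_F: "field F" and char_F: "ring_char_0 F" and N_pos: "N > 0"
    and split_ex: "\<exists>(L :: 'a ring) j n \<phi>. splitting F f A j L n \<phi>"
begin

abbreviation nr where "nr \<equiv> reduced_norm F f A"

lemma split_algebra:
  fixes L :: "'a ring"
  assumes "splitting F f A j L n \<phi>"
  shows "split_algebra F A f N e L j n \<phi>"
  by (rule split_algebra.intro[OF based_algebra_axioms split_algebra_axioms.intro[OF field_F char_F assms]])

text \<open>All splittings are treated at once. The determinant of the pencil of left multiplication
  is a polynomial h over F; each splitting provides an n-th root of its image with constant term 1.
  \<open>polys_root_descent\<close> finds coefficients in F that map to all these roots, and their
  sum, the value at 1, maps to all the determinants.\<close>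

lemma norm_common:
  assumes a: "a \<in> carrier A"
  shows "\<exists>c\<in>carrier F. \<forall>(L :: 'a ring) j n \<phi>. splitting F f A j L n \<phi> \<longrightarrow>
    j c = determinant n L (\<phi> (pure_tensor F f A j L a \<one>\<^bsub>L\<^esub>))"
proof -
  interpret F: field F by (rule field_F)
  interpret F: record_cring F by unfold_locales
  obtain L0 :: "'a ring" and j0 n \<phi>0 where split0: "splitting F f A j0 L0 n \<phi>0"
    using split_ex by blast
  interpret S0: split_algebra F A f N e L0 j0 n \<phi>0 by (rule split_algebra[OF split0])
  have n0: "n > 0" using S0.dimension N_pos by (cases n) auto
  define h where "h = F.pencil_det N (mult_matrix a)"
  have Mcl: "mult_matrix a i l \<in> carrier F" if "i < N" "l < N" for i l
    using that a by (simp add: mult_matrix_def)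
  have h: "h \<in> up F" unfolding h_def by (rule F.pencil_det_up) (rule Mcl)
  define S where "S = {(L :: 'a ring, j, g). \<exists>\<phi>. splitting F f A j L n \<phi> \<and>
    g = record_cring.pencil_det L n (\<phi> (pure_tensor F f A j L a \<one>\<^bsub>L\<^esub>))}"
  have dim: "m = n" if "splitting F f A j L m \<phi>" for L :: "'a ring" and j m \<phi>
  proof -
    interpret S: split_algebra F A f N e L j m \<phi> by (rule split_algebra[OF that])
    have "m * m = n * n" using S.dimension S0.dimension by simp
    then show ?thesis using power2_eq_iff_nonneg[of m n] by (simp add: power2_eq_square)
  qed
  have S: "cring L \<and> j \<in> ring_hom F L \<and> g \<in> up L \<and> g 0 = \<one>\<^bsub>L\<^esub> \<and> (\<forall>k. (g [^]\<^bsub>polys L\<^esub> n) k = j (h k))"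
    if LS: "(L, j, g) \<in> S" for L j g
  proof -
    obtain \<phi> where \<phi>: "splitting F f A j L n \<phi>" and g: "g = record_cring.pencil_det L n (\<phi> (pure_tensor F f A j L a \<one>\<^bsub>L\<^esub>))"
      using LS by (auto simp: S_def)
    interpret S: split_algebra F A f N e L j n \<phi> by (rule split_algebra[OF \<phi>])
    have cl: "\<phi> (S.pt a \<one>\<^bsub>L\<^esub>) r c \<in> carrier L" if "r < n" "c < n" for r c using that a by simp
    have "(g [^]\<^bsub>polys L\<^esub> n) k = j (h k)" for k
      unfolding g S.pencil_power[OF a, symmetric] h_def
      by (rule pencil_det_hom[OF k.cring_axioms S.L.cring_axioms S.j_hom Mcl, symmetric])
    then show ?thesis
      unfolding g using S.L.pencil_det_up[OF cl] S.L.pencil_det_0[OF cl] S.L.cring_axioms S.j_hom g by auto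
  qed
  have n1: "add_pow F n \<one>\<^bsub>F\<^esub> \<noteq> \<zero>\<^bsub>F\<^esub>" using char_F n0 by (auto simp: ring_char_0_def)
  have "\<exists>c. c \<in> carrier F \<and> (\<forall>L j g. (L, j, g) \<in> S \<longrightarrow> j c = g k)" for k
    using polys_root_descent[OF field_F n1 h S, of S k] by blast
  then obtain c where c: "\<And>k. c k \<in> carrier F" "\<And>k L j g. (L, j, g) \<in> S \<Longrightarrow> j (c k) = g k"
    by metis
  define g0 where "g0 = record_cring.pencil_det L0 n (\<phi>0 (pure_tensor F f A j0 L0 a \<one>\<^bsub>L0\<^esub>))"
  have S0S: "(L0, j0, g0) \<in> S" using split0 by (auto simp: S_def g0_def)
  \<comment> \<open>The degree bound of the root in one splitting bounds them all: the coefficients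
    c k come from F and the map into the chosen field is injective, so c k vanishes beyond
    d.\<close>
  obtain d where d: "\<And>k. k > d \<Longrightarrow> g0 k = \<zero>\<^bsub>L0\<^esub>"
    using S0.L.up_vanishes[of g0] S[OF S0S] by blast
  have cz: "c k = \<zero>\<^bsub>F\<^esub>" if "k > d" for k
  proof (rule field_hom_inj[OF field_F S0.field_L S0.j_hom c(1) k.zero_closed])
    show "j0 (c k) = j0 \<zero>\<^bsub>F\<^esub>"
      using c(2)[OF S0S] d[OF that] ring_hom_zero[OF S0.j_hom k.ring_axioms S0.L.ring_axioms] by simp
  qed
  show ?thesis
  proof (rule bexI[of _ "\<Oplus>\<^bsub>F\<^esub>k\<in>{..d}. c k"], intro allI impI)
    fix L :: "'a ring" and j m \<phi> assume "splitting F f A j L m \<phi>"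
    with dim have \<phi>: "splitting F f A j L n \<phi>" and m: "m = n" by blast+
    interpret S: split_algebra F A f N e L j n \<phi> by (rule split_algebra[OF \<phi>])
    interpret j: ring_hom_ring F L j
      using S.j_hom k.ring_axioms S.L.ring_axioms by (simp add: ring_hom_ring_def ring_hom_ring_axioms_def)
    let ?g = "S.L.pencil_det n (\<phi> (S.pt a \<one>\<^bsub>L\<^esub>))"
    have gS: "(L, j, ?g) \<in> S" using \<phi> by (auto simp: S_def)
    have cl: "\<phi> (S.pt a \<one>\<^bsub>L\<^esub>) r c \<in> carrier L" if "r < n" "c < n" for r c using that a by simp
    have "determinant n L (\<phi> (S.pt a \<one>\<^bsub>L\<^esub>)) = S.L.eval1 ?g"
      by (rule S.L.pencil_det_eval1[OF cl, symmetric])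
    also have "\<dots> = (\<Oplus>\<^bsub>L\<^esub>k\<in>{..d}. ?g k)"
    proof (rule S.L.eval1)
      show "?g \<in> up L" by (rule S.L.pencil_det_up[OF cl])
      show "?g k = \<zero>\<^bsub>L\<^esub>" if "d < k" for k using c(2)[OF gS, of k] cz[OF that] by simp
    qed
    also have "\<dots> = (\<Oplus>\<^bsub>L\<^esub>k\<in>{..d}. j (c k))"
      using c(2)[OF gS] by simp
    also have "\<dots> = j (\<Oplus>\<^bsub>F\<^esub>k\<in>{..d}. c k)"
      using c(1) by (subst S.g.hom_finsum) (auto simp: comp_def)
    finally show "j (\<Oplus>\<^bsub>F\<^esub>k\<in>{..d}. c k) = determinant m L (\<phi> (S.pt a \<one>\<^bsub>L\<^esub>))" by (simp add: m)
  qed (use c(1) in \<open>auto intro!: k.finsum_closed\<close>)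
qed

lemma
  assumes a: "a \<in> carrier A"
  shows norm_closed: "nr a \<in> carrier F"
    and norm_eq: "splitting F f A j (L :: 'a ring) n \<phi> \<Longrightarrow>
      j (nr a) = determinant n L (\<phi> (pure_tensor F f A j L a \<one>\<^bsub>L\<^esub>))"
proof -
  obtain c where c: "c \<in> carrier F" "\<And>(L :: 'a ring) j n \<phi>. splitting F f A j L n \<phi> \<Longrightarrow>
    j c = determinant n L (\<phi> (pure_tensor F f A j L a \<one>\<^bsub>L\<^esub>))"
    using norm_common[OF a] by blast
  have "nr a = c"
    unfolding reduced_norm_def
  proof (rule the_equality)
    show "c \<in> carrier F \<and> (\<exists>(L :: 'a ring) j n \<phi>. splitting F f A j L n \<phi> \<and>
      j c = determinant n L (\<phi> (pure_tensor F f A j L a \<one>\<^bsub>L\<^esub>)))"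
      using c split_ex by blast
    fix c' assume "c' \<in> carrier F \<and> (\<exists>(L :: 'a ring) j n \<phi>. splitting F f A j L n \<phi> \<and>
      j c' = determinant n L (\<phi> (pure_tensor F f A j L a \<one>\<^bsub>L\<^esub>)))"
    then obtain L :: "'a ring" and j n \<phi> where *: "c' \<in> carrier F" "splitting F f A j L n \<phi>" "j c' = j c"
      using c(2) by metis
    then show "c' = c" using c(1) field_F by (intro field_hom_inj[of F L j]) (auto simp: splitting_def)
  qed
  with c show "nr a \<in> carrier F" "splitting F f A j L n \<phi> \<Longrightarrow> j (nr a) = determinant n L (\<phi> (pure_tensor F f A j L a \<one>\<^bsub>L\<^esub>))"
    by auto
qed

lemma norm_mult:
  assumes "a \<in> carrier A" "b \<in> carrier A"
  shows "nr (a \<otimes>\<^bsub>A\<^esub> b) = nr a \<otimes>\<^bsub>F\<^esub> nr b"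
proof -
  obtain L :: "'a ring" and j n \<phi> where sp: "splitting F f A j L n \<phi>" using split_ex by blast
  interpret S: split_algebra F A f N e L j n \<phi> by (rule split_algebra[OF sp])
  have "j (nr (a \<otimes>\<^bsub>A\<^esub> b)) = determinant n L (\<phi> (S.pt a \<one>\<^bsub>L\<^esub> \<otimes>\<^bsub>S.T\<^esub> S.pt b \<one>\<^bsub>L\<^esub>))"
    using assms by (simp add: norm_eq[OF _ sp])
  also have "\<dots> = determinant n L (\<lambda>r c. \<Oplus>\<^bsub>L\<^esub>h\<in>{..<n}. \<phi> (S.pt a \<one>\<^bsub>L\<^esub>) r h \<otimes>\<^bsub>L\<^esub> \<phi> (S.pt b \<one>\<^bsub>L\<^esub>) h c)"
    using assms by (intro S.L.determinant_cong) (auto intro!: S.L.finsum_closed simp: S.phi_mult simp del: S.pt_mult)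
  also have "\<dots> = determinant n L (\<phi> (S.pt a \<one>\<^bsub>L\<^esub>)) \<otimes>\<^bsub>L\<^esub> determinant n L (\<phi> (S.pt b \<one>\<^bsub>L\<^esub>))"
    by (rule S.L.determinant_mult) (use assms in auto)
  also have "\<dots> = j (nr a \<otimes>\<^bsub>F\<^esub> nr b)"
    using assms norm_closed ring_hom_mult[OF S.j_hom] by (simp add: norm_eq[OF _ sp])
  finally show ?thesis
    using assms norm_closed field_hom_inj[OF field_F S.field_L S.j_hom] by simp
qed

lemma norm_scalar:
  assumes r: "r \<in> carrier F" and n: "n * n = N"
  shows "nr (f r) = r [^]\<^bsub>F\<^esub> n"
proof -
  interpret F: field F by (rule field_F)
  obtain L :: "'a ring" and j m \<phi> where sp: "splitting F f A j L m \<phi>" using split_ex by blast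
  interpret S: split_algebra F A f N e L j m \<phi> by (rule split_algebra[OF sp])
  interpret j: ring_hom_cring F L j
    using S.j_hom k.cring_axioms S.L.cring_axioms by (simp add: ring_hom_cring_def ring_hom_cring_axioms_def)
  have m: "m = n" using n S.dimension power2_eq_iff_nonneg[of m n] by (simp add: power2_eq_square)
  have jr: "j r \<in> carrier L" using r by simp
  have "j (nr (f r)) = determinant m L (\<phi> (S.pt \<one>\<^bsub>A\<^esub> (j r)))"
    using r S.pt_balanced[of r "\<one>\<^bsub>A\<^esub>" "\<one>\<^bsub>L\<^esub>"] by (simp add: norm_eq[OF _ sp])
  also have "\<dots> = determinant m L (\<lambda>r' c. if r' = c then j r else \<zero>\<^bsub>L\<^esub>)"
    using r by (intro S.L.determinant_cong) (auto simp: S.phi_scalar scalar_matrix_def)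
  also have "\<dots> = j r [^]\<^bsub>L\<^esub> m" by (rule S.L.determinant_scalar[OF jr])
  also have "\<dots> = j (r [^]\<^bsub>F\<^esub> n)" using r m by (simp add: j.hom_pow)
  finally show ?thesis
    using r norm_closed[of "f r"] field_hom_inj[OF field_F S.field_L S.j_hom] by simp
qed

lemma norm_one: "nr \<one>\<^bsub>A\<^esub> = \<one>\<^bsub>F\<^esub>"
proof -
  interpret F: field F by (rule field_F)
  obtain L :: "'a ring" and j m \<phi> where sp: "splitting F f A j L m \<phi>" using split_ex by blast
  interpret S: split_algebra F A f N e L j m \<phi> by (rule split_algebra[OF sp])
  show ?thesis using norm_scalar[OF k.one_closed S.dimension] by simp
qed

text \<open>The value at 1 of the pencil identity \<open>pencil_power\<close>. It allows bounds on
  the entries of a matrix of left multiplication to bound the reduced norm.\<close>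

lemma determinant_mult_matrix:
  assumes a: "a \<in> carrier A" and n: "n * n = N"
  shows "determinant N F (mult_matrix a) = nr a [^]\<^bsub>F\<^esub> n"
proof -
  interpret F: field F by (rule field_F)
  interpret F: record_cring F by unfold_locales
  obtain L :: "'a ring" and j m \<phi> where sp: "splitting F f A j L m \<phi>" using split_ex by blast
  interpret S: split_algebra F A f N e L j m \<phi> by (rule split_algebra[OF sp])
  interpret j: ring_hom_cring F L j
    using S.j_hom k.cring_axioms S.L.cring_axioms by (simp add: ring_hom_cring_def ring_hom_cring_axioms_def)
  interpret ev: ring_hom_cring "polys L" L S.L.eval1
    using S.L.eval1_hom S.L.cring_polys S.L.cring_axioms by (simp add: ring_hom_cring_def ring_hom_cring_axioms_def)
  have m: "m = n" using n S.dimension power2_eq_iff_nonneg[of m n] by (simp add: power2_eq_square)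
  have Mcl: "mult_matrix a i l \<in> carrier F" if "i < N" "l < N" for i l
    using that a by (simp add: mult_matrix_def)
  have cl: "\<phi> (S.pt a \<one>\<^bsub>L\<^esub>) r c \<in> carrier L" if "r < m" "c < m" for r c using that a by simp
  have "j (determinant N F (mult_matrix a)) = determinant N L (\<lambda>i l. j (mult_matrix a i l))"
    by (rule determinant_hom[OF k.cring_axioms S.L.cring_axioms S.j_hom Mcl])
  also have "\<dots> = S.L.eval1 (S.L.pencil_det N (\<lambda>i l. j (mult_matrix a i l)))"
    by (rule S.L.pencil_det_eval1[symmetric]) (use Mcl in auto)
  also have "\<dots> = S.L.eval1 (S.L.pencil_det m (\<phi> (S.pt a \<one>\<^bsub>L\<^esub>))) [^]\<^bsub>L\<^esub> m"
    unfolding S.pencil_power[OF a] by (rule ev.hom_pow) (use S.L.pencil_det_up[OF cl] in \<open>simp add: polys_simps(1)\<close>)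
  also have "\<dots> = determinant m L (\<phi> (S.pt a \<one>\<^bsub>L\<^esub>)) [^]\<^bsub>L\<^esub> m"
    by (simp only: S.L.pencil_det_eval1[OF cl])
  also have "\<dots> = j (nr a) [^]\<^bsub>L\<^esub> m"
    by (simp only: norm_eq[OF a sp])
  also have "\<dots> = j (nr a [^]\<^bsub>F\<^esub> n)" using norm_closed[OF a] m by (simp add: j.hom_pow)
  finally show ?thesis
    using norm_closed[OF a] F.determinant_closed[of N "mult_matrix a"] Mcl
    by (intro field_hom_inj[OF field_F S.field_L S.j_hom]) auto
qed

end

section \<open>Splitting over an algebraically closed field\<close>

text \<open>The setting of Wedderburn's theorem over an algebraically closed field. The algebra is a
  subset C of a type because its dimension is a variable and the elements will be functions on the
  natural numbers. The product is defined on the whole type, while u is a unit on C only. Simplicity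
  is stated as: every nonzero two-sided ideal contains u.\<close>

locale simple_algebra_acf = vector_space smul
  for smul :: "'l :: alg_closed_field \<Rightarrow> 'v :: ab_group_add \<Rightarrow> 'v" +
  fixes mul :: "'v \<Rightarrow> 'v \<Rightarrow> 'v" (infixl "\<odot>" 70) and u :: 'v and C :: "'v set" and E :: "'v set"
  assumes mul_add: "(x + y) \<odot> z = x \<odot> z + y \<odot> z" "x \<odot> (y + z) = x \<odot> y + x \<odot> z"
    and mul_smul: "smul c x \<odot> y = smul c (x \<odot> y)" "x \<odot> smul c y = smul c (x \<odot> y)"
    and mul_assoc: "(x \<odot> y) \<odot> z = x \<odot> (y \<odot> z)"
    and C: "subspace C" and mul_C: "x \<in> C \<Longrightarrow> y \<in> C \<Longrightarrow> x \<odot> y \<in> C"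
    and u: "u \<in> C" "u \<noteq> 0" "x \<in> C \<Longrightarrow> u \<odot> x = x" "x \<in> C \<Longrightarrow> x \<odot> u = x"
    and E: "finite E" "C \<subseteq> span E"
    and simple: "subspace J \<Longrightarrow> J \<subseteq> C \<Longrightarrow> (\<And>x y. x \<in> C \<Longrightarrow> y \<in> J \<Longrightarrow> x \<odot> y \<in> J \<and> y \<odot> x \<in> J) \<Longrightarrow> J \<noteq> {0} \<Longrightarrow> u \<in> J"
begin

lemma mul_0 [simp]: "0 \<odot> x = 0" "x \<odot> 0 = 0"
  using mul_add(1)[of 0 0 x] mul_add(2)[of x 0 0] by auto

lemma mul_minus: "(- x) \<odot> y = - (x \<odot> y)" "x \<odot> (- y) = - (x \<odot> y)"
  using mul_add(1)[of x "- x" y] mul_add(2)[of x y "- y"] by (auto simp: eq_neg_iff_add_eq_0 add.commute)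

lemma mul_diff: "(x - y) \<odot> z = x \<odot> z - y \<odot> z" "x \<odot> (y - z) = x \<odot> y - x \<odot> z"
  using mul_add(1)[of x "- y" z] mul_add(2)[of x y "- z"] by (auto simp: mul_minus)

lemma mul_sum: "(\<Sum>i\<in>I. f i) \<odot> z = (\<Sum>i\<in>I. f i \<odot> z)" "z \<odot> (\<Sum>i\<in>I. f i) = (\<Sum>i\<in>I. z \<odot> f i)"
  by (induction I rule: infinite_finite_induct) (auto simp: mul_add)

text \<open>The ambient type may have infinite dimension; finiteness of the bases comes from the
  finite spanning set \<open>E\<close>.\<close>

lemma subspace_eq_of_dim:
  assumes "subspace S" "S \<subseteq> T" "subspace T" "T \<subseteq> C" "dim T \<le> dim S"
  shows "S = T"
proof -
  obtain B where B: "B \<subseteq> S" "independent B" "S \<subseteq> span B" "card B = dim S" by (rule basis_exists)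
  obtain B' where B': "B \<subseteq> B'" "B' \<subseteq> T" "independent B'" "T \<subseteq> span B'"
    using maximal_independent_subset_extend[of B T] B assms by blast
  have "card B' = dim T" by (rule basis_card_eq_dim[OF B'(2,4,3)])
  moreover have "finite B'" using independent_span_bound[OF E(1) B'(3)] B' assms E by blast
  ultimately have "B = B'" using B B' assms card_mono[of B' B] by (intro card_subset_eq) auto
  then have "T \<subseteq> S" using B' B span_minimal[OF B(1) assms(1)] by auto
  then show ?thesis using assms by auto
qed

definition left_ideal :: "'v set \<Rightarrow> bool" where
  "left_ideal I \<longleftrightarrow> subspace I \<and> I \<subseteq> C \<and> (\<forall>x\<in>C. \<forall>y\<in>I. x \<odot> y \<in> I)"

lemma minimal_left_ideal:
  obtains I where "left_ideal I" "I \<noteq> {0}" "\<And>I'. left_ideal I' \<Longrightarrow> I' \<subseteq> I \<Longrightarrow> I' \<noteq> {0} \<Longrightarrow> I' = I"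
proof -
  have "left_ideal C \<and> C \<noteq> {0}" using C mul_C u by (auto simp: left_ideal_def)
  then obtain I where I: "left_ideal I \<and> I \<noteq> {0}" "\<And>I'. left_ideal I' \<and> I' \<noteq> {0} \<Longrightarrow> dim I \<le> dim I'"
    using exists_least_iff[of "\<lambda>d. \<exists>I. left_ideal I \<and> I \<noteq> {0} \<and> dim I = d"] by (metis not_le)
  show ?thesis
    by (rule that[of I]) (use I subspace_eq_of_dim in \<open>auto simp: left_ideal_def\<close>)
qed

text \<open>The elements that kill a left ideal from the left form a two-sided ideal. If it were
  nonzero it would contain u, and I would be zero.\<close>

lemma annihilator_zero:
  assumes I: "left_ideal I" "I \<noteq> {0}" and x: "x \<in> C" "\<And>b. b \<in> I \<Longrightarrow> x \<odot> b = 0"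
  shows "x = 0"
proof (rule ccontr)
  assume "x \<noteq> 0"
  let ?J = "{x \<in> C. \<forall>b\<in>I. x \<odot> b = 0}"
  have "u \<in> ?J"
  proof (rule simple)
    show "subspace ?J" using C by (auto simp: subspace_def mul_add mul_smul)
    show "y \<odot> z \<in> ?J \<and> z \<odot> y \<in> ?J" if "y \<in> C" "z \<in> ?J" for y z
      using that I mul_C by (auto simp: left_ideal_def mul_assoc)
    show "?J \<noteq> {0}" using x \<open>x \<noteq> 0\<close> by auto
  qed auto
  then have "b = 0" if "b \<in> I" for b using that I u(3)[of b] by (auto simp: left_ideal_def)
  moreover have "0 \<in> I" using I by (auto simp: left_ideal_def subspace_def)
  ultimately show False using I(2) by blast
qed

text \<open>A minimal left ideal I is generated by an idempotent e, and the elements z of I with e z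
  = z act on I by right multiplication, commuting with the action of C. By Schur's lemma over an
  algebraically closed field they are scalar multiples of e.\<close>

lemma primitive_idempotent:
  obtains I e where "left_ideal I" "e \<in> I" "e \<noteq> 0" "e \<odot> e = e" "\<And>x. x \<in> I \<Longrightarrow> x \<odot> e = x"
    and "\<And>z. z \<in> I \<Longrightarrow> e \<odot> z = z \<Longrightarrow> \<exists>c. z = smul c e"
proof -
  obtain I where I: "left_ideal I" "I \<noteq> {0}" and min: "\<And>I'. left_ideal I' \<Longrightarrow> I' \<subseteq> I \<Longrightarrow> I' \<noteq> {0} \<Longrightarrow> I' = I"
    by (rule minimal_left_ideal) blast
  have Isub: "subspace I" "I \<subseteq> C" "\<And>x y. x \<in> C \<Longrightarrow> y \<in> I \<Longrightarrow> x \<odot> y \<in> I"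
    using I by (auto simp: left_ideal_def)
  have "0 \<in> I" using Isub(1) by (auto simp: subspace_def)
  then obtain a where a: "a \<in> I" "a \<noteq> 0" using I by blast
  then obtain y where y: "y \<in> I" "a \<odot> y \<noteq> 0" using annihilator_zero[OF I, of a] Isub by blast
  \<comment> \<open>I y is a left ideal inside I, and it is nonzero because it contains a y. By
    minimality it is I, so y itself has the form e y.\<close>
  have "(\<lambda>x. x \<odot> y) ` I = I"
  proof (rule min)
    have "subspace ((\<lambda>x. x \<odot> y) ` I)"
      unfolding subspace_def
    proof (intro conjI ballI allI)
      show "0 \<in> (\<lambda>x. x \<odot> y) ` I" using \<open>0 \<in> I\<close> by (metis imageI mul_0(1))
    next
      fix p q assume "p \<in> (\<lambda>x. x \<odot> y) ` I" "q \<in> (\<lambda>x. x \<odot> y) ` I"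
      then show "p + q \<in> (\<lambda>x. x \<odot> y) ` I" using subspace_add[OF Isub(1)] by (auto simp flip: mul_add)
    next
      fix c p assume "p \<in> (\<lambda>x. x \<odot> y) ` I"
      then show "smul c p \<in> (\<lambda>x. x \<odot> y) ` I" using subspace_scale[OF Isub(1)] by (auto simp flip: mul_smul(1))
    qed
    then show "left_ideal ((\<lambda>x. x \<odot> y) ` I)"
      using Isub y by (auto simp: left_ideal_def mul_assoc[symmetric])
    show "(\<lambda>x. x \<odot> y) ` I \<subseteq> I" using Isub y by auto
    show "(\<lambda>x. x \<odot> y) ` I \<noteq> {0}" using y a by blast
  qed
  then obtain e where e: "e \<in> I" "e \<odot> y = y" using y by (metis imageE)
  have y0: "y \<noteq> 0" using y by auto
  \<comment> \<open>The kernel of right multiplication by y is a left ideal inside I that does not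
    contain e, hence zero. Applied to x e - x this makes e a right identity on I, in particular an
    idempotent.\<close>
  have inj: "z = 0" if "z \<in> I" "z \<odot> y = 0" for z
  proof (rule ccontr)
    assume "z \<noteq> 0"
    have "{z \<in> I. z \<odot> y = 0} = I"
      by (rule min) (use that \<open>z \<noteq> 0\<close> Isub in \<open>auto simp: left_ideal_def subspace_def mul_add mul_smul mul_assoc\<close>)
    then have "e \<in> {z \<in> I. z \<odot> y = 0}" using e by blast
    then show False using e y0 by auto
  qed
  have xe: "x \<odot> e = x" if "x \<in> I" for x
    using inj[of "x \<odot> e - x"] that e Isub subspace_diff[OF Isub(1)] by (auto simp: mul_diff mul_assoc)
  have "\<exists>c. z = smul c e" if z: "z \<in> I" "e \<odot> z = z" for z
  proof -
    \<comment> \<open>Horner evaluation of a polynomial at z with e in the role of the constant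
      1.\<close>
    define ev where "ev q = fold_coeffs (\<lambda>c w. smul c e + w \<odot> z) q 0" for q :: "'l poly"
    have ev_0: "ev 0 = 0" by (simp add: ev_def)
    have ev_pCons: "ev (pCons c q) = smul c e + ev q \<odot> z" for c q
      by (cases "c = 0 \<and> q = 0") (auto simp: ev_def)
    have ev_add: "ev (p + q) = ev p + ev q" for p q
      by (induction p q rule: poly_induct2) (auto simp: ev_0 ev_pCons mul_add scale_left_distrib algebra_simps)
    have ev_smult: "ev (smult c q) = smul c (ev q)" for c q
      by (induction q) (auto simp: ev_0 ev_pCons mul_smul scale_right_distrib)
    have ev_I: "ev q \<in> I" for q
      by (induction q) (use \<open>0 \<in> I\<close> e z Isub subspace_add subspace_scale in \<open>auto simp: ev_0 ev_pCons\<close>)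
    \<comment> \<open>Split off a linear factor with root c. If the cofactor does not vanish at z,
      its value there is an eigenvector for c; otherwise continue with the cofactor, which has
      smaller degree.\<close>
    have eigen: "\<exists>w\<in>I. w \<noteq> 0 \<and> (\<exists>c. w \<odot> z = smul c w)" if "q \<noteq> 0" "ev q = 0" for q
      using that
    proof (induction "Polynomial.degree q" arbitrary: q)
      case 0
      then obtain c where "q = [:c:]" "c \<noteq> 0" by (metis degree_eq_zeroE pCons_0_0)
      then have "smul c e = 0" using 0 by (simp add: ev_pCons ev_0)
      then show ?case using \<open>c \<noteq> 0\<close> e y0 by auto
    next
      case (Suc d)
      then obtain c where "poly q c = 0" using alg_closed_imp_poly_has_root[of q] by auto
      then obtain r where r: "q = [:- c, 1:] * r" by (auto simp: poly_eq_0_iff_dvd)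
      have "q = pCons 0 r + smult (- c) r" by (simp add: r)
      then have "ev q = ev r \<odot> z - smul c (ev r)" by (simp only: ev_add ev_smult ev_pCons) simp
      then have *: "ev r \<odot> z = smul c (ev r)" using Suc by simp
      show ?case
      proof (cases "ev r = 0")
        case True
        have "r \<noteq> 0" using r Suc by auto
        then have "Polynomial.degree q = Suc (Polynomial.degree r)" unfolding r by (subst degree_mult_eq) auto
        then show ?thesis using Suc(1)[of r] Suc(2) \<open>r \<noteq> 0\<close> True by simp
      qed (use * ev_I in blast)
    qed
    define pw where "pw i = ev (Polynomial.monom 1 i)" for i
    have "\<exists>q. q \<noteq> 0 \<and> ev q = 0"
    \<comment> \<open>There are card E + 1 powers of z in a space spanned by E. Either two of them
      coincide or they are linearly dependent; both give a nonzero polynomial vanishing at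
      z.\<close>
    proof (cases "inj_on pw {..card E}")
      case False
      then obtain i j where ij: "i \<noteq> j" "pw i = pw j" by (auto simp: inj_on_def)
      have "Polynomial.monom 1 i + smult (- 1) (Polynomial.monom 1 j) \<noteq> (0 :: 'l poly)"
      proof
        assume "Polynomial.monom 1 i + smult (- 1) (Polynomial.monom 1 j) = (0 :: 'l poly)"
        then have "poly.coeff (Polynomial.monom 1 i + smult (- 1) (Polynomial.monom 1 j)) i = (0 :: 'l)" by simp
        then show False using ij by simp
      qed
      moreover have "ev (Polynomial.monom 1 i + smult (- 1) (Polynomial.monom 1 j)) = 0"
        using ij by (simp only: ev_add ev_smult pw_def) simp
      ultimately show ?thesis by blast
    next
      case True
      have sub: "pw ` {..card E} \<subseteq> span E" using ev_I Isub E unfolding pw_def by blast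
      have "dependent (pw ` {..card E})"
      proof (rule ccontr)
        assume "independent (pw ` {..card E})"
        from independent_span_bound[OF E(1) this sub] show False using card_image[OF True] by simp
      qed
      then obtain v where v: "(\<exists>w\<in>pw ` {..card E}. v w \<noteq> 0)" "(\<Sum>w\<in>pw ` {..card E}. smul (v w) w) = 0"
        using dependent_finite[of "pw ` {..card E}"] by auto
      define q where "q = (\<Sum>i\<le>card E. Polynomial.monom (v (pw i)) i)"
      have ev_sum: "ev (\<Sum>i\<in>A. g i) = (\<Sum>i\<in>A. ev (g i))" for g and A :: "nat set"
        by (induction A rule: infinite_finite_induct) (auto simp: ev_0 ev_add)
      have "ev q = (\<Sum>i\<le>card E. ev (Polynomial.monom (v (pw i)) i))"
        unfolding q_def by (rule ev_sum)
      also have "\<dots> = (\<Sum>i\<le>card E. smul (v (pw i)) (pw i))"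
        unfolding pw_def by (intro sum.cong) (auto simp flip: ev_smult simp: smult_monom)
      also have "(\<Sum>i\<in>{..card E}. smul (v (pw i)) (pw i)) = (\<Sum>w\<in>pw ` {..card E}. smul (v w) w)"
        using True by (simp add: sum.reindex)
      finally have "ev q = 0" using v by simp
      moreover have "q \<noteq> 0"
      proof
        assume "q = 0"
        obtain i where i: "i \<le> card E" "v (pw i) \<noteq> 0" using v by auto
        have "poly.coeff q i = v (pw i)" using i by (simp add: q_def coeff_sum)
        then show False using i \<open>q = 0\<close> by simp
      qed
      ultimately show ?thesis by blast
    qed
    then obtain w c where w: "w \<in> I" "w \<noteq> 0" "w \<odot> z = smul c w" using eigen by blast
    \<comment> \<open>The eigenspace is a left ideal. By minimality it is all of I, so right
      multiplication by z is the scalar c at e as well.\<close>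
    have "{w \<in> I. w \<odot> z = smul c w} = I"
      by (rule min) (use w Isub \<open>0 \<in> I\<close> in \<open>auto simp: left_ideal_def subspace_def mul_add mul_smul mul_assoc scale_right_distrib scale_left_commute\<close>)
    then have "e \<odot> z = smul c e" using e by blast
    then show ?thesis using z by auto
  qed
  moreover have "e \<noteq> 0" using e y0 by auto
  ultimately show ?thesis using that[OF I(1) e(1) _ xe[OF e(1)] xe] by blast
qed

text \<open>The left ideal I = C e is paired with the right ideal W = e C: the product of v in W and
  x in I is a scalar multiple of e. A basis s i of I has a dual family v i in W, and the matrix
  units are the products s i v j. The function \<rho> describes the action of C on I in the basis
  s.\<close>

lemma matrix_units:
  obtains n :: nat and \<rho> and M where
    "\<And>i j. i < n \<Longrightarrow> j < n \<Longrightarrow> M i j \<in> C"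
    "\<And>x. x \<in> C \<Longrightarrow> x = (\<Sum>i<n. \<Sum>j<n. smul (\<rho> x i j) (M i j))"
    "\<And>x y i j. x \<in> C \<Longrightarrow> y \<in> C \<Longrightarrow> i < n \<Longrightarrow> j < n \<Longrightarrow> \<rho> (x + y) i j = \<rho> x i j + \<rho> y i j"
    "\<And>c x i j. x \<in> C \<Longrightarrow> i < n \<Longrightarrow> j < n \<Longrightarrow> \<rho> (smul c x) i j = c * \<rho> x i j"
    "\<And>x y i j. x \<in> C \<Longrightarrow> y \<in> C \<Longrightarrow> i < n \<Longrightarrow> j < n \<Longrightarrow> \<rho> (x \<odot> y) i j = (\<Sum>h<n. \<rho> x i h * \<rho> y h j)"
    "\<And>i j. i < n \<Longrightarrow> j < n \<Longrightarrow> \<rho> u i j = (if i = j then 1 else 0)"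
    "\<And>i j i' j'. i < n \<Longrightarrow> j < n \<Longrightarrow> i' < n \<Longrightarrow> j' < n \<Longrightarrow> \<rho> (M i j) i' j' = (if i' = i \<and> j' = j then 1 else 0)"
proof -
  obtain I e where I: "left_ideal I" "e \<in> I" "e \<noteq> 0" "e \<odot> e = e" "\<And>x. x \<in> I \<Longrightarrow> x \<odot> e = x"
    and prim: "\<And>z. z \<in> I \<Longrightarrow> e \<odot> z = z \<Longrightarrow> \<exists>c. z = smul c e"
    by (rule primitive_idempotent) blast
  have Isub: "subspace I" "I \<subseteq> C" "\<And>x y. x \<in> C \<Longrightarrow> y \<in> I \<Longrightarrow> x \<odot> y \<in> I"
    using I by (auto simp: left_ideal_def)
  have eC: "e \<in> C" using I Isub by auto
  \<comment> \<open>The scalar of a multiple of e; it is determined since e is nonzero.\<close>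
  define \<beta> where "\<beta> z = (THE c. z = smul c e)" for z
  have \<beta>_smul: "\<beta> (smul c e) = c" for c
    unfolding \<beta>_def by (rule the_equality) (use I(3) in auto)
  define W where "W = {v \<in> C. e \<odot> v = v}"
  have W: "subspace W" using C by (auto simp: W_def subspace_def mul_add mul_smul)
  have \<beta>: "v \<odot> x = smul (\<beta> (v \<odot> x)) e" if "v \<in> W" "x \<in> I" for v x
  proof -
    have "v \<odot> x \<in> I" "e \<odot> (v \<odot> x) = v \<odot> x" using that Isub by (auto simp: W_def mul_assoc[symmetric])
    from prim[OF this] show ?thesis using \<beta>_smul by auto
  qed
  have \<beta>_add: "\<beta> (p + q) = \<beta> p + \<beta> q" if "p = smul (\<beta> p) e" "q = smul (\<beta> q) e" for p q
    using that \<beta>_smul by (metis scale_left_distrib)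
  \<comment> \<open>The elements x with e C x = 0 form a two-sided ideal that does not contain u, so
    only 0 pairs to zero with all of W. A nonzero value of the pairing is then scaled to e.\<close>
  have nondeg: "\<exists>v\<in>W. v \<odot> x = e" if "x \<in> I" "x \<noteq> 0" for x
  proof -
    let ?J = "{x \<in> C. \<forall>c\<in>C. e \<odot> (c \<odot> x) = 0}"
    have "\<not> u \<in> ?J" using u eC I by (auto intro!: bexI[of _ e])
    moreover have "u \<in> ?J" if "?J \<noteq> {0}"
    proof (rule simple[OF _ _ _ that])
      show "subspace ?J" using C by (auto simp: subspace_def mul_add mul_smul)
      show "y \<odot> z \<in> ?J \<and> z \<odot> y \<in> ?J" if "y \<in> C" "z \<in> ?J" for y z
      proof -
        have "e \<odot> (c \<odot> (y \<odot> z)) = 0" if "c \<in> C" for c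
          using mul_C[OF that \<open>y \<in> C\<close>] \<open>z \<in> ?J\<close> by (auto simp flip: mul_assoc)
        moreover have "e \<odot> (c \<odot> (z \<odot> y)) = 0" if "c \<in> C" for c
        proof -
          have "e \<odot> (c \<odot> (z \<odot> y)) = (e \<odot> (c \<odot> z)) \<odot> y" by (simp add: mul_assoc)
          then show ?thesis using that \<open>z \<in> ?J\<close> by simp
        qed
        ultimately show ?thesis using that mul_C by auto
      qed
    qed auto
    ultimately have "x \<notin> ?J" using that by blast
    then obtain c where c: "c \<in> C" "e \<odot> (c \<odot> x) \<noteq> 0" using \<open>x \<in> I\<close> Isub by auto
    have v: "e \<odot> c \<in> W" using c eC mul_C I by (auto simp: W_def mul_assoc[symmetric])
    then have *: "(e \<odot> c) \<odot> x = smul (\<beta> ((e \<odot> c) \<odot> x)) e" using \<beta> that by blast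
    define b where "b = \<beta> ((e \<odot> c) \<odot> x)"
    have "b \<noteq> 0" using * c by (auto simp: b_def mul_assoc)
    then have "smul (inverse b) (e \<odot> c) \<odot> x = e"
      using *[folded b_def] by (simp add: mul_smul)
    then show ?thesis using v subspace_scale[OF W] by blast
  qed
  \<comment> \<open>Dual families are extended by one vector at a time. The new vector t is
    corrected to t', which all old functionals kill; a functional w with w t' = e is corrected to
    w', which kills the old vectors; finally the old functionals are corrected by multiples of w' so
    that they kill t.\<close>
  have dual: "\<exists>v. \<forall>s\<in>S. v s \<in> W \<and> (\<forall>t\<in>S. v s \<odot> t = (if s = t then e else 0))"
    if "finite S" "independent S" "S \<subseteq> I" for S
    using that
  proof (induction S)
    case (insert t S)
    then have "independent S" "S \<subseteq> I" using independent_mono[OF insert.prems(1), of S] by auto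
    from insert.IH[OF this] obtain v where v: "\<And>s. s \<in> S \<Longrightarrow> v s \<in> W"
      "\<And>s t. s \<in> S \<Longrightarrow> t \<in> S \<Longrightarrow> v s \<odot> t = (if s = t then e else 0)" by blast
    have t: "t \<in> I" "S \<subseteq> I" using insert by auto
    define t' where "t' = t - (\<Sum>s\<in>S. smul (\<beta> (v s \<odot> t)) s)"
    have "t \<notin> span S" using insert independent_insert[of t S] by auto
    then have "t' \<noteq> 0"
      unfolding t'_def using span_sum[of S "\<lambda>s. smul (\<beta> (v s \<odot> t)) s" S] span_scale span_base by force
    moreover have "t' \<in> I" unfolding t'_def using t Isub
      by (intro subspace_diff subspace_sum subspace_scale) auto
    ultimately obtain w where w: "w \<in> W" "w \<odot> t' = e" using nondeg by blast
    define w' where "w' = w - (\<Sum>s\<in>S. smul (\<beta> (w \<odot> s)) (v s))"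
    have w': "w' \<in> W" unfolding w'_def using w v W by (intro subspace_diff subspace_sum subspace_scale) auto
    have w's: "w' \<odot> s = 0" if "s \<in> S" for s
    proof -
      have "w' \<odot> s = w \<odot> s - (\<Sum>r\<in>S. smul (\<beta> (w \<odot> r)) (v r \<odot> s))"
        by (simp add: w'_def mul_diff mul_sum mul_smul)
      also have "(\<Sum>r\<in>S. smul (\<beta> (w \<odot> r)) (v r \<odot> s)) = (\<Sum>r\<in>S. if r = s then smul (\<beta> (w \<odot> r)) e else 0)"
        using v that by (intro sum.cong) auto
      also have "\<dots> = w \<odot> s" using that insert \<beta>[of w s] w t by auto
      finally show ?thesis by simp
    qed
    have w't: "w' \<odot> t = e"
    proof -
      have "t = t' + (\<Sum>s\<in>S. smul (\<beta> (v s \<odot> t)) s)" by (simp add: t'_def)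
      then have "w' \<odot> t = w' \<odot> (t' + (\<Sum>s\<in>S. smul (\<beta> (v s \<odot> t)) s))" by (rule arg_cong)
      also have "\<dots> = w' \<odot> t' + (\<Sum>s\<in>S. smul (\<beta> (v s \<odot> t)) (w' \<odot> s))"
        by (simp only: mul_add mul_sum mul_smul)
      also have "(\<Sum>s\<in>S. smul (\<beta> (v s \<odot> t)) (w' \<odot> s)) = 0"
        by (rule sum.neutral) (simp add: w's)
      also have "w' \<odot> t' + 0 = w' \<odot> t'" by simp
      also have "\<dots> = e - (\<Sum>s\<in>S. smul (\<beta> (w \<odot> s)) (v s \<odot> t'))"
        using w by (simp add: w'_def mul_diff mul_sum mul_smul)
      also have "(\<Sum>s\<in>S. smul (\<beta> (w \<odot> s)) (v s \<odot> t')) = 0"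
      proof (rule sum.neutral, rule ballI)
        fix s assume s: "s \<in> S"
        have "v s \<odot> t' = v s \<odot> t - (\<Sum>r\<in>S. smul (\<beta> (v r \<odot> t)) (v s \<odot> r))"
          by (simp add: t'_def mul_diff mul_sum mul_smul)
        also have "(\<Sum>r\<in>S. smul (\<beta> (v r \<odot> t)) (v s \<odot> r)) = (\<Sum>r\<in>S. if s = r then smul (\<beta> (v r \<odot> t)) e else 0)"
          using v s by (intro sum.cong) auto
        also have "\<dots> = v s \<odot> t" using s insert \<beta>[of "v s" t] v t by auto
        finally show "smul (\<beta> (w \<odot> s)) (v s \<odot> t') = 0" by simp
      qed
      finally show ?thesis by simp
    qed
    let ?v = "\<lambda>s. if s = t then w' else v s - smul (\<beta> (v s \<odot> t)) w'"
    show ?case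
    proof (rule exI[of _ ?v], intro ballI conjI)
      fix s assume s: "s \<in> insert t S"
      then show "?v s \<in> W" using w' v subspace_diff[OF W] subspace_scale[OF W] by auto
      fix r assume r: "r \<in> insert t S"
      show "?v s \<odot> r = (if s = r then e else 0)"
        using s r insert(2) w's w't v \<beta>[of "v s" t] t by (auto simp: mul_diff mul_smul)
    qed
  qed simp
  obtain U where U: "U \<subseteq> I" "independent U" "I \<subseteq> span U" by (rule maximal_independent_subset)
  have finU: "finite U" using independent_span_bound[OF E(1) U(2)] U Isub E by blast
  from dual[OF finU U(2,1)] obtain v where v: "\<And>s. s \<in> U \<Longrightarrow> v s \<in> W"
    "\<And>s t. s \<in> U \<Longrightarrow> t \<in> U \<Longrightarrow> v s \<odot> t = (if s = t then e else 0)" by blast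
  have vC: "v s \<in> C" "s \<in> C" "s \<in> I" "e \<odot> v s = v s" "s \<odot> e = s" if "s \<in> U" for s
    using v that U Isub I by (auto simp: W_def)
  \<comment> \<open>The sum of the s v s acts as the identity on I, by duality. Its difference from
    u annihilates I and so vanishes by \<open>annihilator_zero\<close>.\<close>
  have one: "u = (\<Sum>s\<in>U. s \<odot> v s)"
  proof -
    let ?x = "u - (\<Sum>s\<in>U. s \<odot> v s)"
    have "?x \<odot> w = 0" if w: "w \<in> I" for w
    proof -
      have "w \<in> span U" using w U by auto
      then obtain c where c: "w = (\<Sum>t\<in>U. smul (c t) t)" using span_finite[OF finU] by auto
      have vw: "v s \<odot> w = smul (c s) e" if "s \<in> U" for s
      proof -
        have "v s \<odot> w = (\<Sum>t\<in>U. smul (c t) (v s \<odot> t))" by (simp add: c mul_sum mul_smul)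
        also have "\<dots> = (\<Sum>t\<in>U. if s = t then smul (c t) e else 0)" using v that by (intro sum.cong) auto
        also have "\<dots> = smul (c s) e" using finU that by simp
        finally show ?thesis .
      qed
      have "(\<Sum>s\<in>U. s \<odot> v s) \<odot> w = (\<Sum>s\<in>U. smul (c s) s)"
        unfolding mul_sum by (intro sum.cong) (auto simp: mul_assoc vw mul_smul vC)
      then show ?thesis using c u(3)[of w] w Isub by (auto simp: mul_diff)
    qed
    moreover have "?x \<in> C" using vC mul_C u C by (intro subspace_diff subspace_sum) auto
    moreover have "I \<noteq> {0}" using I by auto
    ultimately have "?x = 0" using annihilator_zero[OF I(1), of ?x] by blast
    then show ?thesis by simp
  qed
  obtain n s where s: "U = s ` {..<n :: nat}" "inj_on s {..<n}"
    using finite_imp_nat_seg_image_inj_on[OF finU] by (metis lessThan_def)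
  have sU: "s i \<in> U" if "i < n" for i using that s by auto
  define \<rho> where "\<rho> x i j = \<beta> (v (s i) \<odot> (x \<odot> s j))" for x i j
  define M where "M i j = s i \<odot> v (s j)" for i j
  have one': "u = (\<Sum>i<n. s i \<odot> v (s i))" using one s by (simp add: sum.reindex)
  have vs: "v (s i) \<odot> s j = (if i = j then e else 0)" if "i < n" "j < n" for i j
    using v(2)[OF sU[OF that(1)] sU[OF that(2)]] s(2) that by (auto simp: inj_on_def)
  have \<rho>: "v (s i) \<odot> (x \<odot> s j) = smul (\<rho> x i j) e" if "x \<in> C" "i < n" "j < n" for x i j
    unfolding \<rho>_def using that v(1) sU vC Isub by (intro \<beta>) auto
  have \<rho>I: "\<rho> x i j = c" if "v (s i) \<odot> (x \<odot> s j) = smul c e" for x i j c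
    unfolding \<rho>_def that by (rule \<beta>_smul)
  have ins: "x \<odot> s j = (\<Sum>h<n. smul (\<rho> x h j) (s h))" if "x \<in> C" "j < n" for x j
  proof -
    have "x \<odot> s j = u \<odot> (x \<odot> s j)" using that sU vC mul_C u(3)[of "x \<odot> s j"] by auto
    also have "\<dots> = (\<Sum>h<n. s h \<odot> (v (s h) \<odot> (x \<odot> s j)))"
      by (subst one') (simp add: mul_sum mul_assoc)
    also have "\<dots> = (\<Sum>h<n. smul (\<rho> x h j) (s h))"
      using that by (intro sum.cong) (auto simp: \<rho> mul_smul vC sU)
    finally show ?thesis .
  qed
  show ?thesis
  proof (rule that[of n M \<rho>])
    fix i j assume ij: "i < n" "j < n"
    show "M i j \<in> C" unfolding M_def using ij sU vC mul_C by auto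
    show "\<rho> u i j = (if i = j then 1 else 0)"
      by (rule \<rho>I) (use ij sU vC u vs in auto)
    show "\<rho> (x + y) i j = \<rho> x i j + \<rho> y i j" if "x \<in> C" "y \<in> C" for x y
      by (rule \<rho>I) (use ij that in \<open>simp add: mul_add \<rho> scale_left_distrib\<close>)
    show "\<rho> (smul c x) i j = c * \<rho> x i j" if "x \<in> C" for c x
      by (rule \<rho>I) (use ij that in \<open>simp add: mul_smul \<rho>\<close>)
    show "\<rho> (x \<odot> y) i j = (\<Sum>h<n. \<rho> x i h * \<rho> y h j)" if "x \<in> C" "y \<in> C" for x y
    proof (rule \<rho>I)
      have "v (s i) \<odot> ((x \<odot> y) \<odot> s j) = (\<Sum>h<n. smul (\<rho> y h j) (v (s i) \<odot> (x \<odot> s h)))"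
        using ij that by (simp add: mul_assoc ins mul_sum mul_smul)
      also have "\<dots> = smul (\<Sum>h<n. \<rho> x i h * \<rho> y h j) e"
        unfolding scale_sum_left using ij that by (intro sum.cong) (auto simp: \<rho> mult.commute)
      finally show "v (s i) \<odot> ((x \<odot> y) \<odot> s j) = smul (\<Sum>h<n. \<rho> x i h * \<rho> y h j) e" .
    qed
    fix i' j' assume ij': "i' < n" "j' < n"
    show "\<rho> (M i j) i' j' = (if i' = i \<and> j' = j then 1 else 0)"
    proof (rule \<rho>I)
      have "v (s i') \<odot> (M i j \<odot> s j') = (v (s i') \<odot> s i) \<odot> (v (s j) \<odot> s j')"
        by (simp add: M_def mul_assoc)
      then show "v (s i') \<odot> (M i j \<odot> s j') = smul (if i' = i \<and> j' = j then 1 else 0) e"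
        using ij ij' vs I by auto
    qed
  next
    fix x assume x: "x \<in> C"
    have "x = x \<odot> u" using u x by simp
    also have "\<dots> = (\<Sum>j<n. (x \<odot> s j) \<odot> v (s j))"
      by (subst one') (simp add: mul_sum mul_assoc)
    also have "\<dots> = (\<Sum>j<n. \<Sum>i<n. smul (\<rho> x i j) (M i j))"
      using x by (intro sum.cong) (auto simp: ins mul_sum mul_smul M_def)
    also have "\<dots> = (\<Sum>i<n. \<Sum>j<n. smul (\<rho> x i j) (M i j))" by (rule sum.swap)
    finally show "x = (\<Sum>i<n. \<Sum>j<n. smul (\<rho> x i j) (M i j))" .
  qed
qed

end

section \<open>Scalar extension of a central simple algebra\<close>

lemma ring_of_type_algebra_simps [simp]:
  "carrier ring_of_type_algebra = UNIV" "monoid.mult ring_of_type_algebra = (*)" "monoid.one ring_of_type_algebra = 1"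
  "ring.zero ring_of_type_algebra = 0" "ring.add ring_of_type_algebra = (+)"
  by (simp_all add: ring_of_type_algebra_def)

lemma ring_ring_of_type_algebra: "ring (ring_of_type_algebra :: 'b :: ring_1 ring)"
proof (rule ringI)
  show "abelian_group (ring_of_type_algebra :: 'b ring)"
    by (rule abelian_groupI) (auto simp: algebra_simps intro: exI[of _ "- x" for x])
  show "Group.monoid (ring_of_type_algebra :: 'b ring)"
    by (rule Group.monoidI) (auto simp: algebra_simps)
qed (auto simp: algebra_simps)

lemma sum_fun_apply: "(\<Sum>i\<in>A. g i) x = (\<Sum>i\<in>A. g i x)"
  by (induction A rule: infinite_finite_induct) auto

locale central_simple_basis =
  fixes scale :: "'k :: field \<Rightarrow> 'b :: ring_1 \<Rightarrow> 'b" and N :: nat and e :: "nat \<Rightarrow> 'b" and co :: "'b \<Rightarrow> nat \<Rightarrow> 'k"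
  assumes csa: "central_simple_algebra scale"
    and co_add: "co (x + y) i = co x i + co y i" and co_scale: "co (scale c x) i = c * co x i"
    and co_expand: "x = (\<Sum>i<N. scale (co x i) (e i))"
    and co_e: "i < N \<Longrightarrow> j < N \<Longrightarrow> co (e j) i = (if i = j then 1 else 0)"
begin

lemma is_alg: "vector_space scale" "scale c x * y = scale c (x * y)" "x * scale c y = scale c (x * y)"
  using csa by (auto simp: central_simple_algebra_def is_algebra_def)

sublocale vector_space scale by (rule is_alg)

lemma co_0 [simp]: "co 0 i = 0"
  using co_scale[of 0 0 i] by simp

lemma co_minus: "co (x - y) i = co x i - co y i"
  using co_add[of "x - y" y i] by simp

lemma co_sum: "co (\<Sum>l\<in>A. g l) i = (\<Sum>l\<in>A. co (g l) i)"
  by (induction A rule: infinite_finite_induct) (auto simp: co_add)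

lemma co_eq_0: "(\<And>i. i < N \<Longrightarrow> co x i = 0) \<Longrightarrow> x = 0"
  by (subst co_expand) simp

text \<open>The sums of products a b c form the two-sided ideal generated by b, which by simplicity
  is the whole algebra.\<close>

lemma two_sided_span:
  fixes b :: 'b
  assumes "b \<noteq> 0"
  shows "\<exists>(n::nat) a c. (\<Sum>k<n. a k * b * c k) = 1"
proof -
  let ?I = "{\<Sum>k<n. a k * b * c k |(n::nat) a c. True}"
  interpret R: ring "ring_of_type_algebra :: 'b ring" by (rule ring_ring_of_type_algebra)
  have minus: "inv\<^bsub>add_monoid ring_of_type_algebra\<^esub> x = - x" for x :: 'b
    using R.minus_equality[of "- x" x] by (simp add: a_inv_def)
  have I: "(\<Sum>k<n. a k * b * c k) \<in> ?I" for n :: nat and a c by blast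
  have "ideal ?I (ring_of_type_algebra :: 'b ring)"
  proof (rule idealI[OF ring_ring_of_type_algebra])
    show "subgroup ?I (add_monoid (ring_of_type_algebra :: 'b ring))"
    proof (rule group.subgroupI[OF R.a_group])
      fix x assume "x \<in> ?I"
      then obtain n a c where "x = (\<Sum>k<(n::nat). a k * b * c k)" by blast
      then have "- x = (\<Sum>k<n. - a k * b * c k)" by (simp add: sum_negf)
      then show "inv\<^bsub>add_monoid ring_of_type_algebra\<^esub> x \<in> ?I" unfolding minus by (simp only:) (rule I)
    next
      fix x y assume "x \<in> ?I" "y \<in> ?I"
      then obtain n a c m a' c' where x: "x = (\<Sum>k<(n::nat). a k * b * c k)" and y: "y = (\<Sum>k<(m::nat). a' k * b * c' k)" by blast
      have "x + y = (\<Sum>k<n + m. (if k < n then a k else a' (k - n)) * b * (if k < n then c k else c' (k - n)))"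
      proof -
        have "{..<n + m} = {..<n} \<union> (\<lambda>k. n + k) ` {..<m}"
        proof (intro equalityI subsetI)
          fix x assume "x \<in> {..<n + m}"
          then have "x < n \<or> x = n + (x - n) \<and> x - n \<in> {..<m}" by auto
          then show "x \<in> {..<n} \<union> (\<lambda>k. n + k) ` {..<m}" by blast
        qed auto
        then show ?thesis
          by (subst sum.union_disjoint[symmetric, of "{..<n}" "(\<lambda>k. n + k) ` {..<m}", THEN trans[rotated]])
             (auto simp: x y sum.reindex)
      qed
      then have "x + y \<in> ?I" by (simp only:) (rule I)
      then show "x \<otimes>\<^bsub>add_monoid ring_of_type_algebra\<^esub> y \<in> ?I" by simp
    qed auto
  next
    fix x y :: 'b assume "x \<in> ?I"
    then obtain n a c where x: "x = (\<Sum>k<(n::nat). a k * b * c k)" by blast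
    have "y * x = (\<Sum>k<n. (y * a k) * b * c k)" "x * y = (\<Sum>k<n. a k * b * (c k * y))"
      by (simp_all add: x sum_distrib_left sum_distrib_right mult.assoc)
    then show "y \<otimes>\<^bsub>ring_of_type_algebra\<^esub> x \<in> ?I" "x \<otimes>\<^bsub>ring_of_type_algebra\<^esub> y \<in> ?I"
      by (simp_all only: ring_of_type_algebra_simps) (rule I)+
  qed
  then have "?I = {0} \<or> ?I = UNIV" using csa by (auto simp: central_simple_algebra_def)
  moreover have "(\<Sum>k<(1::nat). 1 * b * 1) \<in> ?I" by (rule I)
  then have "?I \<noteq> {0}" using assms by auto
  ultimately have "1 \<in> ?I" by blast
  then obtain n a c where "1 = (\<Sum>k<(n::nat). a k * b * c k)" by blast
  then have "(\<Sum>k<n. a k * b * c k) = 1" by (rule sym)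
  then show ?thesis by (intro exI)
qed

end

locale csa_extension = central_simple_basis scale N e co
  for scale :: "'k :: field \<Rightarrow> 'b :: ring_1 \<Rightarrow> 'b" and N e co +
  fixes h :: "'k \<Rightarrow> 'l :: alg_closed_field"
  assumes h_add [simp]: "h (x + y) = h x + h y" and h_mult [simp]: "h (x * y) = h x * h y" and h_1 [simp]: "h 1 = 1"
begin

lemma h_0 [simp]: "h 0 = 0" using h_add[of 0 0] by (metis add_0_right add_left_cancel)

lemma h_minus [simp]: "h (- x) = - h x" using h_add[of x "- x"] by (simp add: eq_neg_iff_add_eq_0 add.commute)

lemma h_diff [simp]: "h (x - y) = h x - h y" using h_add[of x "- y"] by simp

lemma h_eq_0 [simp]: "h x = 0 \<longleftrightarrow> x = 0"
  using h_mult[of x "inverse x"] by (cases "x = 0") auto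

text \<open>Elements of the extended algebra are represented by their coordinate vectors over \<open>'l\<close>.\<close>

definition tensor :: "'b \<Rightarrow> 'l \<Rightarrow> nat \<Rightarrow> 'l" where
  "tensor b l = (\<lambda>k. if k < N then h (co b k) * l else 0)"

definition xmul :: "(nat \<Rightarrow> 'l) \<Rightarrow> (nat \<Rightarrow> 'l) \<Rightarrow> nat \<Rightarrow> 'l" where
  "xmul x y = (\<Sum>i<N. \<Sum>j<N. tensor (e i * e j) (x i * y j))"

definition vmul :: "'l \<Rightarrow> (nat \<Rightarrow> 'l) \<Rightarrow> nat \<Rightarrow> 'l" where
  "vmul c x = (\<lambda>i. c * x i)"

definition ext :: "(nat \<Rightarrow> 'l) set" where
  "ext = {x. \<forall>i\<ge>N. x i = 0}"

lemma tensor_add: "tensor (a + b) l = tensor a l + tensor b l" "tensor a (l + m) = tensor a l + tensor a m"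
  by (auto simp: tensor_def fun_eq_iff co_add algebra_simps)

lemma tensor_0 [simp]: "tensor 0 l = 0" "tensor a 0 = 0"
  by (auto simp: tensor_def fun_eq_iff)

lemma tensor_minus: "tensor (a - b) l = tensor a l - tensor b l"
  by (auto simp: tensor_def fun_eq_iff co_minus algebra_simps)

lemma tensor_scale: "tensor (scale c a) l = tensor a (h c * l)" "vmul m (tensor a l) = tensor a (m * l)"
  by (auto simp: tensor_def vmul_def fun_eq_iff co_scale algebra_simps)

lemma tensor_sum: "tensor (\<Sum>i\<in>A. g i) l = (\<Sum>i\<in>A. tensor (g i) l)" "tensor a (\<Sum>i\<in>A. l' i) = (\<Sum>i\<in>A. tensor a (l' i))"
  by (induction A rule: infinite_finite_induct) (auto simp: tensor_add)

lemma tensor_ext [simp]: "tensor a l \<in> ext"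
  by (simp add: tensor_def ext_def)

lemma vector_space_vmul: "vector_space vmul"
  by unfold_locales (auto simp: vmul_def fun_eq_iff algebra_simps)

lemma xmul_add: "xmul (x + y) z = xmul x z + xmul y z" "xmul x (y + z) = xmul x y + xmul x z"
  by (simp_all add: xmul_def distrib_left distrib_right tensor_add sum.distrib)

lemma xmul_vmul: "xmul (vmul c x) y = vmul c (xmul x y)" "xmul x (vmul c y) = vmul c (xmul x y)"
proof -
  interpret V: vector_space vmul by (rule vector_space_vmul)
  show "xmul (vmul c x) y = vmul c (xmul x y)" "xmul x (vmul c y) = vmul c (xmul x y)"
    by (simp_all add: xmul_def V.scale_sum_right tensor_scale) (simp_all add: vmul_def mult.assoc mult.left_commute)
qed

lemma xmul_sum: "xmul (\<Sum>i\<in>A. g i) z = (\<Sum>i\<in>A. xmul (g i) z)" "xmul z (\<Sum>i\<in>A. g i) = (\<Sum>i\<in>A. xmul z (g i))"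
proof -
  have "xmul 0 z = 0" "xmul z 0 = 0" using xmul_add(1)[of 0 0 z] xmul_add(2)[of z 0 0] by auto
  then show "xmul (\<Sum>i\<in>A. g i) z = (\<Sum>i\<in>A. xmul (g i) z)" "xmul z (\<Sum>i\<in>A. g i) = (\<Sum>i\<in>A. xmul z (g i))"
    by (induction A rule: infinite_finite_induct) (auto simp: xmul_add)
qed

lemma xmul_tensor: "xmul (tensor a l) (tensor b m) = tensor (a * b) (l * m)"
proof -
  have "a * b = (\<Sum>i<N. scale (co a i) (e i)) * (\<Sum>j<N. scale (co b j) (e j))"
    using co_expand[of a] co_expand[of b] by simp
  also have "\<dots> = (\<Sum>i<N. \<Sum>j<N. scale (co a i * co b j) (e i * e j))"
    by (simp add: sum_product is_alg(2,3) scale_scale mult.commute)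
  finally have "tensor (a * b) (l * m) = (\<Sum>i<N. \<Sum>j<N. tensor (e i * e j) (h (co a i * co b j) * (l * m)))"
    by (simp only: tensor_sum tensor_scale)
  also have "\<dots> = xmul (tensor a l) (tensor b m)"
    unfolding xmul_def by (intro sum.cong) (auto simp: tensor_def algebra_simps)
  finally show ?thesis by simp
qed

lemma ext_expand: "x \<in> ext \<Longrightarrow> x = (\<Sum>i<N. tensor (e i) (x i))"
proof
  fix k assume "x \<in> ext"
  have "(\<Sum>i<N. tensor (e i) (x i)) k = (\<Sum>i<N. if k = i then x i else 0)"
    unfolding sum_fun_apply using \<open>x \<in> ext\<close> by (intro sum.cong) (auto simp: tensor_def co_e ext_def)
  then show "x k = (\<Sum>i<N. tensor (e i) (x i)) k" using \<open>x \<in> ext\<close> by (simp add: ext_def)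
qed

lemma xmul_ext: "xmul x y \<in> ext"
  by (auto simp: xmul_def ext_def sum_fun_apply tensor_def)

text \<open>\<open>xmul\<close> reads only the coordinates below N. Truncation therefore extends
  associativity from \<open>ext\<close> to all functions, as \<open>simple_algebra_acf\<close>
  requires of its product.\<close>

definition trunc :: "(nat \<Rightarrow> 'l) \<Rightarrow> nat \<Rightarrow> 'l" where "trunc x = (\<lambda>i. if i < N then x i else 0)"

lemma trunc: "trunc x \<in> ext" "xmul (trunc x) y = xmul x y" "xmul x (trunc y) = xmul x y"
  by (auto simp: trunc_def ext_def xmul_def intro!: sum.cong)

lemma xmul_assoc_ext:
  assumes "x \<in> ext" "y \<in> ext" "z \<in> ext"
  shows "xmul (xmul x y) z = xmul x (xmul y z)"
proof -
  have "xmul (xmul (\<Sum>i<N. tensor (e i) (x i)) (\<Sum>i<N. tensor (e i) (y i))) (\<Sum>i<N. tensor (e i) (z i)) =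
    xmul (\<Sum>i<N. tensor (e i) (x i)) (xmul (\<Sum>i<N. tensor (e i) (y i)) (\<Sum>i<N. tensor (e i) (z i)))"
    by (simp only: xmul_sum xmul_tensor mult.assoc)
  then show ?thesis using assms by (simp flip: ext_expand)
qed

lemma xmul_assoc: "xmul (xmul x y) z = xmul x (xmul y z)"
  using xmul_assoc_ext[of "trunc x" "trunc y" "trunc z"] by (simp add: trunc)

lemma xmul_unit: "x \<in> ext \<Longrightarrow> xmul (tensor 1 1) x = x" "x \<in> ext \<Longrightarrow> xmul x (tensor 1 1) = x"
proof -
  assume x: "x \<in> ext"
  have "xmul (tensor 1 1) (\<Sum>i<N. tensor (e i) (x i)) = (\<Sum>i<N. tensor (e i) (x i))"
    "xmul (\<Sum>i<N. tensor (e i) (x i)) (tensor 1 1) = (\<Sum>i<N. tensor (e i) (x i))"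
    by (simp_all add: xmul_sum xmul_tensor)
  then show "xmul (tensor 1 1) x = x" "xmul x (tensor 1 1) = x" using x by (simp_all flip: ext_expand)
qed

text \<open>
  A nonzero element of a two-sided ideal written with as few pure tensors as possible is turned, by
  multiplication with elements of the algebra, into one whose terms are all scalar.
\<close>

lemma ext_simple:
  assumes J: "module.subspace vmul J" and sub: "J \<subseteq> ext"
    and ideal: "\<And>x y. x \<in> ext \<Longrightarrow> y \<in> J \<Longrightarrow> xmul x y \<in> J \<and> xmul y x \<in> J" and nz: "J \<noteq> {0}"
  shows "tensor 1 1 \<in> J"
proof -
  interpret V: vector_space vmul by (rule vector_space_vmul)
  note J_simps = V.subspace_add[OF J] V.subspace_scale[OF J] V.subspace_0[OF J] V.subspace_diff[OF J] V.subspace_sum[OF J]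
  let ?P = "\<lambda>r. \<exists>(S :: nat set) b l. finite S \<and> card S = r \<and> (\<Sum>i\<in>S. tensor (b i) (l i)) \<in> J - {0}"
  obtain z0 where z0: "z0 \<in> J" "z0 \<noteq> 0" using nz J_simps(3) by blast
  then have "?P N" using ext_expand[of z0] sub by (intro exI[of _ "{..<N}"] exI[of _ e] exI[of _ z0]) auto
  define r where "r = (LEAST r. ?P r)"
  have "?P r" unfolding r_def by (rule LeastI[of ?P N]) fact
  then obtain S :: "nat set" and b l where "finite S \<and> card S = r \<and> (\<Sum>i\<in>S. tensor (b i) (l i)) \<in> J - {0}"
    by blast
  then have S: "finite S" "card S = r" and z: "(\<Sum>i\<in>S. tensor (b i) (l i)) \<in> J" "(\<Sum>i\<in>S. tensor (b i) (l i)) \<noteq> 0"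
    by blast+
  have short: "(\<Sum>i\<in>S'. tensor (b' i) (l' i)) = 0" if "finite S'" "card S' < r" "(\<Sum>i\<in>S'. tensor (b' i) (l' i)) \<in> J" for S' :: "nat set" and b' l'
  proof (rule ccontr)
    assume "(\<Sum>i\<in>S'. tensor (b' i) (l' i)) \<noteq> 0"
    then have "?P (card S')" using that by blast
    then have "r \<le> card S'" unfolding r_def by (rule Least_le)
    then show False using that by simp
  qed
  \<comment> \<open>Minimality of r makes the l i linearly independent over the image of
    \<open>'k\<close>: a relation would express one l m through the others, and the term with index
    m could be absorbed into the remaining ones.\<close>
  have indep: "\<kappa> m = 0" if \<kappa>: "(\<Sum>i\<in>S. h (\<kappa> i) * l i) = 0" and m: "m \<in> S" for \<kappa> m
  proof (rule ccontr)
    assume nz: "\<kappa> m \<noteq> 0"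
    have "h (\<kappa> m) * l m = - (\<Sum>i\<in>S - {m}. h (\<kappa> i) * l i)"
      using \<kappa> S m by (simp add: sum.remove eq_neg_iff_add_eq_0)
    then have e1: "inverse (h (\<kappa> m)) * (h (\<kappa> m) * l m) = inverse (h (\<kappa> m)) * (- (\<Sum>i\<in>S - {m}. h (\<kappa> i) * l i))"
      by (rule arg_cong)
    have e2: "inverse (h (\<kappa> m)) = h (inverse (\<kappa> m))"
      using nz h_mult[of "\<kappa> m" "inverse (\<kappa> m)"] by (intro inverse_unique) simp
    have "l m = inverse (h (\<kappa> m)) * (h (\<kappa> m) * l m)" using nz by simp
    also have "\<dots> = - (\<Sum>i\<in>S - {m}. h (inverse (\<kappa> m)) * (h (\<kappa> i) * l i))"
      by (simp only: e1) (simp only: e2 sum_distrib_left mult_minus_right)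
    finally have lm: "l m = - (\<Sum>i\<in>S - {m}. h (inverse (\<kappa> m) * \<kappa> i) * l i)"
      by (simp only: h_mult mult.assoc)
    have "(\<Sum>i\<in>S. tensor (b i) (l i)) = tensor (b m) (l m) + (\<Sum>i\<in>S - {m}. tensor (b i) (l i))"
      using S m by (simp add: sum.remove)
    also have "tensor (b m) (l m) = - (\<Sum>i\<in>S - {m}. tensor (scale (inverse (\<kappa> m) * \<kappa> i) (b m)) (l i))"
    proof -
      have "tensor (b m) (- x) = - tensor (b m) x" for x by (auto simp: tensor_def fun_eq_iff)
      then show ?thesis unfolding lm by (simp only: tensor_scale tensor_sum)
    qed
    also have "\<dots> + (\<Sum>i\<in>S - {m}. tensor (b i) (l i)) = (\<Sum>i\<in>S - {m}. tensor (b i - scale (inverse (\<kappa> m) * \<kappa> i) (b m)) (l i))"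
      by (simp add: tensor_minus sum_subtractf)
    finally have eq: "(\<Sum>i\<in>S. tensor (b i) (l i)) = (\<Sum>i\<in>S - {m}. tensor (b i - scale (inverse (\<kappa> m) * \<kappa> i) (b m)) (l i))" .
    have "card (S - {m}) < r" using S m by (metis card_Diff1_less)
    then have "(\<Sum>i\<in>S - {m}. tensor (b i - scale (inverse (\<kappa> m) * \<kappa> i) (b m)) (l i)) = 0"
      by (intro short z(1)[unfolded eq]) (use S in simp)
    then show False using z(2) unfolding eq by (rule notE[rotated])
  qed
  have indep': "y i = 0" if "(\<Sum>i\<in>S. tensor (y i) (l i)) = 0" "i \<in> S" for y i
  proof (rule co_eq_0)
    fix k assume k: "k < N"
    have "(\<Sum>i\<in>S. tensor (y i) (l i)) k = (\<Sum>i\<in>S. h (co (y i) k) * l i)"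
      unfolding sum_fun_apply using k by (simp add: tensor_def)
    then show "co (y i) k = 0" using indep[of "\<lambda>i. co (y i) k" i] that by simp
  qed
  have "S \<noteq> {}" using z by auto
  then obtain m where m: "m \<in> S" by blast
  have "b m \<noteq> 0"
  proof
    assume "b m = 0"
    then have "(\<Sum>i\<in>S. tensor (b i) (l i)) = (\<Sum>i\<in>S - {m}. tensor (b i) (l i))"
      using S m by (simp add: sum.remove)
    moreover have "card (S - {m}) < r" using S m by (metis card_Diff1_less)
    ultimately show False using short[of "S - {m}" b l] z S by simp
  qed
  then obtain n a c where ac: "(\<Sum>k<(n::nat). a k * b m * c k) = 1" using two_sided_span by blast
  \<comment> \<open>The multiplications on both sides that turn b m into 1 are applied to every
    term; the result stays in J and has the same length.\<close>
  define b' where "b' i = (\<Sum>k<n. a k * b i * c k)" for i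
  have b'm: "b' m = 1" by (simp add: b'_def ac)
  define z' where "z' = (\<Sum>i\<in>S. tensor (b' i) (l i))"
  have z'J: "z' \<in> J"
  proof -
    have "z' = (\<Sum>i\<in>S. \<Sum>k<n. tensor (a k * b i * c k) (l i))"
      by (simp add: z'_def b'_def tensor_sum)
    also have "\<dots> = (\<Sum>k<n. xmul (xmul (tensor (a k) 1) (\<Sum>i\<in>S. tensor (b i) (l i))) (tensor (c k) 1))"
      by (subst sum.swap) (simp add: xmul_sum xmul_tensor)
    finally show ?thesis using z ideal by (auto intro!: J_simps(5))
  qed
  \<comment> \<open>In the commutator with x the term of index m disappears, since b' m = 1. The
    commutator is then shorter than r, hence zero, and independence of the l i makes each b' i
    commute with x. By centrality all b' i are scalars.\<close>
  have central: "x * b' i = b' i * x" if "i \<in> S" for x i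
  proof -
    have "xmul (tensor x 1) z' - xmul z' (tensor x 1) = (\<Sum>i\<in>S. tensor (x * b' i - b' i * x) (l i))"
      by (simp add: z'_def xmul_sum xmul_tensor tensor_minus sum_subtractf)
    moreover have "xmul (tensor x 1) z' - xmul z' (tensor x 1) \<in> J" using z'J ideal by (auto intro!: J_simps(4))
    moreover have "(\<Sum>i\<in>S. tensor (x * b' i - b' i * x) (l i)) = (\<Sum>i\<in>S - {m}. tensor (x * b' i - b' i * x) (l i))"
      using S m by (simp add: sum.remove b'm)
    moreover have "card (S - {m}) < r" using S m by (metis card_Diff1_less)
    ultimately have "(\<Sum>i\<in>S. tensor (x * b' i - b' i * x) (l i)) = 0" using short[of "S - {m}"] S by auto
    then show ?thesis using indep'[of "\<lambda>i. x * b' i - b' i * x" i] that by simp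
  qed
  have "\<exists>\<kappa>. b' i = scale \<kappa> 1" if "i \<in> S" for i
  proof -
    have "b' i \<in> {z. \<forall>x. z * x = x * z}" using central[OF that] by simp
    then show ?thesis using csa by (auto simp: central_simple_algebra_def)
  qed
  then obtain \<kappa> where \<kappa>: "\<And>i. i \<in> S \<Longrightarrow> b' i = scale (\<kappa> i) 1" by metis
  have z': "z' = tensor 1 (\<Sum>i\<in>S. h (\<kappa> i) * l i)"
    by (simp add: z'_def \<kappa> tensor_sum tensor_scale)
  have "(\<Sum>i\<in>S. h (\<kappa> i) * l i) \<noteq> 0"
  proof
    assume "(\<Sum>i\<in>S. h (\<kappa> i) * l i) = 0"
    then have "\<kappa> m = 0" using indep m by blast
    then have "b m = 0" using \<kappa>[OF m] b'm by (metis mult_1_left mult_zero_left scale_zero_left)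
    then show False using \<open>b m \<noteq> 0\<close> by simp
  qed
  then have "tensor 1 1 = vmul (inverse (\<Sum>i\<in>S. h (\<kappa> i) * l i)) z'"
    unfolding z' tensor_scale by simp
  then show ?thesis using J_simps(2) z'J by simp
qed

text \<open>The isomorphism with a matrix algebra as equations between coordinates: \<rho> (e k) is
  the matrix of a basis element and \<sigma> i j lists the coordinates of a matrix unit, so the two
  are inverse to each other. In this form it can be transported along a ring homomorphism out of
  \<open>'l\<close>.\<close>

lemma splitting_representation:
  obtains n :: nat and \<rho> and \<sigma> where
    "\<And>x y i j. i < n \<Longrightarrow> j < n \<Longrightarrow> \<rho> (x + y) i j = \<rho> x i j + \<rho> y i j"
    "\<And>c x i j. i < n \<Longrightarrow> j < n \<Longrightarrow> \<rho> (scale c x) i j = h c * \<rho> x i j"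
    "\<And>x y i j. i < n \<Longrightarrow> j < n \<Longrightarrow> \<rho> (x * y) i j = (\<Sum>m<n. \<rho> x i m * \<rho> y m j)"
    "\<And>i j. i < n \<Longrightarrow> j < n \<Longrightarrow> \<rho> 1 i j = (if i = j then 1 else 0)"
    "\<And>i j i' j'. i < n \<Longrightarrow> j < n \<Longrightarrow> i' < n \<Longrightarrow> j' < n \<Longrightarrow>
      (\<Sum>k<N. \<sigma> i j k * \<rho> (e k) i' j') = (if i' = i \<and> j' = j then 1 else 0)"
    "\<And>k k'. k < N \<Longrightarrow> k' < N \<Longrightarrow> (\<Sum>i<n. \<Sum>j<n. \<rho> (e k) i j * \<sigma> i j k') = (if k = k' then 1 else 0)"
proof -
  interpret V: vector_space vmul by (rule vector_space_vmul)
  have sp: "V.subspace ext" by (auto simp: V.subspace_def ext_def vmul_def)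
  have span: "ext \<subseteq> V.span ((\<lambda>i. tensor (e i) 1) ` {..<N})"
  proof
    fix x assume "x \<in> ext"
    then have "x = (\<Sum>i<N. vmul (x i) (tensor (e i) 1))" by (simp add: tensor_scale flip: ext_expand)
    also have "\<dots> \<in> V.span ((\<lambda>i. tensor (e i) 1) ` {..<N})"
      by (intro V.span_sum V.span_scale V.span_base) auto
    finally show "x \<in> V.span ((\<lambda>i. tensor (e i) 1) ` {..<N})" .
  qed
  have nz: "tensor 1 1 \<noteq> 0"
  proof
    assume t: "tensor 1 1 = 0"
    have "co 1 i = 0" if "i < N" for i using fun_cong[OF t, of i] that by (simp add: tensor_def)
    then show False using co_eq_0[of 1] by simp
  qed
  interpret A: simple_algebra_acf vmul xmul "tensor 1 1" ext "(\<lambda>i. tensor (e i) 1) ` {..<N}"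
    by unfold_locales (use xmul_add xmul_vmul xmul_assoc sp xmul_ext tensor_ext nz xmul_unit span ext_simple in auto)
  obtain n :: nat and \<rho> M where
    M: "\<And>i j. i < n \<Longrightarrow> j < n \<Longrightarrow> M i j \<in> ext"
    and expand: "\<And>x. x \<in> ext \<Longrightarrow> x = (\<Sum>i<n. \<Sum>j<n. vmul (\<rho> x i j) (M i j))"
    and add: "\<And>x y i j. x \<in> ext \<Longrightarrow> y \<in> ext \<Longrightarrow> i < n \<Longrightarrow> j < n \<Longrightarrow> \<rho> (x + y) i j = \<rho> x i j + \<rho> y i j"
    and scale: "\<And>c x i j. x \<in> ext \<Longrightarrow> i < n \<Longrightarrow> j < n \<Longrightarrow> \<rho> (vmul c x) i j = c * \<rho> x i j"
    and mult: "\<And>x y i j. x \<in> ext \<Longrightarrow> y \<in> ext \<Longrightarrow> i < n \<Longrightarrow> j < n \<Longrightarrow> \<rho> (xmul x y) i j = (\<Sum>h<n. \<rho> x i h * \<rho> y h j)"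
    and one: "\<And>i j. i < n \<Longrightarrow> j < n \<Longrightarrow> \<rho> (tensor 1 1) i j = (if i = j then 1 else 0)"
    and unit: "\<And>i j i' j'. i < n \<Longrightarrow> j < n \<Longrightarrow> i' < n \<Longrightarrow> j' < n \<Longrightarrow> \<rho> (M i j) i' j' = (if i' = i \<and> j' = j then 1 else 0)"
    by (rule A.matrix_units) blast
  have \<rho>_sum: "\<rho> (\<Sum>k\<in>A. g k) i j = (\<Sum>k\<in>A. \<rho> (g k) i j)" if "finite A" "\<And>k. k \<in> A \<Longrightarrow> g k \<in> ext" "i < n" "j < n" for A :: "nat set" and g i j
    using that(1,2)
  proof (induction A)
    case empty
    have "\<rho> (vmul 0 0) i j = 0" using scale[of 0 i j 0] that V.subspace_0[OF sp] by simp
    then show ?case by (simp only: sum.empty V.scale_zero_left)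
  next
    case (insert k A)
    have "\<rho> (g k + sum g A) i j = \<rho> (g k) i j + \<rho> (sum g A) i j"
      by (rule add) (use insert that V.subspace_sum[OF sp, of A g] in auto)
    moreover have "\<rho> (sum g A) i j = (\<Sum>k\<in>A. \<rho> (g k) i j)" using insert by simp
    ultimately show ?case unfolding sum.insert[OF insert(1,2)] by (rule trans[OF _ arg_cong])
  qed
  show ?thesis
  proof (rule that[of n "\<lambda>x. \<rho> (tensor x 1)" M])
    fix i j assume ij: "i < n" "j < n"
    show "\<rho> (tensor (x + y) 1) i j = \<rho> (tensor x 1) i j + \<rho> (tensor y 1) i j" for x y
      using ij by (simp add: tensor_add add)
    show "\<rho> (tensor (scale c x) 1) i j = h c * \<rho> (tensor x 1) i j" for c x
      using ij scale[of "tensor x 1" i j "h c"] by (simp add: tensor_scale)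
    show "\<rho> (tensor (x * y) 1) i j = (\<Sum>m<n. \<rho> (tensor x 1) i m * \<rho> (tensor y 1) m j)" for x y
      using ij mult[of "tensor x 1" "tensor y 1" i j] by (simp add: xmul_tensor)
    show "\<rho> (tensor 1 1) i j = (if i = j then 1 else 0)" by (rule one[OF ij])
    fix i' j' assume ij': "i' < n" "j' < n"
    have "M i j = (\<Sum>k<N. vmul (M i j k) (tensor (e k) 1))"
      using ext_expand[OF M[OF ij]] by (simp add: tensor_scale)
    then have "\<rho> (M i j) i' j' = \<rho> (\<Sum>k<N. vmul (M i j k) (tensor (e k) 1)) i' j'" by simp
    also have "\<dots> = (\<Sum>k<N. M i j k * \<rho> (tensor (e k) 1) i' j')"
      using ij' by (subst \<rho>_sum) (auto simp: scale V.subspace_scale[OF sp])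
    finally show "(\<Sum>k<N. M i j k * \<rho> (tensor (e k) 1) i' j') = (if i' = i \<and> j' = j then 1 else 0)"
      using unit[OF ij ij'] by simp
  next
    fix k k' assume k: "k < N" "k' < N"
    have "tensor (e k) 1 k' = (\<Sum>i<n. \<Sum>j<n. vmul (\<rho> (tensor (e k) 1) i j) (M i j)) k'"
      using expand[of "tensor (e k) 1"] by simp
    then show "(\<Sum>i<n. \<Sum>j<n. \<rho> (tensor (e k) 1) i j * M i j k') = (if k = k' then 1 else 0)"
      using k by (simp add: sum_fun_apply vmul_def tensor_def co_e split: if_splits)
  qed
qed

end

section \<open>Completions\<close>

locale abs_val =
  fixes v :: "'k :: field \<Rightarrow> real"
  assumes absolute_value: "absolute_value v"
begin

lemma v_simps [simp]: "0 \<le> v x" "v x = 0 \<longleftrightarrow> x = 0" "v (x * y) = v x * v y"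
  using absolute_value by (auto simp: absolute_value_def)

lemma v_0 [simp]: "v 0 = 0"
  by simp

lemma v_triangle: "v (x + y) \<le> v x + v y"
  using absolute_value by (auto simp: absolute_value_def)

lemma v_1 [simp]: "v 1 = 1"
  using v_simps(3)[of 1 1] v_simps(2)[of 1] by simp

lemma v_minus [simp]: "v (- x) = v x"
proof -
  have "v (- 1) * v (- 1) = 1" using v_simps(3)[of "- 1" "- 1"] by simp
  then have "v (- 1) = 1" using v_simps(1)[of "- 1"] by (metis abs_of_nonneg real_sqrt_abs2 real_sqrt_one)
  then show ?thesis using v_simps(3)[of "- 1" x] by simp
qed

lemma v_diff_commute: "v (x - y) = v (y - x)"
  using v_minus[of "x - y"] by simp

lemma v_diff: "v (x - y) \<le> v x + v y"
  using v_triangle[of x "- y"] by simp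

lemma v_abs_diff: "\<bar>v x - v y\<bar> \<le> v (x - y)"
  using v_triangle[of "x - y" y] v_triangle[of "y - x" x] v_diff_commute[of x y] by (simp add: abs_le_iff)

lemma v_inverse [simp]: "v (inverse x) = inverse (v x)"
  using v_simps(3)[of x "inverse x"] by (cases "x = 0") (auto simp: field_simps)

lemma v_power [simp]: "v (x ^ n) = v x ^ n"
  by (induction n) auto

abbreviation CR where "CR \<equiv> cauchy_ring v"

lemma CR_simps [simp]:
  "monoid.mult CR = (\<lambda>x y n. x n * y n)" "monoid.one CR = (\<lambda>n. 1)" "ring.zero CR = (\<lambda>n. 0)"
  "ring.add CR = (\<lambda>x y n. x n + y n)"
  by (simp_all add: cauchy_ring_def)

lemma CR_carrier: "x \<in> carrier CR \<longleftrightarrow> (\<forall>e>0. \<exists>N. \<forall>m\<ge>N. \<forall>n\<ge>N. v (x m - x n) < e)"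
  by (simp add: cauchy_ring_def)

lemma const_CR [simp]: "(\<lambda>n. c) \<in> carrier CR"
  by (simp add: CR_carrier)

lemma uminus_CR: "x \<in> carrier CR \<Longrightarrow> (\<lambda>n. - x n) \<in> carrier CR"
  unfolding CR_carrier using v_diff_commute by (simp add: v_diff_commute)

lemma add_CR:
  assumes "x \<in> carrier CR" "y \<in> carrier CR"
  shows "(\<lambda>n. x n + y n) \<in> carrier CR"
  unfolding CR_carrier
proof (intro allI impI)
  fix e :: real assume "e > 0"
  then have e: "e / 2 > 0" by simp
  obtain N1 where 1: "\<And>m n. m \<ge> N1 \<Longrightarrow> n \<ge> N1 \<Longrightarrow> v (x m - x n) < e / 2" using assms(1) e unfolding CR_carrier by blast
  obtain N2 where 2: "\<And>m n. m \<ge> N2 \<Longrightarrow> n \<ge> N2 \<Longrightarrow> v (y m - y n) < e / 2" using assms(2) e unfolding CR_carrier by blast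
  have "v (x m + y m - (x n + y n)) < e" if "m \<ge> max N1 N2" "n \<ge> max N1 N2" for m n
    using 1[of m n] 2[of m n] v_triangle[of "x m - x n" "y m - y n"] that by (simp add: algebra_simps)
  then show "\<exists>N. \<forall>m\<ge>N. \<forall>n\<ge>N. v (x m + y m - (x n + y n)) < e" by blast
qed

lemma CR_bounded:
  assumes "x \<in> carrier CR"
  obtains B where "B > 0" "\<And>n. v (x n) \<le> B"
proof -
  obtain N where N: "\<And>m n. m \<ge> N \<Longrightarrow> n \<ge> N \<Longrightarrow> v (x m - x n) < 1"
    using assms[unfolded CR_carrier, rule_format, of 1] by auto
  define B where "B = 1 + (\<Sum>i\<le>N. v (x i))"
  have s: "v (x i) \<le> (\<Sum>i\<le>N. v (x i))" if "i \<le> N" for i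
    using that by (intro member_le_sum) auto
  have "v (x n) \<le> B" for n
  proof (cases "n \<le> N")
    case False
    then show ?thesis using N[of n N] v_abs_diff[of "x n" "x N"] s[of N] by (auto simp: B_def)
  qed (use s[of n] in \<open>auto simp: B_def\<close>)
  moreover have "B > 0" unfolding B_def by (intro add_pos_nonneg sum_nonneg) auto
  ultimately show ?thesis using that by blast
qed

lemma mult_CR:
  assumes "x \<in> carrier CR" "y \<in> carrier CR"
  shows "(\<lambda>n. x n * y n) \<in> carrier CR"
  unfolding CR_carrier
proof (intro allI impI)
  fix e :: real assume e: "e > 0"
  obtain B where B: "B > 0" "\<And>n. v (x n) \<le> B" using CR_bounded[OF assms(1)] by blast
  obtain B' where B': "B' > 0" "\<And>n. v (y n) \<le> B'" using CR_bounded[OF assms(2)] by blast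
  have e1: "e / (2 * B') > 0" "e / (2 * B) > 0" using e B B' by auto
  obtain N1 where 1: "\<And>m n. m \<ge> N1 \<Longrightarrow> n \<ge> N1 \<Longrightarrow> v (x m - x n) < e / (2 * B')" using assms(1) e1 unfolding CR_carrier by blast
  obtain N2 where 2: "\<And>m n. m \<ge> N2 \<Longrightarrow> n \<ge> N2 \<Longrightarrow> v (y m - y n) < e / (2 * B)" using assms(2) e1 unfolding CR_carrier by blast
  have "v (x m * y m - x n * y n) < e" if "m \<ge> max N1 N2" "n \<ge> max N1 N2" for m n
  proof -
    have "x m * y m - x n * y n = x m * (y m - y n) + (x m - x n) * y n" by (simp add: algebra_simps)
    then have "v (x m * y m - x n * y n) \<le> v (x m) * v (y m - y n) + v (x m - x n) * v (y n)"
      using v_triangle[of "x m * (y m - y n)" "(x m - x n) * y n"] by simp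
    also have "v (x m) * v (y m - y n) \<le> B * v (y m - y n)" using B by (intro mult_right_mono) auto
    also have "B * v (y m - y n) < B * (e / (2 * B))" using B 2[of m n] that by (intro mult_strict_left_mono) auto
    also have "v (x m - x n) * v (y n) \<le> v (x m - x n) * B'" using B' by (intro mult_left_mono) auto
    also have "v (x m - x n) * B' \<le> e / (2 * B') * B'" using B' 1[of m n] that by (intro mult_right_mono) auto
    finally have "v (x m * y m - x n * y n) < B * (e / (2 * B)) + e / (2 * B') * B'" by simp
    also have "B * (e / (2 * B)) = e / 2" using B by simp
    also have "e / (2 * B') * B' = e / 2" using B' by simp
    finally show ?thesis by simp
  qed
  then show "\<exists>N. \<forall>m\<ge>N. \<forall>n\<ge>N. v (x m * y m - x n * y n) < e" by blast
qed

lemma cring_CR: "cring CR"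
proof (rule cringI)
  show "abelian_group CR"
  proof (rule abelian_groupI)
    fix x assume "x \<in> carrier CR"
    then show "\<exists>y\<in>carrier CR. y \<oplus>\<^bsub>CR\<^esub> x = \<zero>\<^bsub>CR\<^esub>"
      by (intro bexI[of _ "\<lambda>n. - x n"]) (auto simp: uminus_CR)
  qed (auto simp: add_CR algebra_simps)
  show "comm_monoid CR"
    by (rule comm_monoidI) (auto simp: mult_CR algebra_simps)
qed (auto simp: algebra_simps)

sublocale CR: cring CR by (rule cring_CR)

lemma CR_limit:
  assumes "x \<in> carrier CR"
  shows "convergent (\<lambda>n. v (x n))"
proof -
  have "Cauchy (\<lambda>n. v (x n))"
  proof (rule metric_CauchyI)
    fix e :: real assume "e > 0"
    then obtain N where N: "\<And>m n. m \<ge> N \<Longrightarrow> n \<ge> N \<Longrightarrow> v (x m - x n) < e" using assms unfolding CR_carrier by blast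
    have "dist (v (x m)) (v (x n)) < e" if "m \<ge> N" "n \<ge> N" for m n
      using v_abs_diff[of "x m" "x n"] N[OF that] by (simp add: dist_real_def)
    then show "\<exists>M. \<forall>m\<ge>M. \<forall>n\<ge>M. dist (v (x m)) (v (x n)) < e" by blast
  qed
  then show ?thesis by (rule Cauchy_convergent)
qed

abbreviation NI where "NI \<equiv> null_ideal v"

lemma NI_iff: "x \<in> NI \<longleftrightarrow> (\<lambda>n. v (x n)) \<longlonglongrightarrow> 0"
  by (simp add: null_ideal_def)

lemma NI_CR: assumes "x \<in> NI" shows "x \<in> carrier CR"
  unfolding CR_carrier
proof (intro allI impI)
  fix e :: real assume "e > 0"
  then have "e / 2 > 0" by simp
  then obtain N where "\<forall>n\<ge>N. norm (v (x n) - 0) < e / 2"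
    using assms unfolding NI_iff LIMSEQ_iff by blast
  then have N: "v (x n) < e / 2" if "n \<ge> N" for n using that by simp
  have "v (x m - x n) < e" if "m \<ge> N" "n \<ge> N" for m n
    using N[OF that(1)] N[OF that(2)] v_diff[of "x m" "x n"] by simp
  then show "\<exists>N. \<forall>m\<ge>N. \<forall>n\<ge>N. v (x m - x n) < e" by blast
qed

lemma NI_add: "x \<in> NI \<Longrightarrow> y \<in> NI \<Longrightarrow> (\<lambda>n. x n + y n) \<in> NI"
  unfolding NI_iff
  by (rule tendsto_sandwich[of "\<lambda>n. 0" _ _ "\<lambda>n. v (x n) + v (y n)"])
     (auto intro: always_eventually v_triangle tendsto_add_zero)

lemma NI_mult: assumes "x \<in> NI" "y \<in> carrier CR" shows "(\<lambda>n. y n * x n) \<in> NI"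
proof -
  obtain B where B: "B > 0" "\<And>n. v (y n) \<le> B" using CR_bounded[OF assms(2)] by blast
  show ?thesis
    unfolding NI_iff
  proof (rule tendsto_sandwich[of "\<lambda>n. 0" _ _ "\<lambda>n. B * v (x n)"])
    show "(\<lambda>n. B * v (x n)) \<longlonglongrightarrow> 0" using assms(1) unfolding NI_iff by (rule tendsto_mult_right_zero)
  qed (use B in \<open>auto intro!: always_eventually mult_right_mono\<close>)
qed

lemma NI_mult': "x \<in> NI \<Longrightarrow> y \<in> carrier CR \<Longrightarrow> (\<lambda>n. x n * y n) \<in> NI"
  using NI_mult[of x y] by (simp add: mult.commute)

lemma ideal_NI: "ideal NI CR"
proof (rule idealI)
  show "ring CR" by unfold_locales
  show "subgroup NI (add_monoid CR)"
  proof (rule group.subgroupI[OF CR.a_group])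
    show "NI \<noteq> {}" using NI_iff[of "\<lambda>n. 0"] by auto
    fix x assume x: "x \<in> NI"
    have "inv\<^bsub>add_monoid CR\<^esub> x = (\<lambda>n. - x n)"
      using CR.minus_equality[of "\<lambda>n. - x n" x] NI_CR[OF x] by (simp add: a_inv_def uminus_CR)
    then show "inv\<^bsub>add_monoid CR\<^esub> x \<in> NI" using x by (simp add: NI_iff)
  qed (auto simp: NI_CR NI_add)
qed (auto simp: NI_mult NI_mult')

lemma NI_diff: "x \<in> carrier CR \<Longrightarrow> y \<in> carrier CR \<Longrightarrow> NI +>\<^bsub>CR\<^esub> x = NI +>\<^bsub>CR\<^esub> y \<longleftrightarrow> (\<lambda>n. x n - y n) \<in> NI"
proof -
  interpret I: ideal NI CR by (rule ideal_NI)
  assume xy: "x \<in> carrier CR" "y \<in> carrier CR"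
  have "NI +>\<^bsub>CR\<^esub> x = NI +>\<^bsub>CR\<^esub> y \<longleftrightarrow> x \<ominus>\<^bsub>CR\<^esub> y \<in> NI"
    using CR.quotient_eq_iff_same_a_r_cos[OF ideal_NI xy] by simp
  moreover have "\<ominus>\<^bsub>CR\<^esub> y = (\<lambda>n. - y n)"
    using CR.minus_equality[of "\<lambda>n. - y n" y] xy by (simp add: uminus_CR)
  ultimately show ?thesis by (simp add: a_minus_def)
qed

abbreviation CQ where "CQ \<equiv> CR Quot NI"

lemma CQ_carrier: "carrier CQ = (\<lambda>x. NI +>\<^bsub>CR\<^esub> x) ` carrier CR"
  by (auto simp: FactRing_def A_RCOSETS_def')

lemma coset_hom_CR: "(+>\<^bsub>CR\<^esub>) NI \<in> ring_hom CR CQ"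
  by (rule ideal.rcos_ring_hom[OF ideal_NI])

text \<open>A Cauchy sequence that is not null is eventually bounded away from 0. Its finitely many
  possible zero terms are harmless because \<open>inverse 0\<close> is 0 and a finite number of
  terms does not affect a class modulo null sequences.\<close>

lemma CR_inverse:
  assumes x: "x \<in> carrier CR" "x \<notin> NI"
  shows "(\<lambda>n. inverse (x n)) \<in> carrier CR" "(\<lambda>n. x n * inverse (x n) - 1) \<in> NI"
proof -
  obtain l where l: "(\<lambda>n. v (x n)) \<longlonglongrightarrow> l" using CR_limit[OF x(1)] by (auto simp: convergent_def)
  have "l \<ge> 0" by (rule LIMSEQ_le_const[OF l]) auto
  then have "l > 0" using l x(2) by (cases "l = 0") (auto simp: NI_iff)
  then have d: "l / 2 > 0" by simp
  then obtain N0 where "\<forall>n\<ge>N0. norm (v (x n) - l) < l / 2"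
    using l unfolding LIMSEQ_iff by blast
  then have N0: "\<bar>v (x n) - l\<bar> < l / 2" if "n \<ge> N0" for n using that by simp
  have pos: "v (x n) > l / 2" if "n \<ge> N0" for n
  proof -
    have "l - v (x n) < l / 2" using N0[OF that] by linarith
    then show ?thesis by simp
  qed
  have nz: "x n \<noteq> 0" if "n \<ge> N0" for n
    using pos[OF that] d v_simps(2)[of "x n"] by (metis less_trans less_irrefl)
  show "(\<lambda>n. inverse (x n)) \<in> carrier CR"
    unfolding CR_carrier
  proof (intro allI impI)
    fix e :: real assume e: "e > 0"
    have "e * (l / 2) * (l / 2) > 0" using e d by simp
    then obtain N where N: "\<And>m n. m \<ge> N \<Longrightarrow> n \<ge> N \<Longrightarrow> v (x m - x n) < e * (l / 2) * (l / 2)"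
      using x(1) unfolding CR_carrier by blast
    have "v (inverse (x m) - inverse (x n)) < e" if mn: "m \<ge> max N N0" "n \<ge> max N N0" for m n
    proof -
      have xm: "x m \<noteq> 0" "x n \<noteq> 0" using mn nz by auto
      have "inverse (x m) - inverse (x n) = (x n - x m) * (inverse (x m) * inverse (x n))"
        using xm by (simp add: field_simps)
      then have "v (inverse (x m) - inverse (x n)) = v (x n - x m) / (v (x m) * v (x n))"
        by (simp add: divide_inverse)
      also have "v (x n - x m) < e * (v (x m) * v (x n))"
      proof -
        have "(l / 2) * (l / 2) \<le> v (x m) * v (x n)" using pos[of m] pos[of n] mn d by (intro mult_mono) auto
        then have "e * ((l / 2) * (l / 2)) \<le> e * (v (x m) * v (x n))" using e by (intro mult_left_mono) auto
        then show ?thesis using N[of n m] mn by (simp add: mult.assoc)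
      qed
      then have "v (x n - x m) / (v (x m) * v (x n)) < e"
        using pos[of m] pos[of n] mn d by (subst pos_divide_less_eq) (auto intro!: mult_pos_pos)
      finally show ?thesis .
    qed
    then show "\<exists>N. \<forall>m\<ge>N. \<forall>n\<ge>N. v (inverse (x m) - inverse (x n)) < e" by blast
  qed
  have "eventually (\<lambda>n. v (x n * inverse (x n) - 1) = 0) sequentially"
    unfolding eventually_sequentially using nz by (intro exI[of _ N0]) auto
  then show "(\<lambda>n. x n * inverse (x n) - 1) \<in> NI"
    unfolding NI_iff by (rule tendsto_eventually)
qed

lemma field_CQ: "field CQ"
proof -
  interpret Q: cring CQ by (rule ideal.quotient_is_cring[OF ideal_NI cring_CR])
  have one: "\<one>\<^bsub>CQ\<^esub> = NI +>\<^bsub>CR\<^esub> (\<lambda>n. 1)" and zero: "\<zero>\<^bsub>CQ\<^esub> = NI +>\<^bsub>CR\<^esub> (\<lambda>n. 0)"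
    using ring_hom_one[OF coset_hom_CR] ring_hom_zero[OF coset_hom_CR CR.ring_axioms Q.ring_axioms] by simp_all
  show ?thesis
  proof (rule Q.cring_fieldI2)
    show "\<zero>\<^bsub>CQ\<^esub> \<noteq> \<one>\<^bsub>CQ\<^esub>" unfolding one zero by (subst NI_diff) (auto simp: NI_iff LIMSEQ_const_iff)
    fix a assume a: "a \<in> carrier CQ" "a \<noteq> \<zero>\<^bsub>CQ\<^esub>"
    then obtain x where x: "x \<in> carrier CR" "a = NI +>\<^bsub>CR\<^esub> x" by (auto simp: CQ_carrier)
    then have "x \<notin> NI" using a unfolding zero by (subst (asm) x(2), subst (asm) NI_diff) auto
    note i = CR_inverse[OF x(1) this]
    have "a \<otimes>\<^bsub>CQ\<^esub> (NI +>\<^bsub>CR\<^esub> (\<lambda>n. inverse (x n))) = \<one>\<^bsub>CQ\<^esub>"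
      unfolding one x(2) ring_hom_mult[OF coset_hom_CR x(1) i(1), symmetric]
      using i mult_CR[OF x(1) i(1)] by (simp add: NI_diff)
    then show "\<exists>b\<in>carrier CQ. a \<otimes>\<^bsub>CQ\<^esub> b = \<one>\<^bsub>CQ\<^esub>" using i by (auto simp: CQ_carrier)
  qed
qed

text \<open>This is \<open>completion_abs\<close> for a fixed absolute value instead of the chosen
  representative of a place.\<close>

definition lim_abs :: "(nat \<Rightarrow> 'k) set \<Rightarrow> real" where
  "lim_abs Z = (THE c. \<forall>x\<in>Z. (\<lambda>n. v (x n)) \<longlonglongrightarrow> c)"

lemma lim_abs:
  assumes x: "x \<in> carrier CR"
  shows "(\<lambda>n. v (x n)) \<longlonglongrightarrow> lim_abs (NI +>\<^bsub>CR\<^esub> x)"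
proof -
  interpret I: ideal NI CR by (rule ideal_NI)
  obtain l where l: "(\<lambda>n. v (x n)) \<longlonglongrightarrow> l" using CR_limit[OF x] by (auto simp: convergent_def)
  have y: "(\<lambda>n. v (y n)) \<longlonglongrightarrow> l" if y: "y \<in> NI +>\<^bsub>CR\<^esub> x" for y
  proof -
    obtain d where d: "d \<in> NI" "y = (\<lambda>n. d n + x n)" using y by (auto simp: a_r_coset_def')
    have "(\<lambda>n. v (y n) - v (x n)) \<longlonglongrightarrow> 0"
    proof (rule tendsto_rabs_zero_cancel, rule tendsto_sandwich[of "\<lambda>n. 0" _ _ "\<lambda>n. v (d n)"])
      show "\<forall>\<^sub>F n in sequentially. \<bar>v (y n) - v (x n)\<bar> \<le> v (d n)"
        by (rule always_eventually, rule allI) (use v_abs_diff[of "y n" "x n" for n] in \<open>simp add: d(2)\<close>)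
    qed (use d in \<open>auto simp: NI_iff\<close>)
    from tendsto_add[OF this l] show ?thesis by simp
  qed
  have "x \<in> NI +>\<^bsub>CR\<^esub> x" using I.a_rcos_self[OF x] .
  then have "lim_abs (NI +>\<^bsub>CR\<^esub> x) = l"
    unfolding lim_abs_def using y by (intro the_equality) (auto intro: LIMSEQ_unique)
  then show ?thesis using l by simp
qed

lemma lim_abs_eqI: "x \<in> carrier CR \<Longrightarrow> (\<lambda>n. v (x n)) \<longlonglongrightarrow> l \<Longrightarrow> lim_abs (NI +>\<^bsub>CR\<^esub> x) = l"
  using lim_abs LIMSEQ_unique by blast

lemma lim_abs_nonneg: "Z \<in> carrier CQ \<Longrightarrow> 0 \<le> lim_abs Z"
proof -
  assume "Z \<in> carrier CQ"
  then obtain x where x: "x \<in> carrier CR" "Z = NI +>\<^bsub>CR\<^esub> x" by (auto simp: CQ_carrier)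
  show ?thesis unfolding x(2) by (rule LIMSEQ_le_const[OF lim_abs[OF x(1)]]) auto
qed

lemma lim_abs_mult: "Z \<in> carrier CQ \<Longrightarrow> W \<in> carrier CQ \<Longrightarrow> lim_abs (Z \<otimes>\<^bsub>CQ\<^esub> W) = lim_abs Z * lim_abs W"
proof -
  assume "Z \<in> carrier CQ" "W \<in> carrier CQ"
  then obtain x y where xy: "x \<in> carrier CR" "y \<in> carrier CR" "Z = NI +>\<^bsub>CR\<^esub> x" "W = NI +>\<^bsub>CR\<^esub> y" by (auto simp: CQ_carrier)
  have "Z \<otimes>\<^bsub>CQ\<^esub> W = NI +>\<^bsub>CR\<^esub> (\<lambda>n. x n * y n)"
    unfolding xy(3,4) ring_hom_mult[OF coset_hom_CR xy(1,2), symmetric] by simp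
  then show ?thesis using xy tendsto_mult[OF lim_abs[OF xy(1)] lim_abs[OF xy(2)]] by (simp add: lim_abs_eqI mult_CR)
qed

lemma lim_abs_nonarch:
  assumes "nonarchimedean v" "Z \<in> carrier CQ" "W \<in> carrier CQ"
  shows "lim_abs (Z \<oplus>\<^bsub>CQ\<^esub> W) \<le> max (lim_abs Z) (lim_abs W)"
proof -
  obtain x y where xy: "x \<in> carrier CR" "y \<in> carrier CR" "Z = NI +>\<^bsub>CR\<^esub> x" "W = NI +>\<^bsub>CR\<^esub> y"
    using assms by (auto simp: CQ_carrier)
  have "Z \<oplus>\<^bsub>CQ\<^esub> W = NI +>\<^bsub>CR\<^esub> (\<lambda>n. x n + y n)"
    unfolding xy(3,4) ring_hom_add[OF coset_hom_CR xy(1,2), symmetric] by simp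
  then have "(\<lambda>n. v (x n + y n)) \<longlonglongrightarrow> lim_abs (Z \<oplus>\<^bsub>CQ\<^esub> W)" using lim_abs[OF add_CR[OF xy(1,2)]] by simp
  moreover have "(\<lambda>n. max (v (x n)) (v (y n))) \<longlonglongrightarrow> max (lim_abs Z) (lim_abs W)"
    using xy lim_abs by (intro tendsto_max) auto
  ultimately show ?thesis
    by (rule LIMSEQ_le) (use assms(1) in \<open>auto simp: nonarchimedean_def\<close>)
qed

lemma lim_abs_const: "lim_abs (NI +>\<^bsub>CR\<^esub> (\<lambda>n. c)) = v c"
  by (rule lim_abs_eqI) auto

lemma lim_abs_zero_iff: "Z \<in> carrier CQ \<Longrightarrow> lim_abs Z = 0 \<longleftrightarrow> Z = \<zero>\<^bsub>CQ\<^esub>"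
proof -
  interpret Q: field CQ by (rule field_CQ)
  have zero: "\<zero>\<^bsub>CQ\<^esub> = NI +>\<^bsub>CR\<^esub> (\<lambda>n. 0)"
    using ring_hom_zero[OF coset_hom_CR CR.ring_axioms Q.ring_axioms] by simp
  assume "Z \<in> carrier CQ"
  then obtain x where x: "x \<in> carrier CR" "Z = NI +>\<^bsub>CR\<^esub> x" by (auto simp: CQ_carrier)
  have "Z = \<zero>\<^bsub>CQ\<^esub> \<longleftrightarrow> x \<in> NI" unfolding zero x(2) using x(1) by (simp add: NI_diff)
  also have "\<dots> \<longleftrightarrow> lim_abs Z = 0" unfolding NI_iff x(2) using lim_abs[OF x(1)] LIMSEQ_unique by auto
  finally show ?thesis by simp
qed

end

lemma place_abs:
  assumes "\<nu> \<in> places"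
  shows "place_abs \<nu> \<in> \<nu>" "absolute_value (place_abs \<nu>)"
proof -
  obtain v where v: "nontrivial_absolute_value v" "\<nu> = {w. absolute_value w \<and> equivalent_absolute_values v w}"
    using assms by (auto simp: places_def)
  have "v \<in> \<nu>" using v by (auto simp: nontrivial_absolute_value_def equivalent_absolute_values_def absolute_value_def intro!: exI[of _ 1])
  then show "place_abs \<nu> \<in> \<nu>" unfolding place_abs_def by (rule someI[of "\<lambda>v. v \<in> \<nu>"])
  then show "absolute_value (place_abs \<nu>)" using v by auto
qed

lemma place_abs_nonarch: "\<nu> \<in> finite_places \<Longrightarrow> nonarchimedean (place_abs \<nu>)"
  using place_abs(1)[of \<nu>] by (auto simp: finite_places_def)

lemma to_completion_hom:
  assumes "\<nu> \<in> places"
  shows "to_completion \<nu> \<in> ring_hom (ring_of_type_algebra :: 'k :: field ring) (completion_at \<nu>)"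
proof -
  interpret abs_val "place_abs \<nu>" using place_abs(2)[OF assms] by (simp add: abs_val_def)
  have h: "ring_hom CR (completion_at \<nu>) = ring_hom CR CQ" by (simp add: completion_at_def)
  note hom = coset_hom_CR[folded h]
  show ?thesis
  proof (rule ring_hom_memI)
    fix x y :: 'k
    show "to_completion \<nu> x \<in> carrier (completion_at \<nu>)"
      unfolding to_completion_def by (rule ring_hom_closed[OF hom]) simp
    show "to_completion \<nu> (x \<otimes>\<^bsub>ring_of_type_algebra\<^esub> y) = to_completion \<nu> x \<otimes>\<^bsub>completion_at \<nu>\<^esub> to_completion \<nu> y"
      unfolding to_completion_def by (subst ring_hom_mult[OF hom, symmetric]) auto
    show "to_completion \<nu> (x \<oplus>\<^bsub>ring_of_type_algebra\<^esub> y) = to_completion \<nu> x \<oplus>\<^bsub>completion_at \<nu>\<^esub> to_completion \<nu> y"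
      unfolding to_completion_def by (subst ring_hom_add[OF hom, symmetric]) auto
    show "to_completion \<nu> \<one>\<^bsub>ring_of_type_algebra\<^esub> = \<one>\<^bsub>completion_at \<nu>\<^esub>"
      unfolding to_completion_def using ring_hom_one[OF hom] by simp
  qed
qed

lemma field_completion: "\<nu> \<in> places \<Longrightarrow> field (completion_at \<nu>)"
  unfolding completion_at_def
  by (rule abs_val.field_CQ) (simp add: abs_val_def place_abs)

lemma field_type_algebra: "field (ring_of_type_algebra :: 'k :: field ring)"
  by (rule field_from_type_algebra)

lemma char_0_type_algebra: "ring_char_0 (ring_of_type_algebra :: 'k :: field_char_0 ring)"
proof -
  interpret K: field "ring_of_type_algebra :: 'k ring" by (rule field_type_algebra)
  have "add_pow (ring_of_type_algebra :: 'k ring) m 1 = of_nat m" for m :: nat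
    by (induction m) (use K.add.nat_pow_Suc[of 1] in \<open>auto simp: add.commute\<close>)
  then show ?thesis by (auto simp: ring_char_0_def)
qed

lemma char_0_completion: "\<nu> \<in> places \<Longrightarrow> ring_char_0 (completion_at (\<nu> :: 'k :: field_char_0 place))"
  by (rule ring_char_0_hom[OF field_type_algebra field_completion to_completion_hom char_0_type_algebra])

section \<open>A common extension of the completion and the algebraic closure\<close>

text \<open>Zorn's lemma for the ideals above I that omit the unit; omitting it is preserved by
  unions of chains.\<close>

lemma (in cring) maximalideal_exists:
  assumes "ideal I R" "\<one> \<notin> I"
  obtains M where "maximalideal M R" "I \<subseteq> M"
proof -
  let ?A = "{J. ideal J R \<and> I \<subseteq> J \<and> \<one> \<notin> J}"
  have "\<exists>M\<in>?A. \<forall>Y\<in>?A. M \<subseteq> Y \<longrightarrow> Y = M"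
  proof (rule subset_Zorn_nonempty)
    fix C assume C: "C \<noteq> {}" "subset.chain ?A C"
    then have "subset.chain {I. ideal I R} C" by (auto simp: subset.chain_def)
    from chain_Union_is_ideal[OF this] have "ideal (\<Union>C) R" using C(1) by simp
    then show "\<Union>C \<in> ?A" using C by (auto simp: subset.chain_def)
  qed (use assms in auto)
  then obtain M where M: "ideal M R" "I \<subseteq> M" "\<one> \<notin> M"
    and max: "\<And>Y. ideal Y R \<Longrightarrow> I \<subseteq> Y \<Longrightarrow> \<one> \<notin> Y \<Longrightarrow> M \<subseteq> Y \<Longrightarrow> Y = M" by auto
  have "maximalideal M R"
  proof (rule maximalidealI[OF M(1)])
    show "carrier R \<noteq> M" using M(3) by auto
    fix J assume J: "ideal J R" "M \<subseteq> J" "J \<subseteq> carrier R"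
    then show "J = M \<or> J = carrier R"
      using max[of J] M(2) ideal.one_imp_carrier[OF J(1)] by auto
  qed
  then show ?thesis using that M(2) by blast
qed

locale compositum = abs_val v for v :: "'k :: field \<Rightarrow> real" +
  fixes h :: "'k \<Rightarrow> 'l :: field"
  assumes h_add [simp]: "h (x + y) = h x + h y" and h_mult [simp]: "h (x * y) = h x * h y" and h_1 [simp]: "h 1 = 1"
begin

lemma h_0 [simp]: "h 0 = 0" using h_add[of 0 0] by (metis add_0_right add_left_cancel)

text \<open>The \<open>'l\<close>-span of the Cauchy sequences of \<open>'k\<close>, that is, the
  image of the tensor product of \<open>'l\<close> with the Cauchy ring in the sequences over
  \<open>'l\<close>. Working with actual sequences keeps the type small enough for the later
  relabelling.\<close>

inductive_set S :: "(nat \<Rightarrow> 'l) set" where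
  S_gen: "c \<in> carrier CR \<Longrightarrow> (\<lambda>t. \<kappa> * h (c t)) \<in> S"
| S_add: "x \<in> S \<Longrightarrow> y \<in> S \<Longrightarrow> (\<lambda>t. x t + y t) \<in> S"

text \<open>The ideal of the sequence ring that has to vanish if null sequences are to be zero in
  the quotient. Both \<open>'l\<close> and the completion map into any quotient by an ideal
  containing it.\<close>

inductive_set I0 :: "(nat \<Rightarrow> 'l) set" where
  I0_gen: "c \<in> NI \<Longrightarrow> (\<lambda>t. \<kappa> * h (c t)) \<in> I0"
| I0_add: "x \<in> I0 \<Longrightarrow> y \<in> I0 \<Longrightarrow> (\<lambda>t. x t + y t) \<in> I0"

definition SR :: "(nat \<Rightarrow> 'l) ring" where
  "SR = \<lparr>carrier = S, monoid.mult = (\<lambda>x y t. x t * y t), one = (\<lambda>t. 1), ring.zero = (\<lambda>t. 0), add = (\<lambda>x y t. x t + y t)\<rparr>"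

lemma SR_simps [simp]:
  "carrier SR = S" "monoid.mult SR = (\<lambda>x y t. x t * y t)" "monoid.one SR = (\<lambda>t. 1)" "ring.zero SR = (\<lambda>t. 0)"
  "ring.add SR = (\<lambda>x y t. x t + y t)"
  by (simp_all add: SR_def)

lemma S_const [simp]: "(\<lambda>t. \<kappa>) \<in> S"
  using S_gen[of "\<lambda>t. 1" \<kappa>] by simp

lemma S_h: "c \<in> carrier CR \<Longrightarrow> (\<lambda>t. h (c t)) \<in> S"
  using S_gen[of c 1] by simp

lemma S_uminus: "x \<in> S \<Longrightarrow> (\<lambda>t. - x t) \<in> S"
proof (induction rule: S.induct)
  case (S_gen c \<kappa>)
  then show ?case using S.S_gen[of c "- \<kappa>"] by simp
next
  case (S_add x y)
  then show ?case using S.S_add[OF S_add(3,4)] by simp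
qed

lemma S_mult: "x \<in> S \<Longrightarrow> y \<in> S \<Longrightarrow> (\<lambda>t. x t * y t) \<in> S"
proof (induction arbitrary: y rule: S.induct)
  case (S_gen c \<kappa>)
  show ?case using S_gen(2)
  proof (induction rule: S.induct)
    case (S_gen c' \<kappa>')
    then show ?case using S.S_gen[OF mult_CR[OF \<open>c \<in> carrier CR\<close> S_gen(1)], of "\<kappa> * \<kappa>'"] by (simp add: ac_simps)
  next
    case (S_add x y)
    then show ?case using S.S_add[OF S_add(3,4)] by (simp add: distrib_left)
  qed
next
  case (S_add x z)
  then show ?case using S.S_add[OF S_add(3)[of y] S_add(4)[of y]] by (simp add: distrib_right)
qed

lemma I0_S: "x \<in> I0 \<Longrightarrow> x \<in> S"
  by (induction rule: I0.induct) (auto intro: S.intros NI_CR)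

lemma I0_uminus: "x \<in> I0 \<Longrightarrow> (\<lambda>t. - x t) \<in> I0"
proof (induction rule: I0.induct)
  case (I0_gen c \<kappa>)
  then show ?case using I0.I0_gen[of c "- \<kappa>"] by simp
next
  case (I0_add x y)
  then show ?case using I0.I0_add[OF I0_add(3,4)] by simp
qed

lemma I0_mult: "x \<in> I0 \<Longrightarrow> y \<in> S \<Longrightarrow> (\<lambda>t. y t * x t) \<in> I0"
proof (induction arbitrary: y rule: I0.induct)
  case (I0_gen c \<kappa>)
  show ?case using I0_gen(2)
  proof (induction rule: S.induct)
    case (S_gen c' \<kappa>')
    then show ?case using I0.I0_gen[OF NI_mult[OF \<open>c \<in> NI\<close> S_gen(1)], of "\<kappa>' * \<kappa>"] by (simp add: ac_simps)
  next
    case (S_add x y)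
    then show ?case using I0.I0_add[OF S_add(3,4)] by (simp add: distrib_right)
  qed
next
  case (I0_add x z)
  then show ?case using I0.I0_add[OF I0_add(3)[of y] I0_add(4)[of y]] by (simp add: distrib_left)
qed

lemma cring_SR: "cring SR"
proof (rule cringI)
  show "abelian_group SR"
  proof (rule abelian_groupI)
    fix x assume "x \<in> carrier SR"
    then show "\<exists>y\<in>carrier SR. y \<oplus>\<^bsub>SR\<^esub> x = \<zero>\<^bsub>SR\<^esub>"
      by (intro bexI[of _ "\<lambda>t. - x t"]) (auto simp: S_uminus)
  qed (auto simp: S_add algebra_simps)
  show "comm_monoid SR"
    by (rule comm_monoidI) (auto simp: S_mult algebra_simps)
qed (auto simp: algebra_simps)

lemma ideal_I0: "ideal I0 SR"
proof (rule idealI)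
  interpret SR: cring SR by (rule cring_SR)
  show "ring SR" by unfold_locales
  show "subgroup I0 (add_monoid SR)"
  proof (rule group.subgroupI[OF SR.a_group])
    show "I0 \<noteq> {}" using I0_gen[of "\<lambda>n. 0" 0] by (auto simp: NI_iff)
    fix x assume x: "x \<in> I0"
    have "inv\<^bsub>add_monoid SR\<^esub> x = (\<lambda>n. - x n)"
      using SR.minus_equality[of "\<lambda>n. - x n" x] I0_S[OF x] by (simp add: a_inv_def S_uminus)
    then show "inv\<^bsub>add_monoid SR\<^esub> x \<in> I0" using I0_uminus[OF x] by simp
  qed (auto simp: I0_S I0_add)
  fix a x assume "a \<in> I0" "x \<in> carrier SR"
  then show "x \<otimes>\<^bsub>SR\<^esub> a \<in> I0" "a \<otimes>\<^bsub>SR\<^esub> x \<in> I0"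
    using I0_mult[of a x] by (simp_all add: mult.commute)
qed

text \<open>A \<open>'k\<close>-linear functional fixing 1 maps \<open>I0\<close> to null sequences, so \<open>I0\<close> is a proper ideal.\<close>

lemma one_notin_I0: "(\<lambda>t. 1) \<notin> I0"
proof
  assume 1: "(\<lambda>t. 1) \<in> I0"
  interpret V: vector_space "\<lambda>c x. h c * x" by unfold_locales (auto simp: algebra_simps)
  interpret K: vector_space "\<lambda>c (x :: 'k). c * x" by unfold_locales (auto simp: algebra_simps)
  interpret VK: vector_space_pair "\<lambda>c x. h c * x" "\<lambda>c (x :: 'k). c * x" by unfold_locales
  have "V.independent {1}" by simp
  from VK.linear_independent_extend[OF this, of "\<lambda>_. 1"] obtain \<Lambda> where
    "Vector_Spaces.linear (\<lambda>c x. h c * x) (\<lambda>c (x :: 'k). c * x) \<Lambda>" and \<Lambda>1: "\<Lambda> 1 = 1" by auto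
  then interpret \<Lambda>: Vector_Spaces.linear "\<lambda>c x. h c * x" "\<lambda>c (x :: 'k). c * x" \<Lambda> by simp
  have "(\<lambda>t. \<Lambda> (x t)) \<in> NI" if "x \<in> I0" for x
    using that
  proof (induction rule: I0.induct)
    case (I0_gen c \<kappa>)
    have "\<Lambda> (\<kappa> * h (c t)) = \<Lambda> \<kappa> * c t" for t
      using \<Lambda>.scale[of "c t" \<kappa>] by (simp add: mult.commute)
    then show ?case using NI_mult[OF I0_gen, of "\<lambda>t. \<Lambda> \<kappa>"] by simp
  next
    case (I0_add x y)
    then show ?case using NI_add by (simp add: \<Lambda>.add)
  qed
  from this[OF 1] show False by (simp add: NI_iff \<Lambda>1 LIMSEQ_const_iff)
qed

text \<open>The two maps agree on \<open>'k\<close>, so structure constants of B have the same image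
  along either of them. The function r picks a sequence from each coset; it is injective and permits
  the elements of L to be renamed by sequences over \<open>'l\<close>.\<close>

lemma compositum_exists:
  obtains L :: "(nat \<Rightarrow> 'l) set ring" and i j r where "field L"
    "i \<in> ring_hom (ring_of_type_algebra :: 'l ring) L" "j \<in> ring_hom CQ L"
    "\<And>c. j (NI +>\<^bsub>CR\<^esub> (\<lambda>n. c)) = i (h c)" "inj_on (r :: _ \<Rightarrow> nat \<Rightarrow> 'l) (carrier L)"
proof -
  interpret SR: cring SR by (rule cring_SR)
  obtain M where M: "maximalideal M SR" "I0 \<subseteq> M"
    using SR.maximalideal_exists[OF ideal_I0] one_notin_I0 by auto
  interpret M: maximalideal M SR by (rule M(1))
  interpret I: ideal NI CR by (rule ideal_NI)
  let ?L = "SR Quot M"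
  have hom: "(+>\<^bsub>SR\<^esub>) M \<in> ring_hom SR ?L" by (rule M.rcos_ring_hom)
  have eq: "M +>\<^bsub>SR\<^esub> x = M +>\<^bsub>SR\<^esub> y" if "x \<in> S" "y \<in> S" "(\<lambda>t. x t - y t) \<in> M" for x y
  proof -
    have "\<ominus>\<^bsub>SR\<^esub> y = (\<lambda>n. - y n)"
      using SR.minus_equality[of "\<lambda>n. - y n" y] that by (simp add: S_uminus)
    then have "x \<ominus>\<^bsub>SR\<^esub> y \<in> M" using that by (simp add: a_minus_def)
    then show ?thesis using SR.quotient_eq_iff_same_a_r_cos[OF M.is_ideal, of x y] that by simp
  qed
  define i where "i \<kappa> = M +>\<^bsub>SR\<^esub> (\<lambda>t. \<kappa>)" for \<kappa>
  \<comment> \<open>The image of a class is computed from an arbitrary representative; another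
    choice changes the result by an element of \<open>I0\<close>, which lies in M.\<close>
  define j where "j Z = M +>\<^bsub>SR\<^esub> (\<lambda>t. h ((SOME x. x \<in> Z) t))" for Z
  define r where "r Z = (SOME x. x \<in> Z)" for Z :: "(nat \<Rightarrow> 'l) set"
  have j: "j (NI +>\<^bsub>CR\<^esub> x) = M +>\<^bsub>SR\<^esub> (\<lambda>t. h (x t))" if x: "x \<in> carrier CR" for x
  proof -
    define y where "y = (SOME y. y \<in> NI +>\<^bsub>CR\<^esub> x)"
    have "y \<in> NI +>\<^bsub>CR\<^esub> x" unfolding y_def by (rule someI[of "\<lambda>y. y \<in> NI +>\<^bsub>CR\<^esub> x"]) (rule I.a_rcos_self[OF x])
    then obtain d where d: "d \<in> NI" "y = (\<lambda>n. d n + x n)" by (auto simp: a_r_coset_def')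
    have "(\<lambda>t. h (d t)) \<in> I0" using I0_gen[OF d(1), of 1] by simp
    then have "(\<lambda>t. h (y t) - h (x t)) \<in> M" using M(2) by (auto simp: d(2))
    then show ?thesis
      unfolding j_def y_def[symmetric] using S_h[OF x] S_h[of y] add_CR[OF NI_CR[OF d(1)] x]
      by (intro eq) (simp_all add: d(2))
  qed
  show ?thesis
  proof (rule that[of ?L i j r])
    show "field ?L" by (rule M.quotient_is_field[OF cring_SR])
    show "i \<in> ring_hom (ring_of_type_algebra :: 'l ring) ?L"
    proof (rule ring_hom_memI)
      fix x y :: 'l
      show "i x \<in> carrier ?L" unfolding i_def by (rule ring_hom_closed[OF hom]) simp
      show "i (x \<otimes>\<^bsub>ring_of_type_algebra\<^esub> y) = i x \<otimes>\<^bsub>?L\<^esub> i y"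
        unfolding i_def by (subst ring_hom_mult[OF hom, symmetric]) auto
      show "i (x \<oplus>\<^bsub>ring_of_type_algebra\<^esub> y) = i x \<oplus>\<^bsub>?L\<^esub> i y"
        unfolding i_def by (subst ring_hom_add[OF hom, symmetric]) auto
      show "i \<one>\<^bsub>ring_of_type_algebra\<^esub> = \<one>\<^bsub>?L\<^esub>"
        unfolding i_def using ring_hom_one[OF hom] by simp
    qed
    show "j \<in> ring_hom CQ ?L"
    proof (rule ring_hom_memI)
      fix Z W assume "Z \<in> carrier CQ" "W \<in> carrier CQ"
      then obtain x y where xy: "x \<in> carrier CR" "y \<in> carrier CR" "Z = NI +>\<^bsub>CR\<^esub> x" "W = NI +>\<^bsub>CR\<^esub> y" by (auto simp: CQ_carrier)
      have m: "Z \<otimes>\<^bsub>CQ\<^esub> W = NI +>\<^bsub>CR\<^esub> (\<lambda>n. x n * y n)" "Z \<oplus>\<^bsub>CQ\<^esub> W = NI +>\<^bsub>CR\<^esub> (\<lambda>n. x n + y n)"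
        unfolding xy(3,4) ring_hom_mult[OF coset_hom_CR xy(1,2), symmetric] ring_hom_add[OF coset_hom_CR xy(1,2), symmetric] by simp_all
      show "j Z \<in> carrier ?L" unfolding xy(3) j[OF xy(1)] by (rule ring_hom_closed[OF hom]) (simp add: S_h xy)
      show "j (Z \<otimes>\<^bsub>CQ\<^esub> W) = j Z \<otimes>\<^bsub>?L\<^esub> j W"
        unfolding m j[OF mult_CR[OF xy(1,2)]] unfolding xy(3,4) j[OF xy(1)] j[OF xy(2)]
        by (subst ring_hom_mult[OF hom, symmetric]) (auto simp: S_h xy)
      show "j (Z \<oplus>\<^bsub>CQ\<^esub> W) = j Z \<oplus>\<^bsub>?L\<^esub> j W"
        unfolding m j[OF add_CR[OF xy(1,2)]] unfolding xy(3,4) j[OF xy(1)] j[OF xy(2)]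
        by (subst ring_hom_add[OF hom, symmetric]) (auto simp: S_h xy)
    next
      have "\<one>\<^bsub>CQ\<^esub> = NI +>\<^bsub>CR\<^esub> (\<lambda>n. 1)" using ring_hom_one[OF coset_hom_CR] by simp
      then show "j \<one>\<^bsub>CQ\<^esub> = \<one>\<^bsub>?L\<^esub>" using ring_hom_one[OF hom] j[of "\<lambda>n. 1"] by simp
    qed
    show "j (NI +>\<^bsub>CR\<^esub> (\<lambda>n. c)) = i (h c)" for c
      by (simp add: j i_def)
    show "inj_on r (carrier ?L)"
    proof (rule inj_onI)
      fix Z W assume "Z \<in> carrier ?L" "W \<in> carrier ?L" and rr: "r Z = r W"
      then obtain x y where xy: "x \<in> S" "y \<in> S" "Z = M +>\<^bsub>SR\<^esub> x" "W = M +>\<^bsub>SR\<^esub> y"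
        by (auto simp: FactRing_def A_RCOSETS_def')
      have r: "M +>\<^bsub>SR\<^esub> x = M +>\<^bsub>SR\<^esub> r (M +>\<^bsub>SR\<^esub> x)" if "x \<in> S" for x
      proof -
        have x: "x \<in> carrier SR" using that by simp
        have "r (M +>\<^bsub>SR\<^esub> x) \<in> M +>\<^bsub>SR\<^esub> x"
          unfolding r_def by (rule someI[of "\<lambda>y. y \<in> M +>\<^bsub>SR\<^esub> x"]) (rule M.a_rcos_self[OF x])
        from M.a_repr_independence'[OF this x] show ?thesis .
      qed
      have "Z = M +>\<^bsub>SR\<^esub> r Z" unfolding xy(3) by (rule r[OF xy(1)])
      also have "\<dots> = M +>\<^bsub>SR\<^esub> r W" by (simp only: rr)
      also have "\<dots> = W" unfolding xy(4) by (rule r[OF xy(2), symmetric])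
      finally show "Z = W" .
    qed
  qed
qed

end

text \<open>Countability allows sequences over the algebraic closure of \<open>'k\<close> to be
  encoded by sequences over \<open>'k\<close>, see \<open>countable_inj_type\<close>.\<close>

lemma countable_number_field:
  assumes "number_field TYPE('k :: field_char_0)"
  shows "countable (UNIV :: 'k set)"
proof -
  obtain S :: "'k set" where S: "finite S" "module.span (\<lambda>(q::rat) x. of_rat q * x) S = UNIV"
    using assms by (auto simp: number_field_def)
  interpret Q: vector_space "\<lambda>(q::rat) (x :: 'k). of_rat q * x"
    by unfold_locales (auto simp: algebra_simps of_rat_add of_rat_mult)
  have "countable (Q.span S)"
    using S(1)
  proof (induction S)
    case (insert a S)
    have "Q.span (insert a S) \<subseteq> (\<lambda>(q, x). x + of_rat q * a) ` (UNIV \<times> Q.span S)"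
    proof
      fix x assume "x \<in> Q.span (insert a S)"
      then obtain q where "x - of_rat q * a \<in> Q.span S" by (auto simp: Q.span_insert)
      then show "x \<in> (\<lambda>(q, x). x + of_rat q * a) ` (UNIV \<times> Q.span S)"
        by (intro image_eqI[of _ _ "(q, x - of_rat q * a)"]) auto
    qed
    moreover have "countable ((\<lambda>(q, x). x + of_rat q * a) ` ((UNIV :: rat set) \<times> Q.span S))"
      by (intro countable_image countable_SIGMA insert.IH) auto
    ultimately show ?case by (rule countable_subset)
  qed simp
  then show ?thesis using S by simp
qed

lemma countable_alg_closure:
  assumes "countable (UNIV :: 'k :: field set)"
  shows "countable (UNIV :: 'k alg_closure set)"
proof -
  have "countable (lists (UNIV :: 'k set))" using assms by blast
  then have "countable (UNIV :: 'k list set)" by (simp add: lists_UNIV)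
  moreover have "inj (Polynomial.coeffs :: 'k poly \<Rightarrow> 'k list)" by (simp add: inj_on_def coeffs_eq_iff)
  ultimately have P: "countable (UNIV :: 'k poly set)"
    by (rule countable_image_inj_on[OF countable_subset[OF subset_UNIV]])
  have "UNIV \<subseteq> (\<Union>p\<in>{p :: 'k poly. p \<noteq> 0}. {x. poly (map_poly to_ac p) x = 0})"
  proof
    fix x :: "'k alg_closure"
    obtain p :: "'k poly" where "p \<noteq> 0" "poly (map_poly to_ac p) x = 0" by (rule alg_closure_algebraic)
    then show "x \<in> (\<Union>p\<in>{p :: 'k poly. p \<noteq> 0}. {x. poly (map_poly to_ac p) x = 0})" by blast
  qed
  moreover have "countable (\<Union>p\<in>{p :: 'k poly. p \<noteq> 0}. {x. poly (map_poly to_ac p) x = 0})"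
  proof (rule countable_UN)
    show "countable {p :: 'k poly. p \<noteq> 0}" using P by (rule countable_subset[rotated]) auto
    fix p :: "'k poly" assume "p \<in> {p. p \<noteq> 0}"
    then have "map_poly to_ac p \<noteq> 0" by (auto simp: map_poly_eq_0_iff)
    then show "countable {x. poly (map_poly to_ac p) x = 0}" by (intro countable_finite poly_roots_finite)
  qed
  ultimately show ?thesis by (rule countable_subset)
qed

section \<open>Places where an element is not a unit\<close>

lemma (in abs_val) v_pos: "x \<noteq> 0 \<Longrightarrow> 0 < v x"
  by (metis less_eq_real_def v_simps(1,2))

locale nonarch_val = abs_val v for v :: "'k :: field_char_0 \<Rightarrow> real" +
  assumes nonarch: "nonarchimedean v"
begin

lemma v_max: "v (x + y) \<le> max (v x) (v y)"
  using nonarch by (simp add: nonarchimedean_def)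

lemma v_sum_le: "B \<ge> 0 \<Longrightarrow> (\<And>i. i \<in> A \<Longrightarrow> v (g i) \<le> B) \<Longrightarrow> v (sum g A) \<le> B"
proof (induction A rule: infinite_finite_induct)
  case (insert i A)
  then have "v (g i) \<le> B" "v (sum g A) \<le> B" by auto
  then show ?case using v_max[of "g i" "sum g A"] by (subst sum.insert[OF insert.hyps]) linarith
qed auto

lemma v_sum_less: "B > 0 \<Longrightarrow> (\<And>i. i \<in> A \<Longrightarrow> v (g i) < B) \<Longrightarrow> v (sum g A) < B"
proof (induction A rule: infinite_finite_induct)
  case (insert i A)
  then have "v (g i) < B" "v (sum g A) < B" by auto
  then show ?case using v_max[of "g i" "sum g A"] by (subst sum.insert[OF insert.hyps]) linarith
qed auto

lemma v_dominant: assumes "v y < v x" shows "v (x + y) = v x"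
proof -
  have "v x \<le> max (v (x + y)) (v y)" using v_max[of "x + y" "- y"] by simp
  then show ?thesis using v_max[of x y] assms by linarith
qed

lemma v_of_nat: "v (of_nat n) \<le> 1"
proof (induction n)
  case (Suc n)
  then show ?case using v_max[of 1 "of_nat n"] by simp
qed simp

lemma v_of_int: "v (of_int n) \<le> 1"
  using v_of_nat[of "nat \<bar>n\<bar>"] by (cases "n \<ge> 0") auto

text \<open>If v x exceeds 1, the leading term strictly dominates all the others, whose coefficients
  are integers and so have value at most 1; then the sum cannot vanish. The leading coefficient only
  has to be a unit for v, which covers integer polynomials that are not monic.\<close>

lemma v_root_le_1:
  fixes p :: "'k poly"
  assumes p: "p \<noteq> 0" "\<And>i. Polynomial.coeff p i \<in> \<int>" "poly p x = 0" and lead: "v (Polynomial.lead_coeff p) = 1"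
  shows "v x \<le> 1"
proof (rule ccontr)
  assume "\<not> v x \<le> 1"
  then have x: "v x > 1" by simp
  define n where "n = Polynomial.degree p"
  have "n > 0" using p by (cases "n = 0") (auto simp: n_def elim!: degree_eq_zeroE)
  have "0 = (\<Sum>i\<le>n. Polynomial.coeff p i * x ^ i)"
    using p(3) by (simp add: poly_altdef n_def)
  also have "\<dots> = Polynomial.coeff p n * x ^ n + (\<Sum>i<n. Polynomial.coeff p i * x ^ i)"
    by (simp flip: lessThan_Suc_atMost)
  finally have s: "Polynomial.coeff p n * x ^ n + (\<Sum>i<n. Polynomial.coeff p i * x ^ i) = 0" by simp
  have "v (\<Sum>i<n. Polynomial.coeff p i * x ^ i) \<le> v x ^ (n - 1)"
  proof (rule v_sum_le)
    fix i assume i: "i \<in> {..<n}"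
    obtain c where c: "Polynomial.coeff p i = of_int c" using p(2)[of i] by (auto elim: Ints_cases)
    have "v (Polynomial.coeff p i * x ^ i) \<le> 1 * v x ^ i"
      using v_of_int[of c] x by (simp add: c mult_left_le_one_le)
    also have "\<dots> \<le> v x ^ (n - 1)" using i x by (simp add: power_increasing)
    finally show "v (Polynomial.coeff p i * x ^ i) \<le> v x ^ (n - 1)" .
  qed simp
  also have "\<dots> < v x ^ n" using x \<open>n > 0\<close> by (intro power_strict_increasing) auto
  also have "\<dots> = v (Polynomial.coeff p n * x ^ n)" using lead by (simp add: n_def)
  finally have "v (Polynomial.coeff p n * x ^ n + (\<Sum>i<n. Polynomial.coeff p i * x ^ i)) = v (Polynomial.coeff p n * x ^ n)"
    by (rule v_dominant)
  then have "v x ^ n = 0" using s lead by (simp add: n_def)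
  then show False using x by simp
qed

lemma v_algebraic_int: "algebraic_int x \<Longrightarrow> v x \<le> 1"
  unfolding algebraic_int.simps by (auto intro!: v_root_le_1)

lemma prime_divisor_less_1:
  assumes "m > 0" "v (of_nat m) < 1"
  shows "\<exists>q. Factorial_Ring.prime q \<and> q dvd m \<and> v (of_nat q) < 1"
  using assms
proof (induction m rule: less_induct)
  case (less m)
  then have "m \<noteq> 1" by auto
  then obtain q where q: "Factorial_Ring.prime q" "q dvd m" using prime_factor_nat by blast
  show ?case
  proof (cases "v (of_nat q) < 1")
    case False
    then have q1: "v (of_nat q) = 1" using v_of_nat[of q] by simp
    obtain m' where m: "m = q * m'" using q by auto
    have "q > 1" using q prime_gt_1_nat by blast
    then have "m' < m" "m' > 0" "v (of_nat m') < 1" using less.prems m q1 by auto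
    with less.IH show ?thesis using m by (metis dvd_mult)
  qed (use q in blast)
qed

end

text \<open>An integer prime to q has value 1: otherwise the Bezout identity would write 1 as a sum
  of two elements of value below 1. So the value of q determines the absolute value on all
  integers.\<close>

lemma nonarch_eq_on_nat:
  fixes v w :: "'k :: field_char_0 \<Rightarrow> real"
  assumes "nonarch_val v" "nonarch_val w" "Factorial_Ring.prime (q::nat)"
    and "v (of_nat q) = w (of_nat q)" "v (of_nat q) < 1"
  shows "v (of_nat m) = w (of_nat m)"
proof (induction m rule: less_induct)
  case (less m)
  interpret v: nonarch_val v by fact
  interpret w: nonarch_val w by fact
  have unit: "u (of_nat m) = 1" if u: "nonarch_val u" "u (of_nat q) < 1" "\<not> q dvd m" for u :: "'k \<Rightarrow> real"
  proof (rule ccontr)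
    interpret u: nonarch_val u by fact
    assume "u (of_nat m) \<noteq> 1"
    then have m: "u (of_nat m) < 1" using u.v_of_nat[of m] by simp
    have "coprime (int q) (int m)" using assms(3) u(3) by (simp add: prime_imp_coprime)
    then obtain a b where "a * int q + b * int m = 1" using bezout_int[of "int q" "int m"] by auto
    then have "(1 :: 'k) = of_int a * of_nat q + of_int b * of_nat m"
      by (metis of_int_1 of_int_add of_int_mult of_int_of_nat_eq)
    moreover have "u (of_int a * of_nat q) < 1" "u (of_int b * of_nat m) < 1"
      using u.v_of_int[of a] u.v_of_int[of b] m u(2) mult_le_one[of "u (of_int a)" "u (of_nat q)"]
      by (auto simp: mult_left_le_one_le intro: le_less_trans[OF mult_left_le_one_le])
    ultimately show False using u.v_max[of "of_int a * of_nat q" "of_int b * of_nat m"] u.v_1 by (metis max_less_iff_conj not_less)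
  qed
  show ?case
  proof (cases "q dvd m \<and> m > 0")
    case True
    then obtain m' where m: "m = q * m'" by auto
    then have "m' < m" using True assms(3) prime_gt_1_nat[of q] by auto
    then show ?thesis using less assms(4) by (simp add: m)
  next
    case False
    then show ?thesis using unit[OF assms(1)] unit[OF assms(2)] assms(4,5) by (cases "m = 0") auto
  qed
qed

lemma nonarch_eq_on_rat:
  fixes v w :: "'k :: field_char_0 \<Rightarrow> real"
  assumes "nonarch_val v" "nonarch_val w" "Factorial_Ring.prime (q::nat)"
    and "v (of_nat q) = w (of_nat q)" "v (of_nat q) < 1"
  shows "v (of_rat r) = w (of_rat r)"
proof -
  interpret v: nonarch_val v by fact
  interpret w: nonarch_val w by fact
  have int: "v (of_int n) = w (of_int n)" for n
    using nonarch_eq_on_nat[OF assms, of "nat \<bar>n\<bar>"] by (cases "n \<ge> 0") auto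
  obtain a b where "r = Rat.Fract a b" "b > 0" by (cases r rule: Rat_cases) auto
  then show ?thesis using int by (simp add: of_rat_rat divide_inverse)
qed

text \<open>The classical argument that inclusion of open unit discs makes absolute values
  equivalent. The common value at q fixes the exponent, so equivalence becomes equality. Powers of q
  serve to compare sizes, and the opposite inequality follows by passing to the inverse of
  x.\<close>

lemma nonarch_dominated_eq:
  fixes v w :: "'k :: field_char_0 \<Rightarrow> real"
  assumes v: "nonarch_val v" and w: "nonarch_val w"
    and q: "v (of_nat q) = w (of_nat q)" "v (of_nat q) < 1" "q > 0"
    and dom: "\<And>x. v x < 1 \<Longrightarrow> w x < 1"
  shows "v x = w x"
proof -
  interpret v: nonarch_val v by fact
  interpret w: nonarch_val w by fact
  define c where "c = v (of_nat q)"
  have c: "0 < c" "c < 1" unfolding c_def using q(2,3) v.v_pos[of "of_nat q"] by simp_all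
  have le: False if "v x < w x" "x \<noteq> 0" for x
  proof -
    have vx: "v x > 0" "w x > 0" using that v.v_pos w.v_pos by auto
    have "w x / v x > 1" using that vx by simp
    \<comment> \<open>A large power opens a gap wider than the factor 1 / c between the two values,
      so the gap contains a power of c.\<close>
    then obtain m where m: "(w x / v x) ^ m > 1 / c" using real_arch_pow by blast
    define b where "b = w x ^ m"
    have b: "b > 0" using vx by (simp add: b_def)
    \<comment> \<open>This k satisfies b * c < c powi k \<le> b, while v x ^ m < b * c. Dividing x ^
      m by the k-th power of q yields an element with v below 1 but w at least 1, against
      \<open>dom\<close>.\<close>
    define k where "k = \<lceil>ln b / ln c\<rceil>"
    have lc: "ln c < 0" using c by simp
    have pk: "c powi k = exp (of_int k * ln c)" using c powr_real_of_int'[of c k] by (simp add: powr_def)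
    have "of_int k * ln c \<le> (ln b / ln c) * ln c"
      using lc by (intro mult_right_mono_neg) (auto simp: k_def)
    then have "of_int k * ln c \<le> ln b" using lc by simp
    then have 1: "c powi k \<le> b" unfolding pk using b by (metis exp_le_cancel_iff exp_ln)
    have "of_int k < ln b / ln c + 1" unfolding k_def by linarith
    then have "of_int k * ln c > (ln b / ln c + 1) * ln c" using lc by (simp add: mult_strict_right_mono_neg)
    then have "of_int k * ln c > ln b + ln c" using lc by (simp add: field_simps)
    then have "exp (of_int k * ln c) > exp (ln b + ln c)" by simp
    then have 2: "c powi k > b * c" unfolding pk using b c by (simp add: exp_add)
    have 3: "v x ^ m < b * c" using m vx c by (simp add: b_def power_divide field_simps)
    have pint: "u (of_nat q powi i) = u (of_nat q) powi i" if "nonarch_val u" for u :: "'k \<Rightarrow> real" and i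
    proof -
      interpret u: nonarch_val u by fact
      show ?thesis by (cases "i \<ge> 0") (auto simp: power_int_def)
    qed
    have pos: "c powi k > 0" using c by simp
    have "v (x ^ m * inverse (of_nat q powi k)) = v x ^ m * inverse (c powi k)"
      by (simp only: v.v_simps v.v_power v.v_inverse pint[OF v] c_def)
    also have "\<dots> < 1" using 2 3 pos by (simp add: field_simps)
    finally have "w (x ^ m * inverse (of_nat q powi k)) < 1" by (rule dom)
    also have "w (x ^ m * inverse (of_nat q powi k)) = b * inverse (c powi k)"
      by (simp only: w.v_simps w.v_power w.v_inverse pint[OF w] c_def b_def q(1))
    finally show False using 1 pos by (simp add: field_simps)
  qed
  show ?thesis
  proof (cases "x = 0")
    case False
    then have "v x > 0" "w x > 0" using v.v_pos w.v_pos by auto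
    then show ?thesis using le[of x] le[of "inverse x"] False by (cases "v x" "w x" rule: linorder_cases) auto
  qed simp
qed

text \<open>The Artin-Whaples argument, by induction on the number of absolute values. An element z
  that works for J and an element y that separates i from the new index j are combined, and high
  powers of z suppress the uncontrolled size of y on J.\<close>

lemma weak_approximation:
  fixes w :: "'i \<Rightarrow> 'k :: field_char_0 \<Rightarrow> real"
  assumes "finite J" "i \<notin> J" and val: "\<And>j. j \<in> insert i J \<Longrightarrow> nonarch_val (w j)"
    and indep: "\<And>j l. j \<in> insert i J \<Longrightarrow> l \<in> insert i J \<Longrightarrow> j \<noteq> l \<Longrightarrow> \<exists>x. w j x < 1 \<and> w l x \<ge> 1"
    and big: "\<exists>x. w i x > 1"
  shows "\<exists>x. w i x > 1 \<and> (\<forall>j\<in>J. w j x < 1)"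
  using assms
proof (induction J)
  case empty
  then show ?case by auto
next
  case (insert j J)
  have "\<exists>x. w i x > 1 \<and> (\<forall>j\<in>J. w j x < 1)" by (rule insert.IH) (use insert.prems in auto)
  then obtain z where z: "w i z > 1" "\<And>l. l \<in> J \<Longrightarrow> w l z < 1" by blast
  interpret i: nonarch_val "w i" using insert.prems by simp
  interpret j: nonarch_val "w j" using insert.prems by simp
  obtain a where a: "w i a < 1" "w j a \<ge> 1" using insert.prems(3)[of i j] insert.prems(1) by auto
  obtain b where b: "w j b < 1" "w i b \<ge> 1" using insert.prems(3)[of j i] insert.prems(1) by auto
  have a0: "a \<noteq> 0" using a(2) by (metis j.v_0 not_one_le_zero)
  \<comment> \<open>The two one-sided separations combine to w i y > 1 and w j y < 1.\<close>
  define y where "y = b * inverse a"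
  have "w i a > 0" using a0 by (rule i.v_pos)
  then have inv: "inverse (w i a) > 1" "inverse (w j a) \<le> 1" using a by (simp_all add: one_less_inverse_iff inverse_le_1_iff)
  have "w i y = w i b * inverse (w i a)" by (simp only: y_def i.v_simps i.v_inverse)
  moreover have "1 * inverse (w i a) \<le> w i b * inverse (w i a)" using b inv by (intro mult_right_mono) auto
  ultimately have yi: "w i y > 1" using inv by linarith
  have "w j y = w j b * inverse (w j a)" by (simp only: y_def j.v_simps j.v_inverse)
  moreover have "w j b * inverse (w j a) \<le> w j b * 1" using inv by (intro mult_left_mono) auto
  ultimately have yj: "w j y < 1" using b by linarith
  have "\<exists>m>0. \<forall>l\<in>J. w l z ^ m * w l y < 1"
  proof -
    have "\<forall>\<^sub>F m in sequentially. w l z ^ m * w l y < 1" if l: "l \<in> J" for l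
    proof -
      interpret l: nonarch_val "w l" using insert.prems l by simp
      have "(\<lambda>m. w l z ^ m * w l y) \<longlonglongrightarrow> 0 * w l y"
        using z(2)[OF l] by (intro tendsto_mult LIMSEQ_realpow_zero tendsto_const) auto
      then show ?thesis by (intro order_tendstoD(2)) auto
    qed
    then have "\<forall>\<^sub>F m in sequentially. \<forall>l\<in>J. w l z ^ m * w l y < 1"
      using insert.hyps(1) by (simp add: eventually_ball_finite)
    then have "\<forall>\<^sub>F m in sequentially. m > 0 \<and> (\<forall>l\<in>J. w l z ^ m * w l y < 1)"
      by (intro eventually_conj eventually_gt_at_top)
    then show ?thesis using eventually_happens trivial_limit_sequentially by blast
  qed
  then obtain m :: nat where m: "m > 0" "\<And>l. l \<in> J \<Longrightarrow> w l z ^ m * w l y < 1" by blast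
  show ?case
  \<comment> \<open>If z is not large at j, then z ^ m * y is small there and the product works as
    it stands.\<close>
  proof (cases "w j z \<le> 1")
    case True
    have "w i (z ^ m * y) > 1" using z(1) yi by (simp add: less_1_mult m(1))
    moreover have "w j (z ^ m * y) < 1"
      using True yj mult_left_le_one_le[of "w j y" "w j z ^ m"] power_le_one[of "w j z" m] by simp
    moreover have "w l (z ^ m * y) < 1" if l: "l \<in> J" for l
    proof -
      interpret l: nonarch_val "w l" using insert.prems l by simp
      show ?thesis using m(2)[OF l] by simp
    qed
    ultimately show ?thesis by (intro exI[of _ "z ^ m * y"]) auto
  next
    case False
    \<comment> \<open>If z is large at j, its powers would destroy smallness there. The quotient z ^
      m / (1 + z ^ m) has value exactly 1 wherever z is large, since the absolute values are
      nonarchimedean, and the same value as z ^ m wherever z is small.\<close>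
    let ?x = "z ^ m * inverse (1 + z ^ m) * y"
    have large: "u (z ^ m * inverse (1 + z ^ m)) = 1" if "nonarch_val u" "u z > 1" for u :: "'k \<Rightarrow> real"
    proof -
      interpret u: nonarch_val u by fact
      have "u (z ^ m) > 1" unfolding u.v_power using that(2) m(1) by (rule one_less_power)
      then have "u (z ^ m + 1) = u (z ^ m)" by (intro u.v_dominant) simp
      moreover have "z \<noteq> 0" using that(2) by (metis u.v_0 not_one_less_zero)
      moreover have "u z ^ m \<noteq> 0" using \<open>u (z ^ m) > 1\<close> unfolding u.v_power by linarith
      ultimately show ?thesis by (simp add: add.commute)
    qed
    have "w i ?x > 1" using large[of "w i"] z(1) yi i.nonarch_val_axioms by simp
    moreover have "w j ?x < 1" using large[of "w j"] False yj j.nonarch_val_axioms by simp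
    moreover have "w l ?x < 1" if l: "l \<in> J" for l
    proof -
      interpret l: nonarch_val "w l" using insert.prems l by simp
      have "w l (z ^ m) < 1" using z(2)[OF l] m(1) by (simp add: power_less_one_iff)
      then have "w l (1 + z ^ m) = 1" using l.v_dominant[of "z ^ m" 1] by simp
      then show ?thesis using m(2)[OF l] by simp
    qed
    ultimately show ?thesis by (intro exI[of _ ?x]) auto
  qed
qed

section \<open>Finitely many places above a rational prime\<close>

lemma finite_places_nonarch: "\<nu> \<in> finite_places \<Longrightarrow> nonarch_val (place_abs (\<nu> :: 'k :: field_char_0 place))"
  using place_abs(2)[of \<nu>] place_abs_nonarch[of \<nu>]
  by (simp add: nonarch_val_def nonarch_val_axioms_def abs_val_def finite_places_def)

text \<open>From infinitely many such places choose one more than the size of a spanning set of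
  \<open>'k\<close> over the rationals. Weak approximation gives each chosen place an element that
  is large there and small at the others, and these elements are linearly independent over the
  rationals, which is too many.\<close>

lemma finite_places_above_prime:
  assumes nf: "number_field TYPE('k :: field_char_0)" and q: "Factorial_Ring.prime (q :: nat)"
  shows "finite {\<nu> \<in> finite_places :: 'k place set. place_abs \<nu> (of_nat q) < 1}" (is "finite ?P")
proof (rule ccontr)
  assume "infinite ?P"
  obtain S :: "'k set" where S: "finite S" "module.span (\<lambda>(q::rat) x. of_rat q * x) S = UNIV"
    using nf by (auto simp: number_field_def)
  interpret Q: vector_space "\<lambda>(q::rat) (x :: 'k). of_rat q * x"
    by unfold_locales (auto simp: algebra_simps of_rat_add of_rat_mult)
  obtain I where I: "finite I" "card I = Suc (card S)" "I \<subseteq> ?P"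
    using infinite_arbitrarily_large[OF \<open>infinite ?P\<close>] by blast
  have q1: "real q > 1" using q prime_gt_1_nat by simp
  \<comment> \<open>The exponent that normalises the value of q to 1 / q. With this common value the
    absolute values agree on the rationals.\<close>
  define s where "s \<nu> = - ln q / ln (place_abs \<nu> (of_nat q))" for \<nu> :: "'k place"
  define w where "w \<nu> x = place_abs \<nu> x powr s \<nu>" for \<nu> :: "'k place" and x
  have w: "nonarch_val (w \<nu>)" "w \<nu> (of_nat q) = 1 / q" "s \<nu> > 0" if \<nu>: "\<nu> \<in> I" for \<nu>
  proof -
    interpret v: nonarch_val "place_abs \<nu>" using \<nu> I by (intro finite_places_nonarch) auto
    have vq: "0 < place_abs \<nu> (of_nat q)" "place_abs \<nu> (of_nat q) < 1"
      using \<nu> I v.v_pos[of "of_nat q"] q1 by auto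
    then show s: "s \<nu> > 0" using q1 by (simp add: s_def divide_less_0_iff)
    have max: "w \<nu> (x + y) \<le> max (w \<nu> x) (w \<nu> y)" for x y
      using v.v_max[of x y] s unfolding w_def by (metis le_max_iff_disj less_eq_real_def powr_mono2 v.v_simps(1))
    then have "w \<nu> (x + y) \<le> w \<nu> x + w \<nu> y" for x y
    proof -
      have "w \<nu> x \<ge> 0" "w \<nu> y \<ge> 0" by (simp_all add: w_def)
      then show ?thesis using max[of x y] by linarith
    qed
    then show "nonarch_val (w \<nu>)" using max
      by unfold_locales (auto simp: absolute_value_def nonarchimedean_def w_def powr_mult)
    show "w \<nu> (of_nat q) = 1 / q"
      using vq q1 by (simp add: w_def s_def powr_def exp_minus field_simps)
  qed
  \<comment> \<open>Equal normalisations mean equivalent representatives. A place is defined as the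
    class of some v, while \<open>place_abs\<close> is any of its members, hence the detour through
    symmetry and transitivity.\<close>
  have eqv: "w \<nu> = w \<mu> \<Longrightarrow> \<nu> = \<mu>" if "\<nu> \<in> I" "\<mu> \<in> I" for \<nu> \<mu>
  proof -
    assume e: "w \<nu> = w \<mu>"
    have pl: "\<nu> \<in> places" "\<mu> \<in> places" using that I by (auto simp: finite_places_def)
    interpret a: abs_val "place_abs \<nu>" using place_abs(2)[OF pl(1)] by (simp add: abs_val_def)
    interpret b: abs_val "place_abs \<mu>" using place_abs(2)[OF pl(2)] by (simp add: abs_val_def)
    have "place_abs \<mu> x = place_abs \<nu> x powr (s \<nu> / s \<mu>)" for x
    proof -
      have "place_abs \<mu> x = w \<mu> x powr (1 / s \<mu>)" using w(3)[OF that(2)] by (simp add: w_def powr_powr)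
      also have "\<dots> = place_abs \<nu> x powr (s \<nu> / s \<mu>)" unfolding e[symmetric] by (simp add: w_def powr_powr)
      finally show ?thesis .
    qed
    then have ev: "equivalent_absolute_values (place_abs \<nu>) (place_abs \<mu>)"
      unfolding equivalent_absolute_values_def using w(3) that by (intro exI[of _ "s \<nu> / s \<mu>"]) auto
    have trans: "equivalent_absolute_values x z" if xy: "equivalent_absolute_values x y" and yz: "equivalent_absolute_values y z" for x y z :: "'k \<Rightarrow> real"
    proof -
      obtain s where "s > 0" "\<forall>a. y a = x a powr s" using xy unfolding equivalent_absolute_values_def by blast
      moreover obtain t where "t > 0" "\<forall>a. z a = y a powr t" using yz unfolding equivalent_absolute_values_def by blast
      ultimately show ?thesis unfolding equivalent_absolute_values_def by (intro exI[of _ "s * t"]) (auto simp: powr_powr)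
    qed
    have sym: "equivalent_absolute_values y x" if xy: "equivalent_absolute_values x y" and x: "absolute_value x" for x y :: "'k \<Rightarrow> real"
    proof -
      obtain s where "s > 0" "\<forall>a. y a = x a powr s" using xy unfolding equivalent_absolute_values_def by blast
      then show ?thesis unfolding equivalent_absolute_values_def using x
        by (intro exI[of _ "1 / s"]) (auto simp: powr_powr absolute_value_def)
    qed
    have cls: "\<rho> = {x. absolute_value x \<and> equivalent_absolute_values (place_abs \<rho>) x}" if \<rho>: "\<rho> \<in> places" for \<rho> :: "'k place"
    proof -
      obtain v where v: "nontrivial_absolute_value v" "\<rho> = {w. absolute_value w \<and> equivalent_absolute_values v w}"
        using \<rho> by (auto simp: places_def)
      have vp: "equivalent_absolute_values v (place_abs \<rho>)" "absolute_value v" using place_abs(1)[OF \<rho>] v by (auto simp: nontrivial_absolute_value_def)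
      show ?thesis
        by (subst v(2)) (use trans[OF vp(1)] trans[OF sym[OF vp]] in blast)
    qed
    show "\<nu> = \<mu>"
      by (subst cls[OF pl(1)], subst cls[OF pl(2)]) (use trans[OF ev] trans[OF sym[OF ev place_abs(2)[OF pl(1)]]] in blast)
  qed
  have "\<exists>x. w \<nu> x > 1 \<and> (\<forall>\<mu>\<in>I - {\<nu>}. w \<mu> x < 1)" if \<nu>: "\<nu> \<in> I" for \<nu>
  proof (rule weak_approximation)
    have ins: "insert \<nu> (I - {\<nu>}) = I" using \<nu> by auto
    show "nonarch_val (w j)" if "j \<in> insert \<nu> (I - {\<nu>})" for j using that w(1) unfolding ins by blast
    show "\<exists>x. w j x < 1 \<and> w l x \<ge> 1" if "j \<in> insert \<nu> (I - {\<nu>})" "l \<in> insert \<nu> (I - {\<nu>})" "j \<noteq> l" for j l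
    proof (rule ccontr)
      assume "\<not> (\<exists>x. w j x < 1 \<and> w l x \<ge> 1)"
      then have dom: "w l x < 1" if "w j x < 1" for x using that by (meson not_le)
      have jl: "j \<in> I" "l \<in> I" using that ins by auto
      have "w j x = w l x" for x
      proof (rule nonarch_dominated_eq[OF w(1)[OF jl(1)] w(1)[OF jl(2)]])
        show "w j (of_nat q) = w l (of_nat q)" by (simp only: w(2)[OF jl(1)] w(2)[OF jl(2)])
        show "w j (of_nat q) < 1" unfolding w(2)[OF jl(1)] using q1 by simp
        show "q > 0" using q1 by simp
      qed (rule dom)
      then have "w j = w l" by (rule ext)
      then show False using eqv[OF jl] \<open>j \<noteq> l\<close> by simp
    qed
    interpret v: nonarch_val "w \<nu>" using w(1)[OF \<nu>] .
    show "\<exists>x. w \<nu> x > 1" using w(2)[OF \<nu>] q1 by (intro exI[of _ "inverse (of_nat q)"]) simp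
  qed (use I in auto)
  then have "\<exists>x. \<forall>\<nu>\<in>I. w \<nu> (x \<nu>) > 1 \<and> (\<forall>\<mu>\<in>I - {\<nu>}. w \<mu> (x \<nu>) < 1)"
    by (intro bchoice) blast
  then obtain x where x: "\<And>\<nu>. \<nu> \<in> I \<Longrightarrow> w \<nu> (x \<nu>) > 1" "\<And>\<nu> \<mu>. \<nu> \<in> I \<Longrightarrow> \<mu> \<in> I \<Longrightarrow> \<mu> \<noteq> \<nu> \<Longrightarrow> w \<mu> (x \<nu>) < 1"
    by blast
  have inj: "inj_on x I"
  proof (rule inj_onI)
    fix \<nu> \<mu> assume I: "\<nu> \<in> I" "\<mu> \<in> I" and "x \<nu> = x \<mu>"
    then show "\<nu> = \<mu>" using x(1)[OF I(2)] x(2)[OF I] by (cases "\<nu> = \<mu>") auto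
  qed
  have "Q.independent (x ` I)"
  proof (rule Q.independent_if_scalars_zero)
    show "finite (x ` I)" using I by simp
    fix f y assume f: "(\<Sum>y\<in>x ` I. of_rat (f y) * y) = 0" and y: "y \<in> x ` I"
    define r where "r \<nu> = f (x \<nu>)" for \<nu>
    have sum: "(\<Sum>\<nu>\<in>I. of_rat (r \<nu>) * x \<nu>) = 0" using f inj by (simp add: sum.reindex r_def)
    show "f y = 0"
    proof (rule ccontr)
      assume "f y \<noteq> 0"
      then obtain \<nu>0 where \<nu>0: "\<nu>0 \<in> I" "r \<nu>0 \<noteq> 0" using y by (auto simp: r_def)
      \<comment> \<open>The size of a rational coefficient. By \<open>nonarch_eq_on_rat\<close> it
        is the same at every place of I, so coefficients can be compared without mentioning a
        place.\<close>
      define N where "N \<nu> = w \<nu>0 (of_rat (r \<nu>))" for \<nu>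
      have N: "w \<mu> (of_rat (r \<nu>)) = N \<nu>" if "\<mu> \<in> I" for \<mu> \<nu>
        unfolding N_def by (rule nonarch_eq_on_rat[OF w(1)[OF that] w(1)[OF \<nu>0(1)] q]) (use w(2) that \<nu>0 q1 in auto)
      have fin: "finite (N ` I)" "N ` I \<noteq> {}" using I \<nu>0 by auto
      \<comment> \<open>At the place belonging to a largest coefficient its own term exceeds N
        \<nu>, because x \<nu> is large there, and the other terms do not, because their elements
        are small. The dominant term prevents the sum from being zero.\<close>
      obtain \<nu> where \<nu>: "\<nu> \<in> I" "N \<nu> = Max (N ` I)" using Max_in[OF fin] by (metis imageE)
      have max: "N \<mu> \<le> N \<nu>" if "\<mu> \<in> I" for \<mu> unfolding \<nu>(2) using fin that by auto
      interpret v: nonarch_val "w \<nu>" using w(1)[OF \<nu>(1)] .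
      interpret v0: nonarch_val "w \<nu>0" using w(1)[OF \<nu>0(1)] .
      have "N \<nu>0 > 0" using \<nu>0 v0.v_pos[of "of_rat (r \<nu>0)"] by (simp add: N_def)
      then have pos: "N \<nu> > 0" using max[OF \<nu>0(1)] by simp
      have big: "w \<nu> (of_rat (r \<nu>) * x \<nu>) > N \<nu>" using x(1)[OF \<nu>(1)] pos by (simp add: N[OF \<nu>(1)])
      have "w \<nu> (\<Sum>\<mu>\<in>I - {\<nu>}. of_rat (r \<mu>) * x \<mu>) < w \<nu> (of_rat (r \<nu>) * x \<nu>)"
      proof (rule v.v_sum_less)
        show "w \<nu> (of_rat (r \<nu>) * x \<nu>) > 0" using big pos by linarith
        fix \<mu> assume \<mu>: "\<mu> \<in> I - {\<nu>}"
        have "N \<mu> \<ge> 0" by (simp add: N_def)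
        have less: "w \<nu> (x \<mu>) < 1" by (rule x(2)) (use \<mu> \<nu> in auto)
        have "w \<nu> (of_rat (r \<mu>) * x \<mu>) = N \<mu> * w \<nu> (x \<mu>)" by (simp add: N[OF \<nu>(1)])
        also have "\<dots> \<le> N \<mu> * 1" using less \<open>N \<mu> \<ge> 0\<close> by (intro mult_left_mono) auto
        also have "\<dots> \<le> N \<nu>" using max \<mu> by simp
        finally show "w \<nu> (of_rat (r \<mu>) * x \<mu>) < w \<nu> (of_rat (r \<nu>) * x \<nu>)" using big by linarith
      qed
      then have "w \<nu> (of_rat (r \<nu>) * x \<nu> + (\<Sum>\<mu>\<in>I - {\<nu>}. of_rat (r \<mu>) * x \<mu>)) = w \<nu> (of_rat (r \<nu>) * x \<nu>)"
        by (rule v.v_dominant)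
      moreover have "of_rat (r \<nu>) * x \<nu> + (\<Sum>\<mu>\<in>I - {\<nu>}. of_rat (r \<mu>) * x \<mu>) = 0"
        using sum I(1) \<nu>(1) by (simp add: sum.remove)
      ultimately have "w \<nu> (of_rat (r \<nu>) * x \<nu>) = 0" by (simp only: v.v_0)
      then show False using big pos by linarith
    qed
  qed
  then have "card (x ` I) \<le> card S" using Q.independent_span_bound[OF S(1)] S(2) by blast
  then show False using I card_image[OF inj] by simp
qed

lemma number_field_algebraic:
  fixes k :: "'k :: field_char_0"
  assumes nf: "number_field TYPE('k)"
  obtains p where "p \<noteq> 0" "\<And>i. Polynomial.coeff p i \<in> \<int>" "poly p k = 0"
proof -
  obtain S :: "'k set" where S: "finite S" "module.span (\<lambda>(q::rat) x. of_rat q * x) S = UNIV"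
    using nf by (auto simp: number_field_def)
  interpret Q: vector_space "\<lambda>(q::rat) (x :: 'k). of_rat q * x"
    by unfold_locales (auto simp: algebra_simps of_rat_add of_rat_mult)
  have "\<exists>p :: 'k poly. p \<noteq> 0 \<and> (\<forall>i. Polynomial.coeff p i \<in> \<rat>) \<and> poly p k = 0"
  proof (cases "inj_on (\<lambda>i. k ^ i) {..card S}")
    case False
    then obtain i j where ij: "i \<noteq> j" "k ^ i = k ^ j" by (auto simp: inj_on_def)
    have "Polynomial.coeff (Polynomial.monom 1 i - Polynomial.monom 1 j) i \<noteq> (0 :: 'k)" using ij by simp
    then have "Polynomial.monom 1 i - Polynomial.monom 1 j \<noteq> (0 :: 'k poly)" by (metis Polynomial.coeff_0)
    then show ?thesis using ij by (intro exI[of _ "Polynomial.monom 1 i - Polynomial.monom 1 j"]) (auto simp: poly_monom)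
  next
    case True
    let ?B = "(\<lambda>i. k ^ i) ` {..card S}"
    have "Q.dependent ?B"
    proof (rule ccontr)
      assume "Q.independent ?B"
      from Q.independent_span_bound[OF S(1) this] show False using S(2) card_image[OF True] by simp
    qed
    then obtain u where u: "\<exists>y\<in>?B. u y \<noteq> 0" "(\<Sum>y\<in>?B. of_rat (u y) * y) = 0"
      using Q.dependent_finite[of ?B] by auto
    define p where "p = (\<Sum>i\<le>card S. Polynomial.monom (of_rat (u (k ^ i)) :: 'k) i)"
    have c: "Polynomial.coeff p i = (if i \<le> card S then of_rat (u (k ^ i)) else 0)" for i
      by (simp add: p_def coeff_sum)
    have "poly p k = (\<Sum>y\<in>?B. of_rat (u y) * y)"
      using True by (simp add: p_def poly_sum poly_monom sum.reindex)
    moreover obtain i where "i \<le> card S" "u (k ^ i) \<noteq> 0" using u by auto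
    then have "p \<noteq> 0" using c[of i] by auto
    ultimately show ?thesis using u c by (intro exI[of _ p]) auto
  qed
  then have "algebraic k" by (subst algebraic_altdef) blast
  then show ?thesis using that by (auto simp: algebraic_def)
qed

text \<open>If k has value above 1 at \<nu>, then by \<open>v_root_le_1\<close> the leading
  coefficient of an integer polynomial with root k is not a unit at \<nu>. So \<nu> lies above one
  of the finitely many primes dividing that coefficient.\<close>

lemma finite_places_greater_1:
  fixes k :: "'k :: field_char_0"
  assumes nf: "number_field TYPE('k)"
  shows "finite {\<nu> \<in> finite_places. place_abs \<nu> k > 1}"
proof -
  obtain p :: "'k poly" where p: "p \<noteq> 0" "\<And>i. Polynomial.coeff p i \<in> \<int>" "poly p k = 0"
    using number_field_algebraic[OF nf] by blast
  obtain a where a: "Polynomial.lead_coeff p = of_int a" using p(2) by (auto elim: Ints_cases)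
  then have a0: "a \<noteq> 0" using p(1) by auto
  define m where "m = nat \<bar>a\<bar>"
  have m: "m > 0" using a0 by (simp add: m_def)
  have "{\<nu> \<in> finite_places. place_abs \<nu> k > 1} \<subseteq> (\<Union>q\<in>{q. Factorial_Ring.prime q \<and> q dvd m}. {\<nu> \<in> finite_places. place_abs \<nu> (of_nat q) < 1})"
  proof
    fix \<nu> assume \<nu>: "\<nu> \<in> {\<nu> \<in> finite_places. place_abs \<nu> k > 1}"
    then interpret v: nonarch_val "place_abs \<nu>" by (intro finite_places_nonarch) auto
    have "place_abs \<nu> (of_nat m) = place_abs \<nu> (Polynomial.lead_coeff p)"
      by (cases "a \<ge> 0") (auto simp: m_def a)
    then have "place_abs \<nu> (of_nat m) \<noteq> 1" using v.v_root_le_1[OF p] \<nu> by auto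
    then have "place_abs \<nu> (of_nat m) < 1" using v.v_of_nat[of m] by simp
    then show "\<nu> \<in> (\<Union>q\<in>{q. Factorial_Ring.prime q \<and> q dvd m}. {\<nu> \<in> finite_places. place_abs \<nu> (of_nat q) < 1})"
      using v.prime_divisor_less_1[OF m] \<nu> by blast
  qed
  moreover have "finite (\<Union>q\<in>{q. Factorial_Ring.prime q \<and> q dvd m}. {\<nu> \<in> finite_places :: 'k place set. place_abs \<nu> (of_nat q) < 1})"
  proof (rule finite_UN_I)
    show "finite {q. Factorial_Ring.prime q \<and> q dvd m}"
      by (rule finite_subset[OF _ finite_divisors_nat[OF m]]) auto
  qed (use finite_places_above_prime[OF nf] in simp)
  ultimately show ?thesis by (rule finite_subset)
qed

lemma finite_places_not_1:
  fixes k :: "'k :: field_char_0"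
  assumes nf: "number_field TYPE('k)" and k: "k \<noteq> 0"
  shows "finite {\<nu> \<in> finite_places. place_abs \<nu> k \<noteq> 1}"
proof (rule finite_subset)
  show "{\<nu> \<in> finite_places. place_abs \<nu> k \<noteq> 1} \<subseteq> {\<nu> \<in> finite_places. place_abs \<nu> k > 1} \<union> {\<nu> \<in> finite_places. place_abs \<nu> (inverse k) > 1}"
  proof
    fix \<nu> assume \<nu>: "\<nu> \<in> {\<nu> \<in> finite_places. place_abs \<nu> k \<noteq> 1}"
    then interpret v: nonarch_val "place_abs \<nu>" by (intro finite_places_nonarch) auto
    have "place_abs \<nu> k > 0" using k by (rule v.v_pos)
    then show "\<nu> \<in> {\<nu> \<in> finite_places. place_abs \<nu> k > 1} \<union> {\<nu> \<in> finite_places. place_abs \<nu> (inverse k) > 1}"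
      using \<nu> by (auto simp: one_less_inverse_iff)
  qed
qed (use finite_places_greater_1[OF nf] in auto)

section \<open>Splittings from matrices\<close>

lemma sum_swap3: "(\<Sum>k\<in>A. \<Sum>l\<in>B. \<Sum>a\<in>C. g k l a) = (\<Sum>l\<in>B. \<Sum>a\<in>C. \<Sum>k\<in>A. g k l a)"
  by (subst sum.swap, intro sum.cong refl, rule sum.swap)

lemma finsum_ring_of_type_algebra: "finsum (ring_of_type_algebra :: 'b :: ring_1 ring) g A = sum g A"
proof -
  interpret R: ring "ring_of_type_algebra :: 'b ring" by (rule ring_ring_of_type_algebra)
  show ?thesis
    by (induction A rule: infinite_finite_induct) (auto simp: R.finsum_infinite R.finsum_insert)
qed

lemma central_simple_basis_exists:
  fixes scale :: "'k :: field \<Rightarrow> 'b :: ring_1 \<Rightarrow> 'b"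
  assumes csa: "central_simple_algebra scale" and dim: "vector_space.dim scale (UNIV :: 'b set) = N" "N > 0"
  obtains e co where "central_simple_basis scale N e co"
proof -
  interpret V: vector_space scale using csa by (simp add: central_simple_algebra_def is_algebra_def)
  obtain B where B: "V.independent B" "UNIV \<subseteq> V.span B" "card B = N"
    using V.basis_exists[of UNIV] dim by metis
  have fin: "finite B" using B dim by (auto intro: card_ge_0_finite)
  obtain e where e: "bij_betw e {..<N} B"
    using ex_bij_betw_nat_finite[OF fin] B(3) by (auto simp: atLeast0LessThan)
  have "central_simple_basis scale N e (\<lambda>x i. V.representation B x (e i))"
  proof
    show "central_simple_algebra scale" by (rule csa)
    show "V.representation B (x + y) (e i) = V.representation B x (e i) + V.representation B y (e i)" for x y i
      using B by (subst V.representation_add) auto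
    show "V.representation B (scale c x) (e i) = c * V.representation B x (e i)" for c x i
      using B by (subst V.representation_scale) auto
    show "x = (\<Sum>i<N. scale (V.representation B x (e i)) (e i))" for x
    proof -
      have "(\<Sum>i<N. scale (V.representation B x (e i)) (e i)) = (\<Sum>b\<in>B. scale (V.representation B x b) b)"
        by (rule sum.reindex_bij_betw[OF e])
      also have "\<dots> = x" using B fin by (intro V.sum_representation_eq) auto
      finally show ?thesis by simp
    qed
    show "V.representation B (e j) (e i) = (if i = j then 1 else 0)" if "i < N" "j < N" for i j
      using B e that by (subst V.representation_basis) (auto simp: bij_betw_def inj_on_def)
  qed
  then show ?thesis by (rule that)
qed

lemma (in central_simple_basis) based_algebra_types:
  "based_algebra (ring_of_type_algebra :: 'k ring) (ring_of_type_algebra :: 'b ring) (\<lambda>c. scale c 1) N e"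
  and coord_types: "i < N \<Longrightarrow> based_algebra.coord (ring_of_type_algebra :: 'k ring) (ring_of_type_algebra :: 'b ring) (\<lambda>c. scale c 1) N e x i = co x i"
proof -
  interpret B: ring "ring_of_type_algebra :: 'b ring" by (rule ring_ring_of_type_algebra)
  interpret K: field "ring_of_type_algebra :: 'k ring" by (rule field_type_algebra)
  have s: "(\<Oplus>\<^bsub>(ring_of_type_algebra :: 'b ring)\<^esub>i\<in>{..<N}. scale (r i) 1 \<otimes>\<^bsub>ring_of_type_algebra\<^esub> e i) = (\<Sum>i<N. scale (r i) (e i))" for r
    by (simp add: finsum_ring_of_type_algebra is_alg)
  have u: "co (\<Sum>i<N. scale (r i) (e i)) l = r l" if "l < N" for r l
    using that by (simp add: co_sum co_scale co_e if_distrib cong: if_cong)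
  show *: "based_algebra (ring_of_type_algebra :: 'k ring) (ring_of_type_algebra :: 'b ring) (\<lambda>c. scale c 1) N e"
  proof (unfold_locales, goal_cases)
    case 1
    show ?case by (rule ring_hom_memI) (auto simp: is_alg scale_left_distrib)
  next
    case 4
    then show ?case unfolding s using co_expand by auto
  next
    case (5 r r' i)
    then show ?case unfolding s using u by metis
  qed (auto simp: is_alg)
  interpret BA: based_algebra "ring_of_type_algebra :: 'k ring" "ring_of_type_algebra :: 'b ring" "\<lambda>c. scale c 1" N e by (rule *)
  assume "i < N"
  then show "BA.coord x i = co x i"
    by (intro BA.coord_eqI) (simp_all only: s, simp_all flip: co_expand)
qed

lemma hom_sum:
  fixes i :: "'l :: comm_ring_1 \<Rightarrow> 't"
  assumes L: "ring L" and i: "i \<in> ring_hom (ring_of_type_algebra :: 'l ring) L"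
  shows "i (sum g A) = (\<Oplus>\<^bsub>L\<^esub>a\<in>A. i (g a))"
proof -
  interpret L: ring L by (rule L)
  have cl: "i x \<in> carrier L" for x using ring_hom_closed[OF i, of x] by simp
  have z: "i 0 = \<zero>\<^bsub>L\<^esub>" using ring_hom_zero[OF i _ L] ring_ring_of_type_algebra by simp
  show ?thesis
  proof (induction A rule: infinite_finite_induct)
    case (insert a A)
    have "i (g a + sum g A) = i (g a) \<oplus>\<^bsub>L\<^esub> i (sum g A)" using ring_hom_add[OF i, of "g a" "sum g A"] by simp
    then show ?case using insert cl by (simp add: L.finsum_insert)
  qed (auto simp: z L.finsum_infinite)
qed

text \<open>The matrices R k are meant as images of the basis elements, \<gamma> and \<omega> as
  structure constants and coordinates of the unit, S as the inverse of R. All identities are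
  polynomial and live over \<open>'l\<close>, so they may be pushed to L by i even though A is not
  an algebra over \<open>'l\<close>; j and i only have to agree on the structure constants.\<close>

lemma splitting_of_matrices:
  fixes F :: "'f ring" and L :: "'t ring" and i :: "'l :: comm_ring_1 \<Rightarrow> 't" and R S \<gamma> :: "nat \<Rightarrow> nat \<Rightarrow> nat \<Rightarrow> 'l"
  assumes A: "based_algebra F A f N e" and L: "field L" and j: "j \<in> ring_hom F L"
    and i: "i \<in> ring_hom (ring_of_type_algebra :: 'l ring) L"
    and mult: "\<And>a b r c. a < N \<Longrightarrow> b < N \<Longrightarrow> r < n \<Longrightarrow> c < n \<Longrightarrow>
      (\<Sum>h<n. R a r h * R b h c) = (\<Sum>k<N. \<gamma> a b k * R k r c)"
    and one: "\<And>r c. r < n \<Longrightarrow> c < n \<Longrightarrow> (\<Sum>k<N. \<omega> k * R k r c) = (if r = c then 1 else 0)"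
    and SR: "\<And>r c r' c'. r < n \<Longrightarrow> c < n \<Longrightarrow> r' < n \<Longrightarrow> c' < n \<Longrightarrow>
      (\<Sum>k<N. S r c k * R k r' c') = (if r' = r \<and> c' = c then 1 else 0)"
    and RS: "\<And>k k'. k < N \<Longrightarrow> k' < N \<Longrightarrow> (\<Sum>r<n. \<Sum>c<n. R k r c * S r c k') = (if k = k' then 1 else 0)"
    and \<gamma>: "\<And>a b k. a < N \<Longrightarrow> b < N \<Longrightarrow> k < N \<Longrightarrow> j (based_algebra.coord F A f N e (e a \<otimes>\<^bsub>A\<^esub> e b) k) = i (\<gamma> a b k)"
    and \<omega>: "\<And>k. k < N \<Longrightarrow> j (based_algebra.coord F A f N e \<one>\<^bsub>A\<^esub> k) = i (\<omega> k)"
  shows "\<exists>\<phi>. splitting F f A j L n \<phi>"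
proof -
  interpret A: based_algebra F A f N e by (rule A)
  interpret L: field L by (rule L)
  interpret L: record_cring L by unfold_locales
  interpret T: tensor_based F A L f j N e
    by unfold_locales (use j A.f A.central in auto)
  interpret TB: based_algebra L T.T "T.pt \<one>\<^bsub>A\<^esub>" N "\<lambda>i. T.pt (e i) \<one>\<^bsub>L\<^esub>" by (rule T.tensor_basis)
  \<comment> \<open>The identities between sums are rearranged in \<open>ring_product\<close>, where
    the type class lemmas on finite sums apply, and \<open>?c\<close> carries them back to L.
    Lifting does not respect sums and products, so every comparison is made under \<open>?c\<close>,
    by \<open>csum\<close> and \<open>cmul\<close>.\<close>
  let ?c = "component L" and ?l = "lift_component L"
  have icl: "i x \<in> carrier L" for x using ring_hom_closed[OF i, of x] by simp
  have i01: "i 0 = \<zero>\<^bsub>L\<^esub>" "i 1 = \<one>\<^bsub>L\<^esub>"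
    using ring_hom_zero[OF i _ L.ring_axioms] ring_ring_of_type_algebra ring_hom_one[OF i] by simp_all
  have ci: "?c (?l (i x)) = i x" for x using icl by simp
  have im: "i (x * y) = i x \<otimes>\<^bsub>L\<^esub> i y" for x y using ring_hom_mult[OF i, of x y] by simp
  have isum: "i (\<Sum>a\<in>I. x a * y a) = ?c (\<Sum>a\<in>I. ?l (i (x a)) * ?l (i (y a)))" for I :: "nat set" and x y
    by (simp add: hom_sum[OF L.ring_axioms i] L.component_sum im ci)
  have csum: "?c (\<Sum>a\<in>I. x a) = ?c (\<Sum>a\<in>I. y a)" if "\<And>a. a \<in> I \<Longrightarrow> ?c (x a) = ?c (y a)" for I :: "nat set" and x y
    unfolding L.component_sum using that by (intro L.finsum_cong') auto
  have cmul: "?c (x * y) = ?c (x' * y')" if "?c x = ?c x'" "?c y = ?c y'" for x y x' y'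
    using that by simp
  define R' where "R' k r c = ?l (i (R k r c))" for k r c
  define S' where "S' r c k = ?l (i (S r c k))" for r c k
  define G where "G a b k = ?l (i (\<gamma> a b k))" for a b k
  define zt where "zt z k = ?l (TB.coord z k)" for z k
  have czt: "?c (zt z k) = TB.coord z k" if "z \<in> carrier T.T" "k < N" for z k
    using that by (simp add: zt_def)
  have cR: "?c (R' k r c) = i (R k r c)" "?c (S' r c k) = i (S r c k)" for k r c
    by (simp_all add: R'_def S'_def ci)
  define \<phi> where "\<phi> z = (\<lambda>r\<in>{..<n}. \<lambda>c\<in>{..<n}. \<Oplus>\<^bsub>L\<^esub>k\<in>{..<N}. TB.coord z k \<otimes>\<^bsub>L\<^esub> i (R k r c))" for z
  have \<phi>: "\<phi> z r c = ?c (\<Sum>k<N. zt z k * R' k r c)" if "z \<in> carrier T.T" "r < n" "c < n" for z r c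
    using that by (auto simp: \<phi>_def L.component_sum czt cR icl intro!: L.finsum_cong')
  have \<phi>_carrier: "\<phi> z \<in> carrier (matrix_ring n L)" if "z \<in> carrier T.T" for z
    using that by (auto simp: matrix_ring_def \<phi>_def icl intro!: L.finsum_closed)
  have ext: "M = M'" if "M \<in> carrier (matrix_ring n L)" "M' \<in> carrier (matrix_ring n L)"
    "\<And>r c. r < n \<Longrightarrow> c < n \<Longrightarrow> M r c = M' r c" for M M'
  proof (rule PiE_ext)
    show "M \<in> {..<n} \<rightarrow>\<^sub>E ({..<n} \<rightarrow>\<^sub>E carrier L)" "M' \<in> {..<n} \<rightarrow>\<^sub>E ({..<n} \<rightarrow>\<^sub>E carrier L)"
      using that by (simp_all add: matrix_ring_def)
    fix r assume "r \<in> {..<n}"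
    then show "M r = M' r" using that
      by (intro PiE_ext[of "M r" "{..<n}" "\<lambda>_. carrier L"]) (auto simp: matrix_ring_def PiE_iff)
  qed
  have coord_mult: "TB.coord (z \<otimes>\<^bsub>T.T\<^esub> w) k = ?c (\<Sum>l<N. zt w l * (\<Sum>a<N. zt z a * G a l k))"
    if "z \<in> carrier T.T" "w \<in> carrier T.T" "k < N" for z w k
  proof -
    have g: "TB.coord (T.pt (e a) \<one>\<^bsub>L\<^esub> \<otimes>\<^bsub>T.T\<^esub> T.pt (e l) \<one>\<^bsub>L\<^esub>) k = ?c (G a l k)" if "a < N" "l < N" for a l
      using that \<open>k < N\<close> by (simp add: T.tensor_coord_pure \<gamma> G_def ci icl)
    have "TB.coord (z \<otimes>\<^bsub>T.T\<^esub> T.pt (e l) \<one>\<^bsub>L\<^esub>) k = ?c (\<Sum>a<N. zt z a * G a l k)" if "l < N" for l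
      using that \<open>z \<in> carrier T.T\<close> \<open>k < N\<close>
      by (subst TB.coord_mult') (auto simp: L.component_sum czt g simp del: T.pt_mult intro!: L.finsum_cong')
    then show ?thesis
      using that by (subst TB.coord_mult) (auto simp: L.component_sum[of _ "{..<N}"] czt intro!: L.finsum_cong')
  qed
  have \<phi>_mult: "\<phi> (z \<otimes>\<^bsub>T.T\<^esub> w) = \<phi> z \<otimes>\<^bsub>matrix_ring n L\<^esub> \<phi> w" if zw: "z \<in> carrier T.T" "w \<in> carrier T.T" for z w
  proof (rule ext)
    show "\<phi> (z \<otimes>\<^bsub>T.T\<^esub> w) \<in> carrier (matrix_ring n L)" using zw by (intro \<phi>_carrier) simp
    show "\<phi> z \<otimes>\<^bsub>matrix_ring n L\<^esub> \<phi> w \<in> carrier (matrix_ring n L)"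
      using \<phi>_carrier[OF zw(1)] \<phi>_carrier[OF zw(2)] by (auto simp: matrix_ring_def PiE_iff intro!: L.finsum_closed)
    fix r c assume rc: "r < n" "c < n"
    have "\<phi> (z \<otimes>\<^bsub>T.T\<^esub> w) r c = ?c (\<Sum>k<N. (\<Sum>l<N. zt w l * (\<Sum>a<N. zt z a * G a l k)) * R' k r c)"
      unfolding \<phi>_def using rc zw by (auto simp: L.component_sum[of _ "{..<N}"] coord_mult[symmetric] cR icl coord_mult intro!: L.finsum_cong')
    also have "(\<Sum>k<N. (\<Sum>l<N. zt w l * (\<Sum>a<N. zt z a * G a l k)) * R' k r c) =
      (\<Sum>l<N. \<Sum>a<N. zt w l * zt z a * (\<Sum>k<N. G a l k * R' k r c))"
      unfolding sum_distrib_left sum_distrib_right by (subst sum_swap3) (simp add: ac_simps)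
    also have "?c \<dots> = ?c (\<Sum>l<N. \<Sum>a<N. zt w l * zt z a * (\<Sum>h<n. R' a r h * R' l h c))"
      using rc by (intro csum cmul refl) (simp add: G_def R'_def mult flip: isum)
    also have "(\<Sum>l<N. \<Sum>a<N. zt w l * zt z a * (\<Sum>h<n. R' a r h * R' l h c)) =
      (\<Sum>h<n. (\<Sum>a<N. zt z a * R' a r h) * (\<Sum>l<N. zt w l * R' l h c))"
      unfolding sum_distrib_left sum_distrib_right by (rule sym, subst sum_swap3) (simp add: ac_simps)
    also have "?c \<dots> = (\<phi> z \<otimes>\<^bsub>matrix_ring n L\<^esub> \<phi> w) r c"
      using rc zw by (auto simp: matrix_ring_def L.component_sum[of _ "{..<n}"] \<phi> intro!: L.finsum_cong')
    finally show "\<phi> (z \<otimes>\<^bsub>T.T\<^esub> w) r c = (\<phi> z \<otimes>\<^bsub>matrix_ring n L\<^esub> \<phi> w) r c" .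
  qed
  have \<phi>_scalar: "\<phi> (T.pt \<one>\<^bsub>A\<^esub> l) = scalar_matrix n L l" if l: "l \<in> carrier L" for l
  proof (rule ext)
    show "\<phi> (T.pt \<one>\<^bsub>A\<^esub> l) \<in> carrier (matrix_ring n L)" using l by (intro \<phi>_carrier) simp
    show "scalar_matrix n L l \<in> carrier (matrix_ring n L)" using l by (auto simp: scalar_matrix_def matrix_ring_def)
    fix r c assume rc: "r < n" "c < n"
    have "\<phi> (T.pt \<one>\<^bsub>A\<^esub> l) r c = ?c (\<Sum>k<N. (?l (i (\<omega> k)) * ?l l) * R' k r c)"
      unfolding \<phi>_def using rc l by (auto simp: L.component_sum T.tensor_coord_pure \<omega> ci cR icl intro!: L.finsum_cong')
    also have "(\<Sum>k<N. (?l (i (\<omega> k)) * ?l l) * R' k r c) = ?l l * (\<Sum>k<N. ?l (i (\<omega> k)) * R' k r c)"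
      by (simp add: sum_distrib_left ac_simps)
    also have "?c \<dots> = l \<otimes>\<^bsub>L\<^esub> i (if r = c then 1 else 0)"
      using rc l by (simp add: R'_def isum[symmetric] one)
    also have "\<dots> = scalar_matrix n L l r c" using rc l by (simp add: scalar_matrix_def i01)
    finally show "\<phi> (T.pt \<one>\<^bsub>A\<^esub> l) r c = scalar_matrix n L l r c" .
  qed
  have "\<phi> \<in> ring_hom T.T (matrix_ring n L)"
  proof (rule ring_hom_memI)
    fix z w assume zw: "z \<in> carrier T.T" "w \<in> carrier T.T"
    show "\<phi> (z \<oplus>\<^bsub>T.T\<^esub> w) = \<phi> z \<oplus>\<^bsub>matrix_ring n L\<^esub> \<phi> w"
    proof (rule ext)
      show "\<phi> z \<oplus>\<^bsub>matrix_ring n L\<^esub> \<phi> w \<in> carrier (matrix_ring n L)"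
        using \<phi>_carrier[OF zw(1)] \<phi>_carrier[OF zw(2)] by (auto simp: matrix_ring_def PiE_iff)
      fix r c assume rc: "r < n" "c < n"
      have "\<phi> (z \<oplus>\<^bsub>T.T\<^esub> w) r c = (\<Oplus>\<^bsub>L\<^esub>k\<in>{..<N}. TB.coord z k \<otimes>\<^bsub>L\<^esub> i (R k r c) \<oplus>\<^bsub>L\<^esub> TB.coord w k \<otimes>\<^bsub>L\<^esub> i (R k r c))"
        unfolding \<phi>_def using rc zw icl
        by (simp del: L.finsum_addf, intro L.finsum_cong' refl) (simp_all add: TB.coord_add L.l_distr Pi_def)
      also have "\<dots> = (\<phi> z \<oplus>\<^bsub>matrix_ring n L\<^esub> \<phi> w) r c"
        using rc zw icl by (subst L.finsum_addf) (auto simp: matrix_ring_def \<phi>_def)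
      finally show "\<phi> (z \<oplus>\<^bsub>T.T\<^esub> w) r c = (\<phi> z \<oplus>\<^bsub>matrix_ring n L\<^esub> \<phi> w) r c" .
    qed (use zw in \<open>auto intro!: \<phi>_carrier\<close>)
  next
    have "scalar_matrix n L \<one>\<^bsub>L\<^esub> = \<one>\<^bsub>matrix_ring n L\<^esub>" by (simp add: scalar_matrix_def matrix_ring_def)
    show "\<phi> \<one>\<^bsub>T.T\<^esub> = \<one>\<^bsub>matrix_ring n L\<^esub>"
      unfolding T.pt_one \<phi>_scalar[OF L.one_closed] by fact
  qed (auto intro!: \<phi>_carrier \<phi>_mult)
  moreover have "bij_betw \<phi> (carrier T.T) (carrier (matrix_ring n L))"
    unfolding bij_betw_def
  proof
    \<comment> \<open>The coordinates of z are recovered from its matrix by the identities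
      \<open>RS\<close>, which proves injectivity. Surjectivity uses the same formula as a
      definition, in \<open>yt\<close>, together with \<open>SR\<close>.\<close>
    have recover: "TB.coord z k' = ?c (\<Sum>r<n. \<Sum>c<n. ?l (\<phi> z r c) * S' r c k')" if z: "z \<in> carrier T.T" and k': "k' < N" for z k'
    proof -
      have "?c (\<Sum>r<n. \<Sum>c<n. ?l (\<phi> z r c) * S' r c k') = ?c (\<Sum>r<n. \<Sum>c<n. (\<Sum>k<N. zt z k * R' k r c) * S' r c k')"
        using z by (intro csum cmul refl) (simp add: \<phi>)
      also have "(\<Sum>r<n. \<Sum>c<n. (\<Sum>k<N. zt z k * R' k r c) * S' r c k') = (\<Sum>k<N. zt z k * (\<Sum>r<n. \<Sum>c<n. R' k r c * S' r c k'))"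
        unfolding sum_distrib_left sum_distrib_right by (subst (2) sum_swap3) (simp add: ac_simps)
      also have "?c \<dots> = ?c (\<Sum>k<N. zt z k * (if k = k' then 1 else 0))"
      proof (intro csum cmul refl)
        fix k assume "k \<in> {..<N}"
        have "?c (\<Sum>r<n. \<Sum>c<n. R' k r c * S' r c k') = (\<Oplus>\<^bsub>L\<^esub>r\<in>{..<n}. i (\<Sum>c<n. R k r c * S r c k'))"
          by (simp add: isum R'_def S'_def L.component_sum[of _ "{..<n}"])
        also have "\<dots> = i (\<Sum>r<n. \<Sum>c<n. R k r c * S r c k')"
          by (rule hom_sum[OF L.ring_axioms i, symmetric])
        also have "\<dots> = ?c (if k = k' then 1 else 0)" using RS[of k k'] \<open>k \<in> {..<N}\<close> k' by (simp add: i01)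
        finally show "?c (\<Sum>r<n. \<Sum>c<n. R' k r c * S' r c k') = ?c (if k = k' then 1 else 0)" .
      qed
      also have "(\<Sum>k<N. zt z k * (if k = k' then 1 else 0)) = zt z k'"
        using k' by (simp add: if_distrib cong: if_cong)
      finally show ?thesis using czt[OF z k'] by simp
    qed
    show "inj_on \<phi> (carrier T.T)"
    proof (rule inj_onI)
      fix z w assume zw: "z \<in> carrier T.T" "w \<in> carrier T.T" and eq: "\<phi> z = \<phi> w"
      have "TB.coord z k = TB.coord w k" if "k < N" for k
        using recover[OF zw(1) that] recover[OF zw(2) that] eq by simp
      then have "(\<Oplus>\<^bsub>T.T\<^esub>k\<in>{..<N}. T.pt \<one>\<^bsub>A\<^esub> (TB.coord z k) \<otimes>\<^bsub>T.T\<^esub> T.pt (e k) \<one>\<^bsub>L\<^esub>) =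
        (\<Oplus>\<^bsub>T.T\<^esub>k\<in>{..<N}. T.pt \<one>\<^bsub>A\<^esub> (TB.coord w k) \<otimes>\<^bsub>T.T\<^esub> T.pt (e k) \<one>\<^bsub>L\<^esub>)"
        using zw by (intro T.T.finsum_cong') (auto simp del: T.pt_mult)
      then show "z = w" by (rule trans[OF TB.coord_expand[OF zw(1)] trans[OF _ TB.coord_expand[OF zw(2), symmetric]]])
    qed
    show "\<phi> ` carrier T.T = carrier (matrix_ring n L)"
    proof (intro equalityI subsetI)
      fix Y assume Y: "Y \<in> carrier (matrix_ring n L)"
      then have Ycl: "Y r c \<in> carrier L" if "r < n" "c < n" for r c using that by (auto simp: matrix_ring_def PiE_iff)
      define yt where "yt k = (\<Sum>r<n. \<Sum>c<n. ?l (Y r c) * S' r c k)" for k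
      define z where "z = (\<Oplus>\<^bsub>T.T\<^esub>k\<in>{..<N}. T.pt \<one>\<^bsub>A\<^esub> (?c (yt k)) \<otimes>\<^bsub>T.T\<^esub> T.pt (e k) \<one>\<^bsub>L\<^esub>)"
      have z: "z \<in> carrier T.T" unfolding z_def by (auto intro!: T.T.finsum_closed simp del: T.pt_mult)
      have coord: "TB.coord z k = ?c (yt k)" if "k < N" for k
        by (rule TB.coord_eqI) (use that in \<open>auto simp: z_def simp del: T.pt_mult\<close>)
      have "\<phi> z = Y"
      proof (rule ext[OF \<phi>_carrier[OF z] Y])
        fix r' c' assume rc: "r' < n" "c' < n"
        have "\<phi> z r' c' = ?c (\<Sum>k<N. yt k * R' k r' c')"
          unfolding \<phi>_def using rc by (auto simp: L.component_sum coord cR icl intro!: L.finsum_cong')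
        also have "(\<Sum>k<N. yt k * R' k r' c') = (\<Sum>r<n. \<Sum>c<n. ?l (Y r c) * (\<Sum>k<N. S' r c k * R' k r' c'))"
          unfolding yt_def sum_distrib_left sum_distrib_right by (subst sum_swap3) (simp add: ac_simps)
        also have "?c \<dots> = ?c (\<Sum>r<n. \<Sum>c<n. ?l (Y r c) * (if r' = r \<and> c' = c then 1 else 0))"
          using rc by (intro csum cmul refl) (simp add: S'_def R'_def SR i01 flip: isum)
        also have "(\<Sum>r<n. \<Sum>c<n. ?l (Y r c) * (if r' = r \<and> c' = c then 1 else 0)) = (\<Sum>r<n. if r = r' then ?l (Y r c') else 0)"
          using rc by (intro sum.cong) (auto simp: if_distrib cong: if_cong)
        also have "\<dots> = ?l (Y r' c')" using rc by simp
        finally show "\<phi> z r' c' = Y r' c'" using Ycl rc by simp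
      qed
      then show "Y \<in> \<phi> ` carrier T.T" using z by blast
    qed (use \<phi>_carrier in auto)
  qed
  ultimately show ?thesis
    using L j \<phi>_scalar by (auto simp: splitting_def ring_iso_def)
qed

section \<open>Algebraic integers and local algebras\<close>

text \<open>x is an eigenvalue of an integer matrix, hence a root of its monic characteristic
  polynomial.\<close>

lemma algebraic_int_eigenvalue:
  fixes x :: "'a :: field_char_0" and B :: "nat \<Rightarrow> nat \<Rightarrow> int" and w :: "nat \<Rightarrow> 'a"
  assumes eq: "\<And>i. i < n \<Longrightarrow> x * w i = (\<Sum>j<n. of_int (B i j) * w j)" and nz: "k < n" "w k \<noteq> 0"
  shows "algebraic_int x"
proof -
  define M where "M = mat n n (\<lambda>(i, j). B i j)"
  define u where "u = vec n w"
  have M: "M \<in> carrier_mat n n" by (simp add: M_def)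
  have "map_mat of_int M *\<^sub>v u = x \<cdot>\<^sub>v u"
    by (rule eq_vecI) (simp_all add: M_def u_def eq scalar_prod_def atLeast0LessThan)
  moreover have "u \<noteq> 0\<^sub>v n" using nz by (metis index_vec index_zero_vec(1) u_def)
  ultimately have "eigenvalue (map_mat of_int M :: 'a mat) x"
    using M by (auto simp: eigenvalue_def eigenvector_def u_def intro!: exI[of _ u])
  then have "poly (char_poly (map_mat of_int M)) x = 0"
    using eigenvalue_root_char_poly[of "map_mat of_int M :: 'a mat" n] M by simp
  moreover have "char_poly (map_mat of_int M :: 'a mat) = map_poly of_int (char_poly M)"
    by (rule of_int_hom.char_poly_hom[OF M])
  moreover have "Polynomial.lead_coeff (char_poly M) = 1" using degree_monic_char_poly[OF M] by simp
  ultimately show ?thesis unfolding algebraic_int_altdef_ipoly by auto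
qed

text \<open>The products x ^ i * y ^ j below the degrees of two monic polynomials generate a
  finitely generated group that is stable under multiplication by x and by y. Multiplication by x y
  on the generators is therefore an integer matrix, and \<open>algebraic_int_eigenvalue\<close>
  applies.\<close>

lemma algebraic_int_mult:
  fixes x y :: "'a :: field_char_0"
  assumes "algebraic_int x" "algebraic_int y"
  shows "algebraic_int (x * y)"
proof -
  interpret Z: Modules.module "\<lambda>(c :: int) (z :: 'a). of_int c * z" by unfold_locales (auto simp: algebra_simps)
  have pow: "\<exists>m > 0. z ^ m \<in> Z.span ((\<lambda>i. z ^ i) ` {..<m})" if "algebraic_int z" for z :: 'a
  proof -
    obtain q :: "int poly" where q: "poly (map_poly of_int q) z = 0" "Polynomial.lead_coeff q = 1"
      using \<open>algebraic_int z\<close> unfolding algebraic_int_altdef_ipoly by auto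
    let ?m = "Polynomial.degree q"
    have "?m > 0"
    proof (rule ccontr)
      assume "\<not> ?m > 0"
      then obtain c where "q = [:c:]" using degree_eq_zeroE by blast
      then show False using q by simp
    qed
    have "poly (map_poly of_int q) z = (\<Sum>i\<le>?m. of_int (Polynomial.coeff q i) * z ^ i)"
      by (simp add: poly_altdef)
    also have "\<dots> = (\<Sum>i<?m. of_int (Polynomial.coeff q i) * z ^ i) + z ^ ?m"
      using q(2) by (simp flip: lessThan_Suc_atMost)
    finally have "z ^ ?m = - (\<Sum>i<?m. of_int (Polynomial.coeff q i) * z ^ i)"
      using q(1) by (simp add: eq_neg_iff_add_eq_0 add.commute)
    also have "\<dots> \<in> Z.span ((\<lambda>i. z ^ i) ` {..<?m})"
      by (intro Z.span_neg Z.span_sum Z.span_scale Z.span_base) auto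
    finally show ?thesis using \<open>?m > 0\<close> by blast
  qed
  obtain m where m: "m > 0" "x ^ m \<in> Z.span ((\<lambda>i. x ^ i) ` {..<m})" using pow[OF assms(1)] by blast
  obtain n where n: "n > 0" "y ^ n \<in> Z.span ((\<lambda>i. y ^ i) ` {..<n})" using pow[OF assms(2)] by blast
  let ?G = "(\<lambda>(i, j). x ^ i * y ^ j) ` ({..<m} \<times> {..<n})"
  have lin: "z * d \<in> Z.span W'" if d: "d \<in> Z.span W" and W: "\<And>w. w \<in> W \<Longrightarrow> z * w \<in> Z.span W'" for z d :: 'a and W W'
    using d
  proof (induction rule: Z.span_induct_alt)
    case base
    then show ?case using Z.span_zero by simp
  next
    case (step c u v)
    have "z * (of_int c * u + v) = of_int c * (z * u) + z * v" by (simp add: algebra_simps)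
    then show ?case using step W by (auto intro!: Z.span_add Z.span_scale)
  qed
  have x: "x * w \<in> Z.span ?G" if w: "w \<in> ?G" for w
  proof -
    obtain i j where w: "w = x ^ i * y ^ j" "i < m" "j < n" using w by auto
    show ?thesis
    proof (cases "Suc i < m")
      case True
      then show ?thesis using w by (intro Z.span_base) (auto intro!: image_eqI[of _ _ "(Suc i, j)"])
    next
      case False
      then have "Suc i = m" using w by simp
      then have "x * w = y ^ j * x ^ m" using w by (auto simp: ac_simps)
      also have "\<dots> \<in> Z.span ?G"
        using w by (intro lin[OF m(2)] Z.span_base) (auto simp: ac_simps)
      finally show ?thesis .
    qed
  qed
  have y: "y * w \<in> Z.span ?G" if w: "w \<in> ?G" for w
  proof -
    obtain i j where w: "w = x ^ i * y ^ j" "i < m" "j < n" using w by auto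
    show ?thesis
    proof (cases "Suc j < n")
      case True
      then show ?thesis using w by (intro Z.span_base) (auto intro!: image_eqI[of _ _ "(i, Suc j)"])
    next
      case False
      then have "Suc j = n" using w by simp
      then have "y * w = x ^ i * y ^ n" using w by (auto simp: ac_simps)
      also have "\<dots> \<in> Z.span ?G"
        using w by (intro lin[OF n(2)] Z.span_base) (auto simp: ac_simps)
      finally show ?thesis .
    qed
  qed
  have xy: "x * y * w \<in> Z.span ?G" if "w \<in> ?G" for w
    using lin[OF y[OF that], of x] x by (simp add: mult.assoc)
  have fin: "finite ?G" by simp
  obtain g where g: "bij_betw g {..<card ?G} ?G"
    using ex_bij_betw_nat_finite[OF fin] by (auto simp: atLeast0LessThan)
  have "\<exists>b. x * y * g i = (\<Sum>j<card ?G. of_int (b j) * g j)" if i: "i < card ?G" for i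
  proof -
    have "g i \<in> ?G" using g i by (auto simp: bij_betw_def)
    from xy[OF this] obtain c where "x * y * g i = (\<Sum>w\<in>?G. of_int (c w) * w)"
      unfolding Z.span_finite[OF fin] by auto
    also have "\<dots> = (\<Sum>j<card ?G. of_int (c (g j)) * g j)"
      by (rule sum.reindex_bij_betw[OF g, symmetric])
    finally show ?thesis by (intro exI[of _ "\<lambda>j. c (g j)"])
  qed
  then have "\<forall>i. \<exists>b. i < card ?G \<longrightarrow> x * y * g i = (\<Sum>j<card ?G. of_int (b j) * g j)" by blast
  from choice[OF this] obtain B where B: "\<And>i. i < card ?G \<Longrightarrow> x * y * g i = (\<Sum>j<card ?G. of_int (B i j) * g j)" by blast
  \<comment> \<open>The eigenvector is the vector of all generators; it is nonzero because 1 is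
    among them.\<close>
  have "1 \<in> ?G" using m n by (auto intro!: image_eqI[of _ _ "(0, 0)"])
  then have "1 \<in> g ` {..<card ?G}" using g by (simp only: bij_betw_def)
  then obtain k where k: "1 = g k" "k \<in> {..<card ?G}" by (rule imageE)
  show ?thesis
  proof (rule algebraic_int_eigenvalue[OF B])
    show "k < card ?G" using k(2) by (simp only: lessThan_iff)
    show "g k \<noteq> 0" using k(1) by (metis zero_neq_one)
  qed
qed

lemma (in central_simple_basis) tensor_local:
  assumes "\<nu> \<in> places"
  shows "tensor_based (ring_of_type_algebra :: 'k ring) (ring_of_type_algebra :: 'b ring) (completion_at \<nu>)
    (\<lambda>c. scale c 1) (to_completion \<nu>) N e"
proof -
  interpret B: based_algebra "ring_of_type_algebra :: 'k ring" "ring_of_type_algebra :: 'b ring" "\<lambda>c. scale c 1" N e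
    by (rule based_algebra_types)
  interpret F: field "completion_at \<nu>" by (rule field_completion[OF assms])
  show ?thesis by unfold_locales (use B.f B.central to_completion_hom[OF assms] in auto)
qed

text \<open>A sequence over a countable type becomes a sequence of natural numbers inside
  \<open>'k\<close>, which has characteristic 0, and is then wrapped into an object of the type that
  carries \<open>local_algebra\<close>.\<close>

lemma countable_inj_type:
  fixes z :: 'z
  assumes "countable (UNIV :: 'l set)"
  obtains g :: "(nat \<Rightarrow> 'l) \<Rightarrow> ('z \<times> (nat \<Rightarrow> 'k :: field_char_0) set \<Rightarrow>\<^sub>0 int) set" where "inj g"
proof -
  obtain c :: "'l \<Rightarrow> nat" where c: "inj c" using assms by (auto simp: countable_def)
  let ?g = "\<lambda>u. {frag_of (z, {\<lambda>n. (of_nat (c (u n)) :: 'k)})}"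
  have "inj ?g"
  proof (rule injI)
    fix u v assume "?g u = ?g v"
    then have "Poly_Mapping.keys (frag_of (z, {\<lambda>n. (of_nat (c (u n)) :: 'k)})) = Poly_Mapping.keys (frag_of (z, {\<lambda>n. (of_nat (c (v n)) :: 'k)}))"
      by simp
    then have "(\<lambda>n. (of_nat (c (u n)) :: 'k)) = (\<lambda>n. of_nat (c (v n)))" by simp
    then have "c (u n) = c (v n)" for n by (simp add: fun_eq_iff)
    then show "u = v" using c by (auto simp: inj_def)
  qed
  then show ?thesis using that by blast
qed

lemma (in csa_extension) representation_expand:
  assumes "\<And>x y. \<rho> (x + y) = \<rho> x + (\<rho> y :: 'l)" "\<And>c x. \<rho> (scale c x) = h c * \<rho> x"
  shows "\<rho> x = (\<Sum>k<N. h (co x k) * \<rho> (e k))"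
proof -
  have z: "\<rho> 0 = 0" using assms(1)[of 0 0] by (metis add_0_right add_left_cancel)
  have "\<rho> (sum g A) = (\<Sum>k\<in>A. \<rho> (g k))" for g and A :: "nat set"
    by (induction A rule: infinite_finite_induct) (simp_all add: z assms)
  then have "\<rho> (\<Sum>i<N. scale (co x i) (e i)) = (\<Sum>k<N. h (co x k) * \<rho> (e k))" by (simp add: assms)
  then show ?thesis by (simp flip: co_expand)
qed

locale number_field_csa = central_simple_basis scale N e co
  for scale :: "'k :: field_char_0 \<Rightarrow> 'b :: ring_1 \<Rightarrow> 'b" and N e co +
  assumes number_field: "number_field TYPE('k)" and N_pos: "N > 0"
begin

abbreviation pt where "pt \<nu> \<equiv> pure_tensor (ring_of_type_algebra :: 'k ring) (\<lambda>c. scale c 1)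
  (ring_of_type_algebra :: 'b ring) (to_completion \<nu>) (completion_at \<nu>)"

text \<open>B is split over the algebraic closure of \<open>'k\<close>, the matrices are moved into
  a field that also contains the completion, and that field is renamed so that it is carried by the
  type of \<open>local_algebra\<close>.\<close>

lemma local_normed_algebra:
  assumes nu: "\<nu> \<in> places"
  shows "normed_algebra (completion_at \<nu>) (local_algebra scale \<nu>) (to_local_algebra scale \<nu>) N
    (\<lambda>i. pt \<nu> (e i) \<one>\<^bsub>completion_at \<nu>\<^esub>)"
proof -
  interpret T: tensor_based "ring_of_type_algebra :: 'k ring" "ring_of_type_algebra :: 'b ring" "completion_at \<nu>"
    "\<lambda>c. scale c 1" "to_completion \<nu>" N e by (rule tensor_local[OF nu])
  have A: "T.T = local_algebra scale \<nu>" "T.pt 1 = to_local_algebra scale \<nu>"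
    by (simp_all add: local_algebra_def to_local_algebra_def)
  have based: "based_algebra (completion_at \<nu>) (local_algebra scale \<nu>) (to_local_algebra scale \<nu>) N
    (\<lambda>i. pt \<nu> (e i) \<one>\<^bsub>completion_at \<nu>\<^esub>)"
    using T.tensor_basis by (simp add: A)
  have coord: "based_algebra.coord (completion_at \<nu>) (local_algebra scale \<nu>) (to_local_algebra scale \<nu>) N
    (\<lambda>i. pt \<nu> (e i) \<one>\<^bsub>completion_at \<nu>\<^esub>) (pt \<nu> a \<one>\<^bsub>completion_at \<nu>\<^esub>) i = to_completion \<nu> (co a i)" if "i < N" for a i
    using T.tensor_coord_pure[of a "\<one>\<^bsub>completion_at \<nu>\<^esub>" i] that
      ring_hom_closed[OF to_completion_hom[OF nu], of "co a i"]
    by (simp add: A coord_types)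
  interpret E: csa_extension scale N e co "to_ac :: 'k \<Rightarrow> 'k alg_closure" by unfold_locales simp_all
  obtain n :: nat and \<rho> and \<sigma> where \<rho>: "\<And>x y i j. i < n \<Longrightarrow> j < n \<Longrightarrow> \<rho> (x + y) i j = \<rho> x i j + \<rho> y i j"
    "\<And>c x i j. i < n \<Longrightarrow> j < n \<Longrightarrow> \<rho> (scale c x) i j = to_ac c * \<rho> x i j"
    "\<And>x y i j. i < n \<Longrightarrow> j < n \<Longrightarrow> \<rho> (x * y) i j = (\<Sum>m<n. \<rho> x i m * \<rho> y m j)"
    "\<And>i j. i < n \<Longrightarrow> j < n \<Longrightarrow> \<rho> 1 i j = (if i = j then 1 else 0)"
    and \<sigma>: "\<And>i j i' j'. i < n \<Longrightarrow> j < n \<Longrightarrow> i' < n \<Longrightarrow> j' < n \<Longrightarrow>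
      (\<Sum>k<N. \<sigma> i j k * \<rho> (e k) i' j') = (if i' = i \<and> j' = j then 1 else 0)"
    "\<And>k k'. k < N \<Longrightarrow> k' < N \<Longrightarrow> (\<Sum>i<n. \<Sum>j<n. \<rho> (e k) i j * \<sigma> i j k') = (if k = k' then 1 else 0)"
    by (rule E.splitting_representation) (rule that)
  have expand: "\<rho> x i j = (\<Sum>k<N. to_ac (co x k) * \<rho> (e k) i j)" if "i < n" "j < n" for x i j
    by (rule E.representation_expand) (use that \<rho> in auto)
  interpret C: compositum "place_abs \<nu>" "to_ac :: 'k \<Rightarrow> 'k alg_closure"
    using place_abs(2)[OF nu] by unfold_locales simp_all
  obtain L :: "(nat \<Rightarrow> 'k alg_closure) set ring" and i j r where L: "field L"
    and i: "i \<in> ring_hom (ring_of_type_algebra :: 'k alg_closure ring) L"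
    and j: "j \<in> ring_hom (completion_at \<nu>) L" and ji: "\<And>c. j (to_completion \<nu> c) = i (to_ac c)"
    and r: "inj_on (r :: _ \<Rightarrow> nat \<Rightarrow> 'k alg_closure) (carrier L)"
    by (rule C.compositum_exists[folded completion_at_def to_completion_def]) (rule that)
  obtain g :: "(nat \<Rightarrow> 'k alg_closure) \<Rightarrow> ('b \<times> (nat \<Rightarrow> 'k) set \<Rightarrow>\<^sub>0 int) set" where "inj g"
    using countable_inj_type[OF countable_alg_closure[OF countable_number_field[OF number_field]]] by blast
  then have inj: "inj_on (g \<circ> r) (carrier L)" using r by (auto intro!: comp_inj_on intro: inj_on_subset)
  let ?L = "image_ring (g \<circ> r) L"
  have hom: "g \<circ> r \<in> ring_hom L ?L" using inj_imp_image_ring_iso[OF inj] by (simp add: ring_iso_def)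
  have "\<exists>\<phi>. splitting (completion_at \<nu>) (to_local_algebra scale \<nu>) (local_algebra scale \<nu>) ((g \<circ> r) \<circ> j) ?L n \<phi>"
  proof (rule splitting_of_matrices[OF based])
    show "field ?L" by (rule field.inj_imp_image_ring_is_field[OF L inj])
    show "(g \<circ> r) \<circ> j \<in> ring_hom (completion_at \<nu>) ?L" by (rule ring_hom_trans[OF j hom])
    show "(g \<circ> r) \<circ> i \<in> ring_hom (ring_of_type_algebra :: 'k alg_closure ring) ?L" by (rule ring_hom_trans[OF i hom])
    show "(\<Sum>h<n. \<rho> (e a) r h * \<rho> (e b) h c) = (\<Sum>k<N. to_ac (co (e a * e b) k) * \<rho> (e k) r c)"
      if "r < n" "c < n" for a b r c
      using expand[of r c "e a * e b"] \<rho>(3)[of r c "e a" "e b"] that by simp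
    show "(\<Sum>k<N. to_ac (co 1 k) * \<rho> (e k) r c) = (if r = c then 1 else 0)" if "r < n" "c < n" for r c
      using expand[of r c 1] \<rho>(4)[of r c] that by simp
    show "((g \<circ> r) \<circ> j) (based_algebra.coord (completion_at \<nu>) (local_algebra scale \<nu>) (to_local_algebra scale \<nu>) N
      (\<lambda>i. pt \<nu> (e i) \<one>\<^bsub>completion_at \<nu>\<^esub>) (pt \<nu> (e a) \<one>\<^bsub>completion_at \<nu>\<^esub> \<otimes>\<^bsub>local_algebra scale \<nu>\<^esub> pt \<nu> (e b) \<one>\<^bsub>completion_at \<nu>\<^esub>) k) =
      ((g \<circ> r) \<circ> i) (to_ac (co (e a * e b) k))" if "k < N" for a b k
      using that coord[of k "e a * e b"] T.pt_mult[of "e a" "\<one>\<^bsub>completion_at \<nu>\<^esub>" "e b" "\<one>\<^bsub>completion_at \<nu>\<^esub>"]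
      by (simp add: A ji)
    show "((g \<circ> r) \<circ> j) (based_algebra.coord (completion_at \<nu>) (local_algebra scale \<nu>) (to_local_algebra scale \<nu>) N
      (\<lambda>i. pt \<nu> (e i) \<one>\<^bsub>completion_at \<nu>\<^esub>) \<one>\<^bsub>local_algebra scale \<nu>\<^esub> k) = ((g \<circ> r) \<circ> i) (to_ac (co 1 k))" if "k < N" for k
      using that coord[of k 1] T.pt_one by (simp add: A ji)
    show "(\<Sum>k<N. \<sigma> r c k * \<rho> (e k) r' c') = (if r' = r \<and> c' = c then 1 else 0)"
      if "r < n" "c < n" "r' < n" "c' < n" for r c r' c' by (rule \<sigma>(1)[OF that])
    show "(\<Sum>r<n. \<Sum>c<n. \<rho> (e k) r c * \<sigma> r c k') = (if k = k' then 1 else 0)" if "k < N" "k' < N" for k k'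
      by (rule \<sigma>(2)[OF that])
  qed
  then show ?thesis
    using N_pos based field_completion[OF nu] char_0_completion[OF nu]
    by (auto simp: normed_algebra_def normed_algebra_axioms_def)
qed

end

section \<open>Absolute values on completions\<close>

lemma
  assumes nu: "\<nu> \<in> places"
  shows completion_abs_nonneg: "Z \<in> carrier (completion_at \<nu>) \<Longrightarrow> 0 \<le> completion_abs \<nu> Z"
    and completion_abs_mult: "Z \<in> carrier (completion_at \<nu>) \<Longrightarrow> W \<in> carrier (completion_at \<nu>) \<Longrightarrow>
      completion_abs \<nu> (Z \<otimes>\<^bsub>completion_at \<nu>\<^esub> W) = completion_abs \<nu> Z * completion_abs \<nu> W"
    and completion_abs_const: "completion_abs \<nu> (to_completion \<nu> c) = place_abs \<nu> c"
    and completion_abs_zero_iff: "Z \<in> carrier (completion_at \<nu>) \<Longrightarrow> completion_abs \<nu> Z = 0 \<longleftrightarrow> Z = \<zero>\<^bsub>completion_at \<nu>\<^esub>"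
proof -
  interpret V: abs_val "place_abs \<nu>" using place_abs(2)[OF nu] by (simp add: abs_val_def)
  have a: "completion_abs \<nu> = V.lim_abs" by (rule ext) (simp add: completion_abs_def V.lim_abs_def)
  note c = completion_at_def[of \<nu>, symmetric]
  show "Z \<in> carrier (completion_at \<nu>) \<Longrightarrow> 0 \<le> completion_abs \<nu> Z"
    using V.lim_abs_nonneg unfolding a c .
  show "Z \<in> carrier (completion_at \<nu>) \<Longrightarrow> W \<in> carrier (completion_at \<nu>) \<Longrightarrow>
      completion_abs \<nu> (Z \<otimes>\<^bsub>completion_at \<nu>\<^esub> W) = completion_abs \<nu> Z * completion_abs \<nu> W"
    using V.lim_abs_mult unfolding a c .
  show "completion_abs \<nu> (to_completion \<nu> c) = place_abs \<nu> c"
    unfolding a to_completion_def by (rule V.lim_abs_const)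
  show "Z \<in> carrier (completion_at \<nu>) \<Longrightarrow> completion_abs \<nu> Z = 0 \<longleftrightarrow> Z = \<zero>\<^bsub>completion_at \<nu>\<^esub>"
    using V.lim_abs_zero_iff unfolding a c .
qed

lemma completion_abs_one: "\<nu> \<in> places \<Longrightarrow> completion_abs \<nu> \<one>\<^bsub>completion_at \<nu>\<^esub> = 1"
proof -
  assume nu: "\<nu> \<in> places"
  interpret V: abs_val "place_abs \<nu>" using place_abs(2)[OF nu] by (simp add: abs_val_def)
  show ?thesis using completion_abs_const[OF nu, of 1] ring_hom_one[OF to_completion_hom[OF nu]] by simp
qed

lemma finite_places_places: "\<nu> \<in> finite_places \<Longrightarrow> \<nu> \<in> places"
  by (simp add: finite_places_def)

lemma Units_completion: "\<nu> \<in> places \<Longrightarrow> Units (completion_at \<nu>) = carrier (completion_at \<nu>) - {\<zero>\<^bsub>completion_at \<nu>\<^esub>}"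
  using field.field_Units[OF field_completion] .

lemma Units_valuation_ring:
  assumes nu: "\<nu> \<in> places"
  shows "Z \<in> Units (completion_at \<nu>\<lparr>carrier := valuation_ring \<nu>\<rparr>) \<longleftrightarrow> Z \<in> carrier (completion_at \<nu>) \<and> completion_abs \<nu> Z = 1"
proof -
  interpret F: field "completion_at \<nu>" by (rule field_completion[OF nu])
  show ?thesis
  proof
    assume "Z \<in> Units (completion_at \<nu>\<lparr>carrier := valuation_ring \<nu>\<rparr>)"
    then obtain W where W: "Z \<in> valuation_ring \<nu>" "W \<in> valuation_ring \<nu>" "Z \<otimes>\<^bsub>completion_at \<nu>\<^esub> W = \<one>\<^bsub>completion_at \<nu>\<^esub>"
      by (auto simp: Units_def)
    then have ZW: "Z \<in> carrier (completion_at \<nu>)" "W \<in> carrier (completion_at \<nu>)" "completion_abs \<nu> Z \<le> 1" "completion_abs \<nu> W \<le> 1"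
      by (auto simp: valuation_ring_def)
    have "completion_abs \<nu> Z * completion_abs \<nu> W = 1"
      using W(3) completion_abs_mult[OF nu ZW(1,2)] completion_abs_one[OF nu] by simp
    moreover have "completion_abs \<nu> Z * completion_abs \<nu> W \<le> completion_abs \<nu> Z * 1"
      using ZW completion_abs_nonneg[OF nu ZW(1)] by (intro mult_left_mono)
    ultimately show "Z \<in> carrier (completion_at \<nu>) \<and> completion_abs \<nu> Z = 1" using ZW by simp
  next
    assume Z: "Z \<in> carrier (completion_at \<nu>) \<and> completion_abs \<nu> Z = 1"
    then have "Z \<in> Units (completion_at \<nu>)"
      using completion_abs_zero_iff[OF nu, of Z] by (auto simp: Units_completion[OF nu])
    then have i: "inv\<^bsub>completion_at \<nu>\<^esub> Z \<in> carrier (completion_at \<nu>)" "Z \<otimes>\<^bsub>completion_at \<nu>\<^esub> inv\<^bsub>completion_at \<nu>\<^esub> Z = \<one>\<^bsub>completion_at \<nu>\<^esub>"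
      "inv\<^bsub>completion_at \<nu>\<^esub> Z \<otimes>\<^bsub>completion_at \<nu>\<^esub> Z = \<one>\<^bsub>completion_at \<nu>\<^esub>" by auto
    then have "completion_abs \<nu> (inv\<^bsub>completion_at \<nu>\<^esub> Z) = 1"
      using completion_abs_mult[OF nu conjunct1[OF Z] i(1)] Z completion_abs_one[OF nu] by simp
    then show "Z \<in> Units (completion_at \<nu>\<lparr>carrier := valuation_ring \<nu>\<rparr>)"
      using Z i by (auto simp: Units_def valuation_ring_def intro!: bexI[of _ "inv\<^bsub>completion_at \<nu>\<^esub> Z"])
  qed
qed

locale finite_place =
  fixes \<nu> :: "'k :: field_char_0 place"
  assumes finite_nu: "\<nu> \<in> finite_places"
begin

lemma nu: "\<nu> \<in> places" using finite_nu by (rule finite_places_places)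

sublocale F: field "completion_at \<nu>" by (rule field_completion[OF nu])

sublocale V: nonarch_val "place_abs \<nu>"
  using place_abs(2)[OF nu] place_abs_nonarch[OF finite_nu]
  by (simp add: abs_val_def nonarch_val_def nonarch_val_axioms_def)

abbreviation F where "F \<equiv> completion_at \<nu>"
abbreviation cabs where "cabs \<equiv> completion_abs \<nu>"

lemmas cabs_nonneg = completion_abs_nonneg[OF nu] and cabs_mult = completion_abs_mult[OF nu]
  and cabs_const = completion_abs_const[OF nu] and cabs_zero_iff = completion_abs_zero_iff[OF nu]
  and cabs_one = completion_abs_one[OF nu]

lemma cabs_max: "Z \<in> carrier F \<Longrightarrow> W \<in> carrier F \<Longrightarrow> cabs (Z \<oplus>\<^bsub>F\<^esub> W) \<le> max (cabs Z) (cabs W)"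
  using V.lim_abs_nonarch[OF place_abs_nonarch[OF finite_nu]]
  unfolding completion_at_def[symmetric] V.lim_abs_def completion_abs_def .

lemma cabs_zero: "cabs \<zero>\<^bsub>F\<^esub> = 0" using cabs_zero_iff by simp

lemma cabs_minus: "Z \<in> carrier F \<Longrightarrow> cabs (\<ominus>\<^bsub>F\<^esub> Z) = cabs Z"
proof -
  assume Z: "Z \<in> carrier F"
  have "cabs (\<ominus>\<^bsub>F\<^esub> Z) * cabs (\<ominus>\<^bsub>F\<^esub> Z) = cabs Z * cabs Z"
    using Z by (simp add: F.l_minus F.r_minus flip: cabs_mult)
  then show ?thesis using Z cabs_nonneg[of Z] cabs_nonneg[of "\<ominus>\<^bsub>F\<^esub> Z"]
    by (metis F.a_inv_closed power2_eq_iff_nonneg power2_eq_square)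
qed

lemma cabs_finsum_le:
  assumes "\<And>i. i \<in> I \<Longrightarrow> u i \<in> carrier F" "\<And>i. i \<in> I \<Longrightarrow> cabs (u i) \<le> B" "B \<ge> 0"
  shows "cabs (\<Oplus>\<^bsub>F\<^esub>i\<in>I. u i) \<le> B"
  using assms(1,2)
proof (induction I rule: infinite_finite_induct)
  case (insert i I)
  then have "cabs (u i \<oplus>\<^bsub>F\<^esub> (\<Oplus>\<^bsub>F\<^esub>i\<in>I. u i)) \<le> max (cabs (u i)) (cabs (\<Oplus>\<^bsub>F\<^esub>i\<in>I. u i))"
    by (intro cabs_max F.finsum_closed) auto
  moreover have "cabs (u i) \<le> B" "cabs (\<Oplus>\<^bsub>F\<^esub>i\<in>I. u i) \<le> B" using insert by auto
  ultimately have "cabs (u i \<oplus>\<^bsub>F\<^esub> (\<Oplus>\<^bsub>F\<^esub>i\<in>I. u i)) \<le> B" by linarith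
  then show ?case using insert by (subst F.finsum_insert) auto
qed (auto simp: F.finsum_infinite cabs_zero assms(3))

lemma cabs_finprod_le:
  assumes "finite I" "\<And>i. i \<in> I \<Longrightarrow> u i \<in> carrier F" "\<And>i. i \<in> I \<Longrightarrow> cabs (u i) \<le> B" "B \<ge> 0"
  shows "cabs (\<Otimes>\<^bsub>F\<^esub>i\<in>I. u i) \<le> B ^ card I"
  using assms(1,2,3)
proof (induction I)
  case (insert i I)
  have "cabs (\<Otimes>\<^bsub>F\<^esub>i\<in>insert i I. u i) = cabs (u i) * cabs (\<Otimes>\<^bsub>F\<^esub>i\<in>I. u i)"
    using insert by (subst F.finprod_insert) (auto intro!: cabs_mult)
  also have "\<dots> \<le> B * B ^ card I"
    using insert assms(4) by (intro mult_mono cabs_nonneg) auto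
  finally show ?case using insert by simp
qed (simp add: cabs_one)

text \<open>By the ultrametric inequality the number of permutations does not enter the
  bound.\<close>

lemma cabs_determinant_le:
  assumes M: "\<And>i j. i < N \<Longrightarrow> j < N \<Longrightarrow> M i j \<in> carrier F" "\<And>i j. i < N \<Longrightarrow> j < N \<Longrightarrow> cabs (M i j) \<le> B" and B: "B \<ge> 0"
  shows "cabs (determinant N F M) \<le> B ^ N"
  unfolding determinant_def
proof (rule cabs_finsum_le)
  fix \<pi> assume "\<pi> \<in> {\<pi>. \<pi> permutes {..<N}}"
  then have p: "\<pi> i < N" if "i < N" for i using that by (auto simp: permutes_in_image[of \<pi> "{..<N}" i, simplified])
  have c: "(\<Otimes>\<^bsub>F\<^esub>i\<in>{..<N}. M i (\<pi> i)) \<in> carrier F" using p M by (intro F.finprod_closed) auto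
  show "(if evenperm \<pi> then \<one>\<^bsub>F\<^esub> else \<ominus>\<^bsub>F\<^esub> \<one>\<^bsub>F\<^esub>) \<otimes>\<^bsub>F\<^esub> (\<Otimes>\<^bsub>F\<^esub>i\<in>{..<N}. M i (\<pi> i)) \<in> carrier F" using c by simp
  have "cabs (\<Otimes>\<^bsub>F\<^esub>i\<in>{..<N}. M i (\<pi> i)) \<le> B ^ card {..<N}"
    using p M B by (intro cabs_finprod_le) auto
  then show "cabs ((if evenperm \<pi> then \<one>\<^bsub>F\<^esub> else \<ominus>\<^bsub>F\<^esub> \<one>\<^bsub>F\<^esub>) \<otimes>\<^bsub>F\<^esub> (\<Otimes>\<^bsub>F\<^esub>i\<in>{..<N}. M i (\<pi> i))) \<le> B ^ N"
    using c by (simp add: cabs_mult cabs_minus cabs_one)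
qed (use B in simp)

lemma subring_valuation_ring: "subring (valuation_ring \<nu>) F"
proof (rule F.subringI)
  show "\<one>\<^bsub>F\<^esub> \<in> valuation_ring \<nu>" by (simp add: valuation_ring_def cabs_one)
  show "\<ominus>\<^bsub>F\<^esub> h \<in> valuation_ring \<nu>" if "h \<in> valuation_ring \<nu>" for h
    using that by (simp add: valuation_ring_def cabs_minus)
  show "h1 \<otimes>\<^bsub>F\<^esub> h2 \<in> valuation_ring \<nu>" "h1 \<oplus>\<^bsub>F\<^esub> h2 \<in> valuation_ring \<nu>"
    if "h1 \<in> valuation_ring \<nu>" "h2 \<in> valuation_ring \<nu>" for h1 h2
    using that cabs_max[of h1 h2] mult_mono[of "cabs h1" 1 "cabs h2" 1]
    by (auto simp: valuation_ring_def cabs_mult cabs_nonneg)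
qed (auto simp: valuation_ring_def)

end

section \<open>Local orders\<close>

lemma pair_ring_minus:
  assumes "ring A" "ring C" "x \<in> carrier (pair_ring A C)"
  shows "\<ominus>\<^bsub>pair_ring A C\<^esub> x = - x"
proof -
  interpret ring "pair_ring A C" by (rule ring_pair_ring[OF assms(1,2)])
  show ?thesis
    by (rule minus_equality) (use assms(3) in \<open>simp_all add: pair_ring_simps\<close>)
qed

text \<open>Used to compare the relation ideal of an order with that of the whole algebra: the
  intersection is an ideal of the smaller ring, hence contains the ideal generated there by the
  smaller relations.\<close>

lemma ideal_Int_pair_ring:
  assumes I: "ideal I (pair_ring A C)" and rings: "ring A" "ring C" "ring (A\<lparr>carrier := S\<rparr>)" "ring (C\<lparr>carrier := U\<rparr>)"
    and sub: "S \<subseteq> carrier A" "U \<subseteq> carrier C"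
  shows "ideal (I \<inter> carrier (pair_ring (A\<lparr>carrier := S\<rparr>) (C\<lparr>carrier := U\<rparr>))) (pair_ring (A\<lparr>carrier := S\<rparr>) (C\<lparr>carrier := U\<rparr>))"
    (is "ideal ?I ?P")
proof -
  interpret I: ideal I "pair_ring A C" by (rule I)
  interpret P: ring ?P by (rule ring_pair_ring[OF rings(3,4)])
  have c: "carrier ?P \<subseteq> carrier (pair_ring A C)" using sub by (auto simp: pair_ring_simps)
  have m: "x \<otimes>\<^bsub>?P\<^esub> y = x \<otimes>\<^bsub>pair_ring A C\<^esub> y" for x y by (simp add: pair_ring_def)
  show ?thesis
  proof (rule idealI)
    show "subgroup ?I (add_monoid ?P)"
    proof (rule group.subgroupI[OF P.a_group])
      show "?I \<noteq> {}" using additive_subgroup.zero_closed[OF ideal.axioms(1)[OF I]] P.zero_closed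
        by (metis IntI empty_iff pair_ring_simps(3))
      show "inv\<^bsub>add_monoid ?P\<^esub> a \<in> ?I" if a: "a \<in> ?I" for a
      proof -
        have "inv\<^bsub>add_monoid ?P\<^esub> a = - a" "- a = \<ominus>\<^bsub>pair_ring A C\<^esub> a"
          using a c pair_ring_minus[OF rings(3,4), of a] pair_ring_minus[OF rings(1,2), of a]
          by (auto simp: a_inv_def)
        then show ?thesis
          using a subgroup.m_inv_closed[OF additive_subgroup.a_subgroup[OF ideal.axioms(1)[OF I]], of a] P.a_inv_closed[of a]
          by (auto simp: a_inv_def)
      qed
      show "a \<otimes>\<^bsub>add_monoid ?P\<^esub> b \<in> ?I" if "a \<in> ?I" "b \<in> ?I" for a b
        using that additive_subgroup.a_closed[OF ideal.axioms(1)[OF I], of a b] P.a_closed[of a b] by (auto simp: pair_ring_simps)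
    qed auto
    show "a \<otimes>\<^bsub>?P\<^esub> x \<in> ?I" "x \<otimes>\<^bsub>?P\<^esub> a \<in> ?I" if "x \<in> carrier ?P" "a \<in> ?I" for x a
      using that c I.I_l_closed[of a x] I.I_r_closed[of a x] P.m_closed[of x a] P.m_closed[of a x] by (auto simp: m)
  qed (rule P.ring_axioms)
qed

locale number_field_order = number_field_csa scale N e co
  for scale :: "'k :: field_char_0 \<Rightarrow> 'b :: ring_1 \<Rightarrow> 'b" and N e co +
  fixes R :: "'b set" and n :: nat
  assumes is_order: "is_order scale R" and n: "n * n = N"
begin

lemma subring_order: "subring R (ring_of_type_algebra :: 'b ring)"
  using is_order by (simp add: is_order_def)

lemma order_one: "1 \<in> R" using subringE(3)[OF subring_order] by simp

lemma order_generators: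
  obtains S where "finite S" "R = {\<Sum>s\<in>S. scale (c s) s |c. \<forall>s\<in>S. algebraic_int (c s)}"
  using is_order unfolding is_order_def ring_of_integers_def by auto

text \<open>An order is described by generators over the ring of integers, so stability under
  integral scalars rests on products of algebraic integers being algebraic integers.\<close>

lemma order_scale:
  assumes "algebraic_int c" "a \<in> R"
  shows "scale c a \<in> R"
proof -
  interpret V: vector_space scale using csa by (simp add: central_simple_algebra_def is_algebra_def)
  obtain S where S: "finite S" "R = {\<Sum>s\<in>S. scale (c s) s |c. \<forall>s\<in>S. algebraic_int (c s)}" by (rule order_generators)
  then obtain d where d: "a = (\<Sum>s\<in>S. scale (d s) s)" "\<forall>s\<in>S. algebraic_int (d s)" using assms by auto
  have "scale c a = (\<Sum>s\<in>S. scale (c * d s) s)" by (simp add: d scale_sum_right)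
  then show ?thesis unfolding S(2) mem_Collect_eq
    using d(2) assms(1) by (intro exI[of _ "\<lambda>s. c * d s"]) (auto intro: algebraic_int_mult)
qed

abbreviation Bring where "Bring \<equiv> ring_of_type_algebra :: 'b ring"

abbreviation cls where "cls \<nu> x \<equiv> tensor_ideal (ring_of_type_algebra :: 'k ring) (\<lambda>c. scale c 1) Bring (to_completion \<nu>) (completion_at \<nu>)
  +>\<^bsub>pair_ring Bring (completion_at \<nu>)\<^esub> x"

text \<open>\<open>local_order\<close> speaks of cosets of \<open>order_tensor\<close> contained in
  cosets of \<open>local_algebra\<close>. The relation ideal of the order lies in that of the
  algebra, so a coset of the former sits inside the class of the same formal combination. This
  description by formal combinations is the one used for products and bounds.\<close>

lemma local_order_iff:
  assumes fin: "\<nu> \<in> finite_places"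
  shows "Y \<in> local_order scale R \<nu> \<longleftrightarrow> (\<exists>x. Poly_Mapping.keys x \<subseteq> R \<times> valuation_ring \<nu> \<and> Y = cls \<nu> x)"
proof -
  interpret finite_place \<nu> by unfold_locales (rule fin)
  interpret T: tensor_based "ring_of_type_algebra :: 'k ring" Bring "completion_at \<nu>"
    "\<lambda>c. scale c 1" "to_completion \<nu>" N e by (rule tensor_local[OF nu])
  let ?R = "Bring\<lparr>carrier := R\<rparr>" and ?O = "completion_at \<nu>\<lparr>carrier := valuation_ring \<nu>\<rparr>"
  let ?k = "ring_of_type_algebra\<lparr>carrier := ring_of_integers\<rparr> :: 'k ring"
  let ?P = "pair_ring ?R ?O" and ?J = "tensor_ideal ?k (\<lambda>c. scale c 1) ?R (to_completion \<nu>) ?O"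
  have rings: "ring Bring" "ring F" "ring ?R" "ring ?O"
    using T.A.ring_axioms F.ring_axioms T.A.subring_is_ring[OF subring_order] F.subring_is_ring[OF subring_valuation_ring] by auto
  interpret P: ring ?P by (rule ring_pair_ring[OF rings(3,4)])
  have O: "valuation_ring \<nu> \<subseteq> carrier F" by (auto simp: valuation_ring_def)
  have c: "carrier ?P \<subseteq> carrier T.P" using O by (auto simp: pair_ring_simps)
  \<comment> \<open>Relations over the ring of integers are relations over \<open>'k\<close>, and
    they involve only pairs from R and the valuation ring: R is stable under integral scalars, and
    algebraic integers have absolute value at most 1.\<close>
  have sub: "tensor_relations ?k (\<lambda>c. scale c 1) ?R (to_completion \<nu>) ?O \<subseteq> T.J \<inter> carrier ?P"
  proof
    fix z assume z: "z \<in> tensor_relations ?k (\<lambda>c. scale c 1) ?R (to_completion \<nu>) ?O"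
    from z consider (left) a a' c where "z = frag_of (a + a', c) - frag_of (a, c) - frag_of (a', c)"
        "a \<in> R" "a' \<in> R" "c \<in> valuation_ring \<nu>"
      | (right) a c c' where "z = frag_of (a, c \<oplus>\<^bsub>F\<^esub> c') - frag_of (a, c) - frag_of (a, c')"
        "a \<in> R" "c \<in> valuation_ring \<nu>" "c' \<in> valuation_ring \<nu>"
      | (balanced) r a c where "z = frag_of (scale r 1 * a, c) - frag_of (a, to_completion \<nu> r \<otimes>\<^bsub>F\<^esub> c)"
        "r \<in> ring_of_integers" "a \<in> R" "c \<in> valuation_ring \<nu>"
      unfolding tensor_relations_def by auto
    note cases = this
    have "z \<in> tensor_relations ring_of_type_algebra (\<lambda>c. scale c 1) Bring (to_completion \<nu>) F"
    proof (cases rule: cases)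
      case left
      then show ?thesis unfolding tensor_relations_def using O
        by (intro UnI1 CollectI exI[of _ a] exI[of _ a'] exI[of _ c]) auto
    next
      case right
      then show ?thesis unfolding tensor_relations_def using O
        by (intro UnI1[OF UnI2] CollectI exI[of _ a] exI[of _ c] exI[of _ c']) auto
    next
      case balanced
      then show ?thesis unfolding tensor_relations_def using O
        by (intro UnI2 CollectI exI[of _ r] exI[of _ a] exI[of _ c]) auto
    qed
    then have "z \<in> T.J" using T.relations_in_J by blast
    moreover have diff: "x - y \<in> carrier ?P" if "x \<in> carrier ?P" "y \<in> carrier ?P" for x y
      using that keys_diff[of x y] by (auto simp: pair_ring_simps)
    have "z \<in> carrier ?P"
    proof -
      have fr: "frag_of (a, c) \<in> carrier ?P" if "a \<in> R" "c \<in> valuation_ring \<nu>" for a c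
        using that by (simp add: pair_ring_simps)
      have R: "a + b \<in> R" if "a \<in> R" "b \<in> R" for a b using subringE(7)[OF subring_order that] by simp
      have sc: "scale r 1 * a \<in> R" if "r \<in> ring_of_integers" "a \<in> R" for r a
        using that order_scale[of r a] by (simp add: ring_of_integers_def is_alg)
      have tc: "to_completion \<nu> r \<otimes>\<^bsub>F\<^esub> c \<in> valuation_ring \<nu>" if "r \<in> ring_of_integers" "c \<in> valuation_ring \<nu>" for r c
      proof -
        have "to_completion \<nu> r \<in> valuation_ring \<nu>"
          using that ring_hom_closed[OF to_completion_hom[OF nu], of r] V.v_algebraic_int[of r]
          by (simp add: valuation_ring_def cabs_const ring_of_integers_def)
        then show ?thesis using subringE(6)[OF subring_valuation_ring _ that(2)] by blast
      qed
      have ad: "c \<oplus>\<^bsub>F\<^esub> c' \<in> valuation_ring \<nu>" if "c \<in> valuation_ring \<nu>" "c' \<in> valuation_ring \<nu>" for c c'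
        using subringE(7)[OF subring_valuation_ring that] .
      show ?thesis
        by (cases rule: cases) (auto intro!: diff fr R sc tc ad)
    qed
    ultimately show "z \<in> T.J \<inter> carrier ?P" by blast
  qed
  have JJ: "?J \<subseteq> T.J"
    using ideal_Int_pair_ring[OF T.ideal_J rings _ O] sub
    unfolding tensor_ideal_def[of ?k] genideal_def by auto
  have zero: "0 \<in> ?J"
    unfolding tensor_ideal_def[of ?k] genideal_def
    using additive_subgroup.zero_closed[OF ideal.axioms(1)] by (fastforce simp: pair_ring_simps)
  have sum: "I +>\<^bsub>Q\<^esub> x = {i + x | i. i \<in> I}" if "\<And>x y. x \<oplus>\<^bsub>Q\<^esub> y = x + y" for I x and Q :: "('b \<times> (nat \<Rightarrow> 'k) set \<Rightarrow>\<^sub>0 int) ring"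
    using that by (auto simp: a_r_coset_def')
  have ot: "carrier (order_tensor scale R \<nu>) = (\<lambda>x. ?J +>\<^bsub>?P\<^esub> x) ` carrier ?P"
    by (auto simp: order_tensor_def tensor_ring_def FactRing_def A_RCOSETS_def')
  have "Y \<in> local_order scale R \<nu> \<longleftrightarrow> Y \<in> carrier T.T \<and> (\<exists>x\<in>carrier ?P. ?J +>\<^bsub>?P\<^esub> x \<subseteq> Y)"
    using fin unfolding local_order_def ot by (simp add: local_algebra_def)
  also have "\<dots> \<longleftrightarrow> (\<exists>x\<in>carrier ?P. Y = cls \<nu> x)"
  proof safe
    fix x assume Y: "Y \<in> carrier T.T" and x: "x \<in> carrier ?P" "?J +>\<^bsub>?P\<^esub> x \<subseteq> Y"
    obtain y where y: "y \<in> carrier T.P" "Y = cls \<nu> y" using Y unfolding T.T_carrier by auto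
    have "x \<in> ?J +>\<^bsub>?P\<^esub> x" using zero by (subst sum) (auto simp: pair_ring_simps)
    then have "x \<in> cls \<nu> y" using x y by blast
    then obtain i where i: "i \<in> T.J" "x = i + y" by (subst (asm) sum) (auto simp: pair_ring_simps)
    then have "cls \<nu> x = cls \<nu> y" using x(1) c y(1) by (intro T.coset_eq) auto
    then show "\<exists>x\<in>carrier ?P. Y = cls \<nu> x" using x(1) y(2) by auto
  next
    fix x assume x: "x \<in> carrier ?P"
    then show "cls \<nu> x \<in> carrier T.T" using c unfolding T.T_carrier by blast
    have "?J +>\<^bsub>?P\<^esub> x \<subseteq> cls \<nu> x" using JJ by (subst (1 2) sum) (auto simp: pair_ring_simps)
    then show "\<exists>xa\<in>carrier ?P. ?J +>\<^bsub>?P\<^esub> xa \<subseteq> cls \<nu> x" using x by blast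
  qed
  also have "\<dots> \<longleftrightarrow> (\<exists>x. Poly_Mapping.keys x \<subseteq> R \<times> valuation_ring \<nu> \<and> Y = cls \<nu> x)"
    by (auto simp: pair_ring_simps)
  finally show ?thesis .
qed

end

lemma keys_frag_induct [consumes 1, case_names zero frag diff]:
  assumes "Poly_Mapping.keys x \<subseteq> S" and "Q 0" and "\<And>p. p \<in> S \<Longrightarrow> Q (frag_of p)"
    and "\<And>x y. Poly_Mapping.keys x \<subseteq> S \<Longrightarrow> Poly_Mapping.keys y \<subseteq> S \<Longrightarrow> Q x \<Longrightarrow> Q y \<Longrightarrow> Q (x - y)"
  shows "Q x"
proof -
  have "Poly_Mapping.keys x \<subseteq> S \<and> Q x"
    using assms(1)
  proof (induction x rule: frag_induction)
    case (diff a b)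
    then show ?case using assms(4)[of a b] keys_diff[of a b] by blast
  qed (use assms(2,3) in auto)
  then show ?thesis by blast
qed

lemma (in finite_place) cabs_summand_le:
  assumes "Z \<in> carrier F" "W \<in> carrier F" "Y = Z \<oplus>\<^bsub>F\<^esub> W"
  shows "cabs Z \<le> max (cabs Y) (cabs W)"
proof -
  have "Z = Y \<oplus>\<^bsub>F\<^esub> (\<ominus>\<^bsub>F\<^esub> W)" using assms by (simp add: F.a_assoc F.r_neg)
  then show ?thesis using cabs_max[of Y "\<ominus>\<^bsub>F\<^esub> W"] assms by (simp add: cabs_minus)
qed

context number_field_order
begin

lemma cls_pure: "cls \<nu> (frag_of (a, c)) = pt \<nu> a c"
  by (simp add: pure_tensor_def)

lemma cls_hom:
  assumes "\<nu> \<in> places"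
  shows "cls \<nu> \<in> ring_hom (pair_ring Bring (completion_at \<nu>)) (local_algebra scale \<nu>)"
proof -
  interpret T: tensor_based "ring_of_type_algebra :: 'k ring" Bring "completion_at \<nu>"
    "\<lambda>c. scale c 1" "to_completion \<nu>" N e by (rule tensor_local[OF assms])
  show ?thesis unfolding local_algebra_def by (rule T.coset_hom)
qed

lemma local_order_mult:
  assumes fin: "\<nu> \<in> finite_places" and "Y \<in> local_order scale R \<nu>" "Z \<in> local_order scale R \<nu>"
  shows "Y \<otimes>\<^bsub>local_algebra scale \<nu>\<^esub> Z \<in> local_order scale R \<nu>"
proof -
  interpret finite_place \<nu> by unfold_locales (rule fin)
  let ?R = "Bring\<lparr>carrier := R\<rparr>" and ?O = "completion_at \<nu>\<lparr>carrier := valuation_ring \<nu>\<rparr>"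
  interpret B: ring Bring by (rule ring_ring_of_type_algebra)
  interpret P: ring "pair_ring ?R ?O"
    by (intro ring_pair_ring B.subring_is_ring[OF subring_order] F.subring_is_ring[OF subring_valuation_ring])
  obtain x where x: "Poly_Mapping.keys x \<subseteq> R \<times> valuation_ring \<nu>" "Y = cls \<nu> x"
    using assms(2) unfolding local_order_iff[OF fin] by (elim exE conjE) (rule that)
  obtain y where y: "Poly_Mapping.keys y \<subseteq> R \<times> valuation_ring \<nu>" "Z = cls \<nu> y"
    using assms(3) unfolding local_order_iff[OF fin] by (elim exE conjE) (rule that)
  note xy = x y
  have O: "valuation_ring \<nu> \<subseteq> carrier F" by (auto simp: valuation_ring_def)
  have "x \<otimes>\<^bsub>pair_ring ?R ?O\<^esub> y \<in> carrier (pair_ring ?R ?O)"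
    using xy by (intro P.m_closed) (auto simp: pair_ring_simps)
  then have "Poly_Mapping.keys (x \<otimes>\<^bsub>pair_ring Bring F\<^esub> y) \<subseteq> R \<times> valuation_ring \<nu>"
    by (simp add: pair_ring_def)
  moreover have "Y \<otimes>\<^bsub>local_algebra scale \<nu>\<^esub> Z = cls \<nu> (x \<otimes>\<^bsub>pair_ring Bring F\<^esub> y)"
    unfolding xy(2,4) using xy(1,3) O
    by (intro ring_hom_mult[OF cls_hom[OF nu], symmetric]) (auto simp: pair_ring_simps)
  ultimately show ?thesis using local_order_iff[OF fin] by blast
qed

lemma pt_in_local_order:
  assumes fin: "\<nu> \<in> finite_places" and "a \<in> R" "c \<in> valuation_ring \<nu>"
  shows "pt \<nu> a c \<in> local_order scale R \<nu>"
  unfolding local_order_iff[OF fin] using assms by (intro exI[of _ "frag_of (a, c)"]) (simp add: cls_pure)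

lemma local_order_one:
  assumes fin: "\<nu> \<in> finite_places"
  shows "\<one>\<^bsub>local_algebra scale \<nu>\<^esub> \<in> local_order scale R \<nu>"
proof -
  interpret finite_place \<nu> by unfold_locales (rule fin)
  interpret T: tensor_based "ring_of_type_algebra :: 'k ring" Bring "completion_at \<nu>"
    "\<lambda>c. scale c 1" "to_completion \<nu>" N e by (rule tensor_local[OF nu])
  have "\<one>\<^bsub>local_algebra scale \<nu>\<^esub> = pt \<nu> 1 \<one>\<^bsub>completion_at \<nu>\<^esub>" using T.pt_one by (simp add: local_algebra_def)
  then show ?thesis using pt_in_local_order[OF fin order_one] subringE(3)[OF subring_valuation_ring] by simp
qed

lemma local_order_subset: "local_order scale R \<nu> \<subseteq> carrier (local_algebra scale \<nu>)"
  by (auto simp: local_order_def)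

abbreviation eb where "eb \<nu> i \<equiv> pt \<nu> (e i) \<one>\<^bsub>completion_at \<nu>\<^esub>"

text \<open>Only the finitely many products of a generator of R with a basis element matter.
  Integral coefficients and factors from the valuation ring have absolute value at most 1, and
  ultrametric sums do not increase a bound, so one constant serves the whole local order.\<close>

lemma local_coord_bounded:
  assumes fin: "\<nu> \<in> finite_places"
  obtains C where "C \<ge> 0" "\<And>Y i l. Y \<in> local_order scale R \<nu> \<Longrightarrow> i < N \<Longrightarrow> l < N \<Longrightarrow>
    completion_abs \<nu> (based_algebra.coord (completion_at \<nu>) (local_algebra scale \<nu>) (to_local_algebra scale \<nu>) N (eb \<nu>)
      (Y \<otimes>\<^bsub>local_algebra scale \<nu>\<^esub> eb \<nu> l) i) \<le> C"
proof -
  interpret finite_place \<nu> by unfold_locales (rule fin)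
  interpret T: tensor_based "ring_of_type_algebra :: 'k ring" Bring "completion_at \<nu>"
    "\<lambda>c. scale c 1" "to_completion \<nu>" N e by (rule tensor_local[OF nu])
  interpret W: normed_algebra "completion_at \<nu>" "local_algebra scale \<nu>" "to_local_algebra scale \<nu>" N "eb \<nu>"
    by (rule local_normed_algebra[OF nu])
  have A: "T.T = local_algebra scale \<nu>" "T.pt 1 = to_local_algebra scale \<nu>"
    by (simp_all add: local_algebra_def to_local_algebra_def)
  obtain S where S: "finite S" "R = {\<Sum>s\<in>S. scale (c s) s |c. \<forall>s\<in>S. algebraic_int (c s)}" by (rule order_generators)
  let ?V = "(\<lambda>(s, i, l). place_abs \<nu> (co (s * e l) i)) ` (S \<times> {..<N} \<times> {..<N})"
  have "bdd_above ?V" using S(1) by (intro bdd_above_finite) auto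
  then obtain C0 where C0: "\<And>y. y \<in> ?V \<Longrightarrow> y \<le> C0" unfolding bdd_above_def by blast
  \<comment> \<open>The upper bound of a finite set of values might be negative if the set is empty;
    the estimates below require C to be nonnegative.\<close>
  define C where "C = max C0 0"
  have C: "place_abs \<nu> (co (s * e l) i) \<le> C" if "s \<in> S" "i < N" "l < N" for s i l
    by (rule order_trans[OF C0]) (use that in \<open>auto simp: C_def intro!: image_eqI[of _ _ "(s, i, l)"]\<close>)
  have bound: "cabs (W.coord (cls \<nu> x \<otimes>\<^bsub>local_algebra scale \<nu>\<^esub> eb \<nu> l) i) \<le> C"
    if x: "Poly_Mapping.keys x \<subseteq> R \<times> valuation_ring \<nu>" and il: "i < N" "l < N" for x i l
    using x
  proof (induction rule: keys_frag_induct)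
    case zero
    have "cls \<nu> 0 = \<zero>\<^bsub>local_algebra scale \<nu>\<^esub>"
      using ring_hom_zero[OF cls_hom[OF nu] T.ring_P W.A.ring_axioms] by (simp add: pair_ring_simps)
    then show ?case using il by (simp add: cabs_zero C_def)
  next
    case (frag p)
    obtain a c where p: "p = (a, c)" "a \<in> R" "c \<in> carrier F" "cabs c \<le> 1" using frag by (auto simp: valuation_ring_def)
    obtain d where d: "a = (\<Sum>s\<in>S. scale (d s) s)" "\<forall>s\<in>S. algebraic_int (d s)" using p(2) S(2) by auto
    have tc: "to_completion \<nu> z \<in> carrier F" for z using ring_hom_closed[OF to_completion_hom[OF nu], of z] by simp
    have "pt \<nu> a c \<otimes>\<^bsub>local_algebra scale \<nu>\<^esub> eb \<nu> l = pt \<nu> (a * e l) c"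
      using T.pt_mult[of a c "e l" "\<one>\<^bsub>F\<^esub>"] p by (simp add: A)
    then have "W.coord (pt \<nu> a c \<otimes>\<^bsub>local_algebra scale \<nu>\<^esub> eb \<nu> l) i = to_completion \<nu> (co (a * e l) i) \<otimes>\<^bsub>F\<^esub> c"
      using T.tensor_coord_pure[of "a * e l" c i] p il by (simp add: A coord_types)
    then have "cabs (W.coord (pt \<nu> a c \<otimes>\<^bsub>local_algebra scale \<nu>\<^esub> eb \<nu> l) i) = place_abs \<nu> (co (a * e l) i) * cabs c"
      using p tc by (simp add: cabs_mult cabs_const)
    also have "\<dots> \<le> C * 1"
    proof (rule mult_mono)
      have "co (a * e l) i = (\<Sum>s\<in>S. d s * co (s * e l) i)"
        by (simp add: d(1) sum_distrib_right is_alg co_sum co_scale)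
      also have "place_abs \<nu> \<dots> \<le> C"
      proof (rule V.v_sum_le)
        fix s assume s: "s \<in> S"
        have "place_abs \<nu> (d s) * place_abs \<nu> (co (s * e l) i) \<le> 1 * C"
          using s d(2) il by (intro mult_mono V.v_algebraic_int C) auto
        then show "place_abs \<nu> (d s * co (s * e l) i) \<le> C" by simp
      qed (simp add: C_def)
      finally show "place_abs \<nu> (co (a * e l) i) \<le> C" .
    qed (use p cabs_nonneg in \<open>auto simp: C_def\<close>)
    finally show ?case by (simp add: p(1) cls_pure)
  next
    case (diff x y)
    have O: "valuation_ring \<nu> \<subseteq> carrier F" by (auto simp: valuation_ring_def)
    have P: "x \<in> carrier T.P" "y \<in> carrier T.P" using diff(1,2) O by (auto simp: pair_ring_simps)
    then have xy: "x - y \<in> carrier T.P" by (rule T.diff_in_P)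
    have cl: "cls \<nu> z \<in> carrier (local_algebra scale \<nu>)" if "z \<in> carrier T.P" for z
      using ring_hom_closed[OF cls_hom[OF nu] that] .
    have "x = (x - y) \<oplus>\<^bsub>T.P\<^esub> y" by (simp add: pair_ring_simps)
    then have "cls \<nu> x = cls \<nu> (x - y) \<oplus>\<^bsub>local_algebra scale \<nu>\<^esub> cls \<nu> y"
      using ring_hom_add[OF cls_hom[OF nu] xy P(2)] by simp
    then have *: "W.coord (cls \<nu> x \<otimes>\<^bsub>local_algebra scale \<nu>\<^esub> eb \<nu> l) i =
      W.coord (cls \<nu> (x - y) \<otimes>\<^bsub>local_algebra scale \<nu>\<^esub> eb \<nu> l) i \<oplus>\<^bsub>F\<^esub> W.coord (cls \<nu> y \<otimes>\<^bsub>local_algebra scale \<nu>\<^esub> eb \<nu> l) i"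
      using cl xy P il by (simp add: W.A.l_distr W.coord_add del: T.pt_mult)
    have cc: "W.coord (cls \<nu> z \<otimes>\<^bsub>local_algebra scale \<nu>\<^esub> eb \<nu> l) i \<in> carrier F" if "z \<in> carrier T.P" for z
      using cl[OF that] il by (simp del: T.pt_mult)
    have "cabs (W.coord (cls \<nu> (x - y) \<otimes>\<^bsub>local_algebra scale \<nu>\<^esub> eb \<nu> l) i) \<le>
      max (cabs (W.coord (cls \<nu> x \<otimes>\<^bsub>local_algebra scale \<nu>\<^esub> eb \<nu> l) i)) (cabs (W.coord (cls \<nu> y \<otimes>\<^bsub>local_algebra scale \<nu>\<^esub> eb \<nu> l) i))"
      by (rule cabs_summand_le[OF cc[OF xy] cc[OF P(2)] *])
    also have "\<dots> \<le> C" using diff(3,4) by (rule max.boundedI)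
    finally show ?case .
  qed
  show ?thesis
  proof (rule that)
    show "C \<ge> 0" by (simp add: C_def)
    show "cabs (W.coord (Y \<otimes>\<^bsub>local_algebra scale \<nu>\<^esub> eb \<nu> l) i) \<le> C"
      if Yil: "Y \<in> local_order scale R \<nu>" "i < N" "l < N" for Y i l
    proof -
      obtain x where "Poly_Mapping.keys x \<subseteq> R \<times> valuation_ring \<nu>" "Y = cls \<nu> x"
        using Yil(1) unfolding local_order_iff[OF fin] by (elim exE conjE) (rule that)
      then show ?thesis using bound[OF _ Yil(2,3)] by (simp only:)
    qed
  qed
qed

lemma local_norm_le_1:
  assumes fin: "\<nu> \<in> finite_places" and Y: "Y \<in> local_order scale R \<nu>"
  shows "completion_abs \<nu> (local_reduced_norm scale \<nu> Y) \<le> 1"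
proof -
  interpret finite_place \<nu> by unfold_locales (rule fin)
  interpret W: normed_algebra "completion_at \<nu>" "local_algebra scale \<nu>" "to_local_algebra scale \<nu>" N "eb \<nu>"
    by (rule local_normed_algebra[OF nu])
  have nr: "local_reduced_norm scale \<nu> = W.nr" by (simp add: local_reduced_norm_def)
  have Yc: "Y \<in> carrier (local_algebra scale \<nu>)" using Y local_order_subset by blast
  obtain C where C: "C \<ge> 0" "\<And>Y i l. Y \<in> local_order scale R \<nu> \<Longrightarrow> i < N \<Longrightarrow> l < N \<Longrightarrow>
    cabs (W.coord (Y \<otimes>\<^bsub>local_algebra scale \<nu>\<^esub> eb \<nu> l) i) \<le> C" by (rule local_coord_bounded[OF fin]) (rule that, assumption, blast)
  have pow: "Y [^]\<^bsub>local_algebra scale \<nu>\<^esub> m \<in> local_order scale R \<nu>" for m :: nat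
    by (induction m) (simp_all add: local_order_one[OF fin] local_order_mult[OF fin] Y)
  have nrY: "W.nr Y \<in> carrier F" by (rule W.norm_closed[OF Yc])
  have cpow: "cabs (z [^]\<^bsub>F\<^esub> (m :: nat)) = cabs z ^ m" if "z \<in> carrier F" for z m
    using that by (induction m) (simp_all add: cabs_one cabs_mult mult.commute)
  have norm_pow: "W.nr (Y [^]\<^bsub>local_algebra scale \<nu>\<^esub> m) = W.nr Y [^]\<^bsub>F\<^esub> m" for m :: nat
    using Yc by (induction m) (simp_all add: W.norm_one W.norm_mult)
  \<comment> \<open>The outer exponent n comes from \<open>determinant_mult_matrix\<close>: the
    determinant of left multiplication is the n-th power of the reduced norm. The right-hand side
    does not depend on m.\<close>
  have bound: "(cabs (W.nr Y) ^ m) ^ n \<le> C ^ N" for m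
  proof -
    have Ym: "Y [^]\<^bsub>local_algebra scale \<nu>\<^esub> m \<in> carrier (local_algebra scale \<nu>)" using Yc by simp
    have "cabs (determinant N F (W.mult_matrix (Y [^]\<^bsub>local_algebra scale \<nu>\<^esub> m))) \<le> C ^ N"
      using Ym C(2)[OF pow] C(1) by (intro cabs_determinant_le) (simp_all add: W.mult_matrix_def)
    then show ?thesis
      using nrY by (simp add: W.determinant_mult_matrix[OF Ym n] norm_pow cpow)
  qed
  show ?thesis
  proof (rule ccontr)
    assume "\<not> ?thesis"
    then have gt: "1 < cabs (W.nr Y)" by (simp add: nr)
    then obtain m where m: "C ^ N < cabs (W.nr Y) ^ m" using real_arch_pow by blast
    have "n > 0" using n N_pos by (cases n) auto
    then have "cabs (W.nr Y) ^ m \<le> (cabs (W.nr Y) ^ m) ^ n"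
      using gt by (intro self_le_power one_le_power) auto
    then show False using m bound[of m] by linarith
  qed
qed

lemma
  assumes nu: "\<nu> \<in> places"
  shows local_norm_mult: "x \<in> carrier (local_algebra scale \<nu>) \<Longrightarrow> y \<in> carrier (local_algebra scale \<nu>) \<Longrightarrow>
      local_reduced_norm scale \<nu> (x \<otimes>\<^bsub>local_algebra scale \<nu>\<^esub> y) =
      local_reduced_norm scale \<nu> x \<otimes>\<^bsub>completion_at \<nu>\<^esub> local_reduced_norm scale \<nu> y"
    and local_norm_one: "local_reduced_norm scale \<nu> \<one>\<^bsub>local_algebra scale \<nu>\<^esub> = \<one>\<^bsub>completion_at \<nu>\<^esub>"
    and local_norm_closed: "x \<in> carrier (local_algebra scale \<nu>) \<Longrightarrow> local_reduced_norm scale \<nu> x \<in> carrier (completion_at \<nu>)"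
    and local_norm_scalar: "r \<in> carrier (completion_at \<nu>) \<Longrightarrow>
      local_reduced_norm scale \<nu> (to_local_algebra scale \<nu> r) = r [^]\<^bsub>completion_at \<nu>\<^esub> n"
proof -
  interpret W: normed_algebra "completion_at \<nu>" "local_algebra scale \<nu>" "to_local_algebra scale \<nu>" N "eb \<nu>"
    by (rule local_normed_algebra[OF nu])
  have nr: "local_reduced_norm scale \<nu> = W.nr" by (simp add: local_reduced_norm_def)
  show "x \<in> carrier (local_algebra scale \<nu>) \<Longrightarrow> y \<in> carrier (local_algebra scale \<nu>) \<Longrightarrow>
      local_reduced_norm scale \<nu> (x \<otimes>\<^bsub>local_algebra scale \<nu>\<^esub> y) =
      local_reduced_norm scale \<nu> x \<otimes>\<^bsub>completion_at \<nu>\<^esub> local_reduced_norm scale \<nu> y"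
    unfolding nr by (rule W.norm_mult)
  show "local_reduced_norm scale \<nu> \<one>\<^bsub>local_algebra scale \<nu>\<^esub> = \<one>\<^bsub>completion_at \<nu>\<^esub>"
    unfolding nr by (rule W.norm_one)
  show "x \<in> carrier (local_algebra scale \<nu>) \<Longrightarrow> local_reduced_norm scale \<nu> x \<in> carrier (completion_at \<nu>)"
    unfolding nr by (rule W.norm_closed)
  show "r \<in> carrier (completion_at \<nu>) \<Longrightarrow>
    local_reduced_norm scale \<nu> (to_local_algebra scale \<nu> r) = r [^]\<^bsub>completion_at \<nu>\<^esub> n"
    unfolding nr by (rule W.norm_scalar[OF _ n])
qed

text \<open>The norms of a unit and of its inverse are both bounded by 1 in absolute value, and
  their product is 1.\<close>

lemma local_norm_unit:
  assumes fin: "\<nu> \<in> finite_places" and x: "x \<in> Units (local_algebra scale \<nu>\<lparr>carrier := local_order scale R \<nu>\<rparr>)"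
  shows "completion_abs \<nu> (local_reduced_norm scale \<nu> x) = 1"
proof -
  interpret finite_place \<nu> by unfold_locales (rule fin)
  obtain y where y: "x \<in> local_order scale R \<nu>" "y \<in> local_order scale R \<nu>"
    "x \<otimes>\<^bsub>local_algebra scale \<nu>\<^esub> y = \<one>\<^bsub>local_algebra scale \<nu>\<^esub>"
    using x by (auto simp: Units_def)
  have c: "x \<in> carrier (local_algebra scale \<nu>)" "y \<in> carrier (local_algebra scale \<nu>)"
    using y local_order_subset by blast+
  let ?x = "cabs (local_reduced_norm scale \<nu> x)" and ?y = "cabs (local_reduced_norm scale \<nu> y)"
  have "?x * ?y = cabs (local_reduced_norm scale \<nu> (x \<otimes>\<^bsub>local_algebra scale \<nu>\<^esub> y))"
    unfolding local_norm_mult[OF nu c]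
    by (rule cabs_mult[OF local_norm_closed[OF nu c(1)] local_norm_closed[OF nu c(2)], symmetric])
  then have "?x * ?y = 1" by (simp add: y(3) local_norm_one[OF nu] cabs_one)
  moreover have "?x \<le> 1" "?y \<le> 1" using local_norm_le_1[OF fin] y by auto
  moreover have "?x * ?y \<le> ?x * 1"
    using \<open>?y \<le> 1\<close> cabs_nonneg[OF local_norm_closed[OF nu c(1)]] by (rule mult_left_mono)
  ultimately show ?thesis by simp
qed

end

section \<open>Ideles\<close>

lemma (in group) subgroup_left_inverseI:
  assumes "H \<subseteq> carrier G" "H \<noteq> {}" "\<And>a. a \<in> H \<Longrightarrow> \<exists>b\<in>H. b \<otimes> a = \<one>" "\<And>a b. a \<in> H \<Longrightarrow> b \<in> H \<Longrightarrow> a \<otimes> b \<in> H"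
  shows "subgroup H G"
proof (rule subgroupI)
  fix a assume a: "a \<in> H"
  then obtain b where b: "b \<in> H" "b \<otimes> a = \<one>" using assms(3) by blast
  then have "inv a = b" using a assms(1) by (intro inv_equality) auto
  then show "inv a \<in> H" using b by simp
qed (use assms in auto)

lemma (in ring) unit_normalizer_mult:
  assumes S: "S \<subseteq> carrier R" and x: "x \<in> unit_normalizer R S" and y: "y \<in> unit_normalizer R S"
  shows "x \<otimes> y \<in> unit_normalizer R S"
proof -
  have u: "x \<in> Units R" "y \<in> Units R" using x y by (simp_all add: unit_normalizer_def)
  have "x \<otimes> y \<otimes> r \<otimes> inv (x \<otimes> y) = x \<otimes> (y \<otimes> r \<otimes> inv y) \<otimes> inv x" if "r \<in> S" for r
  proof -
    have "inv (x \<otimes> y) = inv y \<otimes> inv x"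
      using u by (intro inv_unique'[symmetric]) (auto simp: m_assoc Units_closed, simp_all add: m_assoc[symmetric] Units_closed)
    then show ?thesis using u S that by (auto simp: m_assoc Units_closed)
  qed
  then have "(\<lambda>r. x \<otimes> y \<otimes> r \<otimes> inv (x \<otimes> y)) ` S = (\<lambda>r. x \<otimes> r \<otimes> inv x) ` (\<lambda>r. y \<otimes> r \<otimes> inv y) ` S"
    by (simp add: image_image)
  then show ?thesis using x y u by (simp add: unit_normalizer_def)
qed

lemma (in ring) unit_normalizer_inv:
  assumes S: "S \<subseteq> carrier R" and x: "x \<in> unit_normalizer R S"
  shows "inv x \<in> unit_normalizer R S"
proof -
  have u: "x \<in> Units R" and im: "(\<lambda>r. x \<otimes> r \<otimes> inv x) ` S = S" using x by (simp_all add: unit_normalizer_def)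
  have "inv x \<otimes> (x \<otimes> r \<otimes> inv x) \<otimes> inv (inv x) = r" if "r \<in> S" for r
  proof -
    have "inv x \<otimes> (x \<otimes> r \<otimes> inv x) \<otimes> x = (inv x \<otimes> x) \<otimes> r \<otimes> (inv x \<otimes> x)"
      using u S that by (simp add: m_assoc Units_closed subset_iff del: Units_l_inv Units_r_inv)
    then show ?thesis using u S that by auto
  qed
  then have "(\<lambda>r. inv x \<otimes> r \<otimes> inv (inv x)) ` (\<lambda>r. x \<otimes> r \<otimes> inv x) ` S = S"
    by (simp add: image_image)
  then show ?thesis unfolding im using u by (simp add: unit_normalizer_def)
qed

lemma (in ring) Units_subset_carrier:
  assumes S: "S \<subseteq> carrier R" and x: "x \<in> Units (R\<lparr>carrier := S\<rparr>)"
  shows "x \<in> Units R" "inv x \<in> Units (R\<lparr>carrier := S\<rparr>)"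
proof -
  obtain y where y: "x \<in> S" "y \<in> S" "x \<otimes> y = \<one>" "y \<otimes> x = \<one>" using x by (auto simp: Units_def)
  then show "x \<in> Units R" using S by (auto simp: Units_def)
  have "inv x = y" using y S by (intro inv_unique'[symmetric]) auto
  then show "inv x \<in> Units (R\<lparr>carrier := S\<rparr>)" using y by (auto simp: Units_def)
qed

lemma (in ring) Units_subset_mult:
  assumes S: "S \<subseteq> carrier R" "\<And>a b. a \<in> S \<Longrightarrow> b \<in> S \<Longrightarrow> a \<otimes> b \<in> S"
    and x: "x \<in> Units (R\<lparr>carrier := S\<rparr>)" and y: "y \<in> Units (R\<lparr>carrier := S\<rparr>)"
  shows "x \<otimes> y \<in> Units (R\<lparr>carrier := S\<rparr>)"
proof -
  obtain x' where x': "x \<in> S" "x' \<in> S" "x \<otimes> x' = \<one>" "x' \<otimes> x = \<one>" using x by (auto simp: Units_def)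
  obtain y' where y': "y \<in> S" "y' \<in> S" "y \<otimes> y' = \<one>" "y' \<otimes> y = \<one>" using y by (auto simp: Units_def)
  have c: "x \<in> carrier R" "x' \<in> carrier R" "y \<in> carrier R" "y' \<in> carrier R" using x' y' S by auto
  have "x \<otimes> y \<otimes> (y' \<otimes> x') = x \<otimes> (y \<otimes> y') \<otimes> x'" using c by (simp add: m_assoc)
  then have 1: "x \<otimes> y \<otimes> (y' \<otimes> x') = \<one>" using c x' y' by simp
  have "y' \<otimes> x' \<otimes> (x \<otimes> y) = y' \<otimes> (x' \<otimes> x) \<otimes> y" using c by (simp add: m_assoc)
  then have 2: "y' \<otimes> x' \<otimes> (x \<otimes> y) = \<one>" using c x' y' by simp
  show ?thesis unfolding Units_def using x' y' S(2) 1 2 by (auto intro!: bexI[of _ "y' \<otimes> x'"])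
qed

text \<open>Being a unit of the valuation ring is replaced by having absolute value 1, a condition
  that passes to products and inverses by multiplicativity.\<close>

lemma idele_carrier:
  "x \<in> carrier idele_group \<longleftrightarrow> x \<in> (\<Pi>\<^sub>E \<nu>\<in>places. Units (completion_at \<nu>)) \<and>
    finite {\<nu> \<in> finite_places. completion_abs \<nu> (x \<nu>) \<noteq> 1}"
proof (cases "x \<in> (\<Pi>\<^sub>E \<nu>\<in>places. Units (completion_at \<nu>))")
  case True
  then have "x \<nu> \<in> carrier (completion_at \<nu>)" if "\<nu> \<in> finite_places" for \<nu>
    using finite_places_places[OF that] by (auto simp: Units_def)
  then have "{\<nu> \<in> finite_places. x \<nu> \<notin> Units (completion_at \<nu>\<lparr>carrier := valuation_ring \<nu>\<rparr>)} =
    {\<nu> \<in> finite_places. completion_abs \<nu> (x \<nu>) \<noteq> 1}"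
    using Units_valuation_ring[OF finite_places_places] by auto
  then show ?thesis using True by (simp add: idele_group_def)
qed (simp add: idele_group_def)

lemma idele_mult: "x \<otimes>\<^bsub>idele_group\<^esub> y = (\<lambda>\<nu>\<in>places. x \<nu> \<otimes>\<^bsub>completion_at \<nu>\<^esub> y \<nu>)"
  by (simp add: idele_group_def units_of_mult)

lemma idele_one: "\<one>\<^bsub>idele_group\<^esub> = (\<lambda>\<nu>\<in>places. \<one>\<^bsub>completion_at \<nu>\<^esub>)"
  by (simp add: idele_group_def units_of_one)

lemma comm_group_idele: "comm_group (idele_group :: ('k :: field_char_0 place \<Rightarrow> (nat \<Rightarrow> 'k) set) monoid)"
  (is "comm_group ?G")
proof (rule comm_groupI)
  have F: "field (completion_at \<nu>)" if "\<nu> \<in> places" for \<nu> :: "'k place" by (rule field_completion[OF that])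
  have unit: "x \<nu> \<in> Units (completion_at \<nu>)" if "x \<in> carrier ?G" "\<nu> \<in> places" for x \<nu>
    using that by (auto simp: idele_carrier)
  have cl: "x \<nu> \<in> carrier (completion_at \<nu>)" if "x \<in> carrier ?G" "\<nu> \<in> places" for x \<nu>
    using unit[OF that] by (simp add: Units_def)
  have extl: "x \<nu> = undefined" if "x \<in> carrier ?G" "\<nu> \<notin> places" for x \<nu>
    using that by (auto simp: idele_carrier PiE_def extensional_def)
  show "x \<otimes>\<^bsub>?G\<^esub> y \<in> carrier ?G" if xy: "x \<in> carrier ?G" "y \<in> carrier ?G" for x y
  proof -
    have "x \<nu> \<otimes>\<^bsub>completion_at \<nu>\<^esub> y \<nu> \<in> Units (completion_at \<nu>)" if "\<nu> \<in> places" for \<nu>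
    proof -
      interpret field "completion_at \<nu>" by (rule F[OF that])
      show ?thesis using unit[OF xy(1) that] unit[OF xy(2) that] by (rule Units_m_closed)
    qed
    moreover have "finite {\<nu> \<in> finite_places. completion_abs \<nu> ((x \<otimes>\<^bsub>?G\<^esub> y) \<nu>) \<noteq> 1}"
    proof (rule finite_subset)
      show "{\<nu> \<in> finite_places. completion_abs \<nu> ((x \<otimes>\<^bsub>?G\<^esub> y) \<nu>) \<noteq> 1} \<subseteq>
        {\<nu> \<in> finite_places. completion_abs \<nu> (x \<nu>) \<noteq> 1} \<union> {\<nu> \<in> finite_places. completion_abs \<nu> (y \<nu>) \<noteq> 1}"
        using xy cl by (auto simp: idele_mult finite_places_places completion_abs_mult)
    qed (use xy in \<open>auto simp: idele_carrier\<close>)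
    ultimately show ?thesis by (auto simp: idele_carrier idele_mult)
  qed
  show "\<one>\<^bsub>?G\<^esub> \<in> carrier ?G"
  proof -
    have "\<one>\<^bsub>completion_at \<nu>\<^esub> \<in> Units (completion_at \<nu>)" if "\<nu> \<in> places" for \<nu> :: "'k place"
    proof -
      interpret field "completion_at \<nu>" by (rule F[OF that])
      show ?thesis by simp
    qed
    moreover have "{\<nu> \<in> finite_places. completion_abs \<nu> (\<one>\<^bsub>?G\<^esub> \<nu>) \<noteq> 1} = {}"
      by (auto simp: idele_one finite_places_places completion_abs_one)
    then have "finite {\<nu> \<in> finite_places. completion_abs \<nu> (\<one>\<^bsub>?G\<^esub> \<nu>) \<noteq> 1}" by (simp only: finite.emptyI)
    ultimately show ?thesis unfolding idele_carrier by (intro conjI) (auto simp: idele_one)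
  qed
  show "x \<otimes>\<^bsub>?G\<^esub> y \<otimes>\<^bsub>?G\<^esub> z = x \<otimes>\<^bsub>?G\<^esub> (y \<otimes>\<^bsub>?G\<^esub> z)"
    if "x \<in> carrier ?G" "y \<in> carrier ?G" "z \<in> carrier ?G" for x y z
  proof (rule ext)
    fix \<nu> show "(x \<otimes>\<^bsub>?G\<^esub> y \<otimes>\<^bsub>?G\<^esub> z) \<nu> = (x \<otimes>\<^bsub>?G\<^esub> (y \<otimes>\<^bsub>?G\<^esub> z)) \<nu>"
    proof (cases "\<nu> \<in> places")
      case True
      interpret field "completion_at \<nu>" by (rule F[OF True])
      show ?thesis using True cl that by (simp add: idele_mult m_assoc)
    qed (simp add: idele_mult)
  qed
  show "x \<otimes>\<^bsub>?G\<^esub> y = y \<otimes>\<^bsub>?G\<^esub> x" if "x \<in> carrier ?G" "y \<in> carrier ?G" for x y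
  proof (rule ext)
    fix \<nu> show "(x \<otimes>\<^bsub>?G\<^esub> y) \<nu> = (y \<otimes>\<^bsub>?G\<^esub> x) \<nu>"
    proof (cases "\<nu> \<in> places")
      case True
      interpret field "completion_at \<nu>" by (rule F[OF True])
      show ?thesis using True cl that by (simp add: idele_mult m_comm)
    qed (simp add: idele_mult)
  qed
  show "\<one>\<^bsub>?G\<^esub> \<otimes>\<^bsub>?G\<^esub> x = x" if x: "x \<in> carrier ?G" for x
  proof (rule ext)
    fix \<nu> show "(\<one>\<^bsub>?G\<^esub> \<otimes>\<^bsub>?G\<^esub> x) \<nu> = x \<nu>"
    proof (cases "\<nu> \<in> places")
      case True
      interpret field "completion_at \<nu>" by (rule F[OF True])
      show ?thesis using True cl x by (simp add: idele_mult idele_one)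
    qed (simp add: idele_mult extl x)
  qed
  show "\<exists>y\<in>carrier ?G. y \<otimes>\<^bsub>?G\<^esub> x = \<one>\<^bsub>?G\<^esub>" if x: "x \<in> carrier ?G" for x
  proof -
    define y where "y = (\<lambda>\<nu>\<in>places. inv\<^bsub>completion_at \<nu>\<^esub> x \<nu>)"
    have y: "y \<nu> \<in> Units (completion_at \<nu>)" "y \<nu> \<in> carrier (completion_at \<nu>)"
      "y \<nu> \<otimes>\<^bsub>completion_at \<nu>\<^esub> x \<nu> = \<one>\<^bsub>completion_at \<nu>\<^esub>" if "\<nu> \<in> places" for \<nu>
    proof -
      interpret field "completion_at \<nu>" by (rule F[OF that])
      show "y \<nu> \<in> Units (completion_at \<nu>)" "y \<nu> \<in> carrier (completion_at \<nu>)"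
        "y \<nu> \<otimes>\<^bsub>completion_at \<nu>\<^esub> x \<nu> = \<one>\<^bsub>completion_at \<nu>\<^esub>"
        using that unit[OF x that] by (simp_all add: y_def)
    qed
    have "completion_abs \<nu> (y \<nu>) = 1" if "\<nu> \<in> finite_places" "completion_abs \<nu> (x \<nu>) = 1" for \<nu>
    proof -
      have nu: "\<nu> \<in> places" by (rule finite_places_places[OF that(1)])
      have "completion_abs \<nu> (y \<nu>) * completion_abs \<nu> (x \<nu>) = 1"
        using completion_abs_mult[OF nu y(2)[OF nu] cl[OF x nu]] y(3)[OF nu] completion_abs_one[OF nu] by simp
      then show ?thesis using that by simp
    qed
    then have "{\<nu> \<in> finite_places. completion_abs \<nu> (y \<nu>) \<noteq> 1} \<subseteq> {\<nu> \<in> finite_places. completion_abs \<nu> (x \<nu>) \<noteq> 1}" by auto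
    moreover have "finite {\<nu> \<in> finite_places. completion_abs \<nu> (x \<nu>) \<noteq> 1}" using x by (simp add: idele_carrier)
    ultimately have "finite {\<nu> \<in> finite_places. completion_abs \<nu> (y \<nu>) \<noteq> 1}" by (rule finite_subset)
    then have "y \<in> carrier ?G" using y by (auto simp: idele_carrier y_def)
    moreover have "y \<otimes>\<^bsub>?G\<^esub> x = \<one>\<^bsub>?G\<^esub>" unfolding idele_mult idele_one using y(3) by (intro restrict_ext)
    ultimately show ?thesis by blast
  qed
qed

text \<open>Membership in \<open>idele_group\<close> is the substantial point: a nonzero element of
  \<open>'k\<close> has absolute value 1 at almost all finite places, by
  \<open>finite_places_not_1\<close>.\<close>

lemma subgroup_principal_ideles:
  assumes nf: "number_field TYPE('k :: field_char_0)"
  shows "subgroup principal_ideles (idele_group :: ('k place \<Rightarrow> (nat \<Rightarrow> 'k) set) monoid)"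
    (is "subgroup _ ?G")
proof -
  interpret G: comm_group ?G by (rule comm_group_idele)
  define \<iota> where "\<iota> k = (\<lambda>\<nu>\<in>places. to_completion \<nu> k)" for k :: 'k
  have prin: "principal_ideles = \<iota> ` (UNIV - {0})" by (simp add: principal_ideles_def \<iota>_def)
  have mult: "\<iota> k \<otimes>\<^bsub>?G\<^esub> \<iota> l = \<iota> (k * l)" for k l
    using ring_hom_mult[OF to_completion_hom, of _ k l] unfolding idele_mult \<iota>_def by (intro restrict_ext) simp
  have one: "\<iota> 1 = \<one>\<^bsub>?G\<^esub>"
    using ring_hom_one[OF to_completion_hom] unfolding idele_one \<iota>_def by (intro restrict_ext) simp
  show ?thesis
  proof (rule G.subgroup_left_inverseI)
    show "principal_ideles \<subseteq> carrier ?G"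
    proof
      fix x assume "x \<in> (principal_ideles :: ('k place \<Rightarrow> (nat \<Rightarrow> 'k) set) set)"
      then obtain k where k: "k \<noteq> 0" "x = \<iota> k" unfolding prin by auto
      have "to_completion \<nu> k \<in> Units (completion_at \<nu>)" if nu: "\<nu> \<in> places" for \<nu> :: "'k place"
      proof -
        interpret field "completion_at \<nu>" by (rule field_completion[OF nu])
        interpret V: abs_val "place_abs \<nu>" using place_abs(2)[OF nu] by (simp add: abs_val_def)
        have c: "to_completion \<nu> k \<in> carrier (completion_at \<nu>)" using ring_hom_closed[OF to_completion_hom[OF nu], of k] by simp
        then have "to_completion \<nu> k \<noteq> \<zero>\<^bsub>completion_at \<nu>\<^esub>"
          using completion_abs_zero_iff[OF nu c] k by (simp add: completion_abs_const[OF nu])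
        then show ?thesis using c by (simp add: field_Units)
      qed
      moreover have "{\<nu> \<in> finite_places. completion_abs \<nu> (\<iota> k \<nu>) \<noteq> 1} = {\<nu> \<in> finite_places. place_abs \<nu> k \<noteq> 1}"
        by (auto simp: \<iota>_def finite_places_places completion_abs_const)
      ultimately show "x \<in> carrier ?G"
        using finite_places_not_1[OF nf k(1)] unfolding idele_carrier k(2) by (auto simp: \<iota>_def)
    qed
    show "\<exists>b\<in>principal_ideles. b \<otimes>\<^bsub>?G\<^esub> a = \<one>\<^bsub>?G\<^esub>" if "a \<in> principal_ideles" for a
    proof -
      obtain k where k: "k \<noteq> 0" "a = \<iota> k" using \<open>a \<in> principal_ideles\<close> unfolding prin by auto
      then have "\<iota> (inverse k) \<otimes>\<^bsub>?G\<^esub> a = \<one>\<^bsub>?G\<^esub>" "\<iota> (inverse k) \<in> principal_ideles"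
        by (simp_all add: mult one prin)
      then show ?thesis by blast
    qed
    show "a \<otimes>\<^bsub>?G\<^esub> b \<in> principal_ideles" if "a \<in> principal_ideles" "b \<in> principal_ideles" for a b
      using that unfolding prin by (auto simp: mult)
    have "\<iota> 1 \<in> principal_ideles" unfolding prin by (rule imageI) simp
    then show "principal_ideles \<noteq> ({} :: ('k place \<Rightarrow> (nat \<Rightarrow> 'k) set) set)" by blast
  qed
qed

section \<open>Reduced norms of the ideles in the normalizer\<close>

context number_field_order
begin

lemma local_ring: "\<nu> \<in> places \<Longrightarrow> ring (local_algebra scale \<nu>)"
  using local_normed_algebra[THEN normed_algebra.axioms(1)] by (simp add: based_algebra_def)

lemma normalizer_ideles_D:
  assumes "x \<in> normalizer_ideles scale R" "\<nu> \<in> places"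
  shows "x \<nu> \<in> Units (local_algebra scale \<nu>)" "x \<nu> \<in> carrier (local_algebra scale \<nu>)"
    "x \<nu> \<in> unit_normalizer (local_algebra scale \<nu>) (local_order scale R \<nu>)"
  using assms by (auto simp: normalizer_ideles_def algebra_ideles_def Units_def)

lemma normalizer_idelesI:
  assumes x: "x \<in> extensional places"
    and norm: "\<And>\<nu>. \<nu> \<in> places \<Longrightarrow> x \<nu> \<in> unit_normalizer (local_algebra scale \<nu>) (local_order scale R \<nu>)"
    and fin: "finite S" and unit: "\<And>\<nu>. \<nu> \<in> finite_places \<Longrightarrow> \<nu> \<notin> S \<Longrightarrow>
      x \<nu> \<in> Units (local_algebra scale \<nu>\<lparr>carrier := local_order scale R \<nu>\<rparr>)"
  shows "x \<in> normalizer_ideles scale R"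
proof -
  have "{\<nu> \<in> finite_places. x \<nu> \<notin> Units (local_algebra scale \<nu>\<lparr>carrier := local_order scale R \<nu>\<rparr>)} \<subseteq> S"
    using unit by blast
  then have "finite {\<nu> \<in> finite_places. x \<nu> \<notin> Units (local_algebra scale \<nu>\<lparr>carrier := local_order scale R \<nu>\<rparr>)}"
    using fin by (rule finite_subset)
  then show ?thesis using x norm
    by (auto simp: normalizer_ideles_def algebra_ideles_def PiE_iff unit_normalizer_def)
qed

abbreviation bad where "bad x \<equiv> {\<nu> \<in> finite_places. x \<nu> \<notin> Units (local_algebra scale \<nu>\<lparr>carrier := local_order scale R \<nu>\<rparr>)}"

lemma finite_bad: "x \<in> normalizer_ideles scale R \<Longrightarrow> finite (bad x)"
  by (simp add: normalizer_ideles_def algebra_ideles_def)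

text \<open>At every place the norm of the inverse inverts the norm. At a finite place where x is a
  unit of the local order the norm has absolute value 1 by \<open>local_norm_unit\<close>, so only
  the places in \<open>bad x\<close> are exceptional.\<close>

lemma idele_norm_in_idele_group:
  assumes x: "x \<in> normalizer_ideles scale R"
  shows "idele_norm scale x \<in> carrier idele_group"
proof -
  have "local_reduced_norm scale \<nu> (x \<nu>) \<in> Units (completion_at \<nu>)" if nu: "\<nu> \<in> places" for \<nu>
  proof -
    interpret F: field "completion_at \<nu>" by (rule field_completion[OF nu])
    interpret A: ring "local_algebra scale \<nu>" by (rule local_ring[OF nu])
    note u = normalizer_ideles_D(1)[OF x nu]
    have c: "x \<nu> \<in> carrier (local_algebra scale \<nu>)" "inv\<^bsub>local_algebra scale \<nu>\<^esub> x \<nu> \<in> carrier (local_algebra scale \<nu>)"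
      using u by auto
    show ?thesis
    proof (unfold Units_def, intro CollectI conjI bexI)
      show "local_reduced_norm scale \<nu> (x \<nu>) \<in> carrier (completion_at \<nu>)" by (rule local_norm_closed[OF nu c(1)])
      show "local_reduced_norm scale \<nu> (inv\<^bsub>local_algebra scale \<nu>\<^esub> x \<nu>) \<in> carrier (completion_at \<nu>)"
        by (rule local_norm_closed[OF nu c(2)])
      show "local_reduced_norm scale \<nu> (inv\<^bsub>local_algebra scale \<nu>\<^esub> x \<nu>) \<otimes>\<^bsub>completion_at \<nu>\<^esub> local_reduced_norm scale \<nu> (x \<nu>) = \<one>\<^bsub>completion_at \<nu>\<^esub>"
        using local_norm_mult[OF nu c(2,1)] local_norm_one[OF nu] u by simp
      show "local_reduced_norm scale \<nu> (x \<nu>) \<otimes>\<^bsub>completion_at \<nu>\<^esub> local_reduced_norm scale \<nu> (inv\<^bsub>local_algebra scale \<nu>\<^esub> x \<nu>) = \<one>\<^bsub>completion_at \<nu>\<^esub>"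
        using local_norm_mult[OF nu c(1,2)] local_norm_one[OF nu] u by simp
    qed
  qed
  moreover have "{\<nu> \<in> finite_places. completion_abs \<nu> (idele_norm scale x \<nu>) \<noteq> 1} \<subseteq> bad x"
    using local_norm_unit by (auto simp: idele_norm_def finite_places_places)
  then have "finite {\<nu> \<in> finite_places. completion_abs \<nu> (idele_norm scale x \<nu>) \<noteq> 1}"
    using finite_bad[OF x] by (rule finite_subset)
  ultimately show ?thesis unfolding idele_carrier by (auto simp: idele_norm_def)
qed

lemma normalizer_ideles_mult:
  assumes x: "x \<in> normalizer_ideles scale R" and y: "y \<in> normalizer_ideles scale R"
  shows "(\<lambda>\<nu>\<in>places. x \<nu> \<otimes>\<^bsub>local_algebra scale \<nu>\<^esub> y \<nu>) \<in> normalizer_ideles scale R"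
    and "idele_norm scale x \<otimes>\<^bsub>idele_group\<^esub> idele_norm scale y = idele_norm scale (\<lambda>\<nu>\<in>places. x \<nu> \<otimes>\<^bsub>local_algebra scale \<nu>\<^esub> y \<nu>)"
proof -
  show "(\<lambda>\<nu>\<in>places. x \<nu> \<otimes>\<^bsub>local_algebra scale \<nu>\<^esub> y \<nu>) \<in> normalizer_ideles scale R"
  proof (rule normalizer_idelesI[of _ "bad x \<union> bad y"])
    fix \<nu> :: "'k place" assume nu: "\<nu> \<in> places"
    show "(\<lambda>\<nu>\<in>places. x \<nu> \<otimes>\<^bsub>local_algebra scale \<nu>\<^esub> y \<nu>) \<nu> \<in> unit_normalizer (local_algebra scale \<nu>) (local_order scale R \<nu>)"
      using ring.unit_normalizer_mult[OF local_ring[OF nu] local_order_subset normalizer_ideles_D(3)[OF x nu] normalizer_ideles_D(3)[OF y nu]] nu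
      by simp
  next
    fix \<nu> assume "\<nu> \<in> finite_places" "\<nu> \<notin> bad x \<union> bad y"
    then have "\<nu> \<in> places" and fin: "\<nu> \<in> finite_places" and "x \<nu> \<in> Units (local_algebra scale \<nu>\<lparr>carrier := local_order scale R \<nu>\<rparr>)"
      "y \<nu> \<in> Units (local_algebra scale \<nu>\<lparr>carrier := local_order scale R \<nu>\<rparr>)" by (auto simp: finite_places_places)
    then show "(\<lambda>\<nu>\<in>places. x \<nu> \<otimes>\<^bsub>local_algebra scale \<nu>\<^esub> y \<nu>) \<nu> \<in> Units (local_algebra scale \<nu>\<lparr>carrier := local_order scale R \<nu>\<rparr>)"
      using ring.Units_subset_mult[OF local_ring local_order_subset local_order_mult[OF fin]] by simp
  qed (use finite_bad[OF x] finite_bad[OF y] in auto)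
  show "idele_norm scale x \<otimes>\<^bsub>idele_group\<^esub> idele_norm scale y = idele_norm scale (\<lambda>\<nu>\<in>places. x \<nu> \<otimes>\<^bsub>local_algebra scale \<nu>\<^esub> y \<nu>)"
    using normalizer_ideles_D(2)[OF x] normalizer_ideles_D(2)[OF y]
    unfolding idele_mult idele_norm_def by (intro restrict_ext) (simp add: local_norm_mult)
qed

lemma normalizer_ideles_inv:
  assumes x: "x \<in> normalizer_ideles scale R"
  shows "(\<lambda>\<nu>\<in>places. inv\<^bsub>local_algebra scale \<nu>\<^esub> x \<nu>) \<in> normalizer_ideles scale R"
    and "idele_norm scale (\<lambda>\<nu>\<in>places. inv\<^bsub>local_algebra scale \<nu>\<^esub> x \<nu>) \<otimes>\<^bsub>idele_group\<^esub> idele_norm scale x = \<one>\<^bsub>idele_group\<^esub>"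
proof -
  show mem: "(\<lambda>\<nu>\<in>places. inv\<^bsub>local_algebra scale \<nu>\<^esub> x \<nu>) \<in> normalizer_ideles scale R"
  proof (rule normalizer_idelesI[of _ "bad x"])
    fix \<nu> :: "'k place" assume nu: "\<nu> \<in> places"
    show "(\<lambda>\<nu>\<in>places. inv\<^bsub>local_algebra scale \<nu>\<^esub> x \<nu>) \<nu> \<in> unit_normalizer (local_algebra scale \<nu>) (local_order scale R \<nu>)"
      using ring.unit_normalizer_inv[OF local_ring[OF nu] local_order_subset normalizer_ideles_D(3)[OF x nu]] nu by simp
  next
    fix \<nu> assume "\<nu> \<in> finite_places" "\<nu> \<notin> bad x"
    then have "\<nu> \<in> places" "x \<nu> \<in> Units (local_algebra scale \<nu>\<lparr>carrier := local_order scale R \<nu>\<rparr>)"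
      by (auto simp: finite_places_places)
    then show "(\<lambda>\<nu>\<in>places. inv\<^bsub>local_algebra scale \<nu>\<^esub> x \<nu>) \<nu> \<in> Units (local_algebra scale \<nu>\<lparr>carrier := local_order scale R \<nu>\<rparr>)"
      using ring.Units_subset_carrier(2)[OF local_ring local_order_subset] by simp
  qed (use finite_bad[OF x] in auto)
  show "idele_norm scale (\<lambda>\<nu>\<in>places. inv\<^bsub>local_algebra scale \<nu>\<^esub> x \<nu>) \<otimes>\<^bsub>idele_group\<^esub> idele_norm scale x = \<one>\<^bsub>idele_group\<^esub>"
    unfolding normalizer_ideles_mult(2)[OF mem x]
  proof (rule ext)
    fix \<nu> :: "'k place"
    show "idele_norm scale (\<lambda>\<nu>\<in>places. (\<lambda>\<nu>\<in>places. inv\<^bsub>local_algebra scale \<nu>\<^esub> x \<nu>) \<nu> \<otimes>\<^bsub>local_algebra scale \<nu>\<^esub> x \<nu>) \<nu> = \<one>\<^bsub>idele_group\<^esub> \<nu>"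
    proof (cases "\<nu> \<in> places")
      case True
      interpret A: ring "local_algebra scale \<nu>" by (rule local_ring[OF True])
      show ?thesis
        using True normalizer_ideles_D(1)[OF x True] local_norm_one[OF True]
        by (simp add: idele_norm_def idele_one)
    qed (simp add: idele_norm_def idele_one)
  qed
qed

text \<open>Conjugation by a central unit is the identity, so it fixes the local order. A scalar of
  absolute value 1 lies in the order together with its inverse, because the order contains 1 and is
  stable under the valuation ring.\<close>

lemma local_scalar:
  assumes nu: "\<nu> \<in> places" and z: "z \<in> Units (completion_at \<nu>)"
  shows "to_local_algebra scale \<nu> z \<in> unit_normalizer (local_algebra scale \<nu>) (local_order scale R \<nu>)"
    and "\<nu> \<in> finite_places \<Longrightarrow> completion_abs \<nu> z = 1 \<Longrightarrow>
      to_local_algebra scale \<nu> z \<in> Units (local_algebra scale \<nu>\<lparr>carrier := local_order scale R \<nu>\<rparr>)"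
proof -
  interpret W: normed_algebra "completion_at \<nu>" "local_algebra scale \<nu>" "to_local_algebra scale \<nu>" N "eb \<nu>"
    by (rule local_normed_algebra[OF nu])
  interpret F: field "completion_at \<nu>" by (rule field_completion[OF nu])
  let ?f = "to_local_algebra scale \<nu>" and ?w = "inv\<^bsub>completion_at \<nu>\<^esub> z"
  have zw: "z \<in> carrier (completion_at \<nu>)" "?w \<in> carrier (completion_at \<nu>)" "?w \<in> Units (completion_at \<nu>)"
    "z \<otimes>\<^bsub>completion_at \<nu>\<^esub> ?w = \<one>\<^bsub>completion_at \<nu>\<^esub>" "?w \<otimes>\<^bsub>completion_at \<nu>\<^esub> z = \<one>\<^bsub>completion_at \<nu>\<^esub>"
    using z by auto
  have fc: "?f z \<in> carrier (local_algebra scale \<nu>)" "?f ?w \<in> carrier (local_algebra scale \<nu>)"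
    using ring_hom_closed[OF W.f] zw by auto
  have i: "?f z \<otimes>\<^bsub>local_algebra scale \<nu>\<^esub> ?f ?w = \<one>\<^bsub>local_algebra scale \<nu>\<^esub>" "?f ?w \<otimes>\<^bsub>local_algebra scale \<nu>\<^esub> ?f z = \<one>\<^bsub>local_algebra scale \<nu>\<^esub>"
    using ring_hom_mult[OF W.f zw(1,2)] ring_hom_mult[OF W.f zw(2,1)] ring_hom_one[OF W.f] zw(4,5) by simp_all
  have u: "?f z \<in> Units (local_algebra scale \<nu>)" using fc i by (auto simp: Units_def)
  have "?f z \<otimes>\<^bsub>local_algebra scale \<nu>\<^esub> r \<otimes>\<^bsub>local_algebra scale \<nu>\<^esub> inv\<^bsub>local_algebra scale \<nu>\<^esub> ?f z = r"
    if "r \<in> local_order scale R \<nu>" for r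
  proof -
    have r: "r \<in> carrier (local_algebra scale \<nu>)" using that local_order_subset by blast
    have "?f z \<otimes>\<^bsub>local_algebra scale \<nu>\<^esub> r = r \<otimes>\<^bsub>local_algebra scale \<nu>\<^esub> ?f z" by (rule W.central[OF zw(1) r])
    then show ?thesis using u r fc by (simp add: W.A.m_assoc)
  qed
  then show "?f z \<in> unit_normalizer (local_algebra scale \<nu>) (local_order scale R \<nu>)"
    using u by (simp add: unit_normalizer_def)
  assume fin: "\<nu> \<in> finite_places" and abs: "completion_abs \<nu> z = 1"
  have "completion_abs \<nu> z * completion_abs \<nu> ?w = 1"
    using completion_abs_mult[OF nu zw(1,2)] zw(4) completion_abs_one[OF nu] by simp
  then have "z \<in> valuation_ring \<nu>" "?w \<in> valuation_ring \<nu>" using zw abs by (auto simp: valuation_ring_def)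
  then have "?f z \<in> local_order scale R \<nu>" "?f ?w \<in> local_order scale R \<nu>"
    unfolding to_local_algebra_def using pt_in_local_order[OF fin order_one] by auto
  then show "?f z \<in> Units (local_algebra scale \<nu>\<lparr>carrier := local_order scale R \<nu>\<rparr>)"
    using i by (auto simp: Units_def)
qed

lemma idele_power_norm:
  assumes x: "x \<in> carrier idele_group"
  shows "x [^]\<^bsub>idele_group\<^esub> n \<in> idele_norm scale ` normalizer_ideles scale R"
proof -
  interpret G: comm_group "idele_group :: ('k place \<Rightarrow> (nat \<Rightarrow> 'k) set) monoid" by (rule comm_group_idele)
  define y where "y = (\<lambda>\<nu>\<in>places. to_local_algebra scale \<nu> (x \<nu>))"
  have u: "x \<nu> \<in> Units (completion_at \<nu>)" if "\<nu> \<in> places" for \<nu> using x that by (auto simp: idele_carrier)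
  have c: "x \<nu> \<in> carrier (completion_at \<nu>)" if "\<nu> \<in> places" for \<nu> using u[OF that] by (simp add: Units_def)
  have "y \<in> normalizer_ideles scale R"
  proof (rule normalizer_idelesI[of _ "{\<nu> \<in> finite_places. completion_abs \<nu> (x \<nu>) \<noteq> 1}"])
    show "finite {\<nu> \<in> finite_places. completion_abs \<nu> (x \<nu>) \<noteq> 1}" using x by (simp add: idele_carrier)
    show "y \<nu> \<in> unit_normalizer (local_algebra scale \<nu>) (local_order scale R \<nu>)" if "\<nu> \<in> places" for \<nu>
      using local_scalar(1)[OF that u[OF that]] that by (simp add: y_def)
    show "y \<nu> \<in> Units (local_algebra scale \<nu>\<lparr>carrier := local_order scale R \<nu>\<rparr>)"
      if "\<nu> \<in> finite_places" "\<nu> \<notin> {\<nu> \<in> finite_places. completion_abs \<nu> (x \<nu>) \<noteq> 1}" for \<nu>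
      using local_scalar(2)[OF finite_places_places[OF that(1)] u[OF finite_places_places[OF that(1)]] that(1)] that
      by (simp add: y_def finite_places_places)
  qed (simp add: y_def)
  moreover have "x [^]\<^bsub>idele_group\<^esub> m = (\<lambda>\<nu>\<in>places. x \<nu> [^]\<^bsub>completion_at \<nu>\<^esub> m)" for m :: nat
  proof (induction m)
    case 0
    show ?case by (auto simp: idele_one)
  next
    case (Suc m)
    show ?case unfolding nat_pow_Suc Suc.IH idele_mult by (rule restrict_ext) simp
  qed
  then have "x [^]\<^bsub>idele_group\<^esub> n = idele_norm scale y"
    using c unfolding idele_norm_def y_def by (simp only:) (intro restrict_ext, simp add: local_norm_scalar)
  ultimately show ?thesis by blast
qed

lemma subgroup_idele_norm: "subgroup (idele_norm scale ` normalizer_ideles scale R) idele_group"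
proof -
  interpret G: comm_group "idele_group :: ('k place \<Rightarrow> (nat \<Rightarrow> 'k) set) monoid" by (rule comm_group_idele)
  show ?thesis
  proof (rule G.subgroup_left_inverseI)
    show "idele_norm scale ` normalizer_ideles scale R \<subseteq> carrier idele_group"
      using idele_norm_in_idele_group by blast
    show "idele_norm scale ` normalizer_ideles scale R \<noteq> {}" using idele_power_norm[OF G.one_closed] by blast
    show "\<exists>b\<in>idele_norm scale ` normalizer_ideles scale R. b \<otimes>\<^bsub>idele_group\<^esub> a = \<one>\<^bsub>idele_group\<^esub>"
      if a: "a \<in> idele_norm scale ` normalizer_ideles scale R" for a
    proof -
      obtain x where x: "a = idele_norm scale x" "x \<in> normalizer_ideles scale R" using a by (rule imageE)
      show ?thesis unfolding x(1)
        by (rule bexI, rule normalizer_ideles_inv(2)[OF x(2)], rule imageI, rule normalizer_ideles_inv(1)[OF x(2)])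
    qed
    show "a \<otimes>\<^bsub>idele_group\<^esub> b \<in> idele_norm scale ` normalizer_ideles scale R"
      if a: "a \<in> idele_norm scale ` normalizer_ideles scale R" and b: "b \<in> idele_norm scale ` normalizer_ideles scale R" for a b
    proof -
      obtain x where x: "a = idele_norm scale x" "x \<in> normalizer_ideles scale R" using a by (rule imageE)
      obtain y where y: "b = idele_norm scale y" "y \<in> normalizer_ideles scale R" using b by (rule imageE)
      show ?thesis unfolding x(1) y(1) normalizer_ideles_mult(2)[OF x(2) y(2)]
        by (rule imageI[OF normalizer_ideles_mult(1)[OF x(2) y(2)]])
    qed
  qed
qed

lemma elementary_abelian_quotient:
  assumes p: "Factorial_Ring.prime n"
  shows "elementary_abelian n (idele_norm_quotient scale R)"
proof -
  let ?G = "idele_group :: ('k place \<Rightarrow> (nat \<Rightarrow> 'k) set) monoid"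
  let ?I = "idele_norm scale ` normalizer_ideles scale R"
  interpret G: comm_group ?G by (rule comm_group_idele)
  define H where "H = principal_ideles <#>\<^bsub>?G\<^esub> ?I"
  have prin: "subgroup principal_ideles ?G" by (rule subgroup_principal_ideles[OF number_field])
  have H: "subgroup H ?G" unfolding H_def by (rule G.mult_subgroups[OF prin subgroup_idele_norm])
  have IH: "?I \<subseteq> H"
  proof
    fix y assume y: "y \<in> ?I"
    then have "\<one>\<^bsub>?G\<^esub> \<otimes>\<^bsub>?G\<^esub> y \<in> H"
      unfolding H_def set_mult_def using subgroup.one_closed[OF prin] by blast
    moreover have "y \<in> carrier ?G" using y subgroup.subset[OF subgroup_idele_norm] by blast
    ultimately show "y \<in> H" by simp
  qed
  have normal: "H \<lhd> ?G" using H by (simp add: G.normal_iff_subgroup)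
  interpret Q: comm_group "?G Mod H" by (rule G.abelian_FactGroup[OF H])
  have "group.ord (?G Mod H) c = n" if c: "c \<in> carrier (?G Mod H)" "c \<noteq> \<one>\<^bsub>?G Mod H\<^esub>" for c
  proof -
    obtain x where x: "x \<in> carrier ?G" "c = H #>\<^bsub>?G\<^esub> x" using c by (auto simp: FactGroup_def RCOSETS_def)
    have "c [^]\<^bsub>?G Mod H\<^esub> n = H #>\<^bsub>?G\<^esub> (x [^]\<^bsub>?G\<^esub> n)"
      unfolding x(2) using hom_nat_pow[OF normal.r_coset_hom_Mod[OF normal] x(1) G.is_group Q.is_group] by simp
    also have "\<dots> = \<one>\<^bsub>?G Mod H\<^esub>"
      using idele_power_norm[OF x(1)] IH x(1) H by (simp add: G.coset_join2 subset_iff)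
    finally have "Q.ord c dvd n" using Q.pow_eq_id[OF c(1)] by simp
    then have "Q.ord c = 1 \<or> Q.ord c = n" using p by (simp add: prime_nat_iff)
    then show ?thesis using Q.ord_eq_1[OF c(1)] c(2) by blast
  qed
  then show ?thesis
    unfolding elementary_abelian_def idele_norm_quotient_def H_def[symmetric] using Q.comm_group_axioms by blast
qed

end

theorem theorem3p2:
  fixes p :: nat
    and scale :: "'k::field_char_0 \<Rightarrow> 'b::ring_1 \<Rightarrow> 'b"
    and R :: "'b set"
  assumes "Factorial_Ring.prime p" and "odd p"
    and "number_field TYPE('k)"
    and "central_simple_algebra scale"
    and "vector_space.dim scale (UNIV :: 'b set) = p\<^sup>2"
    and "maximal_order scale R"
  shows "elementary_abelian p (idele_norm_quotient scale R)"
proof -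
  have p: "p\<^sup>2 > 0" using assms(1) by (simp add: prime_gt_0_nat)
  obtain e co where "central_simple_basis scale (p\<^sup>2) e co"
    using central_simple_basis_exists[OF assms(4,5) p] by blast
  then have "number_field_order scale (p\<^sup>2) e co R p"
    using assms(3,6) p
    by (simp add: number_field_order_def number_field_csa_def number_field_csa_axioms_def
        number_field_order_axioms_def maximal_order_def power2_eq_square)
  then show ?thesis using assms(1) by (rule number_field_order.elementary_abelian_quotient)
qed

end
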